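(* Let $0<\beta<1$, $n,d\ge1$, and let $\mathbb{W}^x_\Lambda(\mathbf t)=W^x(\Lambda^{(1)}(t_1),\ldots,\Lambda^{(n)}(t_n))$, $\mathbf t\in\mathbb{R}_+^n$, be the $n$-parameter $\mathbb{R}^d$-valued inverse-stable-Lévy-time Brownian sheet of index $\beta$ started at $x\in\mathbb{R}^d$. Let $f:\mathbb{R}^d\to\mathbb{R}$ be bounded and measurable such that all second order partial derivatives of $f$ are bounded and Hölder continuous with exponent $0<\alpha\le1$. For $(\mathbf t,x)\in\mathbb{R}_+^n\times\mathbb{R}^d$ and $j\in\mathbb{N}_n=\{1,\ldots,n\}$ set $$u(\mathbf t,x)=\mathbb{E}\big[f(\mathbb{W}^x_\Lambda(\mathbf t))\big],\qquad \mathscr V^{(j)}(\mathbf t,x)=\mathbb{E}\Big[\Big(\prod_{i\in\mathbb{N}_n\setminus\{j\}}\Lambda^{(i)}(t_i)\Big)f(\mathbb{W}^x_\Lambda(\mathbf t))\Big].$$ Then for every $j\in\mathbb{N}_n$ $$\begin{cases} (a)\ \partial_{t_j}^\beta u=\frac12\Delta_x\mathscr V^{(j)}; & \mathbf t\in(0,\infty)^n,\ x\in\mathbb{R}^d,\\ (b)\ u(\mathbf t,x)=f(x); & \mathbf t\in\partial\mathbb{R}_+^n,\ x\in\mathbb{R}^d,\\ (c)\ \mathscr V^{(j)}(\mathbf t,x)=0; & t_i=0\text{ for some }i\in\mathbb{N}_n\setminus\{j\},\ x\in\mathbb{R}^d,\\ (d)\ \mathscr V^{(j)}(\mathbf t,x)=\Big[\prod_{i\in\mathbb{N}_n\setminus\{j\}}E(\beta,1)t_i^\beta\Big]f(x);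 & t_j=0,\ x\in\mathbb{R}^d, \end{cases}$$ where $E(\beta,\gamma)=\mathbb{E}[\Lambda(1)^\gamma]=\int_0^\infty x^{-\gamma\beta}g_\beta(x)\,dx$ for $\gamma>-1$. If, moreover, $\beta=1/\nu$ with $\nu\in\{2,3,4,\ldots\}$, all the derivatives of $f$ of order $2\nu-2$ are bounded and Hölder continuous with exponent $0<\alpha\le1$, and $$\mathscr U_\nu^{(j)}(\mathbf t,x)=\mathbb{E}\Big[\Big(\prod_{i\in\mathbb{N}_n\setminus\{j\}}\Lambda^{(i)}(t_i)\Big)^\nu f(\mathbb{W}^x_\Lambda(\mathbf t))\Big],$$ then for every $j\in\mathbb{N}_n$ $$\begin{cases} (a)\ \partial_{t_j}u=\sum_{\kappa=1}^{\nu-1}\frac{\Delta_x^\kappa f}{2^\kappa}\,\partial_{t_j}M_\kappa^{(j)}+\frac1{2^\nu}\Delta_x^\nu\mathscr U_\nu^{(j)}; & \mathbf t\in(0,\infty)^n,\ x\in\mathbb{R}^d,\\ (b)\ u(\mathbf t,x)=f(x); & \mathbf t\in\partial\mathbb{R}_+^n,\ x\in\mathbb{R}^d,\\ (c)\ \mathscr U_\nu^{(j)}(\mathbf t,x)=0; & t_i=0\text{ for some }i\in\mathbb{N}_n\setminus\{j\},\ x\in\mathbb{R}^d,\\ (d)\ \mathscr U_\nu^{(j)}(\mathbf t,x)=f(x)N_\nu^{(j)}(\mathbf t); & t_j=0,\ x\in\mathbb{R}^d, \end{cases}$$ where $$N_\nu^{(j)}(\mathbf t)=\prod_{i\in\mathbb{N}_n\setminus\{j\}}\mathbb{E}\big[\Lambda^{(i)}(t_i)^\nu\big]=E(1/\nu,\nu)^{n-1}\prod_{i\in\mathbb{N}_n\setminus\{j\}}t_i,$$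 $$M_\kappa^{(j)}(\mathbf t)=\Big[\prod_{i\in\mathbb{N}_n\setminus\{j\}}\mathbb{E}\big[\Lambda^{(i)}(t_i)^\kappa\big]\Big]\frac{\mathbb{E}\big[\Lambda^{(j)}(t_j)^\kappa\big]}{\kappa!}=\int_{\mathbb{R}_+^n}\Big[\prod_{i\in\mathbb{N}_n\setminus\{j\}}s_i\Big]^\kappa\frac{s_j^\kappa}{\kappa!}\prod_{i=1}^nK^{\Lambda,\beta}_{t_i;0,s_i}\,d\mathbf s=\frac{E(1/\nu,\kappa)^n}{\kappa!}\prod_{i\in\mathbb{N}_n}t_i^{\kappa/\nu},$$ and where, for $\gamma>-1$, $\mathbb{E}[\Lambda(t)^\gamma]=\mathbb{E}[(L(1)/t)^{-\gamma/\nu}]=t^{\gamma/\nu}\,\mathbb{E}[L(1)^{-\gamma/\nu}]=t^{\gamma/\nu}E(1/\nu,\gamma)<\infty$.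
   Context: $\mathbb{R}_+=[0,\infty)$, $\mathbf t=(t_1,\ldots,t_n)$, and $\partial\mathbb{R}_+^n$ is the set of $\mathbf t\in\mathbb{R}_+^n$ with at least one zero coordinate. Empty products equal $1$. $\Delta_x$ is the Laplacian in $x\in\mathbb{R}^d$ and $\Delta_x^\kappa$ its $\kappa$-th power. Brownian sheet: $W^0$ is an $n$-parameter $\mathbb{R}^d$-valued Brownian sheet on a probability space, with independent coordinates, vanishing on $\partial\mathbb{R}_+^n$; $W^x=W^0+x$. For $\mathbf s\in(0,\infty)^n$, $W^x(\mathbf s)$ has density $y\mapsto(2\pi\prod_is_i)^{-d/2}\exp(-|x-y|^2/(2\prod_is_i))$. $\beta$-inverse Lévy motion: $L$ is the strictly increasing $\beta$-stable Lévy motion (stable subordinator) with $\mathbb{E}[e^{-sL(t)}]=e^{-ts^\beta}$; $g_\beta$ is the density of $L(1)$; $\Lambda(t)=\inf\{x:L(x)>t\}$. $K^{\Lambda,\beta}_{t;0,x}$ denotes the density of $\Lambda(t)$ at $x>0$, namely $K^{\Lambda,\beta}_{t;0,x}=t\beta^{-1}x^{-1-1/\beta}g_\beta(tx^{-1/\beta})$. Inverse-stable-Lévy-time Brownian sheet: $\Lambda^{(1)},\ldots,\Lambda^{(n)}$ are independent copies of $\Lambda$, independent of $W^0$, and $\mathbb{W}^x_\Lambda(\mathbf t)=W^x(\Lambda^{(1)}(t_1),\ldots,\Lambda^{(n)}(t_n))$. Caputo fractional derivative of order $0<\beta<1$ in a time variable $t$ (other variables fixed), for functions $C^1$ in that variable: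 $\partial_t^\beta u(t)=\frac1{\Gamma(1-\beta)}\int_0^t\partial_su(s)\frac{ds}{(t-s)^\beta}$. *)

theory Defs
  imports "HOL-Probability.Probability"
begin

section \<open>The parameter space\<close>

definition nonneg_orthant :: "(real^'n) set" where
  "nonneg_orthant = {t. \<forall>i. 0 \<le> t $ i}"

definition pos_orthant :: "(real^'n) set" where
  "pos_orthant = {t. \<forall>i. 0 < t $ i}"

definition orthant_boundary :: "(real^'n) set" where
  "orthant_boundary = {t \<in> nonneg_orthant. \<exists>i. t $ i = 0}"

definition set_coord :: "real^'n \<Rightarrow> 'n \<Rightarrow> real \<Rightarrow> real^'n" where
  "set_coord t j s = (\<chi> i. if i = j then s else t $ i)"

section \<open>Brownian sheet\<close>

text \<open>The events determined by the process \<open>X\<close> with index set \<open>T\<close>.\<close>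

definition process_events :: "'w measure \<Rightarrow> 't set \<Rightarrow> ('t \<Rightarrow> 'w \<Rightarrow> 'b::topological_space) \<Rightarrow> 'w set set" where
  "process_events M T X =
     sigma_sets (space M) {X t -` A \<inter> space M | t A. t \<in> T \<and> A \<in> sets borel}"

text \<open>Centred normal law, including the degenerate case of variance 0.\<close>

definition centered_normal :: "'w measure \<Rightarrow> ('w \<Rightarrow> real) \<Rightarrow> real \<Rightarrow> bool" where
  "centered_normal M X v \<longleftrightarrow> X \<in> borel_measurable M \<and>
     (if v = 0 then (AE \<omega> in M. X \<omega> = 0)
      else 0 < v \<and> distributed M lborel X (\<lambda>y. ennreal (normal_density 0 (sqrt v) y)))"

text \<open>A centred Gaussian process (every finite linear combination is normal) with covariance
  \<open>E (B s * B t) = (\<Prod>i. min (s i) (t i))\<close>, with continuous paths vanishing on the boundary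
  of the orthant.\<close>

definition real_brownian_sheet :: "'w measure \<Rightarrow> (real^'n \<Rightarrow> 'w \<Rightarrow> real) \<Rightarrow> bool" where
  "real_brownian_sheet M B \<longleftrightarrow>
     (\<forall>F c. finite F \<and> F \<subseteq> nonneg_orthant \<longrightarrow>
        centered_normal M (\<lambda>\<omega>. \<Sum>s\<in>F. c s * B s \<omega>)
          (\<Sum>s\<in>F. \<Sum>t\<in>F. c s * c t * (\<Prod>i\<in>UNIV. min (s $ i) (t $ i)))) \<and>
     (\<forall>\<omega>\<in>space M. continuous_on nonneg_orthant (\<lambda>t. B t \<omega>)) \<and>
     (\<forall>\<omega>\<in>space M. \<forall>t\<in>orthant_boundary. B t \<omega> = 0)"

definition brownian_sheet :: "'w measure \<Rightarrow> (real^'n \<Rightarrow> 'w \<Rightarrow> real^'d) \<Rightarrow> bool" where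
  "brownian_sheet M W \<longleftrightarrow>
     (\<forall>k. real_brownian_sheet M (\<lambda>t \<omega>. W t \<omega> $ k)) \<and>
     prob_space.indep_sets M
       (\<lambda>k. process_events M nonneg_orthant (\<lambda>t \<omega>. W t \<omega> $ k)) UNIV"

section \<open>Stable subordinators and their inverses\<close>

definition levy_motion :: "'w measure \<Rightarrow> (real \<Rightarrow> 'w \<Rightarrow> real) \<Rightarrow> bool" where
  "levy_motion M L \<longleftrightarrow>
     (\<forall>t\<ge>0. L t \<in> borel_measurable M) \<and>
     (\<forall>\<omega>\<in>space M. L 0 \<omega> = 0) \<and>
     (\<forall>s\<ge>0. \<forall>t\<ge>0. distr M borel (\<lambda>\<omega>. L (s + t) \<omega> - L s \<omega>) = distr M borel (L t)) \<and>
     (\<forall>(m::nat) (r::nat \<Rightarrow> real). 0 \<le> r 0 \<and> mono r \<longrightarrow>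
        prob_space.indep_vars M (\<lambda>_. borel) (\<lambda>k \<omega>. L (r (Suc k)) \<omega> - L (r k) \<omega>) {..<m}) \<and>
     (\<forall>\<omega>\<in>space M. \<forall>t\<ge>0. ((\<lambda>s. L s \<omega>) \<longlongrightarrow> L t \<omega>) (at_right t)) \<and>
     (\<forall>\<omega>\<in>space M. \<forall>t>0. \<exists>l. ((\<lambda>s. L s \<omega>) \<longlongrightarrow> l) (at_left t))"

definition stable_subordinator :: "real \<Rightarrow> 'w measure \<Rightarrow> (real \<Rightarrow> 'w \<Rightarrow> real) \<Rightarrow> bool" where
  "stable_subordinator \<beta> M L \<longleftrightarrow>
     levy_motion M L \<and>
     (\<forall>\<omega>\<in>space M. strict_mono_on {0..} (\<lambda>t. L t \<omega>)) \<and>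
     (\<forall>t\<ge>0. \<forall>s>0. (\<integral>\<omega>. exp (- s * L t \<omega>) \<partial>M) = exp (- t * s powr \<beta>))"

definition inverse_motion :: "(real \<Rightarrow> 'w \<Rightarrow> real) \<Rightarrow> real \<Rightarrow> 'w \<Rightarrow> real" where
  "inverse_motion L t \<omega> = Inf {x. 0 \<le> x \<and> t < L x \<omega>}"

text \<open>\<open>X\<close>, a process on \<open>M\<close> with values in the half-line, has the same law as the process
  \<open>Y\<close> on \<open>N\<close>.\<close>

definition process_copy ::
  "'v measure \<Rightarrow> (real \<Rightarrow> 'v \<Rightarrow> real) \<Rightarrow> 'w measure \<Rightarrow> (real \<Rightarrow> 'w \<Rightarrow> real) \<Rightarrow> bool" where
  "process_copy N Y M X \<longleftrightarrow>
     (\<forall>t\<ge>0. X t \<in> borel_measurable M \<and> (\<forall>\<omega>\<in>space M. 0 \<le> X t \<omega>)) \<and>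
     distr M (PiM {0..} (\<lambda>_. borel)) (\<lambda>\<omega>. \<lambda>t\<in>{0..}. X t \<omega>) =
     distr N (PiM {0..} (\<lambda>_. borel)) (\<lambda>\<omega>. \<lambda>t\<in>{0..}. Y t \<omega>)"

text \<open>\<open>\<Lambda> i\<close> are independent copies of the inverse of \<open>L\<close>, independent of \<open>W\<close>: the
  events of \<open>W\<close> (index \<open>None\<close>) and of the \<open>\<Lambda> i\<close> (index \<open>Some i\<close>) are mutually
  independent.\<close>

definition independent_inverse_clocks ::
  "'v measure \<Rightarrow> (real \<Rightarrow> 'v \<Rightarrow> real) \<Rightarrow> 'w measure \<Rightarrow> (real^'n \<Rightarrow> 'w \<Rightarrow> real^'d) \<Rightarrow>
   ('n \<Rightarrow> real \<Rightarrow> 'w \<Rightarrow> real) \<Rightarrow> bool" where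
  "independent_inverse_clocks N L M W \<Lambda> \<longleftrightarrow>
     (\<forall>i. process_copy N (inverse_motion L) M (\<Lambda> i)) \<and>
     prob_space.indep_sets M
       (case_option (process_events M nonneg_orthant W) (\<lambda>i. process_events M {0..} (\<Lambda> i))) UNIV"

text \<open>\<open>E(\<beta>,\<gamma>)\<close>; the index \<open>\<beta>\<close> is that of the subordinator \<open>L\<close>.\<close>

definition moment_const :: "'v measure \<Rightarrow> (real \<Rightarrow> 'v \<Rightarrow> real) \<Rightarrow> real \<Rightarrow> real" where
  "moment_const N L \<gamma> = (\<integral>\<omega>. inverse_motion L 1 \<omega> powr \<gamma> \<partial>N)"

text \<open>Here \<open>g\<close> stands for the density of \<open>L 1\<close>.\<close>

definition inverse_kernel :: "real \<Rightarrow> (real \<Rightarrow> real) \<Rightarrow> real \<Rightarrow> real \<Rightarrow> real" where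
  "inverse_kernel \<beta> g t x = t / \<beta> * x powr (- 1 - 1 / \<beta>) * g (t * x powr (- 1 / \<beta>))"

section \<open>The time-changed sheet and its functionals\<close>

definition time_changed_sheet ::
  "(real^'n \<Rightarrow> 'w \<Rightarrow> real^'d) \<Rightarrow> ('n \<Rightarrow> real \<Rightarrow> 'w \<Rightarrow> real) \<Rightarrow>
   real^'d \<Rightarrow> real^'n \<Rightarrow> 'w \<Rightarrow> real^'d" where
  "time_changed_sheet W \<Lambda> x t \<omega> = x + W (\<chi> i. \<Lambda> i (t $ i) \<omega>) \<omega>"

definition other_clocks ::
  "('n::finite \<Rightarrow> real \<Rightarrow> 'w \<Rightarrow> real) \<Rightarrow> 'n \<Rightarrow> real^'n \<Rightarrow> 'w \<Rightarrow> real" where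
  "other_clocks \<Lambda> j t \<omega> = (\<Prod>i\<in>UNIV - {j}. \<Lambda> i (t $ i) \<omega>)"

definition u_fun where
  "u_fun M W \<Lambda> (f :: real^'d \<Rightarrow> real) t x =
     (\<integral>\<omega>. f (time_changed_sheet W \<Lambda> x t \<omega>) \<partial>M)"

definition V_fun where
  "V_fun M W \<Lambda> (f :: real^'d \<Rightarrow> real) j t x =
     (\<integral>\<omega>. other_clocks \<Lambda> j t \<omega> * f (time_changed_sheet W \<Lambda> x t \<omega>) \<partial>M)"

definition U_fun where
  "U_fun M W \<Lambda> (f :: real^'d \<Rightarrow> real) \<nu> j t x =
     (\<integral>\<omega>. other_clocks \<Lambda> j t \<omega> ^ \<nu> * f (time_changed_sheet W \<Lambda> x t \<omega>) \<partial>M)"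

definition N_fun ::
  "'w measure \<Rightarrow> ('n::finite \<Rightarrow> real \<Rightarrow> 'w \<Rightarrow> real) \<Rightarrow> nat \<Rightarrow> 'n \<Rightarrow> real^'n \<Rightarrow> real" where
  "N_fun M \<Lambda> \<nu> j t = (\<Prod>i\<in>UNIV - {j}. \<integral>\<omega>. \<Lambda> i (t $ i) \<omega> ^ \<nu> \<partial>M)"

definition M_fun ::
  "'w measure \<Rightarrow> ('n::finite \<Rightarrow> real \<Rightarrow> 'w \<Rightarrow> real) \<Rightarrow> nat \<Rightarrow> 'n \<Rightarrow> real^'n \<Rightarrow> real" where
  "M_fun M \<Lambda> \<kappa> j t =
     (\<Prod>i\<in>UNIV - {j}. \<integral>\<omega>. \<Lambda> i (t $ i) \<omega> ^ \<kappa> \<partial>M) *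
     ((\<integral>\<omega>. \<Lambda> j (t $ j) \<omega> ^ \<kappa> \<partial>M) / fact \<kappa>)"

section \<open>Spatial derivatives\<close>

definition partial_deriv :: "'d \<Rightarrow> (real^'d \<Rightarrow> real) \<Rightarrow> real^'d \<Rightarrow> real" where
  "partial_deriv k g x = deriv (\<lambda>h. g (x + h *\<^sub>R axis k 1)) 0"

definition iter_partial :: "'d list \<Rightarrow> (real^'d \<Rightarrow> real) \<Rightarrow> real^'d \<Rightarrow> real" where
  "iter_partial ks g = foldr partial_deriv ks g"

text \<open>All iterated partial derivatives up to order \<open>m\<close> exist at every point.\<close>

definition partials_exist :: "nat \<Rightarrow> (real^'d \<Rightarrow> real) \<Rightarrow> bool" where
  "partials_exist m g \<longleftrightarrow>
     (\<forall>ks k x. length ks < m \<longrightarrow>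
        (\<lambda>h. iter_partial ks g (x + h *\<^sub>R axis k 1)) field_differentiable (at 0))"

definition laplacian :: "(real^'d \<Rightarrow> real) \<Rightarrow> real^'d \<Rightarrow> real" where
  "laplacian g x = (\<Sum>k\<in>UNIV. partial_deriv k (partial_deriv k g) x)"

definition holder_continuous :: "real \<Rightarrow> (real^'d \<Rightarrow> real) \<Rightarrow> bool" where
  "holder_continuous \<alpha> g \<longleftrightarrow> (\<exists>C. \<forall>x y. \<bar>g x - g y\<bar> \<le> C * dist x y powr \<alpha>)"

definition bounded_holder_partials :: "nat \<Rightarrow> real \<Rightarrow> (real^'d \<Rightarrow> real) \<Rightarrow> bool" where
  "bounded_holder_partials m \<alpha> f \<longleftrightarrow> partials_exist m f \<and>
     (\<forall>ks. length ks = m \<longrightarrow>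
        bounded (range (iter_partial ks f)) \<and> holder_continuous \<alpha> (iter_partial ks f))"

section \<open>Caputo derivative\<close>

definition caputo_derivative :: "real \<Rightarrow> (real \<Rightarrow> real) \<Rightarrow> real \<Rightarrow> real" where
  "caputo_derivative \<beta> v t =
     1 / Gamma (1 - \<beta>) * (LINT s:{0<..<t}|lborel. deriv v s / (t - s) powr \<beta>)"

text \<open>Being \<open>C\<^sup>1\<close> is required only on the open half-line: already \<open>t powr \<beta>\<close>
  has no derivative at 0.\<close>

definition caputo_differentiable :: "real \<Rightarrow> (real \<Rightarrow> real) \<Rightarrow> real \<Rightarrow> bool" where
  "caputo_differentiable \<beta> v t \<longleftrightarrow>
     (\<forall>s>0. v field_differentiable (at s)) \<and> continuous_on {0<..} (deriv v) \<and>
     set_integrable lborel {0<..<t} (\<lambda>s. deriv v s / (t - s) powr \<beta>)"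

end

theory Submission
  imports Defs
begin

text \<open>Conditionally on the clocks, \<open>W\<close> at the random time is Gaussian with variance the product of
  the clocks, so every functional is \<open>E (A ^ k * \<phi> (A * t powr \<beta> * Z))\<close>, where \<open>\<phi> r\<close> is the heat semigroup
  \<open>exp (r \<Delta> / 2) f\<close> at \<open>x\<close>, \<open>A\<close> is the product of the clocks other than the \<open>j\<close>-th, \<open>t = t $ j\<close>, and
  \<open>t powr \<beta> * Z\<close> with \<open>Z = L 1 powr - \<beta>\<close> has the law of the \<open>j\<close>-th clock. The law of \<open>Z\<close> is determined
  by its moments \<open>k! / \<Gamma> (1 + \<beta> k)\<close>. Since \<open>\<phi>' = \<Delta> \<phi> / 2\<close>, the chain rule gives \<open>\<partial>\<^sub>t u\<close> as an expectation of
  \<open>A Z \<phi>' (A * t powr \<beta> * Z)\<close>. The Caputo integral over \<open>s < t\<close> (substitute \<open>s = t * w\<close>) and, for \<open>\<beta> = 1 / \<nu>\<close>, the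
  integral remainder of the Taylor expansion of \<open>\<phi>'\<close> at 0 of order \<open>\<nu> - 2\<close> then become averages over an
  independent beta variable \<open>w\<close>, and comparing moments shows that the law of \<open>w powr \<beta> * Z\<close> weighted
  by \<open>Z\<close>, respectively of \<open>w * Z\<close> weighted by \<open>Z ^ \<nu>\<close>, is the law of \<open>Z\<close> again.

  The functionals \<open>V\<close> and \<open>U\<close> have two derivatives more than \<open>f\<close>: the last two fall on the Gaussian
  kernel, where by Hoelder continuity they cost only \<open>r powr (\<alpha> / 2 - 1)\<close> at \<open>r = A * t powr \<beta> * Z\<close>,
  which is integrable because \<open>Z\<close> has finite moments of every order \<open>\<gamma> > -1\<close>.\<close>

section \<open>Parameter integrals and determinacy of measures\<close>

text \<open>The two beta variables are forced by scaling. After \<open>s = t * w\<close> all powers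
  of t in \<open>s powr (\<beta> - 1) / (t - s) powr \<beta>\<close> cancel against ds = t dw; what
  is left is the density \<open>w powr (\<beta> - 1) / (1 - w) powr \<beta>\<close> and the argument
  \<open>w powr \<beta> * Z\<close>. In the Taylor remainder the powers of t combine to
  \<open>t powr (\<beta> - 1) * (t powr \<beta>) ^ (\<nu> - 1)\<close>, which is 1 because \<beta>
  \<nu> = 1. Comparing moments is conclusive because dividing k! / \<Gamma>(1 + \<beta> k) by k!
  gives the coefficients of the Mittag-Leffler series, which converges everywhere. The obstacle of
  the second system is the order \<nu>: the (\<nu> - 1)-fold Laplacian of f is only Hoelder
  continuous, so the last derivative cannot be put on f on either side of the equation. Both sides
  are instead written with the Gaussian weight |z|^2 - d. Rescaling the Gaussian in time produces
  this weight, and so does summing the second Hermite weights over the coordinate directions in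
  space; there the two sides meet.\<close>

lemma integral_has_derivative_dominated:
  fixes f :: "real \<Rightarrow> 'a \<Rightarrow> real"
  assumes x0: "x0 \<in> {a<..<b}"
    and int: "\<And>x. x \<in> {a<..<b} \<Longrightarrow> integrable M (f x)"
    and der: "AE \<omega> in M. \<forall>x\<in>{a<..<b}. ((\<lambda>x. f x \<omega>) has_real_derivative f' x \<omega>) (at x)"
    and meas: "f' x0 \<in> borel_measurable M"
    and B: "integrable M B" "AE \<omega> in M. \<forall>x\<in>{a<..<b}. \<bar>f' x \<omega>\<bar> \<le> B \<omega>"
  shows "((\<lambda>x. \<integral>\<omega>. f x \<omega> \<partial>M) has_real_derivative (\<integral>\<omega>. f' x0 \<omega> \<partial>M)) (at x0)"
proof -
  let ?S = "{a<..<b}"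
  have "((\<lambda>y. ((\<integral>\<omega>. f y \<omega> \<partial>M) - (\<integral>\<omega>. f x0 \<omega> \<partial>M)) / (y - x0)) \<longlongrightarrow> (\<integral>\<omega>. f' x0 \<omega> \<partial>M))
      (at x0 within ?S)"
    \<comment> \<open>Dominated convergence concerns sequences, hence the detour through sequences
      tending to \<open>x0\<close>.\<close>
    unfolding tendsto_at_iff_sequentially
  proof (intro allI impI)
    fix X :: "nat \<Rightarrow> real" assume X: "\<forall>i. X i \<in> ?S - {x0}" "X \<longlonglongrightarrow> x0"
    have "(\<lambda>i. \<integral>\<omega>. (f (X i) \<omega> - f x0 \<omega>) / (X i - x0) \<partial>M) \<longlonglongrightarrow> (\<integral>\<omega>. f' x0 \<omega> \<partial>M)"
    proof (rule integral_dominated_convergence[where w=B])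
      show "AE \<omega> in M. (\<lambda>i. (f (X i) \<omega> - f x0 \<omega>) / (X i - x0)) \<longlonglongrightarrow> f' x0 \<omega>"
        using der
      proof eventually_elim
        case (elim \<omega>)
        then have "((\<lambda>x. f x \<omega>) has_real_derivative f' x0 \<omega>) (at x0 within ?S)"
          using x0 by (meson has_field_derivative_at_within)
        then show ?case
          using X unfolding has_field_derivative_iff tendsto_at_iff_sequentially comp_def by blast
      qed
      show "AE \<omega> in M. norm ((f (X i) \<omega> - f x0 \<omega>) / (X i - x0)) \<le> B \<omega>" for i
        using der B(2)
      proof eventually_elim
        case (elim \<omega>)
        \<comment> \<open>The mean value inequality turns the bound \<open>B\<close> on the
          derivative into the same bound on the difference quotients.\<close>
        have "norm (f (X i) \<omega> - f x0 \<omega>) \<le> B \<omega> * norm (X i - x0)"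
        proof (rule field_differentiable_bound[where S="?S" and f'="\<lambda>x. f' x \<omega>"])
          show "convex ?S" by simp
        qed (use elim X x0 in \<open>auto intro: has_field_derivative_at_within\<close>)
        then show ?case using X(1)[rule_format, of i] by (simp add: divide_simps)
      qed
    qed (use int X x0 B meas in auto)
    then show "((\<lambda>y. ((\<integral>\<omega>. f y \<omega> \<partial>M) - (\<integral>\<omega>. f x0 \<omega> \<partial>M)) / (y - x0)) \<circ> X) \<longlonglongrightarrow> (\<integral>\<omega>. f' x0 \<omega> \<partial>M)"
      using X x0 int by (simp add: comp_def)
  qed
  then show ?thesis
    using x0 by (simp add: has_field_derivative_iff at_within_open[of x0 ?S])
qed

lemma integral_continuous_on_dominated:
  fixes f :: "'b::metric_space \<Rightarrow> 'a \<Rightarrow> real"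
  assumes meas: "\<And>x. x \<in> S \<Longrightarrow> f x \<in> borel_measurable M"
    and cont: "AE \<omega> in M. continuous_on S (\<lambda>x. f x \<omega>)"
    and B: "integrable M B" "\<And>x. x \<in> S \<Longrightarrow> AE \<omega> in M. \<bar>f x \<omega>\<bar> \<le> B \<omega>"
  shows "continuous_on S (\<lambda>x. \<integral>\<omega>. f x \<omega> \<partial>M)"
  unfolding continuous_on_sequentially comp_def
proof (intro allI ballI impI, elim conjE)
  fix X x assume X: "\<forall>n. X n \<in> S" "X \<longlonglongrightarrow> x" and x: "x \<in> S"
  show "(\<lambda>n. \<integral>\<omega>. f (X n) \<omega> \<partial>M) \<longlonglongrightarrow> (\<integral>\<omega>. f x \<omega> \<partial>M)"
  proof (rule integral_dominated_convergence[where w=B])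
    show "AE \<omega> in M. (\<lambda>n. f (X n) \<omega>) \<longlonglongrightarrow> f x \<omega>"
      using cont by eventually_elim (use x X in \<open>auto intro: continuous_on_tendsto_compose\<close>)
  qed (use meas x X B in auto)
qed

text \<open>By Weierstrass approximation in the variable \<open>exp (- x) \<in> {0..1}\<close>.\<close>

lemma finite_measure_eq_laplace:
  assumes "finite_measure \<mu>" "finite_measure \<nu>" and sets: "sets \<mu> = sets borel" "sets \<nu> = sets borel"
    and nn: "AE x in \<mu>. 0 \<le> x" "AE x in \<nu>. 0 \<le> x"
    and eq: "\<And>n::nat. (\<integral>x. exp (- real n * x) \<partial>\<mu>) = (\<integral>x. exp (- real n * x) \<partial>\<nu>)"
  shows "\<mu> = \<nu>"
proof -
  interpret \<mu>: finite_measure \<mu> by fact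
  interpret \<nu>: finite_measure \<nu> by fact
  have int: "integrable M (\<lambda>x. h (exp (- x)))"
    if "finite_measure M" "sets M = sets borel" "AE x in M. (0::real) \<le> x"
      "h \<in> borel_measurable borel" "\<And>y. y \<in> {0..1} \<Longrightarrow> \<bar>h y\<bar> \<le> (c::real)" for M h c
  proof -
    note [measurable_cong] = that(2) and [measurable] = that(4)
    interpret finite_measure M by fact
    show ?thesis
    proof (rule integrable_const_bound[where B=c])
      show "AE x in M. norm (h (exp (- x))) \<le> c"
        using that(3) by eventually_elim (use that(5) in auto)
    qed auto
  qed
  \<comment> \<open>With y = exp (- x), the identity y^k (1 - y)^(m+1) = y^k (1 - y)^m - y^(k+1) (1
    - y)^m reduces the integrals of the Bernstein basis to the case m = 0, which is the transform at
    the integer k.\<close>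
  have mono: "(\<integral>x. exp (- x) ^ k * (1 - exp (- x)) ^ m \<partial>\<mu>) = (\<integral>x. exp (- x) ^ k * (1 - exp (- x)) ^ m \<partial>\<nu>)" for k m :: nat
  proof (induction m arbitrary: k)
    case 0
    then show ?case using eq[of k] by (simp flip: exp_of_nat_mult)
  next
    case (Suc m)
    have *: "(\<integral>x. exp (- x) ^ k * (1 - exp (- x)) ^ Suc m \<partial>M) =
      (\<integral>x. exp (- x) ^ k * (1 - exp (- x)) ^ m \<partial>M) - (\<integral>x. exp (- x) ^ Suc k * (1 - exp (- x)) ^ m \<partial>M)"
      if M: "finite_measure M" "sets M = sets borel" "AE x in M. (0::real) \<le> x" for M
    proof -
      have i: "integrable M (\<lambda>x. exp (- x) ^ j * (1 - exp (- x)) ^ m)" for j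
        using M by (intro int[where h="\<lambda>y. y ^ j * (1 - y) ^ m" and c=1])
          (auto simp: abs_mult power_abs intro!: mult_le_one power_le_one)
      then show ?thesis
        by (subst Bochner_Integration.integral_diff[symmetric, OF i i])
           (auto intro!: Bochner_Integration.integral_cong simp: algebra_simps)
    qed
    show ?case
      unfolding *[OF assms(1) sets(1) nn(1)] *[OF assms(2) sets(2) nn(2)] by (simp only: Suc)
  qed
  have cont: "(\<integral>x. h (exp (- x)) \<partial>\<mu>) = (\<integral>x. h (exp (- x)) \<partial>\<nu>)"
    if h: "continuous_on UNIV h" for h :: "real \<Rightarrow> real"
  proof -
    have hc: "continuous_on {0..1} h" using h by (rule continuous_on_subset) auto
    have hm[measurable]: "h \<in> borel_measurable borel" using h by (rule borel_measurable_continuous_onI)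
    have "bounded (h ` {0..1})"
      by (rule compact_imp_bounded[OF compact_continuous_image[OF hc compact_Icc]])
    then obtain c where "\<forall>y\<in>h ` {0..1}. norm y \<le> c" unfolding bounded_iff by blast
    then have c: "\<bar>h y\<bar> \<le> c" if "y \<in> {0..1}" for y using that by auto
    \<comment> \<open>Each integral of \<open>h\<close> differs from that of the Bernstein
      polynomial \<open>p\<close> by at most \<open>e\<close> times the mass, and \<open>p\<close>
      has the same integral under both measures.\<close>
    have "\<bar>(\<integral>x. h (exp (- x)) \<partial>\<mu>) - (\<integral>x. h (exp (- x)) \<partial>\<nu>)\<bar> \<le> e * (measure \<mu> (space \<mu>) + measure \<nu> (space \<nu>))"
      if e: "e > 0" for e
    proof -
      from Bernstein_Weierstrass[OF hc e] obtain n where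
        n: "\<And>x. x \<in> {0..1} \<Longrightarrow> \<bar>h x - (\<Sum>k\<le>n. h (k/n) * Bernstein n k x)\<bar> < e" by blast
      define p where "p x = (\<Sum>k\<le>n. h (k/n) * Bernstein n k x)" for x
      have pm[measurable]: "p \<in> borel_measurable borel" unfolding p_def Bernstein_def by measurable
      have pint: "(\<integral>x. p (exp (- x)) \<partial>M) =
          (\<Sum>k\<le>n. h (k/n) * (real (n choose k) * (\<integral>x. exp (- x) ^ k * (1 - exp (- x)) ^ (n - k) \<partial>M)))"
        if M: "finite_measure M" "sets M = sets borel" "AE x in M. (0::real) \<le> x" for M
      proof -
        have i: "integrable M (\<lambda>x. exp (- x) ^ k * (1 - exp (- x)) ^ m)" for k m
          using M by (intro int[where h="\<lambda>y. y ^ k * (1 - y) ^ m" and c=1])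
            (auto simp: abs_mult power_abs intro!: mult_le_one power_le_one)
        show ?thesis
          unfolding p_def Bernstein_def mult.assoc
          by (subst Bochner_Integration.integral_sum) (auto intro!: i integrable_mult_right simp del: mult_exp_exp)
      qed
      have *: "\<bar>(\<integral>x. h (exp (- x)) \<partial>M) - (\<integral>x. p (exp (- x)) \<partial>M)\<bar> \<le> e * measure M (space M)"
        if M: "finite_measure M" "sets M = sets borel" "AE x in M. (0::real) \<le> x" for M
      proof -
        interpret finite_measure M by fact
        have pb: "\<bar>p y\<bar> \<le> c + e" if "y \<in> {0..1}" for y
          using n[OF that] c[OF that] unfolding p_def by linarith
        have i: "integrable M (\<lambda>x. h (exp (- x)))" "integrable M (\<lambda>x. p (exp (- x)))"
          using int[OF M hm c] int[OF M pm pb] by auto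
        have "\<bar>\<integral>x. h (exp (- x)) - p (exp (- x)) \<partial>M\<bar> \<le> (\<integral>x. \<bar>h (exp (- x)) - p (exp (- x))\<bar> \<partial>M)"
          by (rule integral_abs_bound)
        also have "\<dots> \<le> (\<integral>x. e \<partial>M)"
        proof (rule integral_mono_AE)
          show "AE x in M. \<bar>h (exp (- x)) - p (exp (- x))\<bar> \<le> e"
            using M(3) by eventually_elim (use n in \<open>auto simp: p_def less_imp_le\<close>)
        qed (use i in auto)
        finally have "\<bar>\<integral>x. h (exp (- x)) - p (exp (- x)) \<partial>M\<bar> \<le> (\<integral>x. e \<partial>M)" .
        then show ?thesis using i by (simp add: mult.commute)
      qed
      have "(\<integral>x. p (exp (- x)) \<partial>\<mu>) = (\<integral>x. p (exp (- x)) \<partial>\<nu>)"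
        using pint nn sets assms(1,2) mono by simp
      then show ?thesis
        using *[of \<mu>] *[of \<nu>] nn sets assms(1,2) by (simp add: algebra_simps abs_le_iff)
    qed
    note b = this
    define K where "K = measure \<mu> (space \<mu>) + measure \<nu> (space \<nu>)"
    have "\<bar>(\<integral>x. h (exp (- x)) \<partial>\<mu>) - (\<integral>x. h (exp (- x)) \<partial>\<nu>)\<bar> \<le> 0"
    proof (rule field_le_epsilon)
      fix e :: real assume "0 < e"
      have "K \<ge> 0" by (simp add: K_def)
      have "e / (K + 1) * K \<le> e" using \<open>e > 0\<close> \<open>K \<ge> 0\<close> by (simp add: field_simps)
      then show "\<bar>(\<integral>x. h (exp (- x)) \<partial>\<mu>) - (\<integral>x. h (exp (- x)) \<partial>\<nu>)\<bar> \<le> 0 + e"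
        using b[of "e / (K+1)"] \<open>e > 0\<close> \<open>K \<ge> 0\<close> unfolding K_def[symmetric] by fastforce
    qed
    then show ?thesis by simp
  qed
  have cdf: "measure \<mu> {..a} = measure \<nu> {..a}" for a
  proof -
    \<comment> \<open>Continuous ramps in y = exp (- x): equal to 1 when y \<ge> exp (- a), that is
      x \<le> a, and eventually 0 otherwise. They converge at every point to the indicator of the
      closed half-line, so an atom at \<open>a\<close> is no exception.\<close>
    define h where "h j y = max 0 (min 1 (1 + real j * (y - exp (- a))))" for j y
    have lim: "(\<lambda>j. \<integral>x. h j (exp (- x)) \<partial>M) \<longlonglongrightarrow> measure M {..a}"
      if M: "finite_measure M" "sets M = sets borel" for M
    proof -
      interpret finite_measure M by fact
      note [measurable_cong] = M(2)
      have "(\<lambda>j. \<integral>x. h j (exp (- x)) \<partial>M) \<longlonglongrightarrow> (\<integral>x. indicator {..a} x \<partial>M)"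
      proof (rule integral_dominated_convergence[where w="\<lambda>_. 1"])
        show "AE x in M. (\<lambda>j. h j (exp (- x))) \<longlonglongrightarrow> indicator {..a} x"
        proof (rule AE_I2)
          fix x
          show "(\<lambda>j. h j (exp (- x))) \<longlonglongrightarrow> indicator {..a} x"
          proof (cases "x \<le> a")
            case True
            then have "h j (exp (- x)) = 1" for j by (simp add: h_def)
            then show ?thesis using True by simp
          next
            case False
            define d where "d = exp (- a) - exp (- x)"
            have d: "d > 0" using False by (simp add: d_def)
            have "h j (exp (- x)) = 0" if "j \<ge> nat \<lceil>1 / d\<rceil>" for j
            proof -
              have "1 / d \<le> real j" using that by linarith
              then have "1 \<le> real j * d" using d by (simp add: field_simps)
              then show ?thesis by (simp add: h_def d_def algebra_simps)
            qed
            then have "(\<lambda>j. h j (exp (- x))) \<longlonglongrightarrow> 0"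
              by (intro tendsto_eventually eventually_sequentiallyI)
            then show ?thesis using False by simp
          qed
        qed
      qed (auto simp: h_def)
      then show ?thesis using sets_eq_imp_space_eq[OF M(2)] by simp
    qed
    have "(\<integral>x. h j (exp (- x)) \<partial>\<mu>) = (\<integral>x. h j (exp (- x)) \<partial>\<nu>)" for j
      by (rule cont) (auto simp: h_def intro!: continuous_intros)
    then show ?thesis
      using lim[OF assms(1) sets(1)] lim[OF assms(2) sets(2)] LIMSEQ_unique by auto
  qed
  show ?thesis
    by (rule cdf_unique') (use cdf sets assms(1,2) in \<open>auto simp: finite_borel_measure_def finite_borel_measure_axioms_def cdf_def\<close>)
qed

text \<open>Expanding exp (- n x) into its power series and integrating term by term expresses the
  Laplace transform through the moments. On the half-line a moment is its own absolute moment, so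
  \<open>sm\<close> is exactly the domination that the interchange requires.\<close>

lemma finite_measure_eq_moments:
  assumes fin: "finite_measure \<mu>" "finite_measure \<nu>" and sets: "sets \<mu> = sets borel" "sets \<nu> = sets borel"
    and nn: "AE x in \<mu>. 0 \<le> x" "AE x in \<nu>. 0 \<le> x"
    and int: "\<And>k. integrable \<mu> (\<lambda>x. x ^ k)" "\<And>k. integrable \<nu> (\<lambda>x. x ^ k)"
    and eq: "\<And>k::nat. (\<integral>x. x ^ k \<partial>\<mu>) = m k" "\<And>k::nat. (\<integral>x. x ^ k \<partial>\<nu>) = m k"
    and sm: "\<And>l::real. 0 \<le> l \<Longrightarrow> summable (\<lambda>k. l ^ k * m k / fact k)"
  shows "\<mu> = \<nu>"
proof (rule finite_measure_eq_laplace[OF fin sets nn])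
  fix n :: nat
  have *: "(\<integral>x. exp (- real n * x) \<partial>M) = (\<Sum>k. (- real n) ^ k * m k / fact k)"
    if nn: "AE x in M. 0 \<le> x" and int: "\<And>k. integrable M (\<lambda>x. x ^ k)"
      and eq: "\<And>k::nat. (\<integral>x. x ^ k \<partial>M) = m k" for M
  proof -
    let ?f = "\<lambda>k x. (- real n) ^ k * x ^ k / fact k"
    have i: "integrable M (?f k)" for k using int[of k] by auto
    have "(\<integral>x. (\<Sum>k. ?f k x) \<partial>M) = (\<Sum>k. integral\<^sup>L M (?f k))"
    proof (rule integral_suminf[OF i])
      have a: "summable (\<lambda>k. norm (?f k x))" for x
      proof -
        have "?f k x = (- real n * x) ^ k /\<^sub>R fact k" for k
          unfolding power_mult_distrib by (simp add: divide_inverse)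
        then show ?thesis using summable_norm_exp[of "- real n * x"] by simp
      qed
      show "AE x in M. summable (\<lambda>k. norm (?f k x))" using a by simp
      have "(\<integral>x. norm (?f k x) \<partial>M) = real n ^ k * m k / fact k" for k
      proof -
        have "(\<integral>x. norm (?f k x) \<partial>M) = (\<integral>x. real n ^ k / fact k * x ^ k \<partial>M)"
        proof (rule integral_cong_AE)
          show "(\<lambda>x. norm (?f k x)) \<in> borel_measurable M"
            using i[of k] by (intro borel_measurable_integrable integrable_norm)
          show "AE x in M. norm (?f k x) = real n ^ k / fact k * x ^ k"
            using nn by eventually_elim (simp add: abs_mult power_abs)
        qed (use int[of k] in auto)
        then show ?thesis using eq[of k] by simp
      qed
      then show "summable (\<lambda>k. \<integral>x. norm (?f k x) \<partial>M)" using sm[of "real n"] by simp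
    qed
    moreover have "(\<Sum>k. ?f k x) = exp (- real n * x)" for x
      unfolding exp_def power_mult_distrib by (simp add: divide_inverse mult_ac)
    moreover have "integral\<^sup>L M (?f k) = (- real n) ^ k * m k / fact k" for k
      using eq[of k] by simp
    ultimately show ?thesis by (simp add: eq)
  qed
  show "(\<integral>x. exp (- real n * x) \<partial>\<mu>) = (\<integral>x. exp (- real n * x) \<partial>\<nu>)"
    using *[OF nn(1) int(1) eq(1)] *[OF nn(2) int(2) eq(2)] by simp
qed

section \<open>Gaussian averages\<close>

definition gauss :: "'a::euclidean_space \<Rightarrow> real" where
  "gauss z = (2 * pi) powr (- (real DIM('a) / 2)) * exp (- (norm z)\<^sup>2 / 2)"

text \<open>\<open>heat r w h\<close> averages \<open>w z * h (x + sqrt r z)\<close> against the standard Gaussian: \<open>w = 1\<close> gives the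
  heat semigroup, the Hermite polynomials \<open>w\<close> give its derivatives.\<close>

definition heat :: "real \<Rightarrow> ('a \<Rightarrow> real) \<Rightarrow> ('a \<Rightarrow> real) \<Rightarrow> 'a::euclidean_space \<Rightarrow> real" where
  "heat r w h x = (\<integral>z. h (x + sqrt r *\<^sub>R z) * (w z * gauss z) \<partial>lborel)"

lemma gauss_pos: "0 < gauss z"
  by (simp add: gauss_def)

lemma borel_measurable_gauss [measurable]: "gauss \<in> borel_measurable borel"
  unfolding gauss_def[abs_def] by measurable

lemma gauss_eq_prod:
  "gauss (z::'a::euclidean_space) = (\<Prod>b\<in>Basis. std_normal_density (z \<bullet> b))"
proof -
  have n: "(norm z)\<^sup>2 = (\<Sum>b\<in>Basis. (z \<bullet> b)\<^sup>2)"
    by (subst power2_norm_eq_inner, subst euclidean_inner) (simp add: power2_eq_square)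
  have "(2 * pi) powr (- (real DIM('a) / 2)) = ((2 * pi) powr (- (1 / 2))) ^ DIM('a)"
    by (simp add: powr_realpow[symmetric] powr_powr)
  also have "\<dots> = (1 / sqrt (2 * pi)) ^ DIM('a)"
    by (simp only: powr_minus powr_half_sqrt inverse_eq_divide) (simp add: powr_half_sqrt)
  finally have c: "(2 * pi) powr (- (real DIM('a) / 2)) = (1 / sqrt (2 * pi)) ^ DIM('a)" .
  have "(\<Prod>b\<in>Basis. std_normal_density (z \<bullet> b)) = (\<Prod>b\<in>(Basis::'a set). 1 / sqrt (2 * pi)) * (\<Prod>b\<in>Basis. exp (- (z \<bullet> b)\<^sup>2 / 2))"
    unfolding prod.distrib[symmetric] by (simp add: normal_density_def)
  also have "(\<Prod>b\<in>Basis. exp (- (z \<bullet> b)\<^sup>2 / 2)) = exp (- (norm z)\<^sup>2 / 2)"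
    unfolding n by (simp add: exp_sum[symmetric] sum_negf sum_divide_distrib)
  finally show ?thesis unfolding gauss_def c by (simp only: prod_constant)
qed

lemma power_div_fact_le_exp:
  fixes t :: real
  assumes "0 \<le> t"
  shows "t ^ m / fact m \<le> exp t"
proof -
  have "(\<Sum>k\<in>{m}. t ^ k /\<^sub>R fact k) \<le> (\<Sum>k. t ^ k /\<^sub>R fact k)"
    by (rule sum_le_suminf[OF summable_exp_generic]) (use assms in auto)
  then show ?thesis by (simp add: exp_def divide_inverse mult.commute)
qed

text \<open>Half of the exponent absorbs the power, through t^m / m! \<le> exp t at t = (c / 2)
  |z|^2. The other half is a product of one-dimensional normal densities of variance 1 / c, up to a
  constant.\<close>

lemma integrable_power_times_exp:
  fixes c :: real
  assumes c: "0 < c"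
  shows "integrable lborel (\<lambda>z::'a::euclidean_space. norm z ^ m * exp (- c * (norm z)\<^sup>2))"
proof -
  have n: "(norm z)\<^sup>2 = (\<Sum>b\<in>Basis. (z \<bullet> b)\<^sup>2)" for z :: 'a
    by (subst power2_norm_eq_inner, subst euclidean_inner) (simp add: power2_eq_square)
  define s where "s = sqrt (1 / c)"
  have s: "s > 0" "s\<^sup>2 = 1 / c" using c by (auto simp: s_def)
  have e: "integrable lborel (\<lambda>z::'a. exp (- (c / 2) * (norm z)\<^sup>2))"
  proof (rule integrableI_nonneg)
    have "(\<integral>\<^sup>+z. ennreal (exp (- (c / 2) * (norm (z::'a))\<^sup>2)) \<partial>lborel)
        = (\<integral>\<^sup>+z. (\<Prod>b\<in>Basis. ennreal (exp (- (c / 2) * ((z::'a) \<bullet> b)\<^sup>2))) \<partial>lborel)"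
      by (simp add: n prod_ennreal exp_sum[symmetric] sum_distrib_left sum_negf)
    also have "\<dots> = (\<Prod>b\<in>(Basis::'a set). \<integral>\<^sup>+x. ennreal (exp (- (c / 2) * x\<^sup>2)) \<partial>lborel)"
      by (subst nn_integral_lborel_prod) auto
    also have "\<dots> < \<infinity>"
    proof -
      have "integrable lborel (\<lambda>x. sqrt (2 * pi * s\<^sup>2) * normal_density 0 s x)"
        using s by auto
      moreover have "sqrt (2 * pi * s\<^sup>2) * normal_density 0 s x = exp (- (c / 2) * x\<^sup>2)" for x
        using s c by (simp add: normal_density_def)
      ultimately have "integrable lborel (\<lambda>x. exp (- (c / 2) * x\<^sup>2))" by simp
      then have "(\<integral>\<^sup>+x. ennreal (exp (- (c / 2) * x\<^sup>2)) \<partial>lborel) < \<infinity>"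
        using integrableD(2)[of lborel "\<lambda>x. exp (- (c / 2) * x\<^sup>2)"] by (simp add: less_top)
      then show ?thesis by (simp add: power_less_top_ennreal)
    qed
    finally show "(\<integral>\<^sup>+z. ennreal (exp (- (c / 2) * (norm (z::'a))\<^sup>2)) \<partial>lborel) < \<infinity>" .
  qed auto
  show ?thesis
  proof (rule Bochner_Integration.integrable_bound[OF integrable_mult_right[OF e, of "1 + fact m / (c / 2) ^ m"]])
    show "AE z in lborel. norm (norm z ^ m * exp (- c * (norm z)\<^sup>2))
        \<le> norm ((1 + fact m / (c / 2) ^ m) * exp (- (c / 2) * (norm (z::'a))\<^sup>2))"
    proof (rule AE_I2)
      fix z :: 'a
      let ?t = "(c / 2) * (norm z)\<^sup>2"
      have t: "?t \<ge> 0" using c by simp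
      have "?t ^ m / fact m \<le> exp ?t" by (rule power_div_fact_le_exp[OF t])
      moreover have "?t ^ m = (c / 2) ^ m * norm z ^ (2 * m)"
        by (simp only: power_mult_distrib power_mult)
      moreover have "(c / 2) ^ m > 0" using c by simp
      ultimately have "norm z ^ (2 * m) \<le> fact m / (c / 2) ^ m * exp ?t"
        by (simp add: pos_le_divide_eq pos_divide_le_eq mult.commute)
      moreover have "norm z ^ m \<le> 1 + norm z ^ (2 * m)"
      proof (cases "norm z \<le> 1")
        case True
        then have "norm z ^ m \<le> 1" by (simp add: power_le_one)
        then show ?thesis by (simp add: add_increasing2)
      next
        case False
        then have "norm z ^ m \<le> norm z ^ (2 * m)" by (intro power_increasing) auto
        then show ?thesis by simp
      qed
      moreover have "1 \<le> exp ?t" using t by simp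
      ultimately have "norm z ^ m \<le> (1 + fact m / (c / 2) ^ m) * exp ?t"
        unfolding distrib_right mult_1 by linarith
      then have "norm z ^ m * exp (- c * (norm z)\<^sup>2) \<le> (1 + fact m / (c / 2) ^ m) * exp ?t * exp (- c * (norm z)\<^sup>2)"
        by (intro mult_right_mono) auto
      also have "\<dots> = (1 + fact m / (c / 2) ^ m) * exp (- ?t)"
        by (simp add: mult.assoc mult_exp_exp)
      finally show "norm (norm z ^ m * exp (- c * (norm z)\<^sup>2))
        \<le> norm ((1 + fact m / (c / 2) ^ m) * exp (- (c / 2) * (norm z)\<^sup>2))"
        using c by (simp add: abs_mult)
    qed
  qed auto
qed

text \<open>Measurable weights of polynomial growth. The class is closed under sums and products, so
  it contains every Hermite weight that differentiating the Gaussian produces, and each member is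
  integrable against \<open>gauss\<close>.\<close>

definition tempered :: "('a::euclidean_space \<Rightarrow> real) \<Rightarrow> bool" where
  "tempered w \<longleftrightarrow> w \<in> borel_measurable borel \<and> (\<exists>C m. \<forall>z. \<bar>w z\<bar> \<le> C * (1 + norm z) ^ m)"

lemma temperedD [measurable_dest]: "tempered w \<Longrightarrow> w \<in> borel_measurable borel"
  by (simp add: tempered_def)

lemma temperedE:
  assumes "tempered w"
  obtains C m where "0 \<le> C" "\<And>z. \<bar>w z\<bar> \<le> C * (1 + norm z) ^ m"
proof -
  obtain C m where *: "\<And>z. \<bar>w z\<bar> \<le> C * (1 + norm z) ^ m" using assms unfolding tempered_def by blast
  have "0 \<le> C" using *[of 0] by simp
  then show ?thesis using * that by blast
qed

lemma tempered_const [simp]: "tempered (\<lambda>_. c)"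
  unfolding tempered_def
proof (intro conjI exI allI)
  show "\<bar>c\<bar> \<le> \<bar>c\<bar> * (1 + norm z) ^ 0" for z :: 'a by simp
qed simp

lemma tempered_norm [simp]: "tempered norm"
  unfolding tempered_def
proof (intro conjI exI allI)
  show "\<bar>norm z\<bar> \<le> 1 * (1 + norm z) ^ 1" for z :: 'a by simp
qed simp

lemma tempered_inner [simp]: "tempered (\<lambda>z. z \<bullet> b)"
  unfolding tempered_def
proof (intro conjI exI allI)
  show "\<bar>z \<bullet> b\<bar> \<le> norm b * (1 + norm z) ^ 1" for z
    using Cauchy_Schwarz_ineq2[of z b] by (simp add: algebra_simps add_increasing)
qed simp

lemma tempered_mult [simp, intro]:
  assumes vw: "tempered v" "tempered w"
  shows "tempered (\<lambda>z. v z * w z)" (is "tempered ?w")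
proof -
  obtain C m where v: "0 \<le> C" "\<And>z. \<bar>v z\<bar> \<le> C * (1 + norm z) ^ m" by (rule temperedE[OF vw(1)], rule that)
  obtain D n where w: "0 \<le> D" "\<And>z. \<bar>w z\<bar> \<le> D * (1 + norm z) ^ n" by (rule temperedE[OF vw(2)], rule that)
  note * = vw v(1) w(1) v(2) w(2)
  have "\<bar>v z * w z\<bar> \<le> (C * D) * (1 + norm z) ^ (m + n)" for z
    using mult_mono[OF *(5,6)[of z]] *(3,4) by (simp add: abs_mult power_add mult_ac)
  moreover have "?w \<in> borel_measurable borel" using *(1,2)[THEN temperedD] by measurable
  ultimately show ?thesis unfolding tempered_def by blast
qed

lemma tempered_add [simp, intro]:
  assumes vw: "tempered v" "tempered w"
  shows "tempered (\<lambda>z. v z + w z)" (is "tempered ?w")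
proof -
  obtain C m where v: "0 \<le> C" "\<And>z. \<bar>v z\<bar> \<le> C * (1 + norm z) ^ m" by (rule temperedE[OF vw(1)], rule that)
  obtain D n where w: "0 \<le> D" "\<And>z. \<bar>w z\<bar> \<le> D * (1 + norm z) ^ n" by (rule temperedE[OF vw(2)], rule that)
  note * = vw v(1) w(1) v(2) w(2)
  have "\<bar>v z + w z\<bar> \<le> (C + D) * (1 + norm z) ^ (m + n)" for z
  proof -
    have "(1 + norm z) ^ m \<le> (1 + norm z) ^ (m + n)" "(1 + norm z) ^ n \<le> (1 + norm z) ^ (m + n)"
      by (auto intro: power_increasing)
    then have "C * (1 + norm z) ^ m \<le> C * (1 + norm z) ^ (m + n)" "D * (1 + norm z) ^ n \<le> D * (1 + norm z) ^ (m + n)"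
      using *(3,4) by (auto intro: mult_left_mono)
    then show ?thesis using *(5,6)[of z] by (simp add: algebra_simps)
  qed
  moreover have "?w \<in> borel_measurable borel" using *(1,2)[THEN temperedD] by measurable
  ultimately show ?thesis unfolding tempered_def by blast
qed

lemma tempered_diff [simp, intro]: "tempered v \<Longrightarrow> tempered w \<Longrightarrow> tempered (\<lambda>z. v z - w z)"
  using tempered_add[of v "\<lambda>z. - 1 * w z"] tempered_mult[of "\<lambda>_. -1" w] by simp

lemma tempered_abs [simp, intro]: "tempered w \<Longrightarrow> tempered (\<lambda>z. \<bar>w z\<bar>)"
  unfolding tempered_def by auto

lemma tempered_power [simp, intro]: "tempered w \<Longrightarrow> tempered (\<lambda>z. w z ^ n)"
  by (induction n) auto

lemma integrable_tempered_exp: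
  fixes w :: "'a::euclidean_space \<Rightarrow> real"
  assumes w: "tempered w" and c: "0 < c"
  shows "integrable lborel (\<lambda>z. w z * exp (- c * (norm z)\<^sup>2))"
proof -
  note [measurable] = temperedD[OF w]
  obtain C m where C: "0 \<le> C" "\<And>z. \<bar>w z\<bar> \<le> C * (1 + norm z) ^ m" by (rule temperedE[OF w], rule that)
  have i: "integrable lborel (\<lambda>z. C * (2 ^ m * (norm z ^ 0 * exp (- c * (norm z)\<^sup>2) + norm (z::'a) ^ m * exp (- c * (norm z)\<^sup>2))))"
    by (intro integrable_mult_right Bochner_Integration.integrable_add integrable_power_times_exp c)
  show ?thesis
  proof (rule Bochner_Integration.integrable_bound[OF i], goal_cases)
    case 2
    show ?case
    proof (rule AE_I2)
      fix z :: 'a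
      have "(1 + norm z) ^ m \<le> 2 ^ m * (1 + norm z ^ m)"
      proof (cases "norm z \<le> 1")
        case True
        then have "(1 + norm z) ^ m \<le> 2 ^ m" by (intro power_mono) auto
        also have "\<dots> \<le> 2 ^ m * (1 + norm z ^ m)" by simp
        finally show ?thesis .
      next
        case False
        then have "(1 + norm z) ^ m \<le> (2 * norm z) ^ m" by (intro power_mono) auto
        then show ?thesis by (simp add: power_mult_distrib algebra_simps add_increasing)
      qed
      then have "\<bar>w z\<bar> \<le> C * (2 ^ m * (1 + norm z ^ m))"
        using C(1) C(2)[of z] by (meson mult_left_mono order_trans)
      then have "\<bar>w z\<bar> * exp (- c * (norm z)\<^sup>2) \<le> C * (2 ^ m * (1 + norm z ^ m)) * exp (- c * (norm z)\<^sup>2)"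
        by (intro mult_right_mono) auto
      then show "norm (w z * exp (- c * (norm z)\<^sup>2)) \<le> norm (C * (2 ^ m * (norm z ^ 0 * exp (- c * (norm z)\<^sup>2) + norm z ^ m * exp (- c * (norm z)\<^sup>2))))"
        using C(1) by (simp add: abs_mult algebra_simps)
    qed
  qed measurable
qed

lemma integrable_tempered_gauss [simp, intro]:
  fixes w :: "'a::euclidean_space \<Rightarrow> real"
  assumes w: "tempered w"
  shows "integrable lborel (\<lambda>z. w z * gauss z)"
  using integrable_mult_right[OF integrable_tempered_exp[OF w, of "1/2"], of "(2 * pi) powr (- (real DIM('a) / 2))"]
  by (simp add: gauss_def mult_ac)

lemma integral_gauss: "(\<integral>z. gauss (z::'a::euclidean_space) \<partial>lborel) = 1"
proof -
  have "(\<integral>\<^sup>+z. ennreal (gauss (z::'a)) \<partial>lborel) = (\<integral>\<^sup>+z. (\<Prod>b\<in>Basis. ennreal (std_normal_density ((z::'a) \<bullet> b))) \<partial>lborel)"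
    by (simp add: gauss_eq_prod prod_ennreal)
  also have "\<dots> = (\<Prod>b\<in>(Basis::'a set). \<integral>\<^sup>+x. ennreal (std_normal_density x) \<partial>lborel)"
    by (subst nn_integral_lborel_prod) auto
  also have "(\<integral>\<^sup>+x. ennreal (std_normal_density x) \<partial>lborel) = 1"
    by (subst nn_integral_eq_integral) auto
  finally show ?thesis
    using gauss_pos[where 'a='a] by (simp add: integral_eq_nn_integral less_imp_le)
qed

lemma integrable_heat:
  fixes h :: "'a::euclidean_space \<Rightarrow> real"
  assumes [measurable]: "h \<in> borel_measurable borel" and h: "\<And>x. \<bar>h x\<bar> \<le> K" and w: "tempered w"
  shows "integrable lborel (\<lambda>z. h (x + sqrt r *\<^sub>R z) * (w z * gauss z))"
proof -
  note [measurable] = temperedD[OF w]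
  have K: "0 \<le> K" using h[of 0] by simp
  show ?thesis
    by (rule Bochner_Integration.integrable_bound[OF integrable_mult_right[OF integrable_tempered_gauss[OF w], of K]])
       (use h K in \<open>auto simp: abs_mult intro!: mult_right_mono\<close>)
qed

lemma heat_bound:
  fixes h :: "'a::euclidean_space \<Rightarrow> real"
  assumes [measurable]: "h \<in> borel_measurable borel" and h: "\<And>x. \<bar>h x\<bar> \<le> K" and w: "tempered w"
  shows "\<bar>heat r w h x\<bar> \<le> K * (\<integral>z. \<bar>w z\<bar> * gauss z \<partial>lborel)"
proof -
  have "\<bar>heat r w h x\<bar> \<le> (\<integral>z. \<bar>h (x + sqrt r *\<^sub>R z) * (w z * gauss z)\<bar> \<partial>lborel)"
    unfolding heat_def by (rule integral_abs_bound)
  also have "\<dots> \<le> (\<integral>z. K * (\<bar>w z\<bar> * gauss z) \<partial>lborel)"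
    using integrable_heat[OF assms] w h gauss_pos[where 'a='a]
    by (intro integral_mono integrable_mult_right integrable_abs integrable_tempered_gauss)
       (auto simp: abs_mult less_imp_le intro!: mult_right_mono)
  finally show ?thesis by simp
qed

lemma heat_1_bound:
  fixes h :: "'a::euclidean_space \<Rightarrow> real"
  assumes "h \<in> borel_measurable borel" "\<And>x. \<bar>h x\<bar> \<le> K"
  shows "\<bar>heat r (\<lambda>_. 1) h x\<bar> \<le> K"
  using heat_bound[OF assms tempered_const[of 1], of r x] by (simp add: integral_gauss)

lemma heat_0: "heat 0 w h x = h x * (\<integral>z. w z * gauss z \<partial>lborel)"
  by (simp add: heat_def)

text \<open>\<open>sqrt\<close> is continuous on the whole line (odd for negative arguments), so no
  restriction on r is required. Continuity at r = 0 is what later gives Taylor expansions at 0 their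
  base point.\<close>

lemma heat_continuous_on:
  fixes h :: "'a::euclidean_space \<Rightarrow> real"
  assumes c: "continuous_on UNIV h" and h: "\<And>x. \<bar>h x\<bar> \<le> K" and w: "tempered w"
  shows "continuous_on UNIV (\<lambda>r. heat r w h x)"
  unfolding heat_def
proof (rule integral_continuous_on_dominated[where B="\<lambda>z. K * (\<bar>w z\<bar> * gauss z)"])
  have hm[measurable]: "h \<in> borel_measurable borel" using c by (rule borel_measurable_continuous_onI)
  note [measurable] = temperedD[OF w]
  show "(\<lambda>z. h (x + sqrt r *\<^sub>R z) * (w z * gauss z)) \<in> borel_measurable lborel" for r by measurable
  show "AE z in lborel. continuous_on UNIV (\<lambda>r. h (x + sqrt r *\<^sub>R z) * (w z * gauss z))"
    by (intro AE_I2 continuous_intros continuous_on_compose2[OF c]) auto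
  show "integrable lborel (\<lambda>z. K * (\<bar>w z\<bar> * gauss z))" using w by auto
  show "AE z in lborel. \<bar>h (x + sqrt r *\<^sub>R z) * (w z * gauss z)\<bar> \<le> K * (\<bar>w z\<bar> * gauss z)" for r
    using h gauss_pos[where 'a='a] by (auto simp: abs_mult less_imp_le intro!: mult_right_mono)
qed

section \<open>Derivatives of Gaussian averages of functions that need not be smooth\<close>

lemma lborel_integral_translate:
  fixes F :: "'a::euclidean_space \<Rightarrow> real"
  assumes [measurable]: "F \<in> borel_measurable borel"
  shows "(\<integral>z. F (z + a) \<partial>lborel) = (\<integral>z. F z \<partial>lborel)"
proof -
  have "(\<integral>z. F z \<partial>lborel) = (\<integral>z. F z \<partial>distr lborel borel ((+) a))" by (simp add: lborel_distr_plus)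
  also have "\<dots> = (\<integral>z. F (a + z) \<partial>lborel)" by (subst integral_distr) auto
  finally show ?thesis by (simp add: add.commute)
qed

lemma lborel_integral_scale:
  fixes F :: "'a::euclidean_space \<Rightarrow> real"
  assumes [measurable]: "F \<in> borel_measurable borel" and c: "c > 0"
  shows "(\<integral>z. F z \<partial>lborel) = c ^ DIM('a) * (\<integral>z. F (c *\<^sub>R z) \<partial>lborel)"
proof -
  have "(\<integral>z. F z \<partial>lborel) = (\<integral>z. F z \<partial>density (distr lborel borel (\<lambda>x. 0 + c *\<^sub>R x)) (\<lambda>_. \<bar>c\<bar> ^ DIM('a)))"
    using lborel_affine[of c "0::'a"] c by simp
  also have "\<dots> = (\<integral>z. c ^ DIM('a) * F z \<partial>distr lborel borel (\<lambda>x::'a. c *\<^sub>R x))"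
    using c by (subst integral_density) (auto simp: ennreal_power)
  also have "\<dots> = c ^ DIM('a) * (\<integral>z. F (c *\<^sub>R z) \<partial>lborel)"
    by (subst integral_distr) auto
  finally show ?thesis .
qed

text \<open>One integrable majorant for all kernels translated by at most 1: from |z| \<le> |y| + 1
  and (|y| + 1)^2 \<le> 2 |y|^2 + 2, at the price of half the exponent.\<close>

lemma gauss_shift_bound:
  fixes z y :: "'a::euclidean_space"
  assumes "norm (z - y) \<le> 1"
  shows "gauss y \<le> (2 * pi) powr (- (real DIM('a) / 2)) * exp (1 / 2) * exp (- (1 / 4) * (norm z)\<^sup>2)"
proof -
  have "norm z \<le> norm y + 1" using assms norm_triangle_sub[of z y] by simp
  then have "(norm z)\<^sup>2 \<le> (norm y + 1)\<^sup>2" by (intro power_mono) auto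
  moreover have "(norm y + 1)\<^sup>2 \<le> 2 * (norm y)\<^sup>2 + 2"
    using zero_le_power2[of "norm y - 1"] by (simp add: power2_eq_square algebra_simps)
  ultimately have "- (norm y)\<^sup>2 / 2 \<le> 1 / 2 + - (1 / 4) * (norm z)\<^sup>2" by linarith
  then have "exp (- (norm y)\<^sup>2 / 2) \<le> exp (1 / 2) * exp (- (1 / 4) * (norm z)\<^sup>2)"
    by (simp only: exp_add[symmetric] exp_le_cancel_iff)
  then show ?thesis unfolding gauss_def mult.assoc by (rule mult_left_mono) simp
qed

text \<open>Translating the integration variable moves the displacement from \<open>h\<close>, which
  is only bounded and measurable, to the smooth kernel \<open>w z * gauss z\<close>. The derivative
  of that kernel along b is \<open>(w' z - w z * (z \<bullet> b)) * gauss z\<close>; the sign flips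
  because the shift is \<open>- \<eta> / sqrt r\<close>, which is also the source of the factor
  \<open>1 / sqrt r\<close>.\<close>

lemma heat_has_directional_derivative:
  fixes h :: "'a::euclidean_space \<Rightarrow> real"
  assumes hm [measurable]: "h \<in> borel_measurable borel" and h: "\<And>x. \<bar>h x\<bar> \<le> K"
    and r: "0 < r" and b: "norm b = 1" and w: "tempered w" "tempered w'"
    and der: "\<And>z \<eta>. ((\<lambda>\<eta>. w (z + \<eta> *\<^sub>R b)) has_real_derivative w' (z + \<eta> *\<^sub>R b)) (at \<eta>)"
  shows "((\<lambda>\<eta>. heat r w h (x + \<eta> *\<^sub>R b)) has_real_derivative
           heat r (\<lambda>z. w z * (z \<bullet> b) - w' z) h x / sqrt r) (at 0)"
proof -
  note [measurable] = temperedD[OF w(1)] temperedD[OF w(2)]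
  have K: "0 \<le> K" using h[of 0] by simp
  define s where "s = sqrt r"
  have s: "0 < s" using r by (simp add: s_def)
  define q where "q z = w z * gauss z" for z
  define q' where "q' z = (w' z - w z * (z \<bullet> b)) * gauss z" for z
  have [measurable]: "q \<in> borel_measurable borel" "q' \<in> borel_measurable borel"
    unfolding q_def q'_def by measurable
  have tq: "tempered (\<lambda>z. w' z - w z * (z \<bullet> b))" using w by simp
  obtain C m where C: "0 \<le> C" "\<And>z. \<bar>w' z - w z * (z \<bullet> b)\<bar> \<le> C * (1 + norm z) ^ m"
    by (rule temperedE[OF tq], rule that)
  define D where "D = (2 * pi) powr (- (real DIM('a) / 2)) * exp (1 / 2)"
  have D: "D > 0" by (simp add: D_def)
  define B where "B z = K / s * (C * (2 + norm z) ^ m * (D * exp (- (1 / 4) * (norm z)\<^sup>2)))" for z :: 'a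
  have dg: "((\<lambda>\<eta>. gauss (z + \<eta> *\<^sub>R b)) has_real_derivative - ((z + \<eta> *\<^sub>R b) \<bullet> b) * gauss (z + \<eta> *\<^sub>R b)) (at \<eta>)" for z \<eta>
  proof -
    have "(norm (z + \<eta> *\<^sub>R b))\<^sup>2 = (norm z)\<^sup>2 + 2 * \<eta> * (z \<bullet> b) + \<eta>\<^sup>2" for \<eta>
      using b unfolding power2_norm_eq_inner by (simp add: inner_add_left inner_add_right inner_commute norm_eq_1 power2_eq_square)
    then have *: "gauss (z + \<eta> *\<^sub>R b) = (2 * pi) powr (- (real DIM('a) / 2)) * exp (- ((norm z)\<^sup>2 + 2 * \<eta> * (z \<bullet> b) + \<eta>\<^sup>2) / 2)" for \<eta>
      by (simp add: gauss_def)
    have bb: "b \<bullet> b = 1" using b by (simp add: norm_eq_1)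
    show ?thesis unfolding *
      by (rule derivative_eq_intros refl | simp)+ (simp add: inner_add_left bb algebra_simps)
  qed
  have dq: "((\<lambda>\<eta>. q (z + \<eta> *\<^sub>R b)) has_real_derivative q' (z + \<eta> *\<^sub>R b)) (at \<eta>)" for z \<eta>
    unfolding q_def q'_def
    by (rule derivative_eq_intros der dg refl)+ (simp add: algebra_simps)
  have rep: "heat r w h (x + \<eta> *\<^sub>R b) = (\<integral>z. h (x + s *\<^sub>R z) * q (z + (- \<eta> / s) *\<^sub>R b) \<partial>lborel)" for \<eta>
  proof -
    have "(\<integral>z. h (x + s *\<^sub>R z) * q (z + (- \<eta> / s) *\<^sub>R b) \<partial>lborel)
      = (\<integral>z. h (x + s *\<^sub>R (z + (\<eta> / s) *\<^sub>R b)) * q ((z + (\<eta> / s) *\<^sub>R b) + (- \<eta> / s) *\<^sub>R b) \<partial>lborel)"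
      by (rule lborel_integral_translate[symmetric]) measurable
    also have "\<dots> = heat r w h (x + \<eta> *\<^sub>R b)"
      using s by (simp add: heat_def q_def s_def[symmetric] scaleR_add_right add.commute add.left_commute)
    finally show ?thesis ..
  qed
  have "((\<lambda>\<eta>. \<integral>z. h (x + s *\<^sub>R z) * q (z + (- \<eta> / s) *\<^sub>R b) \<partial>lborel) has_real_derivative
      (\<integral>z. h (x + s *\<^sub>R z) * ((- 1 / s) * q' (z + (- 0 / s) *\<^sub>R b)) \<partial>lborel)) (at 0)"
  \<comment> \<open>For \<eta> in this interval the kernel is translated by less than 1, as
    \<open>gauss_shift_bound\<close> demands.\<close>
  proof (rule integral_has_derivative_dominated[where a="- s" and b=s and B=B])
    show "0 \<in> {- s<..<s}" using s by simp
    show "integrable lborel (\<lambda>z. h (x + s *\<^sub>R z) * q (z + (- \<eta> / s) *\<^sub>R b))" for \<eta>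
    proof -
      have "integrable lborel (\<lambda>z. h ((x + \<eta> *\<^sub>R b) + s *\<^sub>R z) * q z)"
        using integrable_heat[OF hm h w(1)] by (simp add: q_def s_def)
      then have "integrable (distr lborel borel ((+) ((- \<eta> / s) *\<^sub>R b))) (\<lambda>z. h ((x + \<eta> *\<^sub>R b) + s *\<^sub>R z) * q z)"
        by (simp add: lborel_distr_plus)
      then have "integrable lborel (\<lambda>z. h ((x + \<eta> *\<^sub>R b) + s *\<^sub>R ((- \<eta> / s) *\<^sub>R b + z)) * q ((- \<eta> / s) *\<^sub>R b + z))"
        by (subst (asm) integrable_distr_eq) auto
      then show ?thesis using s by (simp add: scaleR_diff_right add.commute add.left_commute)
    qed
    show "AE z in lborel. \<forall>\<eta>\<in>{- s<..<s}. ((\<lambda>\<eta>. h (x + s *\<^sub>R z) * q (z + (- \<eta> / s) *\<^sub>R b)) has_real_derivative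
        h (x + s *\<^sub>R z) * ((- 1 / s) * q' (z + (- \<eta> / s) *\<^sub>R b))) (at \<eta>)"
    proof (intro AE_I2 ballI)
      fix z \<eta>
      have "((\<lambda>\<eta>. q (z + (- \<eta> / s) *\<^sub>R b)) has_real_derivative q' (z + (- \<eta> / s) *\<^sub>R b) * (- 1 / s)) (at \<eta>)"
        by (rule DERIV_chain2[OF dq]) (use s in \<open>auto intro!: derivative_eq_intros\<close>)
      from DERIV_cmult[OF this, of "h (x + s *\<^sub>R z)"]
      show "((\<lambda>\<eta>. h (x + s *\<^sub>R z) * q (z + (- \<eta> / s) *\<^sub>R b)) has_real_derivative
        h (x + s *\<^sub>R z) * ((- 1 / s) * q' (z + (- \<eta> / s) *\<^sub>R b))) (at \<eta>)" by (simp add: mult_ac)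
    qed
    show "(\<lambda>z. h (x + s *\<^sub>R z) * ((- 1 / s) * q' (z + (- 0 / s) *\<^sub>R b))) \<in> borel_measurable lborel"
      by measurable
    have "tempered (\<lambda>z. C * (2 + norm z) ^ m)" by (intro tempered_mult tempered_power tempered_add) auto
    from integrable_mult_right[OF integrable_mult_right[OF integrable_tempered_exp[OF this, of "1/4"]], of "K / s" D]
    show "integrable lborel B" unfolding B_def by (simp add: mult_ac)
    show "AE z in lborel. \<forall>\<eta>\<in>{- s<..<s}. \<bar>h (x + s *\<^sub>R z) * ((- 1 / s) * q' (z + (- \<eta> / s) *\<^sub>R b))\<bar> \<le> B z"
    proof (intro AE_I2 ballI)
      fix z :: 'a and \<eta> assume \<eta>: "\<eta> \<in> {- s<..<s}"
      define y where "y = z + (- \<eta> / s) *\<^sub>R b"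
      have yz: "norm (z - y) \<le> 1" using \<eta> s b by (auto simp: y_def)
      have "norm y \<le> norm z + 1" using yz norm_triangle_sub[of y z] by (simp add: norm_minus_commute)
      then have "(1 + norm y) ^ m \<le> (2 + norm z) ^ m" by (intro power_mono) auto
      then have "\<bar>w' y - w y * (y \<bullet> b)\<bar> \<le> C * (2 + norm z) ^ m" using C(1) C(2)[of y] by (meson mult_left_mono order_trans)
      then have "\<bar>q' y\<bar> \<le> C * (2 + norm z) ^ m * (D * exp (- (1 / 4) * (norm z)\<^sup>2))"
        using gauss_shift_bound[OF yz] gauss_pos[of y] C(1)
        unfolding q'_def abs_mult D_def by (intro mult_mono) auto
      then have "\<bar>h (x + s *\<^sub>R z)\<bar> * (1 / s * \<bar>q' y\<bar>) \<le> K * (1 / s * (C * (2 + norm z) ^ m * (D * exp (- (1 / 4) * (norm z)\<^sup>2))))"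
        using h K s by (intro mult_mono mult_left_mono) auto
      then show "\<bar>h (x + s *\<^sub>R z) * ((- 1 / s) * q' (z + (- \<eta> / s) *\<^sub>R b))\<bar> \<le> B z"
        using s unfolding B_def y_def[symmetric] by (simp add: abs_mult)
    qed
  qed
  moreover have "(\<integral>z. h (x + s *\<^sub>R z) * ((- 1 / s) * q' (z + (- 0 / s) *\<^sub>R b)) \<partial>lborel)
    = heat r (\<lambda>z. w z * (z \<bullet> b) - w' z) h x / sqrt r"
    unfolding heat_def s_def[symmetric] Bochner_Integration.integral_divide_zero[symmetric]
    using s by (intro Bochner_Integration.integral_cong) (auto simp: q'_def field_simps)
  ultimately show ?thesis unfolding rep by simp
qed

text \<open>Integration by parts in disguise: the average of the constant function 1 does not depend
  on the base point, so its directional derivative, which is this integral, vanishes.\<close>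

lemma integral_hermite_gauss:
  fixes b :: "'a::euclidean_space"
  assumes b: "norm b = 1" and w: "tempered w" "tempered w'"
    and der: "\<And>z \<eta>. ((\<lambda>\<eta>. w (z + \<eta> *\<^sub>R b)) has_real_derivative w' (z + \<eta> *\<^sub>R b)) (at \<eta>)"
  shows "(\<integral>z. (w z * (z \<bullet> b) - w' z) * gauss z \<partial>lborel) = 0"
proof -
  have "((\<lambda>\<eta>. heat 1 w (\<lambda>_. 1) (0 + \<eta> *\<^sub>R b)) has_real_derivative
      heat 1 (\<lambda>z. w z * (z \<bullet> b) - w' z) (\<lambda>_. 1) 0 / sqrt 1) (at 0)"
    by (rule heat_has_directional_derivative[where K=1]) (use assms in auto)
  moreover have "((\<lambda>\<eta>. heat 1 w (\<lambda>_. 1) (0 + \<eta> *\<^sub>R b)) has_real_derivative 0) (at 0)"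
    by (simp add: heat_def)
  ultimately have "heat 1 (\<lambda>z. w z * (z \<bullet> b) - w' z) (\<lambda>_. 1) 0 / sqrt 1 = 0" by (rule DERIV_unique)
  then show ?thesis by (simp add: heat_def)
qed

lemma heat_has_derivative_1:
  fixes h :: "'a::euclidean_space \<Rightarrow> real"
  assumes "h \<in> borel_measurable borel" "\<And>x. \<bar>h x\<bar> \<le> K" "0 < r" "norm b = 1"
  shows "((\<lambda>\<eta>. heat r (\<lambda>_. 1) h (x + \<eta> *\<^sub>R b)) has_real_derivative heat r (\<lambda>z. z \<bullet> b) h x / sqrt r) (at 0)"
  using heat_has_directional_derivative[OF assms tempered_const[of 1] tempered_const[of 0], of x] by simp

lemma heat_has_derivative_2:
  fixes h :: "'a::euclidean_space \<Rightarrow> real"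
  assumes "h \<in> borel_measurable borel" "\<And>x. \<bar>h x\<bar> \<le> K" "0 < r" "norm b = 1"
  shows "((\<lambda>\<eta>. heat r (\<lambda>z. z \<bullet> l) h (x + \<eta> *\<^sub>R b)) has_real_derivative
    heat r (\<lambda>z. (z \<bullet> l) * (z \<bullet> b) - b \<bullet> l) h x / sqrt r) (at 0)"
  by (rule heat_has_directional_derivative[OF assms tempered_inner tempered_const])
     (auto intro!: derivative_eq_intros simp: inner_add_left)

lemma integral_hermite_2:
  assumes "norm b = 1"
  shows "(\<integral>z. ((z \<bullet> l) * (z \<bullet> b) - b \<bullet> l) * gauss z \<partial>lborel) = 0"
  by (rule integral_hermite_gauss[OF assms tempered_inner tempered_const])
     (auto intro!: derivative_eq_intros simp: inner_add_left)

text \<open>As for the spatial derivative, the parameter is moved from \<open>h\<close> to the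
  kernel, here by a dilation. The variable is scaled by the square root of r / \<rho>, so that
  \<rho> enters only through l = r / \<rho> in \<open>Q l\<close>; the derivative is then taken at l
  = 1 and the chain rule contributes - 1 / r.\<close>

lemma heat_has_time_derivative:
  fixes h :: "'a::euclidean_space \<Rightarrow> real"
  assumes hm [measurable]: "h \<in> borel_measurable borel" and h: "\<And>x. \<bar>h x\<bar> \<le> K" and r: "0 < r"
  shows "((\<lambda>r. heat r (\<lambda>_. 1) h x) has_real_derivative
           heat r (\<lambda>z. (norm z)\<^sup>2 - real DIM('a)) h x / (2 * r)) (at r)"
proof -
  have K: "0 \<le> K" using h[of 0] by simp
  define d where "d = real DIM('a) / 2"
  have d: "d > 0" by (simp add: d_def)
  define c where "c = (2 * pi) powr (- d)"
  have c: "c > 0" by (simp add: c_def)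
  define Q where "Q l z = c * (l powr d * exp (- l * (norm z)\<^sup>2 / 2))" for l and z :: 'a
  define Q' where "Q' l z = c * (d * l powr (d - 1) - l powr d * ((norm z)\<^sup>2 / 2)) * exp (- l * (norm z)\<^sup>2 / 2)" for l and z :: 'a
  define s where "s = sqrt r"
  have s: "0 < s" using r by (simp add: s_def)
  have rep: "heat \<rho> (\<lambda>_. 1) h x = (\<integral>z. h (x + s *\<^sub>R z) * Q (r / \<rho>) z \<partial>lborel)" if \<rho>: "\<rho> > 0" for \<rho>
  proof -
    define k where "k = sqrt (r / \<rho>)"
    have k: "k > 0" "sqrt \<rho> * k = s" "k\<^sup>2 = r / \<rho>" using r \<rho> by (auto simp: k_def s_def real_sqrt_divide power_divide)
    have "k ^ DIM('a) = (r / \<rho>) powr d"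
    proof -
      have "(r / \<rho>) powr d = (k powr 2) powr d" using k by simp
      also have "\<dots> = k powr real DIM('a)" unfolding powr_powr by (simp add: d_def)
      also have "\<dots> = k ^ DIM('a)" using k(1) by (rule powr_realpow)
      finally show ?thesis ..
    qed
    then have *: "k ^ DIM('a) * gauss (k *\<^sub>R z) = Q (r / \<rho>) z" for z :: 'a
      using k by (simp add: gauss_def Q_def c_def d_def power_mult_distrib)
    have "heat \<rho> (\<lambda>_. 1) h x = k ^ DIM('a) * (\<integral>z. h (x + sqrt \<rho> *\<^sub>R (k *\<^sub>R z)) * (1 * gauss (k *\<^sub>R z)) \<partial>lborel)"
      unfolding heat_def by (rule lborel_integral_scale) (use k in auto)
    also have "\<dots> = (\<integral>z. h (x + s *\<^sub>R z) * Q (r / \<rho>) z \<partial>lborel)"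
      unfolding integral_mult_right_zero[symmetric] *[symmetric] using k(2) by (simp add: mult_ac)
    finally show ?thesis .
  qed
  have QD: "((\<lambda>l. Q l z) has_real_derivative Q' l z) (at l)" if "l > 0" for l z
    unfolding Q_def Q'_def using that
    by (auto intro!: derivative_eq_intros simp: algebra_simps)
  \<comment> \<open>Majorises both \<open>l powr d\<close> and \<open>l powr (d - 1)\<close> on the
    interval from 1/2 to 2. Since d is half the dimension, d - 1 may be negative, and then the left
    endpoint gives the maximum.\<close>
  define A where "A = max 1 (2 powr d) + max 1 (max ((1/2) powr (d - 1)) (2 powr (d - 1)))"
  define B where "B z = K * (c * (A * (d + (norm z)\<^sup>2)) * exp (- (1 / 4) * (norm z)\<^sup>2))" for z :: 'a
  have "((\<lambda>l. \<integral>z. h (x + s *\<^sub>R z) * Q l z \<partial>lborel) has_real_derivative (\<integral>z. h (x + s *\<^sub>R z) * Q' 1 z \<partial>lborel)) (at 1)"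
  proof (rule integral_has_derivative_dominated[where a="1/2" and b=2 and B=B])
    show "integrable lborel (\<lambda>z. h (x + s *\<^sub>R z) * Q l z)" if "l \<in> {1/2<..<2}" for l
    proof -
      have "integrable lborel (\<lambda>z::'a. K * (c * l powr d) * (1 * exp (- (l / 2) * (norm z)\<^sup>2)))"
        by (intro integrable_mult_right integrable_tempered_exp) (use that in auto)
      then show ?thesis
        by (rule Bochner_Integration.integrable_bound)
           (use h K c in \<open>auto simp: Q_def[abs_def] abs_mult intro!: mult_right_mono\<close>)
    qed
    show "AE z in lborel. \<forall>l\<in>{1/2<..<2}. ((\<lambda>l. h (x + s *\<^sub>R z) * Q l z) has_real_derivative h (x + s *\<^sub>R z) * Q' l z) (at l)"
      by (intro AE_I2 ballI DERIV_cmult QD) auto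
    show "(\<lambda>z. h (x + s *\<^sub>R z) * Q' 1 z) \<in> borel_measurable lborel"
      unfolding Q'_def[abs_def] by measurable
    have "tempered (\<lambda>z::'a. c * (A * (d + (norm z)\<^sup>2)))"
      by (intro tempered_mult tempered_add tempered_power tempered_const tempered_norm)
    from integrable_mult_right[OF integrable_tempered_exp[OF this, of "1/4"], of K]
    show "integrable lborel B" unfolding B_def by simp
    show "AE z in lborel. \<forall>l\<in>{1/2<..<2}. \<bar>h (x + s *\<^sub>R z) * Q' l z\<bar> \<le> B z"
    proof (intro AE_I2 ballI)
      fix z :: 'a and l :: real assume l: "l \<in> {1/2<..<2}"
      have 1: "l powr d \<le> A"
      proof -
        have "l powr d \<le> 2 powr d" using l d by (intro powr_mono2) auto
        then show ?thesis unfolding A_def by linarith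
      qed
      have 2: "l powr (d - 1) \<le> A"
      proof (cases "d \<ge> 1")
        case True
        have "l powr (d - 1) \<le> 2 powr (d - 1)" using l True by (intro powr_mono2) auto
        then show ?thesis unfolding A_def by linarith
      next
        case False
        have "l powr (d - 1) \<le> (1/2) powr (d - 1)" using l False by (intro powr_mono2') auto
        then show ?thesis unfolding A_def by linarith
      qed
      have "\<bar>d * l powr (d - 1) - l powr d * ((norm z)\<^sup>2 / 2)\<bar> \<le> d * l powr (d - 1) + l powr d * ((norm z)\<^sup>2 / 2)"
        using d by (intro order_trans[OF abs_triangle_ineq4]) (simp add: abs_mult)
      also have "\<dots> \<le> d * A + A * ((norm z)\<^sup>2 / 2)"
        using 1 2 d by (intro add_mono mult_left_mono mult_right_mono) auto
      also have "\<dots> \<le> A * (d + (norm z)\<^sup>2)"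
        using order_trans[OF _ 1, of 0] by (simp add: algebra_simps)
      finally have 3: "\<bar>d * l powr (d - 1) - l powr d * ((norm z)\<^sup>2 / 2)\<bar> \<le> A * (d + (norm z)\<^sup>2)" .
      have "1 / 2 * (norm z)\<^sup>2 \<le> l * (norm z)\<^sup>2" using l by (intro mult_right_mono) auto
      then have 4: "exp (- l * (norm z)\<^sup>2 / 2) \<le> exp (- (1 / 4) * (norm z)\<^sup>2)"
        unfolding exp_le_cancel_iff by linarith
      have "\<bar>c * (d * l powr (d - 1) - l powr d * ((norm z)\<^sup>2 / 2))\<bar> \<le> c * (A * (d + (norm z)\<^sup>2))"
        unfolding abs_mult using 3 c by (simp add: mult_left_mono)
      then have "\<bar>Q' l z\<bar> \<le> c * (A * (d + (norm z)\<^sup>2)) * exp (- (1 / 4) * (norm z)\<^sup>2)"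
        unfolding Q'_def abs_mult[of _ "exp _"] using 4 by (intro mult_mono) (auto intro: order_trans[OF abs_ge_zero])
      then show "\<bar>h (x + s *\<^sub>R z) * Q' l z\<bar> \<le> B z"
        unfolding B_def abs_mult using h K by (intro mult_mono) auto
    qed
  qed auto
  moreover have "((\<lambda>\<rho>. r / \<rho>) has_real_derivative - 1 / r) (at r)"
    using r by (auto intro!: derivative_eq_intros simp: power2_eq_square)
  ultimately have "((\<lambda>\<rho>. \<integral>z. h (x + s *\<^sub>R z) * Q (r / \<rho>) z \<partial>lborel) has_real_derivative
      (\<integral>z. h (x + s *\<^sub>R z) * Q' 1 z \<partial>lborel) * (- 1 / r)) (at r)"
    using DERIV_chain2[of "\<lambda>l. \<integral>z. h (x + s *\<^sub>R z) * Q l z \<partial>lborel" _ "\<lambda>\<rho>. r / \<rho>" r "- 1 / r" UNIV] r by simp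
  moreover have "(\<integral>z. h (x + s *\<^sub>R z) * Q' 1 z \<partial>lborel) * (- 1 / r) = heat r (\<lambda>z. (norm z)\<^sup>2 - real DIM('a)) h x / (2 * r)"
    unfolding heat_def s_def[symmetric] Bochner_Integration.integral_divide_zero[symmetric] integral_mult_left_zero[symmetric]
    using r by (intro Bochner_Integration.integral_cong) (auto simp: Q'_def gauss_def c_def d_def field_simps)
  ultimately have "((\<lambda>\<rho>. \<integral>z. h (x + s *\<^sub>R z) * Q (r / \<rho>) z \<partial>lborel) has_real_derivative
      heat r (\<lambda>z. (norm z)\<^sup>2 - real DIM('a)) h x / (2 * r)) (at r)" by simp
  then show ?thesis
    by (rule has_field_derivative_transform_within_open[where S="{0<..}"]) (use r rep in auto)
qed

lemma heat_sum:
  fixes h :: "'a::euclidean_space \<Rightarrow> real"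
  assumes "h \<in> borel_measurable borel" "\<And>x. \<bar>h x\<bar> \<le> K" "\<And>i. i \<in> I \<Longrightarrow> tempered (w i)"
  shows "heat r (\<lambda>z. \<Sum>i\<in>I. w i z) h x = (\<Sum>i\<in>I. heat r (w i) h x)"
  unfolding heat_def sum_distrib_left sum_distrib_right
  by (rule Bochner_Integration.integral_sum, rule integrable_heat[OF assms(1,2)]) (use assms in auto)

text \<open>Subtracting \<open>h x\<close> under the integral is free by \<open>w0\<close> and gains the factor \<open>(sqrt r) powr \<alpha>\<close>.\<close>

lemma heat_holder_bound:
  fixes h :: "'a::euclidean_space \<Rightarrow> real"
  assumes hm [measurable]: "h \<in> borel_measurable borel" and h: "\<And>x. \<bar>h x\<bar> \<le> K"
    and ho: "\<And>x y. \<bar>h x - h y\<bar> \<le> C * dist x y powr \<alpha>" and \<alpha>: "0 < \<alpha>" "\<alpha> \<le> 1" and r: "0 \<le> r"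
    and w: "tempered w" and w0: "(\<integral>z. w z * gauss z \<partial>lborel) = 0"
  shows "\<bar>heat r w h x\<bar> \<le> C * r powr (\<alpha> / 2) * (\<integral>z. (1 + norm z) * \<bar>w z\<bar> * gauss z \<partial>lborel)"
proof -
  note [measurable] = temperedD[OF w]
  have C: "0 \<le> C"
  proof -
    obtain b :: 'a where "b \<in> Basis" using nonempty_Basis by blast
    then show ?thesis using ho[of 0 b] by simp
  qed
  have i0: "integrable lborel (\<lambda>z. h x * (w z * gauss z))" using w by auto
  have i1: "integrable lborel (\<lambda>z. h (x + sqrt r *\<^sub>R z) * (w z * gauss z))" by (rule integrable_heat[OF hm h w])
  have "heat r w h x = (\<integral>z. (h (x + sqrt r *\<^sub>R z) - h x) * (w z * gauss z) \<partial>lborel)"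
    unfolding heat_def left_diff_distrib Bochner_Integration.integral_diff[OF i1 i0] using w0 by simp
  also have "\<bar>\<dots>\<bar> \<le> (\<integral>z. \<bar>(h (x + sqrt r *\<^sub>R z) - h x) * (w z * gauss z)\<bar> \<partial>lborel)"
    by (rule integral_abs_bound)
  also have "\<dots> \<le> (\<integral>z. C * r powr (\<alpha> / 2) * ((1 + norm z) * \<bar>w z\<bar> * gauss z) \<partial>lborel)"
  proof (rule integral_mono)
    show "integrable lborel (\<lambda>z. \<bar>(h (x + sqrt r *\<^sub>R z) - h x) * (w z * gauss z)\<bar>)"
      unfolding left_diff_distrib using i0 i1 by auto
    show "integrable lborel (\<lambda>z. C * r powr (\<alpha> / 2) * ((1 + norm z) * \<bar>w z\<bar> * gauss z))"
      by (intro integrable_mult_right integrable_tempered_gauss tempered_mult tempered_add) (use w in auto)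
    show "\<bar>(h (x + sqrt r *\<^sub>R z) - h x) * (w z * gauss z)\<bar> \<le> C * r powr (\<alpha> / 2) * ((1 + norm z) * \<bar>w z\<bar> * gauss z)" for z
    proof -
      have "\<bar>h (x + sqrt r *\<^sub>R z) - h x\<bar> \<le> C * (sqrt r * norm z) powr \<alpha>"
        using ho[of "x + sqrt r *\<^sub>R z" x] r by (simp add: dist_norm)
      also have "(sqrt r * norm z) powr \<alpha> = r powr (\<alpha> / 2) * norm z powr \<alpha>"
        using r by (simp add: powr_mult powr_half_sqrt[symmetric] powr_powr)
      also have "norm z powr \<alpha> \<le> 1 + norm z"
      proof (cases "norm z \<le> 1")
        case True
        then have "norm z powr \<alpha> \<le> 1" using \<alpha> by (intro powr_le1) auto
        then show ?thesis by (simp add: add_increasing2)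
      next
        case False
        then have "norm z powr \<alpha> \<le> norm z powr 1" using \<alpha> by (intro powr_mono) auto
        then show ?thesis using False by simp
      qed
      finally have "\<bar>h (x + sqrt r *\<^sub>R z) - h x\<bar> \<le> C * (r powr (\<alpha> / 2) * (1 + norm z))"
        using C by (simp add: mult_left_mono)
      then have "\<bar>h (x + sqrt r *\<^sub>R z) - h x\<bar> * (\<bar>w z\<bar> * gauss z) \<le> C * (r powr (\<alpha> / 2) * (1 + norm z)) * (\<bar>w z\<bar> * gauss z)"
        using gauss_pos[of z] by (intro mult_right_mono) auto
      then show ?thesis using gauss_pos[of z] by (simp add: abs_mult mult_ac)
    qed
  qed
  finally show ?thesis by simp
qed

section \<open>Iterated partial derivatives\<close>

lemma partial_derivI:
  "((\<lambda>\<eta>. g (x + \<eta> *\<^sub>R axis k 1)) has_real_derivative D) (at 0) \<Longrightarrow> partial_deriv k g x = D"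
  unfolding partial_deriv_def by (rule DERIV_imp_deriv)

lemma has_partial_deriv_line:
  assumes "\<And>x. (\<lambda>\<eta>. g (x + \<eta> *\<^sub>R axis k 1)) field_differentiable (at 0)"
  shows "((\<lambda>\<eta>. g (x + \<eta> *\<^sub>R axis k 1)) has_real_derivative partial_deriv k g (x + \<eta> *\<^sub>R axis k 1)) (at \<eta>)"
proof -
  have "((\<lambda>h. g ((x + \<eta> *\<^sub>R axis k 1) + h *\<^sub>R axis k 1)) has_real_derivative partial_deriv k g (x + \<eta> *\<^sub>R axis k 1)) (at 0)"
    unfolding partial_deriv_def using assms DERIV_deriv_iff_field_differentiable by blast
  then have "((\<lambda>h. g (x + (h + \<eta>) *\<^sub>R axis k 1)) has_real_derivative partial_deriv k g (x + \<eta> *\<^sub>R axis k 1)) (at 0)"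
    by (simp add: algebra_simps)
  then show ?thesis
    using DERIV_shift[of "\<lambda>h. g (x + h *\<^sub>R axis k 1)" _ 0 \<eta>] by simp
qed

lemma iter_partial_simps [simp]:
  "iter_partial [] g = g"
  "iter_partial (k # ks) g = partial_deriv k (iter_partial ks g)"
  "iter_partial (ks @ ms) g = iter_partial ks (iter_partial ms g)"
  by (simp_all add: iter_partial_def)

lemma partials_existD:
  "partials_exist m g \<Longrightarrow> length ks < m \<Longrightarrow>
     (\<lambda>h. iter_partial ks g (x + h *\<^sub>R axis k 1)) field_differentiable (at 0)"
  by (simp add: partials_exist_def)

lemma partials_exist_partial_deriv:
  fixes g :: "real^'d \<Rightarrow> real"
  assumes "partials_exist (Suc m) g"
  shows "partials_exist m (partial_deriv k g)"
  unfolding partials_exist_def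
proof (intro allI impI)
  fix ks :: "'d list" and l x assume "length ks < m"
  then show "(\<lambda>h. iter_partial ks (partial_deriv k g) (x + h *\<^sub>R axis l 1)) field_differentiable at 0"
    using partials_existD[OF assms, of "ks @ [k]" x l] by simp
qed

text \<open>Only derivatives along the axes are available, so y is reached from x by changing one
  coordinate at a time. \<open>w S\<close> is the intermediate point whose coordinates in
  \<open>S\<close> are already those of y; each change costs at most \<open>C * dist x y\<close>,
  whence the factor \<open>CARD('d)\<close>.\<close>

lemma lipschitz_of_partials:
  fixes g :: "real^'d \<Rightarrow> real"
  assumes diff: "\<And>k x. (\<lambda>\<eta>. g (x + \<eta> *\<^sub>R axis k 1)) field_differentiable (at 0)"
    and C: "\<And>k x. \<bar>partial_deriv k g x\<bar> \<le> C"
  shows "\<bar>g x - g y\<bar> \<le> C * real CARD('d) * dist x y"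
proof -
  have C0: "0 \<le> C" using C[of undefined 0] by simp
  have line: "\<bar>g (z + \<eta> *\<^sub>R axis k 1) - g z\<bar> \<le> C * \<bar>\<eta>\<bar>" for z k \<eta>
  proof -
    have "norm (g (z + \<eta> *\<^sub>R axis k 1) - g (z + 0 *\<^sub>R axis k 1)) \<le> C * norm (\<eta> - 0)"
      by (rule field_differentiable_bound[of UNIV "\<lambda>\<eta>. g (z + \<eta> *\<^sub>R axis k 1)"
            "\<lambda>\<eta>. partial_deriv k g (z + \<eta> *\<^sub>R axis k 1)"])
         (use has_partial_deriv_line[OF diff] C in auto)
    then show ?thesis by simp
  qed
  define w where "w S = (\<chi> k. if k \<in> S then y $ k else x $ k)" for S
  have "\<bar>g x - g (w S)\<bar> \<le> C * real (card S) * dist x y" if "finite S" for S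
    using that
  proof (induction S rule: finite_induct)
    case empty
    have "w {} = x" by (simp add: w_def vec_eq_iff)
    then show ?case by simp
  next
    case (insert k S)
    have "w (insert k S) = w S + (y $ k - x $ k) *\<^sub>R axis k 1"
      using insert by (auto simp: w_def vec_eq_iff axis_def)
    then have "\<bar>g (w (insert k S)) - g (w S)\<bar> \<le> C * \<bar>y $ k - x $ k\<bar>" using line by simp
    also have "\<dots> \<le> C * dist x y"
      using C0 component_le_norm_cart[of "x - y" k] by (intro mult_left_mono) (simp_all add: dist_norm abs_minus_commute)
    finally have "\<bar>g x - g (w (insert k S))\<bar> \<le> C * real (card S) * dist x y + C * dist x y"
      using insert.IH by linarith
    then show ?case using insert by (simp add: algebra_simps)
  qed
  from this[of UNIV] show ?thesis by (simp add: w_def)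
qed

section \<open>Finite differences with unit step, for the derivatives of intermediate order\<close>

primrec fdiff :: "'d list \<Rightarrow> (real^'d \<Rightarrow> real) \<Rightarrow> real^'d \<Rightarrow> real" where
  "fdiff [] g x = g x"
| "fdiff (k # ks) g x = fdiff ks g (x + axis k 1) - fdiff ks g x"

lemma fdiff_bound: "(\<And>x. \<bar>g x\<bar> \<le> K) \<Longrightarrow> \<bar>fdiff ks g x\<bar> \<le> 2 ^ length ks * K"
proof (induction ks arbitrary: x)
  case (Cons k ks)
  have "\<bar>fdiff ks g (x + axis k 1)\<bar> \<le> 2 ^ length ks * K" "\<bar>fdiff ks g x\<bar> \<le> 2 ^ length ks * K"
    using Cons by auto
  then show ?case by (auto simp: abs_le_iff)
qed auto

lemma fdiff_has_partial:
  assumes "\<And>x. (\<lambda>\<eta>. g (x + \<eta> *\<^sub>R axis k 1)) field_differentiable (at 0)"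
  shows "((\<lambda>\<eta>. fdiff ks g (x + \<eta> *\<^sub>R axis k 1)) has_real_derivative fdiff ks (partial_deriv k g) (x + \<eta> *\<^sub>R axis k 1)) (at \<eta>)"
proof (induction ks arbitrary: x)
  case Nil
  then show ?case using has_partial_deriv_line[OF assms] by simp
next
  case (Cons l ks)
  have "((\<lambda>\<eta>. fdiff ks g ((x + axis l 1) + \<eta> *\<^sub>R axis k 1) - fdiff ks g (x + \<eta> *\<^sub>R axis k 1)) has_real_derivative
    fdiff ks (partial_deriv k g) ((x + axis l 1) + \<eta> *\<^sub>R axis k 1) - fdiff ks (partial_deriv k g) (x + \<eta> *\<^sub>R axis k 1)) (at \<eta>)"
    by (intro DERIV_diff Cons)
  then show ?case by (simp add: ac_simps)
qed

text \<open>One application of the mean value theorem per direction, each moving the point by at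
  most 1. The head of the list is traded for a derivative first and so becomes the innermost one,
  hence \<open>rev\<close>.\<close>

lemma fdiff_eq_iter_partial:
  assumes "partials_exist (length ms) g"
  shows "\<exists>\<xi>. dist x \<xi> \<le> real (length ms) \<and> fdiff ms g x = iter_partial (rev ms) g \<xi>"
  using assms
proof (induction ms arbitrary: g x)
  case Nil
  then show ?case by (auto intro: exI[of _ x])
next
  case (Cons m ms)
  have d: "(\<lambda>\<eta>. g (x + \<eta> *\<^sub>R axis m 1)) field_differentiable (at 0)" for x
    using partials_existD[OF Cons.prems, of "[]"] by simp
  obtain \<theta> where \<theta>: "0 < \<theta>" "\<theta> < 1"
    "fdiff ms g (x + 1 *\<^sub>R axis m 1) - fdiff ms g (x + 0 *\<^sub>R axis m 1) = (1 - 0) * fdiff ms (partial_deriv m g) (x + \<theta> *\<^sub>R axis m 1)"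
    using MVT2[of 0 1 "\<lambda>\<eta>. fdiff ms g (x + \<eta> *\<^sub>R axis m 1)" "\<lambda>\<eta>. fdiff ms (partial_deriv m g) (x + \<eta> *\<^sub>R axis m 1)"]
      fdiff_has_partial[OF d] by auto
  obtain \<xi> where \<xi>: "dist (x + \<theta> *\<^sub>R axis m 1) \<xi> \<le> real (length ms)"
    "fdiff ms (partial_deriv m g) (x + \<theta> *\<^sub>R axis m 1) = iter_partial (rev ms) (partial_deriv m g) \<xi>"
    using Cons.IH[where g="partial_deriv m g" and x="x + \<theta> *\<^sub>R axis m 1"] partials_exist_partial_deriv[of "length ms" g m] Cons.prems by auto
  have "dist x \<xi> \<le> dist x (x + \<theta> *\<^sub>R axis m 1) + dist (x + \<theta> *\<^sub>R axis m 1) \<xi>" by (rule dist_triangle)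
  also have "dist x (x + \<theta> *\<^sub>R axis m 1) \<le> 1" using \<theta> by (simp add: dist_norm norm_axis_1)
  finally have "dist x \<xi> \<le> real (length (m # ms))" using \<xi>(1) by simp
  moreover have "fdiff (m # ms) g x = iter_partial (rev (m # ms)) g \<xi>" using \<theta>(3) \<xi>(2) by simp
  ultimately show ?case by blast
qed

text \<open>By the mean value theorem an iterated finite difference of \<open>f\<close>, which is bounded, is a value of
  the derivative at a point within bounded distance; the bound one order higher transports it to \<open>x\<close>.\<close>

lemma bounded_intermediate_partials:
  fixes f :: "real^'d \<Rightarrow> real"
  assumes ex: "partials_exist m f" and f: "bounded (range f)"
    and top: "\<And>ks. length ks = m \<Longrightarrow> bounded (range (iter_partial ks f))"
    and ks: "length ks \<le> m"
  shows "bounded (range (iter_partial ks f))"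
proof -
  obtain K where K: "\<And>x. \<bar>f x\<bar> \<le> K" using f unfolding bounded_iff by auto
  \<comment> \<open>Downward induction on the order, starting at the top: bounds of order m - j are
    the Lipschitz constants that are needed at order m - j - 1.\<close>
  have "j \<le> m \<Longrightarrow> \<forall>ks. length ks = m - j \<longrightarrow> bounded (range (iter_partial ks f))" for j
  proof (induction j)
    case 0
    then show ?case using top by simp
  next
    case (Suc j)
    show ?case
    proof (intro allI impI)
      fix ks :: "'d list" assume l: "length ks = m - Suc j"
      let ?g = "iter_partial ks f"
      have d: "(\<lambda>\<eta>. ?g (x + \<eta> *\<^sub>R axis k 1)) field_differentiable (at 0)" for k x
        using partials_existD[OF ex, of ks] l Suc.prems by simp
      have "\<exists>c. \<forall>x. \<bar>partial_deriv k ?g x\<bar> \<le> c" for k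
      proof -
        have "bounded (range (iter_partial (k # ks) f))"
          using Suc.IH[THEN spec, of "k # ks"] Suc.prems l by simp
        then show ?thesis unfolding bounded_iff by auto
      qed
      then obtain c where c: "\<And>k x. \<bar>partial_deriv k ?g x\<bar> \<le> c k" by metis
      have cm: "\<bar>partial_deriv k ?g x\<bar> \<le> Max (range c)" for k x
        using c[of k x] by (meson Max_ge finite_imageI finite_class.finite_UNIV order_trans rangeI)
      have "\<bar>?g x\<bar> \<le> 2 ^ length ks * K + Max (range c) * real CARD('d) * real (length ks)" for x
      proof -
        have "partials_exist (length (rev ks)) f" using ex l unfolding partials_exist_def by auto
        from fdiff_eq_iter_partial[OF this, of x] obtain \<xi> where
          \<xi>: "dist x \<xi> \<le> real (length ks)" "fdiff (rev ks) f x = ?g \<xi>" by auto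
        have "\<bar>?g \<xi>\<bar> \<le> 2 ^ length ks * K" using fdiff_bound[of f K "rev ks" x] K \<xi>(2) by simp
        moreover have "\<bar>?g x - ?g \<xi>\<bar> \<le> Max (range c) * real CARD('d) * dist x \<xi>"
          by (rule lipschitz_of_partials[OF d cm])
        moreover have "\<dots> \<le> Max (range c) * real CARD('d) * real (length ks)"
          using \<xi>(1) cm[of undefined 0] by (intro mult_left_mono) auto
        ultimately show ?thesis by linarith
      qed
      then show "bounded (range ?g)" unfolding bounded_iff by auto
    qed
  qed
  from this[of "m - length ks"] show ?thesis using ks by simp
qed

text \<open>Bounded continuous partials up to order m. All intermediate orders are included so that
  the class passes to partial derivatives and to the Laplacian with the order lowered by one and by
  two.\<close>

definition bcp :: "nat \<Rightarrow> (real^'d \<Rightarrow> real) \<Rightarrow> bool" where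
  "bcp m g \<longleftrightarrow> partials_exist m g \<and>
     (\<forall>ks. length ks \<le> m \<longrightarrow> bounded (range (iter_partial ks g)) \<and> continuous_on UNIV (iter_partial ks g))"

lemma holder_continuous_imp_continuous_on:
  fixes g :: "real^'d \<Rightarrow> real"
  assumes "holder_continuous \<alpha> g" "0 < \<alpha>"
  shows "continuous_on UNIV g"
proof -
  obtain C where C: "\<And>x y. \<bar>g x - g y\<bar> \<le> C * dist x y powr \<alpha>"
    using assms unfolding holder_continuous_def by blast
  show ?thesis unfolding continuous_on_def
  proof
    fix x :: "real^'d"
    have "((\<lambda>y. C * dist y x powr \<alpha>) \<longlongrightarrow> C * 0) (at x)"
    proof (intro tendsto_mult tendsto_const)
      have "((\<lambda>y. dist y x powr \<alpha>) \<longlongrightarrow> dist x x powr \<alpha>) (at x)"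
        using assms(2) by (intro tendsto_powr' tendsto_intros) auto
      then show "((\<lambda>y. dist y x powr \<alpha>) \<longlongrightarrow> 0) (at x)" by simp
    qed
    then have *: "((\<lambda>y. C * dist y x powr \<alpha>) \<longlongrightarrow> 0) (at x)" by simp
    have "((\<lambda>y. g y - g x) \<longlongrightarrow> 0) (at x)"
      by (rule Lim_null_comparison[OF _ *]) (use C in auto)
    then show "(g \<longlongrightarrow> g x) (at x)" by (rule LIM_zero_cancel)
  qed
qed

lemma lipschitz_imp_continuous_on:
  assumes "\<And>x y. \<bar>g x - g y\<bar> \<le> C * dist x (y::real^'d)"
  shows "continuous_on UNIV (g :: real^'d \<Rightarrow> real)"
proof (rule holder_continuous_imp_continuous_on[of 1])
  show "holder_continuous 1 g" unfolding holder_continuous_def using assms by auto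
qed auto

text \<open>At the top order continuity is Hoelder continuity. Below it, the partials of the next
  order are bounded, so the function is Lipschitz.\<close>

lemma bounded_holder_partials_imp_bcp:
  fixes f :: "real^'d \<Rightarrow> real"
  assumes h: "bounded_holder_partials m \<alpha> f" and f: "bounded (range f)" and \<alpha>: "0 < \<alpha>"
  shows "bcp m f"
  unfolding bcp_def
proof (intro conjI allI impI)
  show ex: "partials_exist m f" using h by (simp add: bounded_holder_partials_def)
  have bd: "bounded (range (iter_partial ks f))" if "length ks \<le> m" for ks
    using bounded_intermediate_partials[OF ex f _ that] h by (simp add: bounded_holder_partials_def)
  fix ks :: "'d list" assume l: "length ks \<le> m"
  show "bounded (range (iter_partial ks f))" by (rule bd[OF l])
  show "continuous_on UNIV (iter_partial ks f)"
  proof (cases "length ks = m")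
    case True
    then show ?thesis
      using h \<alpha> by (auto simp: bounded_holder_partials_def intro: holder_continuous_imp_continuous_on)
  next
    case False
    let ?g = "iter_partial ks f"
    have "\<exists>c. \<forall>x. \<bar>partial_deriv k ?g x\<bar> \<le> c" for k
    proof -
      have "bounded (range (iter_partial (k # ks) f))" by (rule bd) (use False l in simp)
      then show ?thesis unfolding bounded_iff by auto
    qed
    then obtain c where c: "\<And>k x. \<bar>partial_deriv k ?g x\<bar> \<le> c k" by metis
    have cm: "\<bar>partial_deriv k ?g x\<bar> \<le> Max (range c)" for k x
      using c[of k x] by (meson Max_ge finite_imageI finite_class.finite_UNIV order_trans rangeI)
    show ?thesis
      by (rule lipschitz_imp_continuous_on, rule lipschitz_of_partials[OF _ cm])
         (use partials_existD[OF ex, of ks] l False in auto)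
  qed
qed

lemma bcp_has_partial:
  assumes "bcp (Suc m) g"
  shows "((\<lambda>\<eta>. g (x + \<eta> *\<^sub>R axis k 1)) has_real_derivative partial_deriv k g (x + \<eta> *\<^sub>R axis k 1)) (at \<eta>)"
  by (rule has_partial_deriv_line) (use assms partials_existD[of "Suc m" g "[]"] in \<open>auto simp: bcp_def\<close>)

lemma bcp_partial_deriv:
  fixes g :: "real^'d \<Rightarrow> real"
  assumes "bcp (Suc m) g"
  shows "bcp m (partial_deriv k g)"
  unfolding bcp_def
proof (intro conjI allI impI)
  show "partials_exist m (partial_deriv k g)"
    using assms by (simp add: bcp_def partials_exist_partial_deriv)
  fix ks :: "'d list" assume "length ks \<le> m"
  then show "bounded (range (iter_partial ks (partial_deriv k g)))" "continuous_on UNIV (iter_partial ks (partial_deriv k g))"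
    using assms[unfolded bcp_def, THEN conjunct2, THEN spec, of "ks @ [k]"] by auto
qed

lemma bcp_mono: "bcp m g \<Longrightarrow> l \<le> m \<Longrightarrow> bcp l g"
  unfolding bcp_def partials_exist_def by auto

lemma bcp_bound:
  assumes "bcp m g"
  obtains K where "\<And>x. \<bar>g x\<bar> \<le> K"
proof -
  have "bounded (range g)" using assms[unfolded bcp_def, THEN conjunct2, THEN spec, of "[]"] by simp
  then obtain K where "\<forall>x\<in>range g. norm x \<le> K" unfolding bounded_iff by blast
  then show ?thesis by (intro that[of K]) auto
qed

lemma bcp_continuous: "bcp m g \<Longrightarrow> continuous_on UNIV g"
  unfolding bcp_def by (metis iter_partial_simps(1) le0 list.size(3))

lemma iter_partial_laplacian:
  fixes g :: "real^'d \<Rightarrow> real"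
  assumes "partials_exist (Suc (Suc m)) g" "length ks \<le> m"
  shows "iter_partial ks (laplacian g) = (\<lambda>x. \<Sum>k\<in>UNIV. iter_partial (ks @ [k, k]) g x)"
  using assms(2)
proof (induction ks)
  case Nil
  then show ?case by (simp add: laplacian_def[abs_def])
next
  case (Cons l ks)
  have "partial_deriv l (\<lambda>x. \<Sum>k\<in>UNIV. iter_partial (ks @ [k, k]) g x) x = (\<Sum>k\<in>UNIV. iter_partial ((l # ks) @ [k, k]) g x)" for x
  proof (rule partial_derivI, rule DERIV_sum)
    fix k
    have "(\<lambda>h. iter_partial (ks @ [k, k]) g (y + h *\<^sub>R axis l 1)) field_differentiable (at 0)" for y
      by (rule partials_existD[OF assms(1)]) (use Cons in auto)
    from has_partial_deriv_line[OF this, of x 0]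
    show "((\<lambda>\<eta>. iter_partial (ks @ [k, k]) g (x + \<eta> *\<^sub>R axis l 1)) has_real_derivative iter_partial ((l # ks) @ [k, k]) g x) (at 0)"
      by simp
  qed
  then show ?case using Cons by auto
qed

lemma bcp_laplacian:
  fixes g :: "real^'d \<Rightarrow> real"
  assumes "bcp (Suc (Suc m)) g"
  shows "bcp m (laplacian g)"
  unfolding bcp_def
proof (intro conjI allI impI)
  have ex: "partials_exist (Suc (Suc m)) g" using assms by (simp add: bcp_def)
  have *: "bounded (range (iter_partial (ks @ [k, k]) g))" "continuous_on UNIV (iter_partial (ks @ [k, k]) g)" if "length ks \<le> m" for ks :: "'d list" and k
    using assms[unfolded bcp_def, THEN conjunct2, THEN spec, of "ks @ [k, k]"] that by auto
  show "partials_exist m (laplacian g)"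
    unfolding partials_exist_def
  proof (intro allI impI)
    fix ks :: "'d list" and l x assume l: "length ks < m"
    have "(\<lambda>h. \<Sum>k\<in>UNIV. iter_partial (ks @ [k, k]) g (x + h *\<^sub>R axis l 1)) field_differentiable at 0"
      by (intro field_differentiable_sum partials_existD[OF ex]) (use l in auto)
    then show "(\<lambda>h. iter_partial ks (laplacian g) (x + h *\<^sub>R axis l 1)) field_differentiable at 0"
      using l by (simp only: iter_partial_laplacian[OF ex less_imp_le])
  qed
  fix ks :: "'d list" assume l: "length ks \<le> m"
  show "continuous_on UNIV (iter_partial ks (laplacian g))"
    unfolding iter_partial_laplacian[OF ex l] by (rule continuous_on_sum) (rule *(2)[OF l])
  have "\<exists>c. \<forall>x. \<bar>iter_partial (ks @ [k, k]) g x\<bar> \<le> c" for k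
    using *(1)[OF l, of k] unfolding bounded_iff by auto
  then obtain c where c: "\<And>k x. \<bar>iter_partial (ks @ [k, k]) g x\<bar> \<le> c k" by metis
  have "\<bar>\<Sum>k\<in>UNIV. iter_partial (ks @ [k, k]) g x\<bar> \<le> (\<Sum>k\<in>UNIV. c k)" for x
    by (rule order_trans[OF sum_abs]) (intro sum_mono c)
  then show "bounded (range (iter_partial ks (laplacian g)))"
    unfolding iter_partial_laplacian[OF ex l] bounded_iff by (auto intro!: exI[of _ "\<Sum>k\<in>UNIV. c k"])
qed

lemma holder_continuous_sum:
  fixes g :: "'i::finite \<Rightarrow> real^'d \<Rightarrow> real"
  assumes "\<And>k. holder_continuous \<alpha> (g k)"
  shows "holder_continuous \<alpha> (\<lambda>x. \<Sum>k\<in>UNIV. g k x)"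
proof -
  obtain C where C: "\<And>k x y. \<bar>g k x - g k y\<bar> \<le> C k * dist x y powr \<alpha>"
    using assms unfolding holder_continuous_def by metis
  have "\<bar>(\<Sum>k\<in>UNIV. g k x) - (\<Sum>k\<in>UNIV. g k y)\<bar> \<le> (\<Sum>k\<in>UNIV. C k) * dist x y powr \<alpha>" for x y
    unfolding sum_subtractf[symmetric] sum_distrib_right
    by (rule order_trans[OF sum_abs]) (intro sum_mono C)
  then show ?thesis unfolding holder_continuous_def by blast
qed

lemma laplacian_power_bcp:
  fixes f :: "real^'d \<Rightarrow> real"
  assumes "bcp (2 * \<kappa> + m) f"
  shows "bcp m ((laplacian ^^ \<kappa>) f)"
  using assms
proof (induction \<kappa> arbitrary: m)
  case (Suc \<kappa>)
  then show ?case using bcp_laplacian[of m "(laplacian ^^ \<kappa>) f"] by simp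
qed simp

text \<open>The induction needs a stronger claim: all derivatives of order 2 (\<kappa> - j) of the
  j-th Laplacian power are Hoelder continuous. The next Laplacian uses up two of these free
  derivatives, because \<open>iter_partial ks\<close> of it is the sum of the derivatives along
  \<open>ks @ [k, k]\<close>.\<close>

lemma laplacian_power_holder:
  fixes f :: "real^'d \<Rightarrow> real"
  assumes "bcp (2 * \<kappa>) f" "\<And>ks. length ks = 2 * \<kappa> \<Longrightarrow> holder_continuous \<alpha> (iter_partial ks f)"
  shows "holder_continuous \<alpha> ((laplacian ^^ \<kappa>) f)"
proof -
  have "j \<le> \<kappa> \<Longrightarrow> \<forall>ks. length ks = 2 * (\<kappa> - j) \<longrightarrow> holder_continuous \<alpha> (iter_partial ks ((laplacian ^^ j) f))" for j
  proof (induction j)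
    case 0
    then show ?case using assms by simp
  next
    case (Suc j)
    show ?case
    proof (intro allI impI)
      fix ks :: "'d list" assume l: "length ks = 2 * (\<kappa> - Suc j)"
      have e: "2 * (\<kappa> - j) = Suc (Suc (length ks))" "2 * \<kappa> = 2 * j + 2 * (\<kappa> - j)" using l Suc.prems by auto
      have "bcp (2 * (\<kappa> - j)) ((laplacian ^^ j) f)"
        by (rule laplacian_power_bcp) (use assms(1) e(2) in simp)
      then have "partials_exist (Suc (Suc (length ks))) ((laplacian ^^ j) f)" unfolding e(1) by (simp add: bcp_def)
      from iter_partial_laplacian[OF this order_refl]
      have "iter_partial ks ((laplacian ^^ Suc j) f) = (\<lambda>x. \<Sum>k\<in>UNIV. iter_partial (ks @ [k, k]) ((laplacian ^^ j) f) x)"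
        by simp
      moreover have "holder_continuous \<alpha> (iter_partial (ks @ [k, k]) ((laplacian ^^ j) f))" for k
        using Suc.IH[THEN spec, of "ks @ [k, k]"] Suc.prems e by simp
      ultimately show "holder_continuous \<alpha> (iter_partial ks ((laplacian ^^ Suc j) f))"
        by (simp add: holder_continuous_sum)
    qed
  qed
  from this[of \<kappa>] show ?thesis by simp
qed

section \<open>Moments of stable laws\<close>

text \<open>Change of variables y = c x^p, a bijection of the open half-line for either sign of p.
  It is used with p = 1 (scaling), p = \<beta> (moments of the stable law) and p = - 1 / \<beta>
  (inverse kernel); integrability is carried in both directions.\<close>

lemma lborel_power_substitution:
  fixes F :: "real \<Rightarrow> real"
  assumes [measurable]: "F \<in> borel_measurable borel" and c: "0 < c" and p: "p \<noteq> 0"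
  defines "G \<equiv> \<lambda>x. \<bar>c * p\<bar> * x powr (p - 1) * F (c * x powr p)"
  shows "set_integrable lborel {0<..} G \<longleftrightarrow> set_integrable lborel {0<..} F"
    and "(LINT x:{0<..}|lborel. G x) = (LINT y:{0<..}|lborel. F y)"
proof -
  have [measurable]: "G \<in> borel_measurable borel" unfolding G_def by measurable
  have leb: "set_integrable lborel {0<..} f \<longleftrightarrow> f absolutely_integrable_on {0<..}"
    if "f \<in> borel_measurable borel" for f :: "real \<Rightarrow> real"
    using that by (simp add: set_integrable_def integrable_completion)
  have img: "(\<lambda>x. c * x powr p) ` {0<..} = {0<..}"
  proof (intro equalityI subsetI)
    fix y :: real assume y: "y \<in> {0<..}"
    have "y = c * ((y / c) powr (1 / p)) powr p" using y c p by (simp add: powr_powr)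
    then show "y \<in> (\<lambda>x. c * x powr p) ` {0<..}" using y c by (intro image_eqI[of _ _ "(y / c) powr (1 / p)"]) auto
  qed (use c in auto)
  have inj: "inj_on (\<lambda>x. c * x powr p) {0<..}"
  proof (rule inj_onI)
    fix x y :: real assume "x \<in> {0<..}" "y \<in> {0<..}" "c * x powr p = c * y powr p"
    then have "(x powr p) powr (1 / p) = (y powr p) powr (1 / p)" "0 < x" "0 < y" using c by auto
    then show "x = y" using p by (simp add: powr_powr)
  qed
  have cov: "(\<lambda>x. \<bar>c * (p * x powr (p - 1))\<bar> * F (c * x powr p)) absolutely_integrable_on {0<..} \<and>
        integral {0<..} (\<lambda>x. \<bar>c * (p * x powr (p - 1))\<bar> * F (c * x powr p)) = b \<longleftrightarrow>
      F absolutely_integrable_on ((\<lambda>x. c * x powr p) ` {0<..}) \<and> integral ((\<lambda>x. c * x powr p) ` {0<..}) F = b" for b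
    by (rule has_absolute_integral_change_of_variables_1'[OF _ _ inj])
       (auto intro!: derivative_eq_intros)
  have G: "(\<lambda>x. \<bar>c * (p * x powr (p - 1))\<bar> * F (c * x powr p)) = G"
    by (simp add: G_def abs_mult mult.assoc fun_eq_iff)
  show iff: "set_integrable lborel {0<..} G \<longleftrightarrow> set_integrable lborel {0<..} F"
    using cov unfolding img G leb[OF \<open>G \<in> _\<close>] leb[OF assms(1)] by blast
  show "(LINT x:{0<..}|lborel. G x) = (LINT y:{0<..}|lborel. F y)"
  proof (cases "set_integrable lborel {0<..} F")
    case True
    then have "F absolutely_integrable_on {0<..}" using leb[OF assms(1)] by simp
    then have "integral {0<..} G = integral {0<..} F" using cov unfolding img G by blast
    moreover have "(LINT x:{0<..}|lborel. G x) = integral {0<..} G"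
      using True iff by (intro set_borel_integral_eq_integral) simp
    moreover have "(LINT x:{0<..}|lborel. F x) = integral {0<..} F"
      using True by (intro set_borel_integral_eq_integral)
    ultimately show ?thesis by simp
  next
    case False
    then show ?thesis using iff
      by (simp add: set_integrable_def set_lebesgue_integral_def not_integrable_integral_eq)
  qed
qed

lemma Gamma_set_integral:
  fixes a :: real
  assumes "0 < a"
  shows "set_integrable lborel {0<..} (\<lambda>t. t powr (a - 1) * exp (- t))"
    and "(LINT t:{0<..}|lborel. t powr (a - 1) * exp (- t)) = Gamma a"
proof -
  have "((\<lambda>t. t powr (a - 1) / exp t) has_integral Gamma a) {0..}" by (rule Gamma_integral_real[OF assms])
  then have h: "((\<lambda>t. t powr (a - 1) * exp (- t)) has_integral Gamma a) {0..}"
    by (simp add: exp_minus divide_inverse)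
  have nn: "(\<integral>\<^sup>+t. ennreal (indicator {0..} t * (t powr (a - 1) * exp (- t))) \<partial>lborel) = ennreal (Gamma a)"
    using nn_integral_has_integral_lebesgue[OF _ h] by simp
  have "has_bochner_integral lborel (\<lambda>t. indicator {0..} t * (t powr (a - 1) * exp (- t))) (Gamma a)"
    by (rule has_bochner_integral_nn_integral[OF _ _ _ nn]) (use Gamma_real_pos[OF assms] in auto)
  then have *: "has_bochner_integral lborel (\<lambda>t. indicator {0<..} t *\<^sub>R (t powr (a - 1) * exp (- t))) (Gamma a)"
    by (rule has_bochner_integralI_AE) (auto intro!: AE_I2 simp: indicator_def)
  then show "set_integrable lborel {0<..} (\<lambda>t. t powr (a - 1) * exp (- t))"
    "(LINT t:{0<..}|lborel. t powr (a - 1) * exp (- t)) = Gamma a"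
    by (auto simp: set_integrable_def set_lebesgue_integral_def has_bochner_integral_iff)
qed

text \<open>The Gamma integral restricted to t \<ge> R. The free parameter R makes Gamma outgrow
  every geometric sequence.\<close>

lemma Gamma_ge_powr_exp:
  fixes x R :: real
  assumes x: "0 \<le> x" and R: "0 \<le> R"
  shows "R powr x * exp (- R) \<le> Gamma (1 + x)"
proof -
  have "((\<lambda>t. exp (- 1 * t)) has_integral exp (- 1 * R) / 1) {R..}"
    by (rule has_integral_exp_minus_to_infinity) simp
  from has_integral_mult_right[OF this, of "R powr x"]
  have "((\<lambda>t. if t \<in> {R..} then R powr x * exp (- t) else 0) has_integral R powr x * exp (- R)) {0..}"
    using R by (subst has_integral_restrict) auto
  moreover have "((\<lambda>t. t powr (1 + x - 1) / exp t) has_integral Gamma (1 + x)) {0..}"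
    by (rule Gamma_integral_real) (use x in simp)
  ultimately show ?thesis
  proof (rule has_integral_le)
    fix t :: real
    show "(if t \<in> {R..} then R powr x * exp (- t) else 0) \<le> t powr (1 + x - 1) / exp t"
      using x R by (auto simp: exp_minus divide_inverse intro!: mult_right_mono powr_mono2)
  qed
qed

text \<open>The Mittag-Leffler series. Its convergence for every l is what makes the law of Z
  determinate by its moments.\<close>

lemma summable_mittag_leffler:
  fixes \<beta> l :: real
  assumes \<beta>: "0 < \<beta>" and l: "0 \<le> l"
  shows "summable (\<lambda>k. l ^ k / Gamma (1 + \<beta> * real k))"
proof -
  \<comment> \<open>Chosen so that \<open>R powr (\<beta> * real k) = (2 * l + 1) ^ k\<close>, which
    leaves a geometric ratio of at most 1/2. The summand 1 keeps R positive when l = 0.\<close>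
  define R where "R = (2 * l + 1) powr (1 / \<beta>)"
  have R: "R > 0" using l by (simp add: R_def)
  have "summable (\<lambda>k. exp R * (1 / 2 :: real) ^ k)" by (intro summable_mult summable_geometric) auto
  then show ?thesis
  proof (rule summable_comparison_test'[where N=0])
    fix k :: nat
    have "R powr (\<beta> * real k) = (2 * l + 1) ^ k"
      using \<beta> l by (simp add: R_def powr_powr powr_realpow[symmetric])
    then have g: "(2 * l + 1) ^ k * exp (- R) \<le> Gamma (1 + \<beta> * real k)"
      using Gamma_ge_powr_exp[of "\<beta> * real k" R] \<beta> R by simp
    have pos: "0 < (2 * l + 1) ^ k * exp (- R)" using l by simp
    have "l ^ k / Gamma (1 + \<beta> * real k) \<le> l ^ k / ((2 * l + 1) ^ k * exp (- R))"
      using g pos l less_le_trans[OF pos g] by (intro divide_left_mono mult_pos_pos) auto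
    also have "\<dots> = exp R * (l / (2 * l + 1)) ^ k" by (simp add: exp_minus power_divide field_simps)
    also have "\<dots> \<le> exp R * (1 / 2) ^ k" using l by (intro mult_left_mono power_mono) (auto simp: field_simps)
    finally show "norm (l ^ k / Gamma (1 + \<beta> * real k)) \<le> exp R * (1 / 2) ^ k"
      using l less_le_trans[OF pos g] by simp
  qed
qed

locale stable_law = prob_space N for N :: "'v measure" +
  fixes X :: "'v \<Rightarrow> real" and \<beta> :: real
  assumes meas [measurable]: "X \<in> borel_measurable N"
    and pos: "\<And>\<omega>. \<omega> \<in> space N \<Longrightarrow> 0 < X \<omega>"
    and beta: "0 < \<beta>" "\<beta> < 1"
    and laplace: "\<And>s. 0 < s \<Longrightarrow> (\<integral>\<omega>. exp (- s * X \<omega>) \<partial>N) = exp (- (s powr \<beta>))"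
begin

lemma nn_laplace: "0 < s \<Longrightarrow> (\<integral>\<^sup>+\<omega>. ennreal (exp (- s * X \<omega>)) \<partial>N) = ennreal (exp (- (s powr \<beta>)))"
proof -
  assume s: "0 < s"
  have "integrable N (\<lambda>\<omega>. exp (- s * X \<omega>))"
    by (rule integrable_const_bound[where B=1]) (use s pos in \<open>auto intro!: AE_I2 simp: less_imp_le\<close>)
  then show ?thesis using laplace[OF s] by (subst nn_integral_eq_integral) auto
qed

text \<open>Evaluate \<open>\<integral> s powr (\<beta> * \<gamma> - 1) * E (exp (- s * X)) ds\<close> in two ways.\<close>

lemma negative_moment:
  assumes \<gamma>: "0 < \<gamma>"
  shows "has_bochner_integral N (\<lambda>\<omega>. X \<omega> powr (- (\<beta> * \<gamma>))) (Gamma (1 + \<gamma>) / Gamma (1 + \<beta> * \<gamma>))"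
proof -
  define a where "a = \<beta> * \<gamma>"
  have a: "a > 0" using beta \<gamma> by (simp add: a_def)
  interpret P: pair_sigma_finite lborel N ..
  define F where "F a t = t powr (a - 1) * exp (- t)" for a t :: real
  have [measurable]: "F a \<in> borel_measurable borel" for a unfolding F_def by measurable
  \<comment> \<open>For fixed y this is the Gamma integral after scaling s by y. It is recorded as a
    nonnegative integral so that the order of integration can be exchanged before any integrability
    is known.\<close>
  have inner: "(\<integral>\<^sup>+s. ennreal (indicator {0<..} s * (s powr (a - 1) * exp (- s * y))) \<partial>lborel) = ennreal (Gamma a * y powr (- a))"
    if y: "0 < y" for y
  proof -
    have e: "\<bar>y * 1\<bar> * s powr (1 - 1) * F a (y * s powr 1) = y powr a * (s powr (a - 1) * exp (- s * y))" if "s > 0" for s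
    proof -
      have "y * y powr (a - 1) = y powr a" using y by (simp add: powr_mult_base)
      then show ?thesis using y that by (simp add: F_def powr_mult mult_ac)
    qed
    have e2: "y powr a * (s powr (a - 1) * exp (- (s * y))) = y * F a (y * s)" if "s > 0" for s
      using e[OF that] y that by simp
    have i: "set_integrable lborel {0<..} (\<lambda>s. y powr a * (s powr (a - 1) * exp (- s * y)))"
      using lborel_power_substitution(1)[of "F a" y 1] y Gamma_set_integral(1)[OF a]
      unfolding F_def[symmetric] set_integrable_def
      by (subst Bochner_Integration.integrable_cong[OF refl, of _ _ "\<lambda>s. indicator {0<..} s *\<^sub>R (\<bar>y * 1\<bar> * s powr (1 - 1) * F a (y * s powr 1))"])
         (auto simp: indicator_def e2)
    have v: "(LINT s:{0<..}|lborel. y powr a * (s powr (a - 1) * exp (- s * y))) = Gamma a"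
      using lborel_power_substitution(2)[of "F a" y 1] y Gamma_set_integral(2)[OF a]
      unfolding F_def[symmetric] set_lebesgue_integral_def
      by (subst Bochner_Integration.integral_cong[OF refl, of _ _ "\<lambda>s. indicator {0<..} s *\<^sub>R (\<bar>y * 1\<bar> * s powr (1 - 1) * F a (y * s powr 1))"])
         (auto simp: indicator_def e2)
    have yp: "y powr (- a) * y powr a = 1" using y by (simp add: powr_minus)
    have "integrable lborel (\<lambda>s. y powr (- a) * (indicator {0<..} s *\<^sub>R (y powr a * (s powr (a - 1) * exp (- s * y)))))"
      by (intro integrable_mult_right) (use i in \<open>simp add: set_integrable_def\<close>)
    moreover have ee: "y powr (- a) * (indicator {0<..} s *\<^sub>R (y powr a * (s powr (a - 1) * exp (- s * y))))
       = indicator {0<..} s * (s powr (a - 1) * exp (- s * y))" for s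
      using yp by (auto simp: indicator_def mult.assoc[symmetric])
    ultimately have I: "integrable lborel (\<lambda>s. indicator {0<..} s * (s powr (a - 1) * exp (- s * y)))" by (simp only: ee)
    have "(\<integral>s. indicator {0<..} s * (s powr (a - 1) * exp (- s * y)) \<partial>lborel) = y powr (- a) * Gamma a"
      unfolding ee[symmetric] integral_mult_right_zero using v unfolding set_lebesgue_integral_def by simp
    then show ?thesis
      using I by (subst nn_integral_eq_integral) (auto simp: mult.commute)
  qed
  \<comment> \<open>The same integral with the Laplace transform inserted. The substitution of
    s^\<beta> gives \<Gamma>(\<gamma>) / \<beta>, because s^(\<beta> - 1) (s^\<beta>)^(\<gamma> - 1)
    = s^(\<beta> \<gamma> - 1).\<close>
  have outer: "(\<integral>\<^sup>+s. ennreal (indicator {0<..} s * (s powr (a - 1) * exp (- (s powr \<beta>)))) \<partial>lborel) = ennreal (Gamma \<gamma> / \<beta>)"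
  proof -
    have e: "\<bar>1 * \<beta>\<bar> * s powr (\<beta> - 1) * F \<gamma> (1 * s powr \<beta>) = \<beta> * (s powr (a - 1) * exp (- (s powr \<beta>)))" if "s > 0" for s
    proof -
      have "s powr (\<beta> - 1) * (s powr \<beta>) powr (\<gamma> - 1) = s powr (a - 1)"
        by (simp add: powr_powr powr_add[symmetric] a_def algebra_simps)
      then show ?thesis using beta by (simp add: F_def mult.assoc[symmetric])
    qed
    have e2: "s powr (a - 1) * exp (- (s powr \<beta>)) = s powr (\<beta> - 1) * F \<gamma> (s powr \<beta>)" if "s > 0" for s
      using e[OF that] beta that by simp
    have i: "set_integrable lborel {0<..} (\<lambda>s. \<beta> * (s powr (a - 1) * exp (- (s powr \<beta>))))"
      using lborel_power_substitution(1)[of "F \<gamma>" 1 \<beta>] beta Gamma_set_integral(1)[OF \<gamma>]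
      unfolding F_def[symmetric] set_integrable_def
      by (subst Bochner_Integration.integrable_cong[OF refl, of _ _ "\<lambda>s. indicator {0<..} s *\<^sub>R (\<bar>1 * \<beta>\<bar> * s powr (\<beta> - 1) * F \<gamma> (1 * s powr \<beta>))"])
         (auto simp: indicator_def e2)
    have v: "(LINT s:{0<..}|lborel. \<beta> * (s powr (a - 1) * exp (- (s powr \<beta>)))) = Gamma \<gamma>"
      using lborel_power_substitution(2)[of "F \<gamma>" 1 \<beta>] beta Gamma_set_integral(2)[OF \<gamma>]
      unfolding F_def[symmetric] set_lebesgue_integral_def
      by (subst Bochner_Integration.integral_cong[OF refl, of _ _ "\<lambda>s. indicator {0<..} s *\<^sub>R (\<bar>1 * \<beta>\<bar> * s powr (\<beta> - 1) * F \<gamma> (1 * s powr \<beta>))"])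
         (auto simp: indicator_def e2)
    have "integrable lborel (\<lambda>s. (1 / \<beta>) * (indicator {0<..} s *\<^sub>R (\<beta> * (s powr (a - 1) * exp (- (s powr \<beta>))))))"
      by (intro integrable_mult_right) (use i in \<open>simp add: set_integrable_def\<close>)
    moreover have ee: "(1 / \<beta>) * (indicator {0<..} s *\<^sub>R (\<beta> * (s powr (a - 1) * exp (- (s powr \<beta>)))))
       = indicator {0<..} s * (s powr (a - 1) * exp (- (s powr \<beta>)))" for s
      using beta by (auto simp: indicator_def)
    ultimately have I: "integrable lborel (\<lambda>s. indicator {0<..} s * (s powr (a - 1) * exp (- (s powr \<beta>))))" by (simp only: ee)
    have "(\<integral>s. indicator {0<..} s * (s powr (a - 1) * exp (- (s powr \<beta>))) \<partial>lborel) = (1 / \<beta>) * Gamma \<gamma>"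
      unfolding ee[symmetric] integral_mult_right_zero using v unfolding set_lebesgue_integral_def by simp
    then show ?thesis
      using I by (subst nn_integral_eq_integral) auto
  qed
  have "(\<integral>\<^sup>+\<omega>. ennreal (Gamma a * X \<omega> powr (- a)) \<partial>N) =
      (\<integral>\<^sup>+\<omega>. (\<integral>\<^sup>+s. ennreal (indicator {0<..} s * (s powr (a - 1) * exp (- s * X \<omega>))) \<partial>lborel) \<partial>N)"
    by (rule nn_integral_cong) (use inner pos in simp)
  also have "\<dots> = (\<integral>\<^sup>+s. (\<integral>\<^sup>+\<omega>. ennreal (indicator {0<..} s * (s powr (a - 1) * exp (- s * X \<omega>))) \<partial>N) \<partial>lborel)"
    by (rule P.Fubini') measurable
  also have "\<dots> = (\<integral>\<^sup>+s. ennreal (indicator {0<..} s * (s powr (a - 1) * exp (- (s powr \<beta>)))) \<partial>lborel)"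
  proof (rule nn_integral_cong)
    fix s :: real
    show "(\<integral>\<^sup>+\<omega>. ennreal (indicator {0<..} s * (s powr (a - 1) * exp (- s * X \<omega>))) \<partial>N) = ennreal (indicator {0<..} s * (s powr (a - 1) * exp (- (s powr \<beta>))))"
    proof (cases "s > 0")
      case True
      then have "(\<integral>\<^sup>+\<omega>. ennreal (indicator {0<..} s * (s powr (a - 1) * exp (- s * X \<omega>))) \<partial>N) = (\<integral>\<^sup>+\<omega>. ennreal (s powr (a - 1)) * ennreal (exp (- s * X \<omega>)) \<partial>N)"
        by (simp add: ennreal_mult)
      also have "\<dots> = ennreal (s powr (a - 1)) * ennreal (exp (- (s powr \<beta>)))"
        using nn_laplace[OF True] by (subst nn_integral_cmult) auto
      finally show ?thesis using True by (simp add: ennreal_mult)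
    qed simp
  qed
  also note outer
  finally have nn: "(\<integral>\<^sup>+\<omega>. ennreal (Gamma a * X \<omega> powr (- a)) \<partial>N) = ennreal (Gamma \<gamma> / \<beta>)" .
  have Ga: "Gamma a > 0" "Gamma \<gamma> > 0" using a \<gamma> by (auto intro: Gamma_real_pos)
  have "has_bochner_integral N (\<lambda>\<omega>. Gamma a * X \<omega> powr (- a)) (Gamma \<gamma> / \<beta>)"
    by (rule has_bochner_integral_nn_integral[OF _ _ _ nn]) (use Ga beta in auto)
  from has_bochner_integral_divide_zero[OF this, of "Gamma a"]
  have "has_bochner_integral N (\<lambda>\<omega>. X \<omega> powr (- a)) (Gamma \<gamma> / \<beta> / Gamma a)" using Ga by simp
  \<comment> \<open>Expanding the fraction by \<gamma> turns both Gamma values into shifted ones,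
    via x \<Gamma>(x) = \<Gamma>(1 + x).\<close>
  moreover have "Gamma \<gamma> / \<beta> / Gamma a = Gamma (1 + \<gamma>) / Gamma (1 + \<beta> * \<gamma>)"
  proof -
    have "a \<notin> \<int>\<^sub>\<le>\<^sub>0" "\<gamma> \<notin> \<int>\<^sub>\<le>\<^sub>0" using a \<gamma> by (auto simp: nonpos_Ints_def)
    then have "Gamma (1 + \<gamma>) = \<gamma> * Gamma \<gamma>" "Gamma (1 + \<beta> * \<gamma>) = \<beta> * \<gamma> * Gamma a"
      using Gamma_plus1[of \<gamma>] Gamma_plus1[of a] by (auto simp: a_def add.commute)
    then show ?thesis using \<gamma> beta by simp
  qed
  ultimately show ?thesis by (simp add: a_def)
qed

text \<open>Up to a constant, X^b is bounded for X \<ge> 1 by the integral of s^(- b - 1) (1 - exp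
  (- s X)) over s in the unit interval. Taking expectations inside leaves 1 - exp (- s^\<beta>)
  \<le> s^\<beta>, and s^(\<beta> - b - 1) is integrable at 0 precisely because b < \<beta>.\<close>

lemma small_positive_moment:
  assumes b: "0 < b" "b < \<beta>"
  shows "integrable N (\<lambda>\<omega>. X \<omega> powr b)"
proof -
  interpret P: pair_sigma_finite lborel N ..
  \<comment> \<open>Contribution of s between 1 / (2 y) and 1 / y: there 1 - exp (- s y) is at least
    1 - exp (- 1/2), s^(- b - 1) is at least y^(b + 1), and the interval has length 1 / (2 y). For y
    \<ge> 1 it lies inside the unit interval.\<close>
  define c :: real where "c = (1 - exp (- (1 / 2))) * (1 / 2)"
  have c: "c > 0" by (simp add: c_def)
  have lower: "ennreal (c * y powr b) \<le> (\<integral>\<^sup>+s. ennreal (indicator {0<..1} s * (s powr (- b - 1) * (1 - exp (- s * y)))) \<partial>lborel)"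
    if y: "1 \<le> y" for y
  proof -
    have "ennreal (c * y powr b) = (\<integral>\<^sup>+s. ennreal (y powr (b + 1) * (1 - exp (- (1 / 2)))) * indicator {1 / (2 * y)..1 / y} s \<partial>lborel)"
    proof -
      have "(\<integral>\<^sup>+s. ennreal (y powr (b + 1) * (1 - exp (- (1 / 2)))) * indicator {1 / (2 * y)..1 / y} s \<partial>lborel)
        = ennreal (y powr (b + 1) * (1 - exp (- (1 / 2)))) * ennreal (1 / y - 1 / (2 * y))"
        using y by (subst nn_integral_cmult_indicator) (auto simp: field_simps)
      also have "\<dots> = ennreal ((y powr (b + 1) * (1 - exp (- (1 / 2)))) * (1 / y - 1 / (2 * y)))"
        using y by (subst ennreal_mult) (auto simp: field_simps)
      also have "y powr (b + 1) = y powr b * y" using y by (simp add: powr_add)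
      also have "y powr b * y * (1 - exp (- (1 / 2))) * (1 / y - 1 / (2 * y)) = c * y powr b"
        using y by (simp add: c_def field_simps)
      finally show ?thesis using y by (simp add: powr_add)
    qed
    also have "\<dots> \<le> (\<integral>\<^sup>+s. ennreal (indicator {0<..1} s * (s powr (- b - 1) * (1 - exp (- s * y)))) \<partial>lborel)"
    proof (rule nn_integral_mono)
      fix s :: real
      show "ennreal (y powr (b + 1) * (1 - exp (- (1 / 2)))) * indicator {1 / (2 * y)..1 / y} s
        \<le> ennreal (indicator {0<..1} s * (s powr (- b - 1) * (1 - exp (- s * y))))"
      proof (cases "s \<in> {1 / (2 * y)..1 / y}")
        case True
        have "0 < 1 / (2 * y)" "1 / y \<le> 1" using y by auto
        then have s: "0 < s" "s \<le> 1" "s \<le> 1 / y" "1 / (2 * y) \<le> s"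
          using True unfolding atLeastAtMost_iff by linarith+
        have "(1 / y) powr (- b - 1) \<le> s powr (- b - 1)" using s b by (intro powr_mono2') auto
        moreover have "(1 / y) powr (- b - 1) = y powr (b + 1)"
          using y by (simp add: powr_divide powr_minus[symmetric] powr_minus_divide[symmetric] add.commute)
        moreover have "1 / 2 \<le> s * y" using s(4) y by (simp add: field_simps)
        then have "exp (- s * y) \<le> exp (- (1 / 2))" by simp
        ultimately have "y powr (b + 1) * (1 - exp (- (1 / 2))) \<le> s powr (- b - 1) * (1 - exp (- s * y))"
          by (intro mult_mono) auto
        then show ?thesis using True s by (simp add: ennreal_leI)
      qed simp
    qed
    finally show ?thesis .
  qed
  have "(\<integral>\<^sup>+\<omega>. (\<integral>\<^sup>+s. ennreal (indicator {0<..1} s * (s powr (- b - 1) * (1 - exp (- s * X \<omega>)))) \<partial>lborel) \<partial>N)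
     = (\<integral>\<^sup>+s. (\<integral>\<^sup>+\<omega>. ennreal (indicator {0<..1} s * (s powr (- b - 1) * (1 - exp (- s * X \<omega>)))) \<partial>N) \<partial>lborel)"
    by (rule P.Fubini') measurable
  also have "\<dots> \<le> (\<integral>\<^sup>+s. ennreal (indicator {0<..1} s * s powr (\<beta> - b - 1)) \<partial>lborel)"
  proof (rule nn_integral_mono)
    fix s :: real
    show "(\<integral>\<^sup>+\<omega>. ennreal (indicator {0<..1} s * (s powr (- b - 1) * (1 - exp (- s * X \<omega>)))) \<partial>N) \<le> ennreal (indicator {0<..1} s * s powr (\<beta> - b - 1))"
    proof (cases "s \<in> {0<..1}")
      case True
      then have s: "s > 0" by simp
      have i: "integrable N (\<lambda>\<omega>. exp (- s * X \<omega>))"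
        by (rule integrable_const_bound[where B=1]) (use s pos in \<open>auto intro!: AE_I2 simp: less_imp_le\<close>)
      have "(\<integral>\<^sup>+\<omega>. ennreal (s powr (- b - 1) * (1 - exp (- s * X \<omega>))) \<partial>N) = ennreal (\<integral>\<omega>. s powr (- b - 1) * (1 - exp (- s * X \<omega>)) \<partial>N)"
        by (rule nn_integral_eq_integral) (use i s pos in \<open>auto intro!: AE_I2 simp: less_imp_le\<close>)
      also have "(\<integral>\<omega>. s powr (- b - 1) * (1 - exp (- s * X \<omega>)) \<partial>N) = s powr (- b - 1) * (1 - exp (- (s powr \<beta>)))"
        using i laplace[OF s] by (simp add: prob_space)
      also have "\<dots> \<le> s powr (- b - 1) * s powr \<beta>"
        using exp_ge_add_one_self[of "- (s powr \<beta>)"] by (intro mult_left_mono) auto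
      also have "\<dots> = s powr (\<beta> - b - 1)" by (simp add: powr_add[symmetric] algebra_simps)
      finally show ?thesis using True by (simp add: ennreal_leI)
    qed simp
  qed
  also have "\<dots> < \<infinity>"
  proof -
    have "set_integrable lborel {0..1} (\<lambda>t. t powr ((\<beta> - b) - 1) * (1 - t) powr (1 - 1))"
      by (rule integrable_Beta) (use b in auto)
    then have "integrable lborel (\<lambda>t. indicator {0..1} t * (t powr (\<beta> - b - 1) * (1 - t) powr 0))"
      by (simp add: set_integrable_def)
    then have "integrable lborel (\<lambda>s. indicator {0<..1} s * s powr (\<beta> - b - 1))"
    proof (rule integrable_cong_AE_imp)
      show "AE t in lborel. indicator {0..1} t * (t powr (\<beta> - b - 1) * (1 - t) powr 0) = indicator {0<..1} t * t powr (\<beta> - b - 1)"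
        using AE_lborel_singleton[of "1::real"] by eventually_elim (auto simp: indicator_def)
    qed measurable
    from integrableD(2)[OF this] show ?thesis by (simp add: less_top)
  qed
  finally have fin: "(\<integral>\<^sup>+\<omega>. (\<integral>\<^sup>+s. ennreal (indicator {0<..1} s * (s powr (- b - 1) * (1 - exp (- s * X \<omega>)))) \<partial>lborel) \<partial>N) < \<infinity>" .
  have "(\<integral>\<^sup>+\<omega>. ennreal (c * X \<omega> powr b) \<partial>N) \<le> (\<integral>\<^sup>+\<omega>. ennreal c + (\<integral>\<^sup>+s. ennreal (indicator {0<..1} s * (s powr (- b - 1) * (1 - exp (- s * X \<omega>)))) \<partial>lborel) \<partial>N)"
  proof (rule nn_integral_mono)
    fix \<omega> assume \<omega>: "\<omega> \<in> space N"
    show "ennreal (c * X \<omega> powr b) \<le> ennreal c + (\<integral>\<^sup>+s. ennreal (indicator {0<..1} s * (s powr (- b - 1) * (1 - exp (- s * X \<omega>)))) \<partial>lborel)"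
    proof (cases "1 \<le> X \<omega>")
      case True
      then show ?thesis by (rule order_trans[OF lower]) simp
    next
      case False
      then have "c * X \<omega> powr b \<le> c * 1" using b c pos[OF \<omega>] by (intro mult_left_mono powr_le1) auto
      then show ?thesis by (intro order_trans[OF ennreal_leI add_increasing2]) auto
    qed
  qed
  also have "\<dots> = ennreal c + (\<integral>\<^sup>+\<omega>. (\<integral>\<^sup>+s. ennreal (indicator {0<..1} s * (s powr (- b - 1) * (1 - exp (- s * X \<omega>)))) \<partial>lborel) \<partial>N)"
    by (subst nn_integral_add) (auto simp: emeasure_space_1)
  also have "\<dots> < \<infinity>" using fin by simp
  finally have "integrable N (\<lambda>\<omega>. c * X \<omega> powr b)"
    by (intro integrableI_nonneg) (use c in auto)
  then show ?thesis using c by simp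
qed

text \<open>For negative \<gamma> this is a positive moment of X of order \<beta> |\<gamma>|, which
  must stay below \<beta>: the origin of the condition \<gamma> > - 1.\<close>

lemma inverse_moment:
  assumes "-1 < \<gamma>"
  shows "integrable N (\<lambda>\<omega>. (X \<omega> powr (- \<beta>)) powr \<gamma>)"
proof -
  consider "\<gamma> > 0" | "\<gamma> = 0" | "\<gamma> < 0" by linarith
  then show ?thesis
  proof cases
    case 1
    then show ?thesis using negative_moment[OF 1] by (simp add: powr_powr has_bochner_integral_iff)
  next
    case 2
    have "integrable N (\<lambda>\<omega>. (X \<omega> powr (- \<beta>)) powr \<gamma>) \<longleftrightarrow> integrable N (\<lambda>_. 1 :: real)"
      by (rule Bochner_Integration.integrable_cong) (use 2 pos in force)+
    then show ?thesis by simp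
  next
    case 3
    have "integrable N (\<lambda>\<omega>. X \<omega> powr (- (\<beta> * \<gamma>)))"
      by (rule small_positive_moment) (use assms 3 beta mult_strict_left_mono[of "- \<gamma>" 1 \<beta>] in \<open>auto simp: mult_pos_neg\<close>)
    then show ?thesis by (simp add: powr_powr)
  qed
qed

lemma inverse_nat_moment:
  "has_bochner_integral N (\<lambda>\<omega>. (X \<omega> powr (- \<beta>)) ^ k) (fact k / Gamma (1 + \<beta> * real k))"
proof (cases "k = 0")
  case True
  then show ?thesis by (simp add: has_bochner_integral_iff prob_space)
next
  case False
  have "has_bochner_integral N (\<lambda>\<omega>. X \<omega> powr (- (\<beta> * real k))) (Gamma (1 + real k) / Gamma (1 + \<beta> * real k))"
    by (rule negative_moment) (use False in simp)
  moreover have "X \<omega> powr (- (\<beta> * real k)) = (X \<omega> powr (- \<beta>)) ^ k" if "\<omega> \<in> space N" for \<omega>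
    using pos[OF that] by (simp add: powr_realpow[symmetric] powr_powr)
  ultimately show ?thesis
    by (simp add: Gamma_fact cong: has_bochner_integral_cong)
qed

end

section \<open>The stable subordinator and its inverse\<close>

locale stable_subordinator_process = prob_space N for N :: "'v measure" +
  fixes L :: "real \<Rightarrow> 'v \<Rightarrow> real" and \<beta> :: real
  assumes sub: "stable_subordinator \<beta> N L" and \<beta>: "0 < \<beta>" "\<beta> < 1"
begin

lemma measurable_L [measurable (raw)]: "0 \<le> t \<Longrightarrow> L t \<in> borel_measurable N"
  using sub by (simp add: stable_subordinator_def levy_motion_def)

lemma L_0: "\<omega> \<in> space N \<Longrightarrow> L 0 \<omega> = 0"
  using sub by (simp add: stable_subordinator_def levy_motion_def)

lemma L_less: "\<omega> \<in> space N \<Longrightarrow> 0 \<le> s \<Longrightarrow> s < t \<Longrightarrow> L s \<omega> < L t \<omega>"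
  using sub by (auto simp: stable_subordinator_def strict_mono_on_def)

lemma L_le: "\<omega> \<in> space N \<Longrightarrow> 0 \<le> s \<Longrightarrow> s \<le> t \<Longrightarrow> L s \<omega> \<le> L t \<omega>"
  using L_less[of \<omega> s t] by (cases "s = t") auto

lemma L_pos: "\<omega> \<in> space N \<Longrightarrow> 0 < t \<Longrightarrow> 0 < L t \<omega>"
  using L_less[of \<omega> 0 t] L_0 by simp

lemma L_nonneg: "\<omega> \<in> space N \<Longrightarrow> 0 \<le> t \<Longrightarrow> 0 \<le> L t \<omega>"
  using L_le[of \<omega> 0 t] L_0 by simp

lemma laplace_L: "0 \<le> t \<Longrightarrow> 0 < s \<Longrightarrow> (\<integral>\<omega>. exp (- s * L t \<omega>) \<partial>N) = exp (- t * s powr \<beta>)"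
  using sub by (simp add: stable_subordinator_def)

sublocale stable_law N "L 1" \<beta>
  by unfold_locales (use \<beta> L_pos laplace_L[of 1] in auto)

text \<open>Both sides have Laplace transform exp (- x s^\<beta>), and laws on the half-line are
  determined by its values at the integers.\<close>

lemma self_similar:
  assumes x: "0 < x"
  shows "distr N borel (L x) = distr N borel (\<lambda>\<omega>. x powr (1 / \<beta>) * L 1 \<omega>)"
proof (rule finite_measure_eq_laplace)
  have [measurable]: "L x \<in> borel_measurable N" using x by simp
  interpret A: prob_space "distr N borel (L x)" by (rule prob_space_distr) simp
  interpret B: prob_space "distr N borel (\<lambda>\<omega>. x powr (1 / \<beta>) * L 1 \<omega>)" by (rule prob_space_distr) simp
  show "finite_measure (distr N borel (L x))" "finite_measure (distr N borel (\<lambda>\<omega>. x powr (1 / \<beta>) * L 1 \<omega>))"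
    by unfold_locales
  show "AE y in distr N borel (L x). 0 \<le> y" using x by (subst AE_distr_iff) (auto intro!: AE_I2 L_nonneg)
  show "AE y in distr N borel (\<lambda>\<omega>. x powr (1 / \<beta>) * L 1 \<omega>). 0 \<le> y"
    by (subst AE_distr_iff) (auto intro!: AE_I2 mult_nonneg_nonneg L_nonneg)
  fix n :: nat
  show "(\<integral>y. exp (- real n * y) \<partial>distr N borel (L x)) = (\<integral>y. exp (- real n * y) \<partial>distr N borel (\<lambda>\<omega>. x powr (1 / \<beta>) * L 1 \<omega>))"
  proof (cases "n = 0")
    case False
    have "(\<integral>\<omega>. exp (- (real n * x powr (1 / \<beta>)) * L 1 \<omega>) \<partial>N) = exp (- 1 * (real n * x powr (1 / \<beta>)) powr \<beta>)"
      by (rule laplace_L) (use False x in auto)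
    also have "(real n * x powr (1 / \<beta>)) powr \<beta> = real n powr \<beta> * x" using x \<beta> by (simp add: powr_mult powr_powr)
    finally show ?thesis using laplace_L[of x "real n"] x False by (simp add: integral_distr mult_ac)
  qed (use A.prob_space B.prob_space in simp)
qed auto

text \<open>On a null set of bounded paths \<open>inverse_motion\<close> takes the junk value \<open>Inf {}\<close>.\<close>

lemma AE_unbounded: "AE \<omega> in N. \<forall>c. \<exists>x\<ge>0. c < L x \<omega>"
proof -
  have "AE \<omega> in N. \<exists>n::nat. real c < L (real n) \<omega>" for c :: nat
  proof -
    \<comment> \<open>Markov's inequality for exp (- L n), whose mean is exp (- n).\<close>
    have m: "prob {\<omega> \<in> space N. L (real n) \<omega> \<le> real c} \<le> exp (real c) * exp (- real n)" for n
    proof -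
      have [measurable]: "L (real n) \<in> borel_measurable N" by simp
      have "prob {\<omega> \<in> space N. L (real n) \<omega> \<le> real c} = (\<integral>\<omega>. indicator {\<omega> \<in> space N. L (real n) \<omega> \<le> real c} \<omega> \<partial>N)"
        by simp
      also have "\<dots> \<le> (\<integral>\<omega>. exp (real c) * exp (- 1 * L (real n) \<omega>) \<partial>N)"
      proof (rule integral_mono)
        show "integrable N (\<lambda>\<omega>. exp (real c) * exp (- 1 * L (real n) \<omega>))"
          by (intro integrable_mult_right integrable_const_bound[where B=1]) (auto intro!: AE_I2 L_nonneg)
        show "indicator {\<omega> \<in> space N. L (real n) \<omega> \<le> real c} \<omega> \<le> exp (real c) * exp (- 1 * L (real n) \<omega>)" for \<omega>
          by (auto simp: indicator_def mult_exp_exp)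
      qed (auto intro: integrable_real_indicator simp: emeasure_eq_measure)
      also have "\<dots> = exp (real c) * exp (- real n)" using laplace_L[of "real n" 1] by simp
      finally show ?thesis .
    qed
    have meas: "{\<omega> \<in> space N. \<forall>n::nat. L (real n) \<omega> \<le> real c} \<in> events"
    proof -
      have [measurable]: "L (real n) \<in> borel_measurable N" for n by simp
      show ?thesis by measurable
    qed
    have "prob {\<omega> \<in> space N. \<forall>n::nat. L (real n) \<omega> \<le> real c} \<le> exp (real c) * exp (- real n)" for n
    proof -
      have [measurable]: "L (real n) \<in> borel_measurable N" by simp
      have "prob {\<omega> \<in> space N. \<forall>n::nat. L (real n) \<omega> \<le> real c} \<le> prob {\<omega> \<in> space N. L (real n) \<omega> \<le> real c}"
        by (rule finite_measure_mono) auto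
      then show ?thesis using m[of n] by linarith
    qed
    moreover have "(\<lambda>n. exp (real c) * exp (- real n)) \<longlonglongrightarrow> 0" by real_asymp
    ultimately have "prob {\<omega> \<in> space N. \<forall>n::nat. L (real n) \<omega> \<le> real c} \<le> 0"
      by (intro LIMSEQ_le_const[where X="\<lambda>n. exp (real c) * exp (- real n)"]) auto
    then have "prob {\<omega> \<in> space N. \<forall>n::nat. L (real n) \<omega> \<le> real c} = 0"
      using measure_nonneg[of N] by (simp add: antisym)
    then have "AE \<omega> in N. \<not> (\<forall>n::nat. L (real n) \<omega> \<le> real c)"
      using meas by (intro AE_I'[of "{\<omega> \<in> space N. \<forall>n::nat. L (real n) \<omega> \<le> real c}"]) (auto simp: null_sets_def emeasure_eq_measure)
    then show ?thesis by (auto simp: not_le)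
  qed
  then have "AE \<omega> in N. \<forall>c::nat. \<exists>n::nat. real c < L (real n) \<omega>" by (simp add: AE_all_countable)
  then show ?thesis
  proof eventually_elim
    case (elim \<omega>)
    show ?case
    proof
      fix c :: real
      obtain k :: nat where "c \<le> real k" using real_arch_simple by blast
      moreover obtain n :: nat where "real k < L (real n) \<omega>" using elim by blast
      ultimately show "\<exists>x\<ge>0. c < L x \<omega>" by (intro exI[of _ "real n"]) auto
    qed
  qed
qed

text \<open>Both inequalities are weak, and each direction uses a different path property. If t
  \<le> L x, strict increase puts every point to the right of x into the set whose infimum is taken.
  If L x < t, right-continuity keeps L below t on an interval to the right of x, so the infimum
  exceeds x.\<close>

lemma inverse_motion_le_iff:
  assumes \<omega>: "\<omega> \<in> space N" and ne: "\<exists>y\<ge>0. t < L y \<omega>" and x: "0 \<le> x"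
  shows "inverse_motion L t \<omega> \<le> x \<longleftrightarrow> t \<le> L x \<omega>"
proof
  let ?S = "{x. 0 \<le> x \<and> t < L x \<omega>}"
  have bd: "bdd_below ?S" by (rule bdd_belowI[of _ 0]) auto
  show "inverse_motion L t \<omega> \<le> x" if t: "t \<le> L x \<omega>"
    unfolding inverse_motion_def
  proof (rule field_le_epsilon)
    fix e :: real assume "0 < e"
    then show "Inf ?S \<le> x + e" using L_less[OF \<omega> x, of "x + e"] t x by (intro cInf_lower bd) auto
  qed
  show "t \<le> L x \<omega>" if le: "inverse_motion L t \<omega> \<le> x"
  proof (rule ccontr)
    assume "\<not> t \<le> L x \<omega>"
    then have "L x \<omega> < t" by simp
    moreover have "((\<lambda>s. L s \<omega>) \<longlongrightarrow> L x \<omega>) (at_right x)"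
      using sub \<omega> x by (simp add: stable_subordinator_def levy_motion_def)
    ultimately have "\<forall>\<^sub>F s in at_right x. L s \<omega> < t" by (intro order_tendstoD(2))
    then obtain b where b: "b > x" "\<And>y. x < y \<Longrightarrow> y < b \<Longrightarrow> L y \<omega> < t"
      unfolding eventually_at_right_field by blast
    define z where "z = (x + b) / 2"
    have z: "x < z" "z < b" using b(1) by (auto simp: z_def)
    have "z \<le> Inf ?S"
    proof (rule cInf_greatest)
      show "?S \<noteq> {}" using ne by auto
      fix y assume y: "y \<in> ?S"
      show "z \<le> y"
      proof (rule ccontr)
        assume "\<not> z \<le> y"
        then have "L y \<omega> \<le> L z \<omega>" using y by (intro L_le[OF \<omega>]) auto
        then show False using y b(2)[OF z] by simp
      qed
    qed
    then show False using le z unfolding inverse_motion_def by simp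
  qed
qed

lemma inverse_motion_0: "\<omega> \<in> space N \<Longrightarrow> inverse_motion L 0 \<omega> = 0"
proof -
  assume \<omega>: "\<omega> \<in> space N"
  have "0 \<le> x \<and> 0 < L x \<omega> \<longleftrightarrow> 0 < x" for x
    using L_pos[OF \<omega>, of x] L_0[OF \<omega>] by (cases "x = 0") auto
  then have "{x. 0 \<le> x \<and> 0 < L x \<omega>} = {0<..}" by auto
  then show ?thesis by (simp add: inverse_motion_def)
qed

text \<open>Measurability is required on all of \<open>space N\<close>, including the null set of
  bounded paths, where the value is the fixed constant \<open>Inf {}\<close>. By monotonicity,
  whether a path ever exceeds t can be tested at integer times.\<close>

lemma measurable_inverse_motion [measurable (raw)]:
  assumes t: "0 \<le> t"
  shows "inverse_motion L t \<in> borel_measurable N"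
proof (rule borel_measurableI_le)
  fix a :: real
  have Lm[measurable]: "L (real n) \<in> borel_measurable N" for n by simp
  have ne: "(\<exists>y\<ge>0. t < L y \<omega>) \<longleftrightarrow> (\<exists>n::nat. t < L (real n) \<omega>)" if "\<omega> \<in> space N" for \<omega>
  proof
    assume "\<exists>y\<ge>0. t < L y \<omega>"
    then obtain y where y: "y \<ge> 0" "t < L y \<omega>" by blast
    obtain n :: nat where "y \<le> real n" using real_arch_simple by blast
    then show "\<exists>n::nat. t < L (real n) \<omega>" using L_le[OF that y(1), of "real n"] y by (intro exI[of _ n]) auto
  qed (metis of_nat_0_le_iff)
  have nn: "0 \<le> inverse_motion L t \<omega>" if "\<exists>y\<ge>0. t < L y \<omega>" for \<omega>
    unfolding inverse_motion_def by (rule cInf_greatest) (use that in auto)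
  define c where "c = Inf ({} :: real set)"
  have cc: "inverse_motion L t \<omega> = c" if "\<not> (\<exists>y\<ge>0. t < L y \<omega>)" for \<omega>
  proof -
    have "{x. 0 \<le> x \<and> t < L x \<omega>} = {}" using that by auto
    then show ?thesis by (simp only: inverse_motion_def c_def)
  qed
  show "{\<omega> \<in> space N. inverse_motion L t \<omega> \<le> a} \<in> sets N"
  proof (cases "0 \<le> a")
    case True
    have [measurable]: "L a \<in> borel_measurable N" using True by simp
    have "{\<omega> \<in> space N. inverse_motion L t \<omega> \<le> a} =
      {\<omega> \<in> space N. if \<exists>n::nat. t < L (real n) \<omega> then t \<le> L a \<omega> else c \<le> a}"
    proof (rule Collect_cong, rule conj_cong[OF refl])
      fix \<omega> assume \<omega>: "\<omega> \<in> space N"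
      show "inverse_motion L t \<omega> \<le> a \<longleftrightarrow> (if \<exists>n::nat. t < L (real n) \<omega> then t \<le> L a \<omega> else c \<le> a)"
      proof (cases "\<exists>y\<ge>0. t < L y \<omega>")
        case ex: True
        then show ?thesis using ne[OF \<omega>] inverse_motion_le_iff[OF \<omega> ex True] by simp
      next
        case ex: False
        then show ?thesis using ne[OF \<omega>] cc[OF ex] by simp
      qed
    qed
    also have "\<dots> \<in> sets N" by measurable
    finally show ?thesis .
  next
    case False
    have "{\<omega> \<in> space N. inverse_motion L t \<omega> \<le> a} =
      {\<omega> \<in> space N. \<not> (\<exists>n::nat. t < L (real n) \<omega>) \<and> c \<le> a}"
    proof (rule Collect_cong, rule conj_cong[OF refl])
      fix \<omega> assume \<omega>: "\<omega> \<in> space N"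
      show "inverse_motion L t \<omega> \<le> a \<longleftrightarrow> \<not> (\<exists>n::nat. t < L (real n) \<omega>) \<and> c \<le> a"
      proof (cases "\<exists>y\<ge>0. t < L y \<omega>")
        case ex: True
        then show ?thesis using ne[OF \<omega>] nn[OF ex] False by simp
      next
        case ex: False
        then show ?thesis using ne[OF \<omega>] cc[OF ex] by simp
      qed
    qed
    also have "\<dots> \<in> sets N" by measurable
    finally show ?thesis .
  qed
qed

text \<open>The event that the inverse at t is at most x is t \<le> L x. By self-similarity this has
  the probability of t \<le> x^(1/\<beta>) L 1, that is of t^\<beta> (L 1)^(- \<beta>) \<le>
  x.\<close>

lemma distr_inverse_motion:
  assumes t: "0 \<le> t"
  shows "distr N borel (inverse_motion L t) = distr N borel (\<lambda>\<omega>. t powr \<beta> * L 1 \<omega> powr (- \<beta>))"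
proof (cases "t = 0")
  case True
  then show ?thesis using \<beta> by (intro distr_cong) (auto simp: inverse_motion_0)
next
  case False
  then have t: "0 < t" using t by simp
  have m[measurable]: "inverse_motion L t \<in> borel_measurable N" using t by simp
  have "cdf (distr N borel (inverse_motion L t)) x = cdf (distr N borel (\<lambda>\<omega>. t powr \<beta> * L 1 \<omega> powr (- \<beta>))) x" for x
  proof (cases "0 < x")
    case x: True
    have [measurable]: "L x \<in> borel_measurable N" using x by simp
    have "prob (inverse_motion L t -` {..x} \<inter> space N) = prob (L x -` {t..} \<inter> space N)"
    proof (rule finite_measure_eq_AE)
      show "AE \<omega> in N. \<omega> \<in> inverse_motion L t -` {..x} \<inter> space N \<longleftrightarrow> \<omega> \<in> L x -` {t..} \<inter> space N"
        using AE_unbounded by eventually_elim (use x inverse_motion_le_iff in auto)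
    qed measurable
    also have "\<dots> = measure (distr N borel (L x)) {t..}" by (simp add: measure_distr)
    also have "\<dots> = prob ((\<lambda>\<omega>. x powr (1 / \<beta>) * L 1 \<omega>) -` {t..} \<inter> space N)"
      unfolding self_similar[OF x] by (simp add: measure_distr)
    also have "(\<lambda>\<omega>. x powr (1 / \<beta>) * L 1 \<omega>) -` {t..} \<inter> space N = (\<lambda>\<omega>. t powr \<beta> * L 1 \<omega> powr (- \<beta>)) -` {..x} \<inter> space N"
    proof -
      have "t \<le> x powr (1 / \<beta>) * y \<longleftrightarrow> t powr \<beta> * y powr (- \<beta>) \<le> x" if y: "0 < y" for y
      proof -
        have "t \<le> x powr (1 / \<beta>) * y \<longleftrightarrow> t powr \<beta> \<le> (x powr (1 / \<beta>) * y) powr \<beta>"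
          using \<beta> t x y powr_mono2[of \<beta> t "x powr (1 / \<beta>) * y"] powr_less_mono2[of \<beta> "x powr (1 / \<beta>) * y" t]
          by (cases "t \<le> x powr (1 / \<beta>) * y") auto
        also have "(x powr (1 / \<beta>) * y) powr \<beta> = x * y powr \<beta>" using x y \<beta> by (simp add: powr_mult powr_powr)
        also have "t powr \<beta> \<le> x * y powr \<beta> \<longleftrightarrow> t powr \<beta> * y powr (- \<beta>) \<le> x"
          using y by (simp add: powr_minus field_simps)
        finally show ?thesis .
      qed
      then show ?thesis using L_pos[of _ 1] by auto
    qed
    finally show ?thesis by (simp add: cdf_def measure_distr)
  next
    case False
    have "prob (inverse_motion L t -` {..x} \<inter> space N) = prob {}"
    proof (rule finite_measure_eq_AE)
      show "AE \<omega> in N. \<omega> \<in> inverse_motion L t -` {..x} \<inter> space N \<longleftrightarrow> \<omega> \<in> {}"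
        using AE_unbounded AE_space
      proof eventually_elim
        case (elim \<omega>)
        then have "\<not> inverse_motion L t \<omega> \<le> 0" using inverse_motion_le_iff[of \<omega> t 0] t L_0[of \<omega>] by auto
        then show ?case using False by auto
      qed
    qed auto
    moreover have "(\<lambda>\<omega>. t powr \<beta> * L 1 \<omega> powr (- \<beta>)) -` {..x} \<inter> space N = {}"
    proof -
      have "0 < t powr \<beta> * L 1 \<omega> powr (- \<beta>)" if "\<omega> \<in> space N" for \<omega>
        using t L_pos[OF that, of 1] by simp
      then show ?thesis using False by force
    qed
    ultimately show ?thesis by (simp add: cdf_def measure_distr)
  qed
  then show ?thesis
    by (intro cdf_unique ext) (auto simp: real_distribution_def real_distribution_axioms_def intro!: prob_space_distr)
qed

lemma integral_inverse_motion:
  fixes h :: "real \<Rightarrow> real"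
  assumes t: "0 \<le> t" and [measurable]: "h \<in> borel_measurable borel"
  shows "(\<integral>\<omega>. h (inverse_motion L t \<omega>) \<partial>N) = (\<integral>\<omega>. h (t powr \<beta> * L 1 \<omega> powr (- \<beta>)) \<partial>N)"
    and "integrable N (\<lambda>\<omega>. h (inverse_motion L t \<omega>)) \<longleftrightarrow> integrable N (\<lambda>\<omega>. h (t powr \<beta> * L 1 \<omega> powr (- \<beta>)))"
proof -
  have [measurable]: "inverse_motion L t \<in> borel_measurable N" using t by simp
  have "(\<integral>\<omega>. h (inverse_motion L t \<omega>) \<partial>N) = (\<integral>y. h y \<partial>distr N borel (inverse_motion L t))"
    by (simp add: integral_distr)
  also have "\<dots> = (\<integral>\<omega>. h (t powr \<beta> * L 1 \<omega> powr (- \<beta>)) \<partial>N)"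
    unfolding distr_inverse_motion[OF t] by (simp add: integral_distr)
  finally show "(\<integral>\<omega>. h (inverse_motion L t \<omega>) \<partial>N) = (\<integral>\<omega>. h (t powr \<beta> * L 1 \<omega> powr (- \<beta>)) \<partial>N)" .
  have "integrable N (\<lambda>\<omega>. h (inverse_motion L t \<omega>)) \<longleftrightarrow> integrable (distr N borel (inverse_motion L t)) h"
    by (simp add: integrable_distr_eq)
  also have "\<dots> \<longleftrightarrow> integrable N (\<lambda>\<omega>. h (t powr \<beta> * L 1 \<omega> powr (- \<beta>)))"
    unfolding distr_inverse_motion[OF t] by (simp add: integrable_distr_eq)
  finally show "integrable N (\<lambda>\<omega>. h (inverse_motion L t \<omega>)) \<longleftrightarrow> integrable N (\<lambda>\<omega>. h (t powr \<beta> * L 1 \<omega> powr (- \<beta>)))" .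
qed

lemma moment_const_eq: "moment_const N L \<gamma> = (\<integral>\<omega>. (L 1 \<omega> powr (- \<beta>)) powr \<gamma> \<partial>N)"
  unfolding moment_const_def using integral_inverse_motion(1)[of 1 "\<lambda>y. y powr \<gamma>"] by simp

lemma moment_const_nat: "moment_const N L (real k) = (\<integral>\<omega>. (L 1 \<omega> powr (- \<beta>)) ^ k \<partial>N)"
  unfolding moment_const_eq
proof (rule Bochner_Integration.integral_cong)
  fix \<omega> assume "\<omega> \<in> space N"
  then have "0 < L 1 \<omega> powr (- \<beta>)" using L_pos[of \<omega> 1] by simp
  then show "(L 1 \<omega> powr (- \<beta>)) powr real k = (L 1 \<omega> powr (- \<beta>)) ^ k" by (rule powr_realpow)
qed simp

end

section \<open>Beta mixtures of the inverse stable law\<close>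

lemma pair_integral_product:
  fixes f :: "'a \<Rightarrow> real" and g :: "'b \<Rightarrow> real"
  assumes "sigma_finite_measure M" "sigma_finite_measure N" and f: "integrable M f" and g: "integrable N g"
  shows "integrable (M \<Otimes>\<^sub>M N) (\<lambda>p. f (fst p) * g (snd p))"
    and "(\<integral>p. f (fst p) * g (snd p) \<partial>(M \<Otimes>\<^sub>M N)) = (\<integral>x. f x \<partial>M) * (\<integral>y. g y \<partial>N)"
proof -
  interpret M: sigma_finite_measure M by fact
  interpret N: sigma_finite_measure N by fact
  interpret pair_sigma_finite M N ..
  have [measurable]: "f \<in> borel_measurable M" "g \<in> borel_measurable N" using f g by auto
  show *: "integrable (M \<Otimes>\<^sub>M N) (\<lambda>p. f (fst p) * g (snd p))"
  proof (rule Fubini_integrable)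
    show "integrable M (\<lambda>x. \<integral>y. norm (f (fst (x, y)) * g (snd (x, y))) \<partial>N)"
      using f by (simp add: abs_mult)
    show "AE x in M. integrable N (\<lambda>y. f (fst (x, y)) * g (snd (x, y)))" using g by simp
  qed measurable
  show "(\<integral>p. f (fst p) * g (snd p) \<partial>(M \<Otimes>\<^sub>M N)) = (\<integral>x. f x \<partial>M) * (\<integral>y. g y \<partial>N)"
    using integral_fst'[OF *] by simp
qed

lemma AE_pair_fst:
  assumes "sigma_finite_measure M" "sigma_finite_measure N" and P: "AE x in M. P x" "Measurable.pred M P"
  shows "AE p in M \<Otimes>\<^sub>M N. P (fst p)"
proof -
  interpret M: sigma_finite_measure M by fact
  interpret N: sigma_finite_measure N by fact
  interpret pair_sigma_finite M N ..
  note [measurable] = P(2)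
  have "AE x in M. AE y in N. P (fst (x, y))" using P(1) by eventually_elim simp
  then show ?thesis by (subst (asm) AE_pair_iff) auto
qed

lemma AE_pair_snd:
  assumes "sigma_finite_measure M" "sigma_finite_measure N" and P: "AE y in N. P y" "Measurable.pred N P"
  shows "AE p in M \<Otimes>\<^sub>M N. P (snd p)"
proof -
  interpret M: sigma_finite_measure M by fact
  interpret N: sigma_finite_measure N by fact
  interpret pair_sigma_finite M N ..
  note [measurable] = P(2)
  have "AE x in M. AE y in N. P (snd (x, y))" using P(1) by simp
  then show ?thesis by (subst (asm) AE_pair_iff) auto
qed

lemma set_integral_Beta:
  fixes a b :: real
  assumes "0 < a" "0 < b"
  shows "integrable lborel (\<lambda>w. indicator {0<..<1} w * (w powr (a - 1) * (1 - w) powr (b - 1)))"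
    and "(\<integral>w. indicator {0<..<1} w * (w powr (a - 1) * (1 - w) powr (b - 1)) \<partial>lborel) = Beta a b"
proof -
  have e: "indicator {0<..<1} w * (w powr (a - 1) * (1 - w) powr (b - 1)) =
      indicator {0..1} w *\<^sub>R (w powr (a - 1) * (1 - w) powr (b - 1))" for w :: real
    by (cases "w = 0 \<or> w = 1") (auto simp: indicator_def)
  have i: "set_integrable lborel {0..1} (\<lambda>t. t powr (a - 1) * (1 - t) powr (b - 1))"
    by (rule integrable_Beta[OF assms])
  show "integrable lborel (\<lambda>w. indicator {0<..<1} w * (w powr (a - 1) * (1 - w) powr (b - 1)))"
    using i unfolding e set_integrable_def .
  show "(\<integral>w. indicator {0<..<1} w * (w powr (a - 1) * (1 - w) powr (b - 1)) \<partial>lborel) = Beta a b"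
    unfolding e
    using set_borel_integral_eq_integral(2)[OF i] integral_unique[OF has_integral_Beta_real[OF assms]]
    by (simp add: set_lebesgue_integral_def)
qed

text \<open>A multiple of the beta law, of total mass c Beta(a, b). The factor c stays free because
  the weighted law built from it in \<open>mixture\<close> has to have mass 1, not this measure
  itself.\<close>

definition beta_measure :: "real \<Rightarrow> real \<Rightarrow> real \<Rightarrow> real measure" where
  "beta_measure c a b = density lborel (\<lambda>w. ennreal (c * (indicator {0<..<1} w * (w powr (a - 1) * (1 - w) powr (b - 1)))))"

lemma beta_measure_integral:
  fixes f :: "real \<Rightarrow> real"
  assumes [measurable]: "f \<in> borel_measurable borel" and c: "0 \<le> c"
  shows "(\<integral>w. f w \<partial>beta_measure c a b) = c * (\<integral>w. indicator {0<..<1} w * (w powr (a - 1) * (1 - w) powr (b - 1)) * f w \<partial>lborel)"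
    and "integrable (beta_measure c a b) f \<longleftrightarrow> integrable lborel (\<lambda>w. c * (indicator {0<..<1} w * (w powr (a - 1) * (1 - w) powr (b - 1)) * f w))"
  unfolding beta_measure_def using c
  by (subst integral_real_density integrable_real_density; auto intro!: AE_I2 simp: mult.assoc)+

lemma beta_measure_moment:
  assumes "0 \<le> c" "0 < a" "0 < b" "0 \<le> s"
  shows "has_bochner_integral (beta_measure c a b) (\<lambda>w. w powr s) (c * Beta (a + s) b)"
proof -
  have e: "indicator {0<..<1} w * (w powr (a - 1) * (1 - w) powr (b - 1)) * w powr s
    = indicator {0<..<1} w * (w powr (a + s - 1) * (1 - w) powr (b - 1))" for w :: real
  proof -
    have "w powr (a - 1) * w powr s = w powr (a + s - 1)" by (simp add: powr_add[symmetric] algebra_simps)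
    moreover have "indicator {0<..<1} w * (w powr (a - 1) * (1 - w) powr (b - 1)) * w powr s
      = indicator {0<..<1} w * ((w powr (a - 1) * w powr s) * (1 - w) powr (b - 1))" by (simp only: mult_ac)
    ultimately show ?thesis by simp
  qed
  show ?thesis
    unfolding has_bochner_integral_iff using assms set_integral_Beta[of "a + s" b]
    by (simp add: beta_measure_integral e)
qed

lemma finite_beta_measure:
  assumes "0 \<le> c" "0 < a" "0 < b"
  shows "finite_measure (beta_measure c a b)"
proof
  have "emeasure (beta_measure c a b) (space (beta_measure c a b)) =
      (\<integral>\<^sup>+w. ennreal (c * (indicator {0<..<1} w * (w powr (a - 1) * (1 - w) powr (b - 1)))) \<partial>lborel)"
    by (simp add: beta_measure_def emeasure_density)
  also have "\<dots> < \<infinity>"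
    using integrableD(2)[OF integrable_mult_right[OF set_integral_Beta(1)[OF assms(2,3)], of c]] assms(1)
    by (simp add: less_top)
  finally show "emeasure (beta_measure c a b) (space (beta_measure c a b)) \<noteq> \<infinity>" by simp
qed

lemma sets_beta_measure [simp, measurable_cong]: "sets (beta_measure c a b) = sets borel"
  by (simp add: beta_measure_def)

lemma AE_beta_measure: "0 \<le> c \<Longrightarrow> AE w in beta_measure c a b. 0 < w \<and> w < 1"
  unfolding beta_measure_def by (subst AE_density) (auto intro!: AE_I2 simp: indicator_def split: if_splits)

text \<open>The law of Z, often called the Mittag-Leffler law. \<open>moment\<close> identifies it;
  \<open>powr_moment\<close> controls the singularity of the kernel at small variance.\<close>

locale inverse_stable_law = prob_space \<zeta> for \<zeta> :: "real measure" +
  fixes \<beta> :: real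
  assumes sets_zeta [simp, measurable_cong]: "sets \<zeta> = sets borel"
    and pos: "AE z in \<zeta>. 0 < z"
    and beta: "0 < \<beta>" "\<beta> < 1"
    and moment: "\<And>k::nat. has_bochner_integral \<zeta> (\<lambda>z. z ^ k) (fact k / Gamma (1 + \<beta> * real k))"
    and powr_moment: "\<And>\<gamma>. -1 < \<gamma> \<Longrightarrow> integrable \<zeta> (\<lambda>z. z powr \<gamma>)"
begin

text \<open>By independence the k-th moment of the weighted law of w^q Z is c Beta(a + q k, b) times
  the moment of Z of order p + k. \<open>mom\<close> says that this is the k-th moment of Z (k = 0
  being the total mass), and these moments determine the law.\<close>

lemma mixture:
  fixes a b c q :: real and p :: nat
  assumes c: "0 \<le> c" "0 < a" "0 < b" "0 < q"
    and mom: "\<And>k::nat. c * Beta (a + q * real k) b * (fact (p + k) / Gamma (1 + \<beta> * real (p + k))) = fact k / Gamma (1 + \<beta> * real k)"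
  shows "distr (density (beta_measure c a b \<Otimes>\<^sub>M \<zeta>) (\<lambda>x. ennreal (snd x ^ p))) borel (\<lambda>x. fst x powr q * snd x) = \<zeta>"
    (is "?D = \<zeta>")
proof -
  let ?\<rho> = "beta_measure c a b"
  interpret \<rho>: finite_measure ?\<rho> by (rule finite_beta_measure[OF c(1-3)])
  interpret P: pair_sigma_finite ?\<rho> \<zeta> ..
  have sf: "sigma_finite_measure ?\<rho>" "sigma_finite_measure \<zeta>" by unfold_locales
  have AEw: "AE x in ?\<rho> \<Otimes>\<^sub>M \<zeta>. 0 < fst x \<and> fst x < 1"
    by (rule AE_pair_fst[OF sf AE_beta_measure[OF c(1)]]) measurable
  have AEz: "AE x in ?\<rho> \<Otimes>\<^sub>M \<zeta>. 0 < snd x"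
    by (rule AE_pair_snd[OF sf pos]) measurable
  have ip: "integrable (?\<rho> \<Otimes>\<^sub>M \<zeta>) (\<lambda>x. fst x powr (q * real k) * snd x ^ (p + k))"
   and vp: "(\<integral>x. fst x powr (q * real k) * snd x ^ (p + k) \<partial>(?\<rho> \<Otimes>\<^sub>M \<zeta>)) = fact k / Gamma (1 + \<beta> * real k)" for k :: nat
  proof -
    have "has_bochner_integral ?\<rho> (\<lambda>w. w powr (q * real k)) (c * Beta (a + q * real k) b)"
      by (rule beta_measure_moment) (use c in auto)
    then have 1: "integrable ?\<rho> (\<lambda>w. w powr (q * real k))" "(\<integral>w. w powr (q * real k) \<partial>?\<rho>) = c * Beta (a + q * real k) b"
      by (auto simp: has_bochner_integral_iff)
    have 2: "integrable \<zeta> (\<lambda>z. z ^ (p + k))" "(\<integral>z. z ^ (p + k) \<partial>\<zeta>) = fact (p + k) / Gamma (1 + \<beta> * real (p + k))"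
      using moment[of "p + k"] by (auto simp: has_bochner_integral_iff)
    show "integrable (?\<rho> \<Otimes>\<^sub>M \<zeta>) (\<lambda>x. fst x powr (q * real k) * snd x ^ (p + k))"
      by (rule pair_integral_product(1)[OF sf 1(1) 2(1)])
    show "(\<integral>x. fst x powr (q * real k) * snd x ^ (p + k) \<partial>(?\<rho> \<Otimes>\<^sub>M \<zeta>)) = fact k / Gamma (1 + \<beta> * real k)"
      using pair_integral_product(2)[OF sf 1(1) 2(1)] mom[of k] by (simp only: 1(2) 2(2))
  qed
  have nn: "AE x in ?\<rho> \<Otimes>\<^sub>M \<zeta>. 0 \<le> snd x ^ p" using AEz by eventually_elim simp
  \<comment> \<open>The identity fails at w = 0, k = 0, where \<open>0 ^ 0\<close> is 1 but
    \<open>0 powr 0\<close> is 0; that point carries no mass.\<close>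
  have eqk: "AE x in ?\<rho> \<Otimes>\<^sub>M \<zeta>. snd x ^ p * (fst x powr q * snd x) ^ k = fst x powr (q * real k) * snd x ^ (p + k)" for k
    using AEw
  proof eventually_elim
    case (elim x)
    have "(fst x powr q) ^ k = (fst x powr q) powr real k" using elim by (subst powr_realpow) auto
    then show ?case by (simp add: power_mult_distrib power_add powr_powr)
  qed
  have pm: "(\<lambda>x. snd x ^ p) \<in> borel_measurable (?\<rho> \<Otimes>\<^sub>M \<zeta>)" by measurable
  have Dm: "(\<lambda>x. fst x powr q * snd x) \<in> measurable (density (?\<rho> \<Otimes>\<^sub>M \<zeta>) (\<lambda>x. ennreal (snd x ^ p))) borel" by measurable
  have D_integral: "integrable (?\<rho> \<Otimes>\<^sub>M \<zeta>) (\<lambda>x. snd x ^ p * h (fst x powr q * snd x)) \<Longrightarrow> integrable ?D h"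
    "(\<integral>x. h x \<partial>?D) = (\<integral>x. snd x ^ p * h (fst x powr q * snd x) \<partial>(?\<rho> \<Otimes>\<^sub>M \<zeta>))"
    if [measurable]: "h \<in> borel_measurable borel" for h :: "real \<Rightarrow> real"
  proof -
    have hm: "(\<lambda>x. h (fst x powr q * snd x)) \<in> borel_measurable (?\<rho> \<Otimes>\<^sub>M \<zeta>)" by measurable
    show "integrable ?D h" if i: "integrable (?\<rho> \<Otimes>\<^sub>M \<zeta>) (\<lambda>x. snd x ^ p * h (fst x powr q * snd x))"
      using i unfolding integrable_distr_eq[OF Dm \<open>h \<in> _\<close>] integrable_real_density[OF pm nn hm] .
    show "(\<integral>x. h x \<partial>?D) = (\<integral>x. snd x ^ p * h (fst x powr q * snd x) \<partial>(?\<rho> \<Otimes>\<^sub>M \<zeta>))"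
      unfolding integral_distr[OF Dm \<open>h \<in> _\<close>] by (rule integral_real_density[OF pm nn hm])
  qed
  have intk: "integrable ?D (\<lambda>x. x ^ k)" and valk: "(\<integral>x. x ^ k \<partial>?D) = fact k / Gamma (1 + \<beta> * real k)" for k
  proof -
    have m: "(\<lambda>x. snd x ^ p * (fst x powr q * snd x) ^ k) \<in> borel_measurable (?\<rho> \<Otimes>\<^sub>M \<zeta>)"
      by measurable
    have "AE x in ?\<rho> \<Otimes>\<^sub>M \<zeta>. fst x powr (q * real k) * snd x ^ (p + k) = snd x ^ p * (fst x powr q * snd x) ^ k"
      using eqk[of k] by eventually_elim simp
    from integrable_cong_AE_imp[OF ip m this]
    have i: "integrable (?\<rho> \<Otimes>\<^sub>M \<zeta>) (\<lambda>x. snd x ^ p * (fst x powr q * snd x) ^ k)" .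
    show "integrable ?D (\<lambda>x. x ^ k)"
      by (rule D_integral(1)) (use i in simp_all)
    have "(\<integral>x. x ^ k \<partial>?D) = (\<integral>x. snd x ^ p * (fst x powr q * snd x) ^ k \<partial>(?\<rho> \<Otimes>\<^sub>M \<zeta>))"
      by (rule D_integral(2)) simp
    also have "\<dots> = fact k / Gamma (1 + \<beta> * real k)"
      unfolding vp[symmetric] by (rule integral_cong_AE[OF m _ eqk]) measurable
    finally show "(\<integral>x. x ^ k \<partial>?D) = fact k / Gamma (1 + \<beta> * real k)" .
  qed
  show ?thesis
  proof (rule finite_measure_eq_moments[where m="\<lambda>k. fact k / Gamma (1 + \<beta> * real k)"])
    show "finite_measure ?D"
      using integrableD(2)[OF intk[of 0]] by (intro finite_measureI) simp
    show "finite_measure \<zeta>" by unfold_locales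
    show "AE x in ?D. 0 \<le> x"
    proof (subst AE_distr_iff[OF Dm], measurable, subst AE_density)
      show "AE x in ?\<rho> \<Otimes>\<^sub>M \<zeta>. 0 < ennreal (snd x ^ p) \<longrightarrow> 0 \<le> fst x powr q * snd x"
        using AEz by eventually_elim simp
    qed measurable
    show "AE x in \<zeta>. 0 \<le> x" using pos by eventually_elim simp
    show "integrable \<zeta> (\<lambda>x. x ^ k)" "(\<integral>x. x ^ k \<partial>\<zeta>) = fact k / Gamma (1 + \<beta> * real k)" for k
      using moment[of k] by (auto simp: has_bochner_integral_iff)
    show "summable (\<lambda>k. l ^ k * (fact k / Gamma (1 + \<beta> * real k)) / fact k)" if "0 \<le> l" for l
      using summable_mittag_leffler[OF beta(1) that] by simp
    show "integrable ?D (\<lambda>x. x ^ k)" "(\<integral>x. x ^ k \<partial>?D) = fact k / Gamma (1 + \<beta> * real k)" for k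
      by (rule intk, rule valk)
  qed simp_all
qed

text \<open>As an equality of laws, \<open>mixture\<close> applies to every integrable
  \<open>h\<close>, in particular to kernels singular at 0. Both orders of integration are recorded:
  the Caputo integral has w outermost, the Taylor remainder has w innermost.\<close>

lemma mixture_integral:
  fixes a b c q :: real and p :: nat and h :: "real \<Rightarrow> real"
  assumes c: "0 \<le> c" "0 < a" "0 < b" "0 < q"
    and mom: "\<And>k::nat. c * Beta (a + q * real k) b * (fact (p + k) / Gamma (1 + \<beta> * real (p + k))) = fact k / Gamma (1 + \<beta> * real k)"
    and h: "integrable \<zeta> h"
  defines "f \<equiv> (\<lambda>w z. z ^ p * h (w powr q * z))"
  shows "integrable (beta_measure c a b) (\<lambda>w. \<integral>z. f w z \<partial>\<zeta>)"
    and "(\<integral>w. (\<integral>z. f w z \<partial>\<zeta>) \<partial>beta_measure c a b) = (\<integral>z. h z \<partial>\<zeta>)"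
    and "(\<integral>z. (\<integral>w. f w z \<partial>beta_measure c a b) \<partial>\<zeta>) = (\<integral>z. h z \<partial>\<zeta>)"
proof -
  let ?\<rho> = "beta_measure c a b"
  interpret \<rho>: finite_measure ?\<rho> by (rule finite_beta_measure[OF c(1-3)])
  interpret P: pair_sigma_finite ?\<rho> \<zeta> ..
  have sf: "sigma_finite_measure ?\<rho>" "sigma_finite_measure \<zeta>" by unfold_locales
  have hb[measurable]: "h \<in> borel_measurable borel" using h by (auto dest: borel_measurable_integrable)
  have nn: "AE x in ?\<rho> \<Otimes>\<^sub>M \<zeta>. 0 \<le> snd x ^ p"
  proof -
    have "AE x in ?\<rho> \<Otimes>\<^sub>M \<zeta>. 0 < snd x" by (rule AE_pair_snd[OF sf pos]) measurable
    then show ?thesis by eventually_elim simp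
  qed
  have pm: "(\<lambda>x. snd x ^ p) \<in> borel_measurable (?\<rho> \<Otimes>\<^sub>M \<zeta>)" by measurable
  have Dm: "(\<lambda>x. fst x powr q * snd x) \<in> measurable (density (?\<rho> \<Otimes>\<^sub>M \<zeta>) (\<lambda>x. ennreal (snd x ^ p))) borel" by measurable
  have hm: "(\<lambda>x. h (fst x powr q * snd x)) \<in> borel_measurable (?\<rho> \<Otimes>\<^sub>M \<zeta>)" by measurable
  note mix = mixture[OF c mom]
  let ?D = "distr (density (?\<rho> \<Otimes>\<^sub>M \<zeta>) (\<lambda>x. ennreal (snd x ^ p))) borel (\<lambda>x. fst x powr q * snd x)"
  have fm: "(\<lambda>x. case x of (w, z) \<Rightarrow> f w z) = (\<lambda>x. snd x ^ p * h (fst x powr q * snd x))"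
    by (auto simp: f_def fun_eq_iff)
  have "integrable ?D h" unfolding mix by (rule h)
  then have i: "integrable (?\<rho> \<Otimes>\<^sub>M \<zeta>) (\<lambda>x. case x of (w, z) \<Rightarrow> f w z)"
    unfolding fm integrable_distr_eq[OF Dm hb] integrable_real_density[OF pm nn hm] .
  have "(\<integral>z. h z \<partial>\<zeta>) = (\<integral>z. h z \<partial>?D)" unfolding mix ..
  also have "\<dots> = (\<integral>x. (case x of (w, z) \<Rightarrow> f w z) \<partial>(?\<rho> \<Otimes>\<^sub>M \<zeta>))"
    unfolding fm integral_distr[OF Dm hb] by (rule integral_real_density[OF pm nn hm])
  finally have v: "(\<integral>x. (case x of (w, z) \<Rightarrow> f w z) \<partial>(?\<rho> \<Otimes>\<^sub>M \<zeta>)) = (\<integral>z. h z \<partial>\<zeta>)" ..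
  show "integrable ?\<rho> (\<lambda>w. \<integral>z. f w z \<partial>\<zeta>)" using P.integrable_fst[OF i] by simp
  show "(\<integral>w. (\<integral>z. f w z \<partial>\<zeta>) \<partial>?\<rho>) = (\<integral>z. h z \<partial>\<zeta>)" using P.integral_fst[OF i] v by simp
  show "(\<integral>z. (\<integral>w. f w z \<partial>?\<rho>) \<partial>\<zeta>) = (\<integral>z. h z \<partial>\<zeta>)" using P.integral_snd[OF i] v by simp
qed

text \<open>Put a = \<beta> (k + 1). The beta function supplies \<Gamma>(a) \<Gamma>(1 - \<beta>) /
  \<Gamma>(1 + \<beta> k), the moment of order k + 1 has \<Gamma>(1 + a) = a \<Gamma>(a) in its
  denominator, and the surplus factor \<beta> (k + 1) / a is 1.\<close>

lemma caputo_moments: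
  "\<beta> / Gamma (1 - \<beta>) * Beta (\<beta> + \<beta> * real k) (1 - \<beta>) * (fact (1 + k) / Gamma (1 + \<beta> * real (1 + k))) = fact k / Gamma (1 + \<beta> * real k)"
proof -
  define a where "a = \<beta> + \<beta> * real k"
  have a: "a > 0" "\<beta> * real (1 + k) = a" "a + (1 - \<beta>) = 1 + \<beta> * real k" "a = \<beta> * real (Suc k)"
    using beta by (auto simp: a_def algebra_simps intro!: add_pos_nonneg)
  have g: "Gamma (1 - \<beta>) > 0" "Gamma a > 0"
    using beta a by (auto intro!: Gamma_real_pos)
  have "a \<notin> \<int>\<^sub>\<le>\<^sub>0" using a(1) by (auto simp: nonpos_Ints_def)
  then have G: "Gamma (1 + a) = a * Gamma a" using Gamma_plus1[of a] by (simp add: add.commute)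
  have B: "Beta a (1 - \<beta>) = Gamma a * Gamma (1 - \<beta>) / Gamma (1 + \<beta> * real k)" by (simp only: Beta_def a(3))
  have f: "fact (1 + k) = real (Suc k) * (fact k :: real)" by simp
  have "\<beta> / Gamma (1 - \<beta>) * (Gamma a * Gamma (1 - \<beta>) / Gamma (1 + \<beta> * real k)) * (real (Suc k) * fact k / (a * Gamma a))
    = (\<beta> * real (Suc k) / a) * (fact k / Gamma (1 + \<beta> * real k))"
    using g by (simp add: mult_ac)
  also have "\<beta> * real (Suc k) / a = 1" using a(1) unfolding a(4)[symmetric] by simp
  finally show ?thesis unfolding a_def[symmetric] B a(2) G f by (simp add: mult_ac)
qed

text \<open>Since \<beta> \<nu> = 1, raising the moment order by \<nu> raises the Gamma argument by
  exactly 1. The resulting factor 1 + \<beta> k = \<beta> (\<nu> + k) cancels against the quotient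
  of (\<nu> + k)! by the (\<nu> + k - 1)! of the beta function.\<close>

lemma taylor_moments:
  fixes \<nu> :: nat
  assumes \<nu>: "2 \<le> \<nu>" "\<beta> = 1 / real \<nu>"
  shows "\<beta> / Gamma (real \<nu> - 1) * Beta (1 + 1 * real k) (real \<nu> - 1) * (fact (\<nu> + k) / Gamma (1 + \<beta> * real (\<nu> + k))) = fact k / Gamma (1 + \<beta> * real k)"
proof -
  have b: "\<beta> * real (\<nu> + k) = 1 + \<beta> * real k" using \<nu> by (simp add: field_simps)
  have g: "Gamma (real \<nu> - 1) > 0" "Gamma (1 + \<beta> * real k) > 0"
    using beta \<nu> by (auto intro!: Gamma_real_pos add_pos_nonneg)
  have p: "1 + \<beta> * real k > 0" using beta by (auto intro!: add_pos_nonneg)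
  then have "1 + \<beta> * real k \<notin> \<int>\<^sub>\<le>\<^sub>0" by (auto simp: nonpos_Ints_def)
  then have G: "Gamma (1 + \<beta> * real (\<nu> + k)) = (1 + \<beta> * real k) * Gamma (1 + \<beta> * real k)"
    using Gamma_plus1[of "1 + \<beta> * real k"] b by (simp add: add.commute)
  have "Gamma (1 + real k) = fact k" by (rule Gamma_fact)
  moreover have "Gamma (1 + 1 * real k + (real \<nu> - 1)) = fact (\<nu> + k - 1)"
  proof -
    have "1 + 1 * real k + (real \<nu> - 1) = 1 + real (\<nu> + k - 1)" using \<nu> by (simp add: of_nat_diff)
    then show ?thesis using Gamma_fact[of "\<nu> + k - 1"] by metis
  qed
  ultimately have B: "Beta (1 + 1 * real k) (real \<nu> - 1) = fact k * Gamma (real \<nu> - 1) / fact (\<nu> + k - 1)"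
    by (simp add: Beta_def)
  have f: "fact (\<nu> + k) = real (\<nu> + k) * fact (\<nu> + k - 1)" using \<nu> by (subst fact_reduce) auto
  have "\<beta> / Gamma (real \<nu> - 1) * Beta (1 + 1 * real k) (real \<nu> - 1) * (fact (\<nu> + k) / Gamma (1 + \<beta> * real (\<nu> + k)))
     = (\<beta> * real (\<nu> + k)) * fact k / ((1 + \<beta> * real k) * Gamma (1 + \<beta> * real k))"
    unfolding B f G using g(1) by simp
  also have "\<dots> = fact k / Gamma (1 + \<beta> * real k)" unfolding b using p by simp
  finally show ?thesis .
qed

end

section \<open>The sheet at independent random times\<close>

lemma prod_Basis_cart:
  fixes f :: "real^'d \<Rightarrow> 'b::comm_monoid_mult"
  shows "(\<Prod>b\<in>Basis. f b) = (\<Prod>k\<in>UNIV. f (axis k 1))"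
proof -
  have B: "(Basis :: (real^'d) set) = (\<lambda>k. axis k 1) ` UNIV"
    by (auto simp: Basis_vec_def)
  have "inj (\<lambda>k. axis k 1 :: real^'d)" by (auto simp: inj_on_def axis_eq_axis)
  then show ?thesis unfolding B by (simp add: prod.reindex)
qed

text \<open>Open boxes form an intersection-stable generator, and on them both measures split into
  the same product of one-dimensional normal probabilities.\<close>

lemma (in prob_space) distr_normal_vec:
  fixes X :: "'a \<Rightarrow> real^'d"
  assumes ind: "indep_vars (\<lambda>_. borel) (\<lambda>k \<omega>. X \<omega> $ k) UNIV"
    and X [measurable]: "X \<in> borel_measurable M" and \<sigma>: "0 < \<sigma>"
    and nd: "\<And>k. distributed M lborel (\<lambda>\<omega>. X \<omega> $ k) (\<lambda>y. ennreal (normal_density 0 \<sigma> y))"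
  shows "distr M borel X = density lborel (\<lambda>z. \<Prod>b\<in>Basis. ennreal (normal_density 0 \<sigma> (z \<bullet> b)))"
    (is "_ = density lborel ?g")
proof (rule measure_eqI_generator_eq)
  let ?E = "range (\<lambda>(a, b). box a b :: (real^'d) set)"
  have g[measurable]: "?g \<in> borel_measurable borel" by measurable
  show "Int_stable ?E" by (auto simp: Int_stable_def box_Int_box)
  show "?E \<subseteq> Pow UNIV" by auto
  show "sets (distr M borel X) = sigma_sets UNIV ?E" "sets (density lborel ?g) = sigma_sets UNIV ?E"
    by (simp_all add: borel_eq_box)
  let ?A = "\<lambda>n::nat. box (- (real n *\<^sub>R One)) (real n *\<^sub>R One) :: (real^'d) set"
  show "range ?A \<subseteq> ?E" "(\<Union>i. ?A i) = UNIV" unfolding UN_box_eq_UNIV by auto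
  show "emeasure (distr M borel X) (?A i) \<noteq> \<infinity>" for i by (simp add: emeasure_distr)
  fix Y assume "Y \<in> ?E"
  then obtain a b where Y: "Y = box a b" by auto
  have ev: "X -` box a b \<inter> space M = (\<Inter>k\<in>UNIV. (\<lambda>\<omega>. X \<omega> $ k) -` {a $ k<..<b $ k} \<inter> space M)"
    by (auto simp: mem_box_cart)
  have "emeasure (distr M borel X) Y = ennreal (prob (\<Inter>k\<in>UNIV. (\<lambda>\<omega>. X \<omega> $ k) -` {a $ k<..<b $ k} \<inter> space M))"
    unfolding Y by (subst emeasure_distr) (auto simp: ev emeasure_eq_measure)
  also have "\<dots> = (\<Prod>k\<in>UNIV. ennreal (prob ((\<lambda>\<omega>. X \<omega> $ k) -` {a $ k<..<b $ k} \<inter> space M)))"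
    by (subst indep_varsD_finite[OF ind]) (auto simp: prod_ennreal)
  also have "\<dots> = (\<Prod>k\<in>UNIV. \<integral>\<^sup>+x. ennreal (normal_density 0 \<sigma> x) * indicator {a $ k<..<b $ k} x \<partial>lborel)"
    using distributed_emeasure[OF nd] by (simp add: emeasure_eq_measure)
  also have "\<dots> = (\<Prod>c\<in>(Basis::(real^'d) set). \<integral>\<^sup>+x. ennreal (normal_density 0 \<sigma> x) * indicator {a \<bullet> c<..<b \<bullet> c} x \<partial>lborel)"
    unfolding prod_Basis_cart by (simp add: cart_eq_inner_axis)
  also have "\<dots> = (\<integral>\<^sup>+z. (\<Prod>c\<in>(Basis::(real^'d) set). ennreal (normal_density 0 \<sigma> (z \<bullet> c)) * indicator {a \<bullet> c<..<b \<bullet> c} (z \<bullet> c)) \<partial>lborel)"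
    by (rule nn_integral_lborel_prod[symmetric]) auto
  also have "\<dots> = (\<integral>\<^sup>+z. ?g z * indicator Y z \<partial>lborel)"
  proof (rule nn_integral_cong)
    fix z :: "real^'d"
    have "(\<Prod>c\<in>Basis. indicator {a \<bullet> c<..<b \<bullet> c} (z \<bullet> c) :: ennreal) = indicator Y z"
      unfolding Y by (auto simp: box_def indicator_def prod.If_cases intro!: prod.neutral)
    then show "(\<Prod>c\<in>Basis. ennreal (normal_density 0 \<sigma> (z \<bullet> c)) * indicator {a \<bullet> c<..<b \<bullet> c} (z \<bullet> c)) = ?g z * indicator Y z"
      by (simp add: prod.distrib)
  qed
  also have "\<dots> = emeasure (density lborel ?g) Y"
    unfolding Y by (subst emeasure_density) auto
  finally show "emeasure (distr M borel X) Y = emeasure (density lborel ?g) Y" .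
qed

lemma (in prob_space) integral_normal_vec:
  fixes X :: "'a \<Rightarrow> real^'d" and h :: "real^'d \<Rightarrow> real"
  assumes ind: "indep_vars (\<lambda>_. borel) (\<lambda>k \<omega>. X \<omega> $ k) UNIV"
    and X [measurable]: "X \<in> borel_measurable M" and v: "0 < v"
    and nd: "\<And>k. distributed M lborel (\<lambda>\<omega>. X \<omega> $ k) (\<lambda>y. ennreal (normal_density 0 (sqrt v) y))"
    and [measurable]: "h \<in> borel_measurable borel"
  shows "(\<integral>\<omega>. h (x + X \<omega>) \<partial>M) = heat v (\<lambda>_. 1) h x"
proof -
  define s where "s = sqrt v"
  have s: "s > 0" using v by (simp add: s_def)
  define g where "g z = (\<Prod>b\<in>Basis. normal_density 0 s (z \<bullet> b))" for z :: "real^'d"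
  have [measurable]: "g \<in> borel_measurable borel" unfolding g_def[abs_def] by measurable
  have g0: "0 \<le> g z" for z unfolding g_def by (intro prod_nonneg) simp
  have gs: "s ^ DIM(real^'d) * g (s *\<^sub>R z) = gauss z" for z
  proof -
    have "normal_density 0 s (s * y) = std_normal_density y / s" for y
      using s by (simp add: normal_density_def real_sqrt_mult power_mult_distrib)
    then have "g (s *\<^sub>R z) = (\<Prod>b\<in>Basis. std_normal_density (z \<bullet> b) / s)"
      by (simp add: g_def)
    also have "\<dots> = gauss z / s ^ DIM(real^'d)" by (simp only: prod_dividef gauss_eq_prod prod_constant)
    finally show ?thesis using s by simp
  qed
  have "(\<integral>\<omega>. h (x + X \<omega>) \<partial>M) = (\<integral>z. h (x + z) \<partial>distr M borel X)" by (simp add: integral_distr)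
  also have "distr M borel X = density lborel (\<lambda>z. ennreal (g z))"
    unfolding g_def s_def by (subst distr_normal_vec[OF ind X _ nd]) (use v in \<open>auto simp: prod_ennreal\<close>)
  also have "(\<integral>z. h (x + z) \<partial>density lborel (\<lambda>z. ennreal (g z))) = (\<integral>z. g z * h (x + z) \<partial>lborel)"
    by (rule integral_real_density) (use g0 in auto)
  also have "\<dots> = s ^ DIM(real^'d) * (\<integral>z. g (s *\<^sub>R z) * h (x + s *\<^sub>R z) \<partial>lborel)"
    by (rule lborel_integral_scale) (use s in auto)
  also have "\<dots> = heat v (\<lambda>_. 1) h x"
    unfolding heat_def s_def[symmetric] gs[symmetric] integral_mult_right_zero[symmetric]
    by (simp only: mult_ac mult_1)
  finally show ?thesis .
qed

lemma borel_measurable_vec_lambda: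
  fixes f :: "'i::finite \<Rightarrow> 'a \<Rightarrow> real"
  assumes "\<And>i. f i \<in> borel_measurable M"
  shows "(\<lambda>\<omega>. \<chi> i. f i \<omega>) \<in> borel_measurable M"
  unfolding borel_measurable_euclidean_space[where 'c="real^'i"]
  using assms by (auto simp: Basis_vec_def inner_axis)

lemma borel_measurable_vec_nth:
  fixes f :: "'a \<Rightarrow> real^'i"
  assumes "f \<in> borel_measurable M"
  shows "(\<lambda>\<omega>. f \<omega> $ i) \<in> borel_measurable M"
  by (rule measurable_compose[OF assms borel_measurable_continuous_onI]) (intro continuous_on_component continuous_on_id)

lemma prod_UNIV_remove:
  fixes f :: "'i::finite \<Rightarrow> real"
  shows "(\<Prod>i\<in>UNIV. f i) = (\<Prod>i\<in>UNIV - {j}. f i) * f j"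
  by (subst prod.remove[of _ j]) auto

locale clocked_sheet = prob_space M + stable: stable_subordinator_process N L \<beta>
  for M :: "'w measure" and N :: "'v measure" and L :: "real \<Rightarrow> 'v \<Rightarrow> real" and \<beta> :: real +
  fixes W :: "real^'n \<Rightarrow> 'w \<Rightarrow> real^'d" and \<Lambda> :: "'n \<Rightarrow> real \<Rightarrow> 'w \<Rightarrow> real"
  assumes sheet: "brownian_sheet M W" and clocks: "independent_inverse_clocks N L M W \<Lambda>"
begin

lemma coordinate_normal:
  assumes s: "s \<in> nonneg_orthant"
  shows "centered_normal M (\<lambda>\<omega>. W s \<omega> $ k) (\<Prod>i\<in>UNIV. s $ i)"
proof -
  have "real_brownian_sheet M (\<lambda>t \<omega>. W t \<omega> $ k)" using sheet by (simp add: brownian_sheet_def)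
  then have "centered_normal M (\<lambda>\<omega>. \<Sum>t\<in>{s}. (\<lambda>_. 1) t * W t \<omega> $ k)
      (\<Sum>t\<in>{s}. \<Sum>r\<in>{s}. (\<lambda>_. 1) t * (\<lambda>_. 1) r * (\<Prod>i\<in>UNIV. min (t $ i) (r $ i)))"
    unfolding real_brownian_sheet_def using s by (elim conjE allE[where x="{s}"] allE[where x="\<lambda>_. 1"]) auto
  then show ?thesis by simp
qed

lemma measurable_W [measurable (raw)]:
  assumes "s \<in> nonneg_orthant"
  shows "W s \<in> borel_measurable M"
proof -
  have "(\<lambda>\<omega>. W s \<omega> $ k) \<in> borel_measurable M" for k
    using coordinate_normal[OF assms, of k] by (simp add: centered_normal_def)
  from borel_measurable_vec_lambda[of "\<lambda>k \<omega>. W s \<omega> $ k", OF this] show ?thesis by simp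
qed

text \<open>On the boundary of the orthant the sheet is 0 and the Gaussian degenerates; there
  \<open>heat 0\<close> is evaluation at x. One formula therefore serves the whole orthant, and the
  clocks need not be known to be positive.\<close>

lemma integral_W:
  fixes h :: "real^'d \<Rightarrow> real"
  assumes s: "s \<in> nonneg_orthant" and [measurable]: "h \<in> borel_measurable borel"
  shows "(\<integral>\<omega>. h (x + W s \<omega>) \<partial>M) = heat (\<Prod>i\<in>UNIV. s $ i) (\<lambda>_. 1) h x"
proof (cases "s \<in> orthant_boundary")
  case True
  then have "W s \<omega> = 0" if "\<omega> \<in> space M" for \<omega>
    using sheet that by (simp add: brownian_sheet_def real_brownian_sheet_def vec_eq_iff)
  then have "(\<integral>\<omega>. h (x + W s \<omega>) \<partial>M) = (\<integral>\<omega>. h x \<partial>M)" by (intro Bochner_Integration.integral_cong) auto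
  moreover have p0: "(\<Prod>i\<in>UNIV. s $ i) = 0" using True by (auto simp: orthant_boundary_def)
  ultimately show ?thesis unfolding p0 by (simp add: prob_space heat_0 integral_gauss)
next
  case False
  then have pos: "0 < s $ i" for i using s by (auto simp: orthant_boundary_def nonneg_orthant_def less_le)
  have v: "0 < (\<Prod>i\<in>UNIV. s $ i)" by (intro prod_pos) (use pos in auto)
  have [measurable]: "W s \<in> borel_measurable M" using s by simp
  show ?thesis
  proof (rule integral_normal_vec[OF _ _ v])
    show "distributed M lborel (\<lambda>\<omega>. W s \<omega> $ k) (\<lambda>y. ennreal (normal_density 0 (sqrt (\<Prod>i\<in>UNIV. s $ i)) y))" for k
    proof -
      have "\<not> (\<exists>a. s $ a = 0)" using pos by (metis less_irrefl)
      then show ?thesis using coordinate_normal[OF s, of k] by (simp add: centered_normal_def)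
    qed
    have "indep_sets (\<lambda>k. process_events M nonneg_orthant (\<lambda>t \<omega>. W t \<omega> $ k)) UNIV"
      using sheet by (simp add: brownian_sheet_def)
    then have "indep_sets (\<lambda>k. {(\<lambda>\<omega>. W s \<omega> $ k) -` A \<inter> space M |A. A \<in> sets borel}) UNIV"
      by (rule indep_sets_mono_sets) (use s in \<open>auto simp: process_events_def intro!: sigma_sets.Basic\<close>)
    then show "indep_vars (\<lambda>_. borel) (\<lambda>k \<omega>. W s \<omega> $ k) UNIV"
      unfolding indep_vars_def2 by (simp add: borel_measurable_vec_nth)
  qed auto
qed

section \<open>Law and independence of the clocks\<close>

lemma measurable_clock [measurable (raw)]: "0 \<le> t \<Longrightarrow> \<Lambda> i t \<in> borel_measurable M"
  using clocks by (simp add: independent_inverse_clocks_def process_copy_def)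

lemma clock_nonneg: "0 \<le> t \<Longrightarrow> \<omega> \<in> space M \<Longrightarrow> 0 \<le> \<Lambda> i t \<omega>"
  using clocks by (simp add: independent_inverse_clocks_def process_copy_def)

lemma distr_clock:
  assumes t: "0 \<le> t"
  shows "distr M borel (\<Lambda> i t) = distr N borel (\<lambda>\<omega>. t powr \<beta> * L 1 \<omega> powr (- \<beta>))"
proof -
  let ?P = "PiM {0..} (\<lambda>_. borel) :: (real \<Rightarrow> real) measure"
  have eq: "distr M ?P (\<lambda>\<omega>. \<lambda>t\<in>{0..}. \<Lambda> i t \<omega>) = distr N ?P (\<lambda>\<omega>. \<lambda>t\<in>{0..}. inverse_motion L t \<omega>)"
    using clocks by (simp add: independent_inverse_clocks_def process_copy_def)
  have 1: "(\<lambda>\<omega>. \<lambda>t\<in>{0..}. \<Lambda> i t \<omega>) \<in> measurable M ?P" by (intro measurable_restrict) simp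
  have 2: "(\<lambda>\<omega>. \<lambda>t\<in>{0..}. inverse_motion L t \<omega>) \<in> measurable N ?P" by (intro measurable_restrict) simp
  have 3: "(\<lambda>f. f t) \<in> measurable ?P borel" using t by (intro measurable_component_singleton) simp
  have "distr M borel (\<Lambda> i t) = distr (distr M ?P (\<lambda>\<omega>. \<lambda>t\<in>{0..}. \<Lambda> i t \<omega>)) borel (\<lambda>f. f t)"
    using t by (simp add: distr_distr[OF 3 1] comp_def)
  also have "\<dots> = distr N borel (inverse_motion L t)"
    unfolding eq using t by (simp add: distr_distr[OF 3 2] comp_def)
  also have "\<dots> = distr N borel (\<lambda>\<omega>. t powr \<beta> * L 1 \<omega> powr (- \<beta>))" by (rule stable.distr_inverse_motion[OF t])
  finally show ?thesis .
qed

definition zeta :: "real measure" where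
  "zeta = distr N borel (\<lambda>\<omega>. L 1 \<omega> powr (- \<beta>))"

lemma distr_clock_zeta: "0 \<le> t \<Longrightarrow> distr M borel (\<Lambda> i t) = distr zeta borel (\<lambda>z. t powr \<beta> * z)"
  unfolding distr_clock zeta_def by (subst distr_distr) (auto simp: comp_def)

sublocale zeta: inverse_stable_law zeta \<beta>
proof -
  interpret Z: prob_space zeta unfolding zeta_def by (rule stable.prob_space_distr) simp
  show "inverse_stable_law zeta \<beta>"
  proof
    show "sets zeta = sets borel" by (simp add: zeta_def)
    show "AE z in zeta. 0 < z"
      unfolding zeta_def using stable.L_pos[of _ 1] by (subst AE_distr_iff) (auto intro!: AE_I2 simp: less_le)
    show "has_bochner_integral zeta (\<lambda>z. z ^ k) (fact k / Gamma (1 + \<beta> * real k))" for k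
      unfolding zeta_def has_bochner_integral_iff using stable.inverse_nat_moment[of k]
      by (subst integrable_distr_eq integral_distr; simp add: has_bochner_integral_iff)+
    show "integrable zeta (\<lambda>z. z powr \<gamma>)" if "- 1 < \<gamma>" for \<gamma>
      unfolding zeta_def using stable.inverse_moment[OF that] by (subst integrable_distr_eq) auto
  qed (use stable.\<beta> in auto)
qed

lemma clock_moment:
  assumes t: "0 \<le> t"
  shows "has_bochner_integral M (\<lambda>\<omega>. \<Lambda> i t \<omega> ^ k) ((t powr \<beta>) ^ k * moment_const N L (real k))"
proof -
  have [measurable]: "\<Lambda> i t \<in> borel_measurable M" using t by simp
  have "has_bochner_integral N (\<lambda>\<omega>. (t powr \<beta>) ^ k * (L 1 \<omega> powr (- \<beta>)) ^ k) ((t powr \<beta>) ^ k * moment_const N L (real k))"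
    unfolding stable.moment_const_nat using stable.inverse_nat_moment[of k]
    by (intro has_bochner_integral_mult_right) (simp add: has_bochner_integral_iff)
  then have "has_bochner_integral (distr N borel (\<lambda>\<omega>. t powr \<beta> * L 1 \<omega> powr (- \<beta>))) (\<lambda>y. y ^ k) ((t powr \<beta>) ^ k * moment_const N L (real k))"
    by (simp add: has_bochner_integral_iff integrable_distr_eq integral_distr power_mult_distrib)
  then show ?thesis unfolding distr_clock[OF t, symmetric, of i]
    by (simp add: has_bochner_integral_iff integrable_distr_eq integral_distr)
qed

lemma clock_AE_pos:
  assumes t: "0 < t"
  shows "AE \<omega> in M. 0 < \<Lambda> i t \<omega>"
proof -
  have [measurable]: "\<Lambda> i t \<in> borel_measurable M" using t by simp
  have "AE y in distr N borel (\<lambda>\<omega>. t powr \<beta> * L 1 \<omega> powr (- \<beta>)). 0 < y"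
    using t stable.L_pos[of _ 1] by (subst AE_distr_iff) (auto intro!: AE_I2 simp: less_le)
  then show ?thesis unfolding distr_clock[OF less_imp_le[OF t], symmetric, of i]
    by (subst (asm) AE_distr_iff) auto
qed

text \<open>The sheet enters only through the real variable \<open>h (W s \<omega>)\<close> at a
  fixed time, which lets it join the real-valued clocks in a single family of independent
  variables.\<close>

lemma indep_clocks_and_sheet:
  fixes h :: "real^'d \<Rightarrow> real"
  assumes t: "t \<in> nonneg_orthant" and s: "s \<in> nonneg_orthant" and [measurable]: "h \<in> borel_measurable borel"
  shows "indep_vars (\<lambda>_. borel) (case_option (\<lambda>\<omega>. h (W s \<omega>)) (\<lambda>i. \<Lambda> i (t $ i))) UNIV"
  unfolding indep_vars_def2
proof (intro conjI ballI)
  have tn: "0 \<le> t $ i" for i using t by (simp add: nonneg_orthant_def)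
  have [measurable]: "W s \<in> borel_measurable M" using s by simp
  show "(case i of None \<Rightarrow> \<lambda>\<omega>. h (W s \<omega>) | Some i \<Rightarrow> \<Lambda> i (t $ i)) \<in> borel_measurable M" for i
    using tn by (cases i) auto
  have "indep_sets (case_option (process_events M nonneg_orthant W) (\<lambda>i. process_events M {0..} (\<Lambda> i))) UNIV"
    using clocks by (simp add: independent_inverse_clocks_def)
  then show "indep_sets (\<lambda>i. {(case i of None \<Rightarrow> \<lambda>\<omega>. h (W s \<omega>) | Some i \<Rightarrow> \<Lambda> i (t $ i)) -` A \<inter> space M |A. A \<in> sets borel}) UNIV"
  proof (rule indep_sets_mono_sets)
    fix i :: "'n option"
    show "{(case i of None \<Rightarrow> \<lambda>\<omega>. h (W s \<omega>) | Some i \<Rightarrow> \<Lambda> i (t $ i)) -` A \<inter> space M |A. A \<in> sets borel}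
       \<subseteq> (case i of None \<Rightarrow> process_events M nonneg_orthant W | Some i \<Rightarrow> process_events M {0..} (\<Lambda> i))"
    proof (cases i)
      case None
      have "(\<lambda>\<omega>. h (W s \<omega>)) -` A \<inter> space M \<in> process_events M nonneg_orthant W" if "A \<in> sets borel" for A
      proof -
        have "h -` A \<in> sets borel" using measurable_sets[OF \<open>h \<in> borel_measurable borel\<close> that] by simp
        moreover have "(\<lambda>\<omega>. h (W s \<omega>)) -` A \<inter> space M = W s -` (h -` A) \<inter> space M" by auto
        ultimately show ?thesis unfolding process_events_def using s by (intro sigma_sets.Basic) blast
      qed
      then show ?thesis using None by auto
    next
      case (Some k)
      then show ?thesis using tn by (auto simp: process_events_def intro!: sigma_sets.Basic)
    qed
  qed
qed

lemma indep_clocks: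
  assumes t: "t \<in> nonneg_orthant"
  shows "indep_vars (\<lambda>_. borel) (\<lambda>i. \<Lambda> i (t $ i)) UNIV"
proof -
  have tn: "0 \<le> t $ i" for i using t by (simp add: nonneg_orthant_def)
  have "indep_sets (case_option (process_events M nonneg_orthant W) (\<lambda>i. process_events M {0..} (\<Lambda> i))) UNIV"
    using clocks by (simp add: independent_inverse_clocks_def)
  then have "indep_sets (\<lambda>i. process_events M {0..} (\<Lambda> i)) UNIV"
  proof -
    assume i: "indep_sets (case_option (process_events M nonneg_orthant W) (\<lambda>i. process_events M {0..} (\<Lambda> i))) UNIV"
    show ?thesis
    proof (rule indep_setsI)
      show "process_events M {0..} (\<Lambda> i) \<subseteq> events" for i
        using i unfolding indep_sets_def by (metis UNIV_I option.simps(5))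
      fix A and J :: "'n set" assume J: "J \<noteq> {}" "J \<subseteq> UNIV" "finite J" "\<forall>j\<in>J. A j \<in> process_events M {0..} (\<Lambda> j)"
      have "prob (\<Inter>j\<in>Some ` J. case_option (space M) A j) = (\<Prod>j\<in>Some ` J. prob (case_option (space M) A j))"
        by (rule indep_setsD[OF i]) (use J in auto)
      then show "prob (\<Inter>j\<in>J. A j) = (\<Prod>j\<in>J. prob (A j))" by (simp add: prod.reindex)
    qed
  qed
  then have "indep_sets (\<lambda>i. {\<Lambda> i (t $ i) -` A \<inter> space M |A. A \<in> sets borel}) UNIV"
    by (rule indep_sets_mono_sets) (use tn in \<open>auto simp: process_events_def intro!: sigma_sets.Basic\<close>)
  then show ?thesis unfolding indep_vars_def2 using tn by auto
qed

text \<open>Independence is applied to clocks with finitely many values; the continuity of the paths and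
  of \<open>h\<close> carries the identity over to the limit.\<close>

lemma integral_time_changed:
  fixes a :: "real^'n \<Rightarrow> real" and h :: "real^'d \<Rightarrow> real"
  assumes t: "t \<in> nonneg_orthant" and a [measurable]: "a \<in> borel_measurable borel"
  defines "\<tau> \<equiv> \<lambda>\<omega>. \<chi> i. \<Lambda> i (t $ i) \<omega>"
  assumes ai: "integrable M (\<lambda>\<omega>. a (\<tau> \<omega>))"
    and h: "continuous_on UNIV h" "\<And>y. \<bar>h y\<bar> \<le> K"
  shows "integrable M (\<lambda>\<omega>. a (\<tau> \<omega>) * h (time_changed_sheet W \<Lambda> x t \<omega>))"
    and "(\<integral>\<omega>. a (\<tau> \<omega>) * h (time_changed_sheet W \<Lambda> x t \<omega>) \<partial>M) =
         (\<integral>\<omega>. a (\<tau> \<omega>) * heat (\<Prod>i\<in>UNIV. \<tau> \<omega> $ i) (\<lambda>_. 1) h x \<partial>M)"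
proof -
  have tn: "0 \<le> t $ i" for i using t by (simp add: nonneg_orthant_def)
  have hm[measurable]: "h \<in> borel_measurable borel" using h(1) by (rule borel_measurable_continuous_onI)
  have K: "0 \<le> K" using h(2)[of 0] by simp
  have \<tau>m[measurable]: "\<tau> \<in> borel_measurable M"
    unfolding \<tau>_def by (rule borel_measurable_vec_lambda) (use tn in simp)
  have \<tau>n: "\<tau> \<omega> \<in> nonneg_orthant" if "\<omega> \<in> space M" for \<omega>
    using clock_nonneg[OF tn that] by (simp add: \<tau>_def nonneg_orthant_def)
  define \<phi> where "\<phi> r = heat r (\<lambda>_. 1) h x" for r
  have \<phi>c: "continuous_on UNIV \<phi>" unfolding \<phi>_def by (rule heat_continuous_on[OF h]) simp
  have \<phi>m[measurable]: "\<phi> \<in> borel_measurable borel" using \<phi>c by (rule borel_measurable_continuous_onI)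
  have \<phi>b: "\<bar>\<phi> r\<bar> \<le> K" for r unfolding \<phi>_def by (rule heat_1_bound[OF hm h(2)])
  have "\<exists>F. (\<forall>i. simple_function borel (F i)) \<and> (\<forall>v\<in>space borel. (\<lambda>i. F i v) \<longlonglongrightarrow> v) \<and>
      (\<forall>i. \<forall>v\<in>space borel. dist (F i v) 0 \<le> 2 * dist v (0 :: real^'n))"
    by (rule borel_measurable_implies_sequence_metric) simp
  then obtain F :: "nat \<Rightarrow> real^'n \<Rightarrow> real^'n" where F: "\<And>m. simple_function borel (F m)" "\<And>v. (\<lambda>m. F m v) \<longlonglongrightarrow> v"
    by auto
  \<comment> \<open>The simple functions \<open>F m\<close> may leave the orthant, where nothing is
    known about the sheet, so they are clipped coordinatewise at 0.\<close>
  define \<sigma> where "\<sigma> m v = (\<chi> i. max 0 (F m v $ i))" for m v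
  have fin: "finite (range (\<sigma> m))" for m
  proof -
    have "finite (range (F m))" using simple_functionD(1)[OF F(1)[of m]] by simp
    moreover have "range (\<sigma> m) = (\<lambda>y. \<chi> i. max 0 (y $ i)) ` range (F m)" by (auto simp: \<sigma>_def)
    ultimately show ?thesis by simp
  qed
  have \<sigma>m[measurable]: "\<sigma> m \<in> borel_measurable borel" for m
  proof -
    have [measurable]: "F m \<in> borel_measurable borel" by (rule borel_measurable_simple_function[OF F(1)])
    show ?thesis unfolding \<sigma>_def[abs_def]
      by (intro borel_measurable_vec_lambda borel_measurable_max borel_measurable_const borel_measurable_vec_nth) fact
  qed
  have \<sigma>n: "\<sigma> m v \<in> nonneg_orthant" for m v by (simp add: \<sigma>_def nonneg_orthant_def)
  have \<sigma>lim: "(\<lambda>m. \<sigma> m v) \<longlonglongrightarrow> v" if "v \<in> nonneg_orthant" for v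
  proof (rule vec_tendstoI)
    fix i
    have "(\<lambda>m. max 0 (F m v $ i)) \<longlonglongrightarrow> max 0 (v $ i)" by (intro tendsto_intros F(2))
    then show "(\<lambda>m. \<sigma> m v $ i) \<longlonglongrightarrow> v $ i" using that by (simp add: \<sigma>_def nonneg_orthant_def max_def)
  qed
  \<comment> \<open>The weight \<open>a\<close> cut down to the event that the discretised clock
    equals q. Summing over the finitely many q replaces the random time in the sheet by fixed
    times.\<close>
  define e where "e m q v = of_bool (\<sigma> m v = q) * a v" for m q v
  have em[measurable]: "e m q \<in> borel_measurable borel" for m q
  proof -
    have "Measurable.pred borel (\<lambda>v. \<sigma> m v = q)" by measurable
    then show ?thesis unfolding e_def[abs_def] by measurable
  qed
  have ei: "integrable M (\<lambda>\<omega>. e m q (\<tau> \<omega>))" for m q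
    by (rule Bochner_Integration.integrable_bound[OF ai]) (auto simp: e_def)
  have sum_e: "(\<Sum>q\<in>range (\<sigma> m). e m q v * y q) = a v * y (\<sigma> m v)" for m v and y :: "real^'n \<Rightarrow> real"
  proof -
    have "(\<Sum>q\<in>range (\<sigma> m). e m q v * y q) = (\<Sum>q\<in>range (\<sigma> m). if q = \<sigma> m v then a v * y q else 0)"
      by (intro sum.cong) (auto simp: e_def)
    also have "\<dots> = a v * y (\<sigma> m v)" using fin[of m] by (subst sum.delta) auto
    finally show ?thesis .
  qed
  have hi: "integrable M (\<lambda>\<omega>. h (x + W q \<omega>))" if "q \<in> nonneg_orthant" for q
  proof (rule integrable_const_bound[where B=K])
    have [measurable]: "W q \<in> borel_measurable M" using that by simp
    show "(\<lambda>\<omega>. h (x + W q \<omega>)) \<in> borel_measurable M" by measurable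
  qed (use h in auto)
  \<comment> \<open>At a fixed time q the clocks are independent of \<open>W q\<close>, so the
    expectation factors and the Gaussian average takes the place of \<open>h\<close>.\<close>
  have prod_q: "integrable M (\<lambda>\<omega>. e m q (\<tau> \<omega>) * h (x + W q \<omega>))"
      "(\<integral>\<omega>. e m q (\<tau> \<omega>) * h (x + W q \<omega>) \<partial>M) = (\<integral>\<omega>. e m q (\<tau> \<omega>) * \<phi> (\<Prod>i\<in>UNIV. q $ i) \<partial>M)"
    if q: "q \<in> nonneg_orthant" for m q
  proof -
    let ?Y = "case_option (\<lambda>\<omega>. h (x + W q \<omega>)) (\<lambda>i. \<Lambda> i (t $ i))"
    have "indep_vars (\<lambda>_. borel) ?Y UNIV"
      using indep_clocks_and_sheet[OF t q, of "\<lambda>y. h (x + y)"] by simp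
    from indep_var_restrict[OF this, of "range Some" "{None}"]
    have "indep_var (PiM (range Some) (\<lambda>_. borel)) (\<lambda>\<omega>. \<lambda>i\<in>range Some. ?Y i \<omega>) (PiM {None} (\<lambda>_. borel)) (\<lambda>\<omega>. \<lambda>i\<in>{None}. ?Y i \<omega>)"
      by auto
    moreover have "(\<lambda>f. e m q (\<chi> i. f (Some i))) \<in> borel_measurable (PiM (range Some) (\<lambda>_. borel))"
    proof -
      have [measurable]: "(\<lambda>f. \<chi> i. (f (Some i) :: real)) \<in> borel_measurable (PiM (range Some) (\<lambda>_::'n option. borel))"
        by (rule borel_measurable_vec_lambda) (rule measurable_component_singleton, simp)
      show ?thesis by measurable
    qed
    moreover have "(\<lambda>f. f None) \<in> borel_measurable (PiM {None :: 'n option} (\<lambda>_. borel :: real measure))"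
      by (rule measurable_component_singleton) simp
    ultimately have "indep_var borel ((\<lambda>f. e m q (\<chi> i. f (Some i))) \<circ> (\<lambda>\<omega>. \<lambda>i\<in>range Some. ?Y i \<omega>))
        borel ((\<lambda>f. f None) \<circ> (\<lambda>\<omega>. \<lambda>i\<in>{None}. ?Y i \<omega>))"
      by (rule indep_var_compose)
    then have iv: "indep_var borel (\<lambda>\<omega>. e m q (\<tau> \<omega>)) borel (\<lambda>\<omega>. h (x + W q \<omega>))"
      by (simp add: comp_def \<tau>_def)
    show "integrable M (\<lambda>\<omega>. e m q (\<tau> \<omega>) * h (x + W q \<omega>))"
      by (rule indep_var_integrable[OF iv ei hi[OF q]])
    have "(\<integral>\<omega>. e m q (\<tau> \<omega>) * h (x + W q \<omega>) \<partial>M) = (\<integral>\<omega>. e m q (\<tau> \<omega>) \<partial>M) * (\<integral>\<omega>. h (x + W q \<omega>) \<partial>M)"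
      by (rule indep_var_lebesgue_integral[OF iv ei hi[OF q]])
    then show "(\<integral>\<omega>. e m q (\<tau> \<omega>) * h (x + W q \<omega>) \<partial>M) = (\<integral>\<omega>. e m q (\<tau> \<omega>) * \<phi> (\<Prod>i\<in>UNIV. q $ i) \<partial>M)"
      unfolding integral_W[OF q hm] \<phi>_def by simp
  qed
  have rn: "q \<in> nonneg_orthant" if "q \<in> range (\<sigma> m)" for q m using that \<sigma>n by auto
  have step: "(\<integral>\<omega>. a (\<tau> \<omega>) * h (x + W (\<sigma> m (\<tau> \<omega>)) \<omega>) \<partial>M) = (\<integral>\<omega>. a (\<tau> \<omega>) * \<phi> (\<Prod>i\<in>UNIV. \<sigma> m (\<tau> \<omega>) $ i) \<partial>M)"
    and step_m: "(\<lambda>\<omega>. a (\<tau> \<omega>) * h (x + W (\<sigma> m (\<tau> \<omega>)) \<omega>)) \<in> borel_measurable M" for m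
  proof -
    have 1: "a (\<tau> \<omega>) * h (x + W (\<sigma> m (\<tau> \<omega>)) \<omega>) = (\<Sum>q\<in>range (\<sigma> m). e m q (\<tau> \<omega>) * h (x + W q \<omega>))" for \<omega>
      unfolding sum_e[of m "\<tau> \<omega>" "\<lambda>q. h (x + W q \<omega>)"] ..
    have 2: "a (\<tau> \<omega>) * \<phi> (\<Prod>i\<in>UNIV. \<sigma> m (\<tau> \<omega>) $ i) = (\<Sum>q\<in>range (\<sigma> m). e m q (\<tau> \<omega>) * \<phi> (\<Prod>i\<in>UNIV. q $ i))" for \<omega>
      unfolding sum_e[of m "\<tau> \<omega>" "\<lambda>q. \<phi> (\<Prod>i\<in>UNIV. q $ i)"] ..
    show "(\<integral>\<omega>. a (\<tau> \<omega>) * h (x + W (\<sigma> m (\<tau> \<omega>)) \<omega>) \<partial>M) = (\<integral>\<omega>. a (\<tau> \<omega>) * \<phi> (\<Prod>i\<in>UNIV. \<sigma> m (\<tau> \<omega>) $ i) \<partial>M)"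
      unfolding 1 2
    proof (subst (1 2) Bochner_Integration.integral_sum)
      show "(\<Sum>q\<in>range (\<sigma> m). \<integral>\<omega>. e m q (\<tau> \<omega>) * h (x + W q \<omega>) \<partial>M) = (\<Sum>q\<in>range (\<sigma> m). \<integral>\<omega>. e m q (\<tau> \<omega>) * \<phi> (\<Prod>i\<in>UNIV. q $ i) \<partial>M)"
        by (intro sum.cong refl prod_q(2) rn)
    qed (use prod_q(1) rn ei in auto)
    show "(\<lambda>\<omega>. a (\<tau> \<omega>) * h (x + W (\<sigma> m (\<tau> \<omega>)) \<omega>)) \<in> borel_measurable M"
      unfolding 1 by (intro borel_measurable_sum borel_measurable_integrable prod_q(1) rn)
  qed
  have lim: "(\<lambda>m. a (\<tau> \<omega>) * h (x + W (\<sigma> m (\<tau> \<omega>)) \<omega>)) \<longlonglongrightarrow> a (\<tau> \<omega>) * h (time_changed_sheet W \<Lambda> x t \<omega>)"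
    if \<omega>: "\<omega> \<in> space M" for \<omega>
  proof -
    have "continuous_on nonneg_orthant (\<lambda>s. W s \<omega> $ k)" for k
      using sheet \<omega> by (simp add: brownian_sheet_def real_brownian_sheet_def)
    then have wc: "continuous_on nonneg_orthant (\<lambda>s. W s \<omega>)"
      by (simp add: continuous_on_vec_lambda continuous_on_def vec_tendstoI)
    have "(\<lambda>m. W (\<sigma> m (\<tau> \<omega>)) \<omega>) \<longlonglongrightarrow> W (\<tau> \<omega>) \<omega>"
      by (rule continuous_on_tendsto_compose[OF wc \<sigma>lim[OF \<tau>n[OF \<omega>]] \<tau>n[OF \<omega>]]) (simp add: \<sigma>n)
    then have "(\<lambda>m. h (x + W (\<sigma> m (\<tau> \<omega>)) \<omega>)) \<longlonglongrightarrow> h (x + W (\<tau> \<omega>) \<omega>)"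
      by (intro continuous_on_tendsto_compose[OF h(1)] tendsto_intros) auto
    then show ?thesis by (intro tendsto_intros) (simp add: time_changed_sheet_def \<tau>_def)
  qed
  \<comment> \<open>Measurability of the sheet at the random time comes from the limit of the
    discretised sums; no joint measurability of the sheet in time and chance is assumed.\<close>
  have lim_m: "(\<lambda>\<omega>. a (\<tau> \<omega>) * h (time_changed_sheet W \<Lambda> x t \<omega>)) \<in> borel_measurable M"
    by (rule borel_measurable_LIMSEQ_real[OF lim step_m])
  have ab: "integrable M (\<lambda>\<omega>. K * \<bar>a (\<tau> \<omega>)\<bar>)" using ai by auto
  show int: "integrable M (\<lambda>\<omega>. a (\<tau> \<omega>) * h (time_changed_sheet W \<Lambda> x t \<omega>))"
    by (rule Bochner_Integration.integrable_bound[OF ab lim_m])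
       (use h K in \<open>auto simp: abs_mult mult.commute[of K] intro!: mult_left_mono\<close>)
  have L1: "(\<lambda>m. \<integral>\<omega>. a (\<tau> \<omega>) * h (x + W (\<sigma> m (\<tau> \<omega>)) \<omega>) \<partial>M) \<longlonglongrightarrow> (\<integral>\<omega>. a (\<tau> \<omega>) * h (time_changed_sheet W \<Lambda> x t \<omega>) \<partial>M)"
    by (rule integral_dominated_convergence[OF lim_m step_m ab])
       (use lim h K in \<open>auto simp: abs_mult mult.commute[of K] intro!: mult_left_mono\<close>)
  have pm: "(\<lambda>\<omega>. a (\<tau> \<omega>) * \<phi> (\<Prod>i\<in>UNIV. v \<omega> $ i)) \<in> borel_measurable M" if [measurable]: "v \<in> borel_measurable M" for v
  proof -
    have [measurable]: "(\<lambda>\<omega>. v \<omega> $ i) \<in> borel_measurable M" for i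
      using that by (rule borel_measurable_vec_nth)
    show ?thesis by measurable
  qed
  have L2: "(\<lambda>m. \<integral>\<omega>. a (\<tau> \<omega>) * \<phi> (\<Prod>i\<in>UNIV. \<sigma> m (\<tau> \<omega>) $ i) \<partial>M) \<longlonglongrightarrow> (\<integral>\<omega>. a (\<tau> \<omega>) * \<phi> (\<Prod>i\<in>UNIV. \<tau> \<omega> $ i) \<partial>M)"
  proof (rule integral_dominated_convergence[OF _ _ ab])
    show "AE \<omega> in M. (\<lambda>m. a (\<tau> \<omega>) * \<phi> (\<Prod>i\<in>UNIV. \<sigma> m (\<tau> \<omega>) $ i)) \<longlonglongrightarrow> a (\<tau> \<omega>) * \<phi> (\<Prod>i\<in>UNIV. \<tau> \<omega> $ i)"
    proof (rule AE_I2)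
      fix \<omega> assume \<omega>: "\<omega> \<in> space M"
      have "(\<lambda>m. \<Prod>i\<in>UNIV. \<sigma> m (\<tau> \<omega>) $ i) \<longlonglongrightarrow> (\<Prod>i\<in>UNIV. \<tau> \<omega> $ i)"
        by (intro tendsto_prod tendsto_vec_nth \<sigma>lim \<tau>n \<omega>)
      then show "(\<lambda>m. a (\<tau> \<omega>) * \<phi> (\<Prod>i\<in>UNIV. \<sigma> m (\<tau> \<omega>) $ i)) \<longlonglongrightarrow> a (\<tau> \<omega>) * \<phi> (\<Prod>i\<in>UNIV. \<tau> \<omega> $ i)"
        by (intro tendsto_mult_left continuous_on_tendsto_compose[OF \<phi>c]) auto
    qed
    show "AE \<omega> in M. norm (a (\<tau> \<omega>) * \<phi> (\<Prod>i\<in>UNIV. \<sigma> m (\<tau> \<omega>) $ i)) \<le> K * \<bar>a (\<tau> \<omega>)\<bar>" for m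
      using \<phi>b by (auto simp: abs_mult mult.commute[of K] intro!: mult_left_mono)
    show "(\<lambda>\<omega>. a (\<tau> \<omega>) * \<phi> (\<Prod>i\<in>UNIV. \<tau> \<omega> $ i)) \<in> borel_measurable M" by (rule pm[OF \<tau>m])
    show "(\<lambda>\<omega>. a (\<tau> \<omega>) * \<phi> (\<Prod>i\<in>UNIV. \<sigma> m (\<tau> \<omega>) $ i)) \<in> borel_measurable M" for m
      by (rule pm[of "\<lambda>\<omega>. \<sigma> m (\<tau> \<omega>)"]) measurable
  qed
  show "(\<integral>\<omega>. a (\<tau> \<omega>) * h (time_changed_sheet W \<Lambda> x t \<omega>) \<partial>M) =
         (\<integral>\<omega>. a (\<tau> \<omega>) * heat (\<Prod>i\<in>UNIV. \<tau> \<omega> $ i) (\<lambda>_. 1) h x \<partial>M)"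
    using LIMSEQ_unique[OF L1 L2[folded step]] unfolding \<phi>_def .
qed

lemma other_clocks_moment:
  assumes t: "t \<in> nonneg_orthant"
  shows "has_bochner_integral M (\<lambda>\<omega>. other_clocks \<Lambda> j t \<omega> ^ k)
    (\<Prod>i\<in>UNIV - {j}. (t $ i powr \<beta>) ^ k * moment_const N L (real k))"
proof -
  have tn: "0 \<le> t $ i" for i using t by (simp add: nonneg_orthant_def)
  have iv: "indep_vars (\<lambda>_. borel) (\<lambda>i \<omega>. \<Lambda> i (t $ i) \<omega> ^ k) (UNIV - {j})"
    by (rule indep_vars_compose2[where M'="\<lambda>_. borel" and X="\<lambda>i. \<Lambda> i (t $ i)" and Y="\<lambda>_ y. y ^ k"])
       (use indep_vars_subset[OF indep_clocks[OF t]] in auto)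
  have m: "integrable M (\<lambda>\<omega>. \<Lambda> i (t $ i) \<omega> ^ k)" "(\<integral>\<omega>. \<Lambda> i (t $ i) \<omega> ^ k \<partial>M) = (t $ i powr \<beta>) ^ k * moment_const N L (real k)" for i
    using clock_moment[OF tn, of i i k] by (auto simp: has_bochner_integral_iff)
  show ?thesis
    unfolding has_bochner_integral_iff other_clocks_def prod_power_distrib
    using indep_vars_integrable[OF _ iv m(1)] indep_vars_lebesgue_integral[OF _ iv m(1)]
    by (simp add: m(2))
qed

lemma indep_other_clocks:
  assumes t: "t \<in> nonneg_orthant"
  shows "indep_var borel (other_clocks \<Lambda> j t) borel (\<Lambda> j (t $ j))"
proof -
  have "indep_var (PiM (UNIV - {j}) (\<lambda>_. borel)) (\<lambda>\<omega>. \<lambda>i\<in>UNIV - {j}. \<Lambda> i (t $ i) \<omega>) (PiM {j} (\<lambda>_. borel)) (\<lambda>\<omega>. \<lambda>i\<in>{j}. \<Lambda> i (t $ i) \<omega>)"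
    by (rule indep_var_restrict[OF indep_clocks[OF t]]) auto
  then have "indep_var borel ((\<lambda>f. \<Prod>i\<in>UNIV - {j}. f i) \<circ> (\<lambda>\<omega>. \<lambda>i\<in>UNIV - {j}. \<Lambda> i (t $ i) \<omega>))
      borel ((\<lambda>f. f j) \<circ> (\<lambda>\<omega>. \<lambda>i\<in>{j}. \<Lambda> i (t $ i) \<omega>))"
    by (rule indep_var_compose) measurable
  then show ?thesis by (simp add: comp_def other_clocks_def[abs_def])
qed

lemma measurable_other_clocks:
  "t \<in> nonneg_orthant \<Longrightarrow> other_clocks \<Lambda> j t \<in> borel_measurable M"
  using indep_other_clocks[of t j] unfolding indep_var_distribution_eq by blast

definition alpha :: "'n \<Rightarrow> real^'n \<Rightarrow> real measure" where
  "alpha j t = distr M borel (other_clocks \<Lambda> j t)"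

text \<open>Scaling the j-th clock to \<open>zeta\<close> moves the coordinate \<open>t $ j\<close>
  out of the measure into the integrand. Differentiation in that coordinate then takes place under a
  fixed product measure.\<close>

lemma integral_pair_law:
  fixes F :: "real \<Rightarrow> real \<Rightarrow> real"
  assumes t: "t \<in> nonneg_orthant" and F [measurable]: "case_prod F \<in> borel_measurable (borel \<Otimes>\<^sub>M borel)"
  shows "(\<integral>\<omega>. F (other_clocks \<Lambda> j t \<omega>) (\<Lambda> j (t $ j) \<omega>) \<partial>M) =
    (\<integral>p. F (fst p) ((t $ j) powr \<beta> * snd p) \<partial>(alpha j t \<Otimes>\<^sub>M zeta))"
proof -
  have tj: "0 \<le> t $ j" using t by (simp add: nonneg_orthant_def)
  have [measurable]: "other_clocks \<Lambda> j t \<in> borel_measurable M" "\<Lambda> j (t $ j) \<in> borel_measurable M"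
    using measurable_other_clocks[OF t] tj by auto
  interpret A: prob_space "alpha j t" unfolding alpha_def by (rule prob_space_distr) simp
  interpret P: pair_prob_space "alpha j t" zeta ..
  let ?c = "(t $ j) powr \<beta>"
  have s: "sets (alpha j t) = sets borel" by (simp add: alpha_def)
  have d1: "distr M (borel \<Otimes>\<^sub>M borel) (\<lambda>\<omega>. (other_clocks \<Lambda> j t \<omega>, \<Lambda> j (t $ j) \<omega>)) = alpha j t \<Otimes>\<^sub>M distr zeta borel ((*) ?c)"
    using indep_other_clocks[OF t, of j] distr_clock_zeta[OF tj, of j]
    unfolding indep_var_distribution_eq alpha_def by simp
  have d2: "distr (alpha j t) borel (\<lambda>x. x) \<Otimes>\<^sub>M distr zeta borel ((*) ?c) = distr (alpha j t \<Otimes>\<^sub>M zeta) (borel \<Otimes>\<^sub>M borel) (\<lambda>(x, y). (x, ?c * y))"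
  proof (rule pair_measure_distr)
    interpret D: prob_space "distr zeta borel ((*) ?c)" by (rule zeta.prob_space_distr) simp
    show "sigma_finite_measure (distr zeta borel ((*) ?c))" by unfold_locales
  qed (auto simp: s measurable_cong_sets[OF s refl])
  have d3: "distr (alpha j t) borel (\<lambda>x. x) = alpha j t" by (rule distr_id2) (simp add: s)
  have m: "(\<lambda>(x, y). (x, ?c * y)) \<in> measurable (alpha j t \<Otimes>\<^sub>M zeta) (borel \<Otimes>\<^sub>M borel)"
    unfolding measurable_cong_sets[OF sets_pair_measure_cong[OF s zeta.sets_zeta] refl] by measurable
  have "(\<integral>\<omega>. F (other_clocks \<Lambda> j t \<omega>) (\<Lambda> j (t $ j) \<omega>) \<partial>M) = (\<integral>p. case_prod F p \<partial>distr M (borel \<Otimes>\<^sub>M borel) (\<lambda>\<omega>. (other_clocks \<Lambda> j t \<omega>, \<Lambda> j (t $ j) \<omega>)))"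
    by (subst integral_distr) auto
  also have "\<dots> = (\<integral>p. case_prod F p \<partial>distr (alpha j t \<Otimes>\<^sub>M zeta) (borel \<Otimes>\<^sub>M borel) (\<lambda>(x, y). (x, ?c * y)))"
    unfolding d1 d2[unfolded d3] ..
  also have "\<dots> = (\<integral>p. F (fst p) (?c * snd p) \<partial>(alpha j t \<Otimes>\<^sub>M zeta))"
    by (subst integral_distr[OF m F]) (simp add: case_prod_beta)
  finally show ?thesis .
qed

lemma sheet_functional:
  fixes h :: "real^'d \<Rightarrow> real"
  assumes t: "t \<in> nonneg_orthant" and h: "continuous_on UNIV h" "\<And>y. \<bar>h y\<bar> \<le> K"
  shows "integrable M (\<lambda>\<omega>. other_clocks \<Lambda> j t \<omega> ^ k * h (time_changed_sheet W \<Lambda> x t \<omega>))"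
    and "(\<integral>\<omega>. other_clocks \<Lambda> j t \<omega> ^ k * h (time_changed_sheet W \<Lambda> x t \<omega>) \<partial>M) =
      (\<integral>p. fst p ^ k * heat (fst p * ((t $ j) powr \<beta> * snd p)) (\<lambda>_. 1) h x \<partial>(alpha j t \<Otimes>\<^sub>M zeta))"
proof -
  let ?a = "\<lambda>v :: real^'n. (\<Prod>i\<in>UNIV - {j}. v $ i) ^ k"
  have am: "?a \<in> borel_measurable borel"
    by (intro borel_measurable_continuous_onI continuous_intros)
  have ae: "?a (\<chi> i. \<Lambda> i (t $ i) \<omega>) = other_clocks \<Lambda> j t \<omega> ^ k" for \<omega> by (simp add: other_clocks_def)
  have ai: "integrable M (\<lambda>\<omega>. ?a (\<chi> i. \<Lambda> i (t $ i) \<omega>))"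
    unfolding ae using other_clocks_moment[OF t, of j k] by (simp add: has_bochner_integral_iff)
  note T = integral_time_changed[OF t am ai h, of x, unfolded ae]
  show "integrable M (\<lambda>\<omega>. other_clocks \<Lambda> j t \<omega> ^ k * h (time_changed_sheet W \<Lambda> x t \<omega>))" by (rule T(1))
  have hm: "(\<lambda>r. heat r (\<lambda>_. 1) h x) \<in> borel_measurable borel"
    by (intro borel_measurable_continuous_onI heat_continuous_on[OF h]) simp
  have "(\<integral>\<omega>. other_clocks \<Lambda> j t \<omega> ^ k * h (time_changed_sheet W \<Lambda> x t \<omega>) \<partial>M) =
    (\<integral>\<omega>. other_clocks \<Lambda> j t \<omega> ^ k * heat (other_clocks \<Lambda> j t \<omega> * \<Lambda> j (t $ j) \<omega>) (\<lambda>_. 1) h x \<partial>M)"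
  proof -
    have "(\<Prod>i\<in>UNIV. (\<chi> i. \<Lambda> i (t $ i) \<omega>) $ i) = other_clocks \<Lambda> j t \<omega> * \<Lambda> j (t $ j) \<omega>" for \<omega>
      by (subst prod_UNIV_remove[of _ j]) (simp add: other_clocks_def)
    then show ?thesis unfolding T(2) by simp
  qed
  also have "\<dots> = (\<integral>p. fst p ^ k * heat (fst p * ((t $ j) powr \<beta> * snd p)) (\<lambda>_. 1) h x \<partial>(alpha j t \<Otimes>\<^sub>M zeta))"
  proof (rule integral_pair_law[OF t])
    have [measurable]: "(\<lambda>r. heat r (\<lambda>_. 1) h x) \<in> borel_measurable borel" by (rule hm)
    show "(\<lambda>(a, r). a ^ k * heat (a * r) (\<lambda>_. 1) h x) \<in> borel_measurable (borel \<Otimes>\<^sub>M borel)" by measurable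
  qed
  finally show "(\<integral>\<omega>. other_clocks \<Lambda> j t \<omega> ^ k * h (time_changed_sheet W \<Lambda> x t \<omega>) \<partial>M) =
      (\<integral>p. fst p ^ k * heat (fst p * ((t $ j) powr \<beta> * snd p)) (\<lambda>_. 1) h x \<partial>(alpha j t \<Otimes>\<^sub>M zeta))" .
qed

end

section \<open>The heat equation and Laplacians of mixtures\<close>

lemma heat_sum_fun:
  fixes h :: "'i \<Rightarrow> 'a::euclidean_space \<Rightarrow> real"
  assumes "\<And>i. i \<in> I \<Longrightarrow> continuous_on UNIV (h i)" "\<And>i. i \<in> I \<Longrightarrow> bounded (range (h i))"
  shows "heat r (\<lambda>_. 1) (\<lambda>x. \<Sum>i\<in>I. h i x) x = (\<Sum>i\<in>I. heat r (\<lambda>_. 1) (h i) x)"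
  unfolding heat_def sum_distrib_right
proof (rule Bochner_Integration.integral_sum)
  fix i assume i: "i \<in> I"
  obtain K where "\<And>x. \<bar>h i x\<bar> \<le> K" using assms(2)[OF i] unfolding bounded_iff by auto
  then show "integrable lborel (\<lambda>z. h i (x + sqrt r *\<^sub>R z) * (1 * gauss z))"
    by (intro integrable_heat) (use assms(1)[OF i] in \<open>auto intro: borel_measurable_continuous_onI\<close>)
qed

lemma bcp_measurable: "bcp m g \<Longrightarrow> g \<in> borel_measurable borel"
  by (intro borel_measurable_continuous_onI bcp_continuous)

lemma DERIV_line_shift:
  fixes e :: "'a::real_normed_vector"
  assumes "((\<lambda>\<eta>. g ((x + \<eta>0 *\<^sub>R e) + \<eta> *\<^sub>R e)) has_real_derivative D) (at 0)"
  shows "((\<lambda>\<eta>. g (x + \<eta> *\<^sub>R e)) has_real_derivative D) (at \<eta>0)"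
proof -
  have "((\<lambda>\<eta>. g (x + (\<eta> + \<eta>0) *\<^sub>R e)) has_real_derivative D) (at 0)"
    using assms by (simp add: algebra_simps)
  then show ?thesis using DERIV_shift[of "\<lambda>\<eta>. g (x + \<eta> *\<^sub>R e)" D 0 \<eta>0] by simp
qed

lemma heat_partial_deriv:
  fixes g :: "real^'d \<Rightarrow> real"
  assumes g: "bcp (Suc m) g"
  shows "((\<lambda>\<eta>. heat r (\<lambda>_. 1) g (x + \<eta> *\<^sub>R axis k 1)) has_real_derivative
      heat r (\<lambda>_. 1) (partial_deriv k g) (x + \<eta> *\<^sub>R axis k 1)) (at \<eta>)"
proof -
  obtain K where K: "\<And>x. \<bar>g x\<bar> \<le> K" using bcp_bound[OF g] by metis
  obtain K' where K': "\<And>x. \<bar>partial_deriv k g x\<bar> \<le> K'" using bcp_bound[OF bcp_partial_deriv[OF g, of k]] by metis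
  have [measurable]: "g \<in> borel_measurable borel" "partial_deriv k g \<in> borel_measurable borel"
    using bcp_measurable g bcp_partial_deriv[OF g] by auto
  show ?thesis unfolding heat_def
  proof (rule integral_has_derivative_dominated[where a="\<eta> - 1" and b="\<eta> + 1" and B="\<lambda>z. K' * (1 * gauss z)"])
    show "integrable lborel (\<lambda>z. g (x + \<xi> *\<^sub>R axis k 1 + sqrt r *\<^sub>R z) * (1 * gauss z))" for \<xi>
      by (rule integrable_heat[OF _ K]) auto
    show "AE z in lborel. \<forall>\<xi>\<in>{\<eta> - 1<..<\<eta> + 1}. ((\<lambda>\<xi>. g (x + \<xi> *\<^sub>R axis k 1 + sqrt r *\<^sub>R z) * (1 * gauss z)) has_real_derivative
        partial_deriv k g (x + \<xi> *\<^sub>R axis k 1 + sqrt r *\<^sub>R z) * (1 * gauss z)) (at \<xi>)"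
    proof (intro AE_I2 ballI DERIV_cmult_right)
      fix z \<xi>
      show "((\<lambda>\<xi>. g (x + \<xi> *\<^sub>R axis k 1 + sqrt r *\<^sub>R z)) has_real_derivative partial_deriv k g (x + \<xi> *\<^sub>R axis k 1 + sqrt r *\<^sub>R z)) (at \<xi>)"
        using bcp_has_partial[OF g, of "x + sqrt r *\<^sub>R z" k \<xi>] by (simp add: ac_simps)
    qed
    show "integrable lborel (\<lambda>z. K' * (1 * gauss z))" by (intro integrable_mult_right integrable_tempered_gauss) simp
    show "AE z in lborel. \<forall>\<xi>\<in>{\<eta> - 1<..<\<eta> + 1}. \<bar>partial_deriv k g (x + \<xi> *\<^sub>R axis k 1 + sqrt r *\<^sub>R z) * (1 * gauss z)\<bar> \<le> K' * (1 * gauss z)"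
      using K' by (auto simp: abs_mult gauss_pos less_imp_le intro!: mult_right_mono)
  qed auto
qed

text \<open>Integration by parts by uniqueness of derivatives: the second derivative in x is
  computed once on the kernel, giving the Hermite weight over r, and once on g.\<close>

lemma heat_second_partial:
  fixes g :: "real^'d \<Rightarrow> real"
  assumes g: "bcp 2 g" and r: "0 < r"
  shows "heat r (\<lambda>z. (z \<bullet> axis k 1) * (z \<bullet> axis k 1) - (axis k 1 :: real^'d) \<bullet> axis k 1) g x / r
    = heat r (\<lambda>_. 1) (partial_deriv k (partial_deriv k g)) x"
proof -
  let ?e = "axis k 1 :: real^'d"
  have g1: "bcp (Suc 1) g" using g by (simp add: numeral_2_eq_2)
  obtain K where K: "\<And>x. \<bar>g x\<bar> \<le> K" using bcp_bound[OF g] by metis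
  note gm = bcp_measurable[OF g]
  have one: "heat r (\<lambda>z. z \<bullet> ?e) g y / sqrt r = heat r (\<lambda>_. 1) (partial_deriv k g) y" for y
    using DERIV_unique[OF heat_has_derivative_1[OF gm K r, of ?e y] heat_partial_deriv[OF g1, of r y k 0, simplified]] by simp
  have "((\<lambda>\<eta>. heat r (\<lambda>z. z \<bullet> ?e) g (x + \<eta> *\<^sub>R ?e) / sqrt r) has_real_derivative
      heat r (\<lambda>z. (z \<bullet> ?e) * (z \<bullet> ?e) - ?e \<bullet> ?e) g x / sqrt r / sqrt r) (at 0)"
    by (intro DERIV_cdivide heat_has_derivative_2[OF gm K r]) simp
  moreover have "((\<lambda>\<eta>. heat r (\<lambda>z. z \<bullet> ?e) g (x + \<eta> *\<^sub>R ?e) / sqrt r) has_real_derivative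
      heat r (\<lambda>_. 1) (partial_deriv k (partial_deriv k g)) x) (at 0)"
    unfolding one using heat_partial_deriv[of 0 "partial_deriv k g" r x k 0] bcp_partial_deriv[OF g1] by simp
  ultimately have "heat r (\<lambda>z. (z \<bullet> ?e) * (z \<bullet> ?e) - ?e \<bullet> ?e) g x / sqrt r / sqrt r = heat r (\<lambda>_. 1) (partial_deriv k (partial_deriv k g)) x"
    by (rule DERIV_unique)
  moreover have "y / sqrt r / sqrt r = y / r" for y using r by simp
  ultimately show ?thesis by (simp only:)
qed

lemma norm_hermite_sum:
  fixes z :: "real^'d"
  shows "(norm z)\<^sup>2 - real DIM(real^'d) = (\<Sum>k\<in>UNIV. (z \<bullet> axis k 1) * (z \<bullet> axis k 1) - (axis k 1 :: real^'d) \<bullet> axis k 1)"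
proof -
  have "(norm z)\<^sup>2 = (\<Sum>k\<in>UNIV. (z $ k) * (z $ k))" by (simp add: power2_norm_eq_inner inner_vec_def)
  then show ?thesis by (simp add: sum_subtractf inner_axis)
qed

lemma heat_norm_hermite:
  fixes h :: "real^'d \<Rightarrow> real"
  assumes "h \<in> borel_measurable borel" "\<And>x. \<bar>h x\<bar> \<le> K"
  shows "heat r (\<lambda>z. (norm z)\<^sup>2 - real DIM(real^'d)) h x =
    (\<Sum>k\<in>UNIV. heat r (\<lambda>z. (z \<bullet> axis k 1) * (z \<bullet> axis k 1) - (axis k 1 :: real^'d) \<bullet> axis k 1) h x)"
  unfolding norm_hermite_sum
  by (rule heat_sum[where w="\<lambda>k z. (z \<bullet> axis k 1) * (z \<bullet> axis k 1) - (axis k 1 :: real^'d) \<bullet> axis k 1", OF assms]) auto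

lemma heat_laplacian:
  fixes g :: "real^'d \<Rightarrow> real"
  assumes g: "bcp 2 g"
  shows "heat r (\<lambda>_. 1) (laplacian g) x = (\<Sum>k\<in>UNIV. heat r (\<lambda>_. 1) (partial_deriv k (partial_deriv k g)) x)"
proof -
  have "bcp 0 (partial_deriv k (partial_deriv k g))" for k
    using g by (simp add: numeral_2_eq_2 bcp_partial_deriv)
  then have "continuous_on UNIV (partial_deriv k (partial_deriv k g))" "bounded (range (partial_deriv k (partial_deriv k g)))" for k
    using bcp_continuous bcp_def[of 0 "partial_deriv k (partial_deriv k g)"] by fastforce+
  then show ?thesis unfolding laplacian_def[abs_def] by (intro heat_sum_fun)
qed

text \<open>The time derivative carries the weight |z|^2 - d, which is the sum of the second Hermite
  weights. For twice differentiable g these weights, divided by r, are traded for second derivatives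
  of g.\<close>

lemma heat_equation:
  fixes g :: "real^'d \<Rightarrow> real"
  assumes g: "bcp 2 g" and r: "0 < r"
  shows "((\<lambda>r. heat r (\<lambda>_. 1) g x) has_real_derivative heat r (\<lambda>_. 1) (laplacian g) x / 2) (at r)"
proof -
  obtain K where K: "\<And>x. \<bar>g x\<bar> \<le> K" using bcp_bound[OF g] by metis
  note gm = bcp_measurable[OF g]
  have eq: "heat r (\<lambda>z. (norm z)\<^sup>2 - real DIM(real^'d)) g x / (2 * r) = heat r (\<lambda>_. 1) (laplacian g) x / 2"
  proof -
    have "heat r (\<lambda>z. (norm z)\<^sup>2 - real DIM(real^'d)) g x / r = heat r (\<lambda>_. 1) (laplacian g) x"
      using heat_norm_hermite[OF gm K, of r x] heat_laplacian[OF g, of r x] heat_second_partial[OF g r]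
      by (simp only: sum_divide_distrib)
    moreover have "y / (2 * r) = y / r / 2" for y by simp
    ultimately show ?thesis by (simp only:)
  qed
  show ?thesis using heat_has_time_derivative[OF gm K r, of x] by (simp only: eq)
qed

section \<open>Averages over an independent pair: A with law \<open>\<alpha>\<close>, Z with law
  \<open>\<zeta>\<close>\<close>

locale mixed_law = A: prob_space \<alpha> + inverse_stable_law \<zeta> \<beta> for \<alpha> \<zeta> :: "real measure" and \<beta> :: real +
  assumes sets_alpha [simp, measurable_cong]: "sets \<alpha> = sets borel"
    and alpha_pos: "AE a in \<alpha>. 0 < a"
    and alpha_moment: "\<And>k::nat. integrable \<alpha> (\<lambda>a. a ^ k)"
begin

abbreviation P :: "(real \<times> real) measure" where "P \<equiv> \<alpha> \<Otimes>\<^sub>M \<zeta>"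

sublocale P: pair_prob_space \<alpha> \<zeta> ..

lemma sf: "sigma_finite_measure \<alpha>" "sigma_finite_measure \<zeta>"
  by unfold_locales

lemma AE_P_pos: "AE p in P. 0 < fst p \<and> 0 < snd p"
proof -
  have "AE p in P. 0 < fst p" by (rule AE_pair_fst[OF sf alpha_pos]) measurable
  moreover have "AE p in P. 0 < snd p" by (rule AE_pair_snd[OF sf pos]) measurable
  ultimately show ?thesis by eventually_elim simp
qed

lemma alpha_powr: "0 \<le> \<delta> \<Longrightarrow> integrable \<alpha> (\<lambda>a. a powr \<delta>)"
proof -
  assume \<delta>: "0 \<le> \<delta>"
  define k where "k = nat \<lceil>\<delta>\<rceil>"
  have k: "\<delta> \<le> real k" unfolding k_def by linarith
  have i: "integrable \<alpha> (\<lambda>a. 1 + a ^ k)" using alpha_moment by simp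
  show ?thesis
  proof (rule Bochner_Integration.integrable_bound[OF i])
    show "AE a in \<alpha>. norm (a powr \<delta>) \<le> norm (1 + a ^ k)"
      using alpha_pos
    proof eventually_elim
      case (elim a)
      show ?case
      proof (cases "a \<le> 1")
        case True
        then have "a powr \<delta> \<le> 1" using elim \<delta> by (intro powr_le1) auto
        then show ?thesis using elim by (simp add: add_increasing2)
      next
        case False
        then have "a powr \<delta> \<le> a powr real k" using k by (intro powr_mono) auto
        then show ?thesis using elim by (simp add: powr_realpow)
      qed
    qed
  qed measurable
qed

lemma integrable_powr_P: "0 \<le> \<delta> \<Longrightarrow> -1 < \<gamma> \<Longrightarrow> integrable P (\<lambda>p. fst p powr \<delta> * snd p powr \<gamma>)"
  by (rule pair_integral_product(1)[OF sf alpha_powr powr_moment])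

lemma integrable_fst_power: "integrable P (\<lambda>p. fst p ^ k)"
  using pair_integral_product(1)[OF sf alpha_moment[of k], of "\<lambda>_. 1"] by simp

lemma integrable_bounded_P:
  assumes "\<phi> \<in> borel_measurable borel" "\<And>r. \<bar>\<phi> r\<bar> \<le> K"
  shows "integrable P (\<lambda>p. fst p ^ k * \<phi> (fst p * (c * snd p)))"
proof -
  note [measurable] = assms(1)
  have "integrable P (\<lambda>p. K * \<bar>fst p ^ k\<bar>)" by (intro integrable_mult_right integrable_abs integrable_fst_power)
  then show ?thesis
  proof (rule Bochner_Integration.integrable_bound)
    show "AE p in P. norm (fst p ^ k * \<phi> (fst p * (c * snd p))) \<le> norm (K * \<bar>fst p ^ k\<bar>)"
    proof (rule AE_I2)
      fix p
      have "\<bar>fst p ^ k\<bar> * \<bar>\<phi> (fst p * (c * snd p))\<bar> \<le> \<bar>fst p ^ k\<bar> * K" by (intro mult_left_mono assms(2)) simp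
      moreover have "0 \<le> K" using assms(2)[of 0] by simp
      ultimately show "norm (fst p ^ k * \<phi> (fst p * (c * snd p))) \<le> norm (K * \<bar>fst p ^ k\<bar>)"
        by (simp add: abs_mult mult.commute)
    qed
  qed measurable
qed

text \<open>For the sheet, c is \<open>t $ j powr \<beta>\<close>; then k = 1 gives
  \<open>V_fun\<close> and k = \<nu> gives \<open>U_fun\<close>.\<close>

definition mixed :: "real \<Rightarrow> nat \<Rightarrow> (real^'d \<Rightarrow> real) \<Rightarrow> real^'d \<Rightarrow> real" where
  "mixed c k g x = (\<integral>p. fst p ^ k * heat (fst p * (c * snd p)) (\<lambda>_. 1) g x \<partial>P)"

lemma heat_measurable:
  "continuous_on UNIV g \<Longrightarrow> (\<And>x. \<bar>g x\<bar> \<le> K) \<Longrightarrow> tempered w \<Longrightarrow> (\<lambda>r. heat r w g x) \<in> borel_measurable borel"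
  for g :: "real^'d \<Rightarrow> real"
  by (intro borel_measurable_continuous_onI heat_continuous_on)

lemma integrable_mixed:
  fixes g :: "real^'d \<Rightarrow> real"
  assumes "continuous_on UNIV g" "\<And>x. \<bar>g x\<bar> \<le> K"
  shows "integrable P (\<lambda>p. fst p ^ k * heat (fst p * (c * snd p)) (\<lambda>_. 1) g x)"
  by (rule integrable_bounded_P[OF heat_measurable[OF assms]])
     (use heat_1_bound[OF borel_measurable_continuous_onI[OF assms(1)] assms(2)] in auto)

lemma mixed_partial:
  fixes g :: "real^'d \<Rightarrow> real"
  assumes g: "bcp (Suc m) g"
  shows "((\<lambda>\<eta>. mixed c k g (x + \<eta> *\<^sub>R axis l 1)) has_real_derivative mixed c k (partial_deriv l g) x) (at 0)"
proof -
  obtain K where K: "\<And>x. \<bar>g x\<bar> \<le> K" using bcp_bound[OF g] by metis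
  obtain K' where K': "\<And>x. \<bar>partial_deriv l g x\<bar> \<le> K'" using bcp_bound[OF bcp_partial_deriv[OF g, of l]] by metis
  note gc = bcp_continuous[OF g] bcp_continuous[OF bcp_partial_deriv[OF g, of l]]
  have "((\<lambda>\<eta>. mixed c k g (x + \<eta> *\<^sub>R axis l 1)) has_real_derivative mixed c k (partial_deriv l g) (x + 0 *\<^sub>R axis l 1)) (at 0)"
    unfolding mixed_def
  proof (rule integral_has_derivative_dominated[where a="-1" and b=1 and B="\<lambda>p. K' * \<bar>fst p ^ k\<bar>"])
    show "integrable P (\<lambda>p. fst p ^ k * heat (fst p * (c * snd p)) (\<lambda>_. 1) g (x + \<eta> *\<^sub>R axis l 1))" for \<eta>
      by (rule integrable_mixed[OF gc(1) K])
    show "AE p in P. \<forall>\<eta>\<in>{- 1<..<1}. ((\<lambda>\<eta>. fst p ^ k * heat (fst p * (c * snd p)) (\<lambda>_. 1) g (x + \<eta> *\<^sub>R axis l 1)) has_real_derivative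
        fst p ^ k * heat (fst p * (c * snd p)) (\<lambda>_. 1) (partial_deriv l g) (x + \<eta> *\<^sub>R axis l 1)) (at \<eta>)"
      by (intro AE_I2 ballI DERIV_cmult heat_partial_deriv[OF g])
    show "(\<lambda>p. fst p ^ k * heat (fst p * (c * snd p)) (\<lambda>_. 1) (partial_deriv l g) (x + 0 *\<^sub>R axis l 1)) \<in> borel_measurable P"
      by (intro borel_measurable_integrable integrable_mixed[OF gc(2) K'])
    show "integrable P (\<lambda>p. K' * \<bar>fst p ^ k\<bar>)" by (intro integrable_mult_right integrable_abs integrable_fst_power)
    show "AE p in P. \<forall>\<eta>\<in>{- 1<..<1}. \<bar>fst p ^ k * heat (fst p * (c * snd p)) (\<lambda>_. 1) (partial_deriv l g) (x + \<eta> *\<^sub>R axis l 1)\<bar> \<le> K' * \<bar>fst p ^ k\<bar>"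
      using heat_1_bound[OF borel_measurable_continuous_onI[OF gc(2)] K']
      by (auto simp: abs_mult mult.commute[of K'] intro!: mult_left_mono)
  qed simp
  then show ?thesis by simp
qed

lemma iter_partial_mixed:
  fixes g :: "real^'d \<Rightarrow> real"
  assumes "bcp m g" "length ks \<le> m"
  shows "iter_partial ks (mixed c k g) = mixed c k (iter_partial ks g)"
  using assms(2)
proof (induction ks)
  case (Cons l ks)
  have "bcp (Suc 0) (iter_partial ks g)"
    unfolding bcp_def partials_exist_def
  proof (intro conjI allI impI)
    fix ms :: "'d list" and l' x assume "length ms < Suc 0"
    then show "(\<lambda>h. iter_partial ms (iter_partial ks g) (x + h *\<^sub>R axis l' 1)) field_differentiable at 0"
      using partials_existD[of m g "ms @ ks" x l'] assms Cons.prems by (simp add: bcp_def)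
  next
    fix ms :: "'d list" assume "length ms \<le> Suc 0"
    then show "bounded (range (iter_partial ms (iter_partial ks g)))" "continuous_on UNIV (iter_partial ms (iter_partial ks g))"
      using assms(1)[unfolded bcp_def, THEN conjunct2, THEN spec, of "ms @ ks"] Cons.prems by auto
  qed
  then have "partial_deriv l (mixed c k (iter_partial ks g)) x = mixed c k (partial_deriv l (iter_partial ks g)) x" for x
    by (intro partial_derivI mixed_partial)
  then have "partial_deriv l (mixed c k (iter_partial ks g)) = mixed c k (partial_deriv l (iter_partial ks g))" ..
  then show ?case using Cons by simp
qed simp

lemma mixed_laplacian:
  fixes g :: "real^'d \<Rightarrow> real"
  assumes g: "bcp 2 g"
  shows "laplacian (mixed c k g) = mixed c k (laplacian g)"
proof
  fix x
  have b: "bcp 0 (partial_deriv l (partial_deriv l g))" for l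
    using g by (simp add: numeral_2_eq_2 bcp_partial_deriv)
  have "laplacian (mixed c k g) x = (\<Sum>l\<in>UNIV. mixed c k (partial_deriv l (partial_deriv l g)) x)"
    unfolding laplacian_def using iter_partial_mixed[OF g, of "[l, l]" for l] by simp
  also have "\<dots> = (\<integral>p. (\<Sum>l\<in>UNIV. fst p ^ k * heat (fst p * (c * snd p)) (\<lambda>_. 1) (partial_deriv l (partial_deriv l g)) x) \<partial>P)"
    unfolding mixed_def
  proof (rule Bochner_Integration.integral_sum[symmetric])
    fix l
    obtain K where "\<And>x. \<bar>partial_deriv l (partial_deriv l g) x\<bar> \<le> K" using bcp_bound[OF b] by metis
    then show "integrable P (\<lambda>p. fst p ^ k * heat (fst p * (c * snd p)) (\<lambda>_. 1) (partial_deriv l (partial_deriv l g)) x)"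
      by (rule integrable_mixed[OF bcp_continuous[OF b]])
  qed
  also have "\<dots> = mixed c k (laplacian g) x"
    unfolding mixed_def heat_laplacian[OF g] sum_distrib_left ..
  finally show "laplacian (mixed c k g) x = mixed c k (laplacian g) x" .
qed

lemma mixed_laplacian_power:
  fixes g :: "real^'d \<Rightarrow> real"
  assumes "bcp (2 * \<kappa>) g"
  shows "(laplacian ^^ \<kappa>) (mixed c k g) = mixed c k ((laplacian ^^ \<kappa>) g)"
  using assms
proof (induction \<kappa>)
  case (Suc \<kappa>)
  have "2 * \<kappa> + 2 = 2 * Suc \<kappa>" by simp
  then have "bcp 2 ((laplacian ^^ \<kappa>) g)" using Suc.prems laplacian_power_bcp[of \<kappa> 2 g] by metis
  moreover have "bcp (2 * \<kappa>) g" using Suc.prems by (rule bcp_mono) simp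
  ultimately show ?case using Suc.IH mixed_laplacian by simp
qed simp

end

section \<open>Two more spatial derivatives\<close>

context mixed_law
begin

text \<open>At r = A c Z the bound r^(- \<delta>) becomes A^(- \<delta>) Z^(- \<delta>) up to a
  constant. The factor A^k removes the singularity in A, and \<delta> < 1 is the range of finite
  negative moments of Z. The majorant does not depend on x, so it also justifies differentiation in
  x.\<close>

lemma mixed_weight_integrable:
  fixes h :: "real^'d \<Rightarrow> real"
  assumes h: "continuous_on UNIV h" "\<And>x. \<bar>h x\<bar> \<le> K" and w: "tempered w"
    and c: "0 < c" and \<delta>: "0 \<le> \<delta>" "\<delta> < 1" "real k \<ge> 1" and C: "0 \<le> C"
    and bound: "\<forall>r>0. \<forall>x. \<bar>v r * heat r w h x\<bar> \<le> C * r powr (- \<delta>)"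
    and v [measurable]: "v \<in> borel_measurable borel"
  defines "B \<equiv> \<lambda>p. C * c powr (- \<delta>) * (fst p powr (real k - \<delta>) * snd p powr (- \<delta>))"
  shows "integrable P B"
    and "AE p in P. \<forall>x. \<bar>fst p ^ k * (v (fst p * (c * snd p)) * heat (fst p * (c * snd p)) w h x)\<bar> \<le> B p"
    and "integrable P (\<lambda>p. fst p ^ k * (v (fst p * (c * snd p)) * heat (fst p * (c * snd p)) w h x))"
proof -
  show B: "integrable P B"
    unfolding B_def by (intro integrable_mult_right integrable_powr_P) (use \<delta> in auto)
  show A: "AE p in P. \<forall>x. \<bar>fst p ^ k * (v (fst p * (c * snd p)) * heat (fst p * (c * snd p)) w h x)\<bar> \<le> B p"
    using AE_P_pos
  proof (eventually_elim, intro allI)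
    fix p :: "real \<times> real" and x assume p: "0 < fst p \<and> 0 < snd p"
    let ?r = "fst p * (c * snd p)"
    have r: "0 < ?r" using p c by simp
    have "\<bar>fst p ^ k * (v ?r * heat ?r w h x)\<bar> \<le> fst p ^ k * (C * ?r powr (- \<delta>))"
      unfolding abs_mult[of "fst p ^ k"] using bound r p by (intro mult_mono) auto
    also have "\<dots> = B p"
    proof -
      have "fst p ^ k * fst p powr (- \<delta>) = fst p powr (real k - \<delta>)"
      proof -
        have "fst p ^ k = fst p powr real k" using p by (simp add: powr_realpow)
        then show ?thesis by (simp only: powr_add[symmetric]) simp
      qed
      then show ?thesis using p c by (simp add: B_def powr_mult mult_ac)
    qed
    finally show "\<bar>fst p ^ k * (v ?r * heat ?r w h x)\<bar> \<le> B p" .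
  qed
  have [measurable]: "(\<lambda>r. heat r w h x) \<in> borel_measurable borel" by (rule heat_measurable[OF h w])
  show "integrable P (\<lambda>p. fst p ^ k * (v (fst p * (c * snd p)) * heat (fst p * (c * snd p)) w h x))"
      proof (rule Bochner_Integration.integrable_bound[OF B])
    show "AE p in P. norm (fst p ^ k * (v (fst p * (c * snd p)) * heat (fst p * (c * snd p)) w h x)) \<le> norm (B p)"
      using A by eventually_elim (auto intro: order_trans)
  qed measurable
qed

text \<open>The first derivative of \<open>mixed c k h\<close> taken on the kernel instead of on h,
  and below it the second; they cost the factors r^(- 1/2) and r^(- 1).\<close>

definition smooth1 :: "real \<Rightarrow> nat \<Rightarrow> (real^'d \<Rightarrow> real) \<Rightarrow> 'd \<Rightarrow> real^'d \<Rightarrow> real" where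
  "smooth1 c k h l x = (\<integral>p. fst p ^ k * (1 / sqrt (fst p * (c * snd p)) * heat (fst p * (c * snd p)) (\<lambda>z. z \<bullet> axis l 1) h x) \<partial>P)"

definition smooth2 :: "real \<Rightarrow> nat \<Rightarrow> (real^'d \<Rightarrow> real) \<Rightarrow> 'd \<Rightarrow> 'd \<Rightarrow> real^'d \<Rightarrow> real" where
  "smooth2 c k h l m x = (\<integral>p. fst p ^ k * (1 / (fst p * (c * snd p)) *
     heat (fst p * (c * snd p)) (\<lambda>z. (z \<bullet> axis l 1) * (z \<bullet> axis m 1) - axis m 1 \<bullet> (axis l 1 :: real^'d)) h x) \<partial>P)"

text \<open>One kernel derivative is affordable for any bounded continuous h: it costs \<delta> =
  1/2, well inside the range \<delta> < 1.\<close>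

lemma mixed_has_partial_smooth1:
  fixes h :: "real^'d \<Rightarrow> real"
  assumes h: "continuous_on UNIV h" "\<And>x. \<bar>h x\<bar> \<le> K" and c: "0 < c" and k: "1 \<le> k"
  shows "((\<lambda>\<eta>. mixed c k h (x + \<eta> *\<^sub>R axis l 1)) has_real_derivative smooth1 c k h l x) (at 0)"
proof -
  let ?e = "axis l 1 :: real^'d"
  let ?w = "\<lambda>z. z \<bullet> ?e"
  have hm: "h \<in> borel_measurable borel" by (rule borel_measurable_continuous_onI[OF h(1)])
  define C where "C = K * (\<integral>z. \<bar>z \<bullet> ?e\<bar> * gauss z \<partial>lborel)"
  have K: "0 \<le> K" using h(2)[of 0] by simp
  have C: "0 \<le> C" unfolding C_def by (intro mult_nonneg_nonneg K integral_nonneg_AE) (auto simp: gauss_pos less_imp_le)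
  have bound: "\<bar>1 / sqrt r * heat r ?w h y\<bar> \<le> C * r powr (- (1 / 2))" if r: "0 < r" for r y
  proof -
    have "\<bar>heat r ?w h y\<bar> \<le> C" unfolding C_def by (rule heat_bound[OF hm h(2)]) simp
    then have "1 / sqrt r * \<bar>heat r ?w h y\<bar> \<le> 1 / sqrt r * C" using r by (intro mult_left_mono) auto
    moreover have "r powr (- (1 / 2)) = 1 / sqrt r"
      using r by (simp only: powr_minus powr_half_sqrt less_imp_le inverse_eq_divide)
    ultimately show ?thesis using r by (simp add: abs_mult)
  qed
  then have bound': "\<forall>r>0. \<forall>y. \<bar>1 / sqrt r * heat r ?w h y\<bar> \<le> C * r powr (- (1 / 2))" by blast
  have v: "(\<lambda>r. 1 / sqrt r) \<in> borel_measurable borel" by measurable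
  have k1: "real k \<ge> 1" using k by simp
  have d: "0 \<le> (1 / 2 :: real)" "1 / 2 < (1 :: real)" by auto
  note W = mixed_weight_integrable[OF h tempered_inner[of ?e] c d k1 C bound' v]
  have "((\<lambda>\<eta>. mixed c k h (x + \<eta> *\<^sub>R ?e)) has_real_derivative smooth1 c k h l (x + 0 *\<^sub>R ?e)) (at 0)"
    unfolding mixed_def smooth1_def
  proof (rule integral_has_derivative_dominated[where a="-1" and b=1
        and f="\<lambda>\<eta> p. fst p ^ k * heat (fst p * (c * snd p)) (\<lambda>_. 1) h (x + \<eta> *\<^sub>R ?e)"
        and f'="\<lambda>\<eta> p. fst p ^ k * (1 / sqrt (fst p * (c * snd p)) * heat (fst p * (c * snd p)) ?w h (x + \<eta> *\<^sub>R ?e))"])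
    show "integrable P (\<lambda>p. fst p ^ k * heat (fst p * (c * snd p)) (\<lambda>_. 1) h (x + \<eta> *\<^sub>R ?e))" for \<eta>
      by (rule integrable_mixed[OF h])
    show "AE p in P. \<forall>\<eta>\<in>{- 1<..<1}. ((\<lambda>\<eta>. fst p ^ k * heat (fst p * (c * snd p)) (\<lambda>_. 1) h (x + \<eta> *\<^sub>R ?e)) has_real_derivative
        fst p ^ k * (1 / sqrt (fst p * (c * snd p)) * heat (fst p * (c * snd p)) ?w h (x + \<eta> *\<^sub>R ?e))) (at \<eta>)"
      using AE_P_pos
    proof (eventually_elim, intro ballI)
      fix p :: "real \<times> real" and \<eta> assume p: "0 < fst p \<and> 0 < snd p"
      have "0 < fst p * (c * snd p)" using p c by simp
      from heat_has_derivative_1[OF hm h(2) this, of ?e "x + \<eta> *\<^sub>R ?e"]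
      have "((\<lambda>\<eta>'. heat (fst p * (c * snd p)) (\<lambda>_. 1) h (x + \<eta> *\<^sub>R ?e + \<eta>' *\<^sub>R ?e)) has_real_derivative
        1 / sqrt (fst p * (c * snd p)) * heat (fst p * (c * snd p)) ?w h (x + \<eta> *\<^sub>R ?e)) (at 0)" by simp
      from DERIV_cmult[OF DERIV_line_shift[of "heat (fst p * (c * snd p)) (\<lambda>_. 1) h", OF this], of "fst p ^ k"]
      show "((\<lambda>\<eta>. fst p ^ k * heat (fst p * (c * snd p)) (\<lambda>_. 1) h (x + \<eta> *\<^sub>R ?e)) has_real_derivative
        fst p ^ k * (1 / sqrt (fst p * (c * snd p)) * heat (fst p * (c * snd p)) ?w h (x + \<eta> *\<^sub>R ?e))) (at \<eta>)" .
    qed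
    show "(\<lambda>p. fst p ^ k * (1 / sqrt (fst p * (c * snd p)) * heat (fst p * (c * snd p)) ?w h (x + 0 *\<^sub>R ?e))) \<in> borel_measurable P"
      by (intro borel_measurable_integrable W(3))
    show "integrable P (\<lambda>p. C * c powr (- (1 / 2)) * (fst p powr (real k - 1 / 2) * snd p powr (- (1 / 2))))"
      by (rule W(1))
    show "AE p in P. \<forall>\<eta>\<in>{- 1<..<1}. \<bar>fst p ^ k * (1 / sqrt (fst p * (c * snd p)) * heat (fst p * (c * snd p)) ?w h (x + \<eta> *\<^sub>R ?e))\<bar>
        \<le> C * c powr (- (1 / 2)) * (fst p powr (real k - 1 / 2) * snd p powr (- (1 / 2)))"
      using W(2) by eventually_elim blast
  qed simp
  then show ?thesis by simp
qed

text \<open>Two kernel derivatives cost r^(- 1), and the order - 1 lies just outside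
  \<open>powr_moment\<close>. As the weight has Gaussian mean 0, Hoelder continuity wins back
  r^(\<alpha>' / 2) and leaves \<delta> = 1 - \<alpha>' / 2 < 1.\<close>

lemma smooth2_bounds:
  fixes h :: "real^'d \<Rightarrow> real"
  assumes h: "continuous_on UNIV h" "\<And>x. \<bar>h x\<bar> \<le> K" and ho: "holder_continuous \<alpha>' h" and \<alpha>': "0 < \<alpha>'" "\<alpha>' \<le> 1"
    and w: "tempered w" "(\<integral>z. w z * gauss z \<partial>lborel) = 0"
  shows "\<exists>C\<ge>0. \<forall>r>0. \<forall>x. \<bar>1 / r * heat r w h x\<bar> \<le> C * r powr (- (1 - \<alpha>' / 2))"
proof -
  obtain D where D: "\<And>x y. \<bar>h x - h y\<bar> \<le> D * dist x y powr \<alpha>'" using ho unfolding holder_continuous_def by blast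
  have "\<bar>h x - h y\<bar> \<le> \<bar>D\<bar> * dist x y powr \<alpha>'" for x y
    by (rule order_trans[OF D]) (intro mult_right_mono, auto)
  note hb = heat_holder_bound[OF borel_measurable_continuous_onI[OF h(1)] h(2) this \<alpha>' _ w]
  define C where "C = \<bar>D\<bar> * (\<integral>z. (1 + norm z) * \<bar>w z\<bar> * gauss z \<partial>lborel)"
  have "0 \<le> C" unfolding C_def by (intro mult_nonneg_nonneg integral_nonneg_AE) (auto simp: gauss_pos less_imp_le)
  moreover have "\<bar>1 / r * heat r w h x\<bar> \<le> C * r powr (- (1 - \<alpha>' / 2))" if r: "0 < r" for r x
  proof -
    have "1 / r * \<bar>heat r w h x\<bar> \<le> 1 / r * (C * r powr (\<alpha>' / 2))"
      using hb[of r x] r unfolding C_def by (intro mult_left_mono) (auto simp: mult_ac)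
    also have "\<dots> = C * (r powr (-1) * r powr (\<alpha>' / 2))" using r by (simp add: powr_minus inverse_eq_divide)
    also have "\<dots> = C * r powr (- (1 - \<alpha>' / 2))" unfolding powr_add[symmetric] by (simp add: algebra_simps)
    finally show ?thesis using r by (simp add: abs_mult)
  qed
  ultimately show ?thesis by blast
qed

lemma smooth1_has_partial_smooth2:
  fixes h :: "real^'d \<Rightarrow> real"
  assumes h: "continuous_on UNIV h" "\<And>x. \<bar>h x\<bar> \<le> K" and ho: "holder_continuous \<alpha>' h" and \<alpha>': "0 < \<alpha>'" "\<alpha>' \<le> 1"
    and c: "0 < c" and k: "1 \<le> k"
  shows "((\<lambda>\<eta>. smooth1 c k h l (x + \<eta> *\<^sub>R axis m 1)) has_real_derivative smooth2 c k h l m x) (at 0)"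
    and "integrable P (\<lambda>p. fst p ^ k * (1 / (fst p * (c * snd p)) *
      heat (fst p * (c * snd p)) (\<lambda>z. (z \<bullet> axis l 1) * (z \<bullet> axis m 1) - axis m 1 \<bullet> (axis l 1 :: real^'d)) h x))"
proof -
  let ?e = "axis m 1 :: real^'d" and ?f = "axis l 1 :: real^'d"
  let ?w = "\<lambda>z. (z \<bullet> ?f) * (z \<bullet> ?e) - ?e \<bullet> ?f"
  have hm: "h \<in> borel_measurable borel" by (rule borel_measurable_continuous_onI[OF h(1)])
  have tw: "tempered ?w" by auto
  obtain C where C: "0 \<le> C" "\<forall>r>0. \<forall>x. \<bar>1 / r * heat r ?w h x\<bar> \<le> C * r powr (- (1 - \<alpha>' / 2))"
    using smooth2_bounds[OF h ho \<alpha>' tw integral_hermite_2] by auto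
  have v: "(\<lambda>r. 1 / r :: real) \<in> borel_measurable borel" by measurable
  have k1: "real k \<ge> 1" using k by simp
  have \<delta>: "0 \<le> 1 - \<alpha>' / 2" "1 - \<alpha>' / 2 < 1" using \<alpha>' by auto
  note W = mixed_weight_integrable[OF h tw c \<delta> k1 C v]
  show "integrable P (\<lambda>p. fst p ^ k * (1 / (fst p * (c * snd p)) * heat (fst p * (c * snd p)) ?w h x))"
    by (rule W(3))
  define C1 where "C1 = K * (\<integral>z. \<bar>z \<bullet> ?f\<bar> * gauss z \<partial>lborel)"
  have K: "0 \<le> K" using h(2)[of 0] by simp
  have C1: "0 \<le> C1" unfolding C1_def by (intro mult_nonneg_nonneg K integral_nonneg_AE) (auto simp: gauss_pos less_imp_le)
  have bound1: "\<bar>1 / sqrt r * heat r (\<lambda>z. z \<bullet> ?f) h y\<bar> \<le> C1 * r powr (- (1 / 2))" if r: "0 < r" for r y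
  proof -
    have "\<bar>heat r (\<lambda>z. z \<bullet> ?f) h y\<bar> \<le> C1" unfolding C1_def by (rule heat_bound[OF hm h(2)]) simp
    then have "1 / sqrt r * \<bar>heat r (\<lambda>z. z \<bullet> ?f) h y\<bar> \<le> 1 / sqrt r * C1" using r by (intro mult_left_mono) auto
    moreover have "r powr (- (1 / 2)) = 1 / sqrt r"
      using r by (simp only: powr_minus powr_half_sqrt less_imp_le inverse_eq_divide)
    ultimately show ?thesis using r by (simp add: abs_mult)
  qed
  then have bound1': "\<forall>r>0. \<forall>y. \<bar>1 / sqrt r * heat r (\<lambda>z. z \<bullet> ?f) h y\<bar> \<le> C1 * r powr (- (1 / 2))" by blast
  have v1: "(\<lambda>r. 1 / sqrt r) \<in> borel_measurable borel" by measurable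
  have d: "0 \<le> (1 / 2 :: real)" "1 / 2 < (1 :: real)" by auto
  note W1 = mixed_weight_integrable[OF h tempered_inner[of ?f] c d k1 C1 bound1' v1]
  have "((\<lambda>\<eta>. smooth1 c k h l (x + \<eta> *\<^sub>R ?e)) has_real_derivative smooth2 c k h l m (x + 0 *\<^sub>R ?e)) (at 0)"
    unfolding smooth1_def smooth2_def
  proof (rule integral_has_derivative_dominated[where a="-1" and b=1
        and f="\<lambda>\<eta> p. fst p ^ k * (1 / sqrt (fst p * (c * snd p)) * heat (fst p * (c * snd p)) (\<lambda>z. z \<bullet> ?f) h (x + \<eta> *\<^sub>R ?e))"
        and f'="\<lambda>\<eta> p. fst p ^ k * (1 / (fst p * (c * snd p)) * heat (fst p * (c * snd p)) ?w h (x + \<eta> *\<^sub>R ?e))"])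
    show "integrable P (\<lambda>p. fst p ^ k * (1 / sqrt (fst p * (c * snd p)) * heat (fst p * (c * snd p)) (\<lambda>z. z \<bullet> ?f) h (x + \<eta> *\<^sub>R ?e)))" for \<eta>
      by (rule W1(3))
    show "AE p in P. \<forall>\<eta>\<in>{- 1<..<1}. ((\<lambda>\<eta>. fst p ^ k * (1 / sqrt (fst p * (c * snd p)) * heat (fst p * (c * snd p)) (\<lambda>z. z \<bullet> ?f) h (x + \<eta> *\<^sub>R ?e))) has_real_derivative
        fst p ^ k * (1 / (fst p * (c * snd p)) * heat (fst p * (c * snd p)) ?w h (x + \<eta> *\<^sub>R ?e))) (at \<eta>)"
      using AE_P_pos
    proof (eventually_elim, intro ballI)
      fix p :: "real \<times> real" and \<eta> assume p: "0 < fst p \<and> 0 < snd p"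
      let ?r = "fst p * (c * snd p)"
      have r: "0 < ?r" using p c by simp
      have "1 / sqrt ?r * (heat ?r ?w h (x + \<eta> *\<^sub>R ?e) / sqrt ?r) = 1 / ?r * heat ?r ?w h (x + \<eta> *\<^sub>R ?e)"
      proof -
        have "sqrt ?r * sqrt ?r = ?r" using r by simp
        moreover have "1 / s * (y / s) = 1 / (s * s) * y" for s y :: real by simp
        ultimately show ?thesis by (simp only:)
      qed
      then have "((\<lambda>\<eta>'. 1 / sqrt ?r * heat ?r (\<lambda>z. z \<bullet> ?f) h (x + \<eta> *\<^sub>R ?e + \<eta>' *\<^sub>R ?e)) has_real_derivative
        1 / ?r * heat ?r ?w h (x + \<eta> *\<^sub>R ?e)) (at 0)"
        using DERIV_cmult[OF heat_has_derivative_2[OF hm h(2) r, of ?e ?f "x + \<eta> *\<^sub>R ?e"], of "1 / sqrt ?r"]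
        by (simp only: norm_axis_1)
      from DERIV_cmult[OF DERIV_line_shift[of "\<lambda>y. 1 / sqrt ?r * heat ?r (\<lambda>z. z \<bullet> ?f) h y", OF this], of "fst p ^ k"]
      show "((\<lambda>\<eta>. fst p ^ k * (1 / sqrt ?r * heat ?r (\<lambda>z. z \<bullet> ?f) h (x + \<eta> *\<^sub>R ?e))) has_real_derivative
        fst p ^ k * (1 / ?r * heat ?r ?w h (x + \<eta> *\<^sub>R ?e))) (at \<eta>)" .
    qed
    show "(\<lambda>p. fst p ^ k * (1 / (fst p * (c * snd p)) * heat (fst p * (c * snd p)) ?w h (x + 0 *\<^sub>R ?e))) \<in> borel_measurable P"
      by (intro borel_measurable_integrable W(3))
    show "integrable P (\<lambda>p. C * c powr (- (1 - \<alpha>' / 2)) * (fst p powr (real k - (1 - \<alpha>' / 2)) * snd p powr (- (1 - \<alpha>' / 2))))"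
      by (rule W(1))
    show "AE p in P. \<forall>\<eta>\<in>{- 1<..<1}. \<bar>fst p ^ k * (1 / (fst p * (c * snd p)) * heat (fst p * (c * snd p)) ?w h (x + \<eta> *\<^sub>R ?e))\<bar>
        \<le> C * c powr (- (1 - \<alpha>' / 2)) * (fst p powr (real k - (1 - \<alpha>' / 2)) * snd p powr (- (1 - \<alpha>' / 2)))"
      using W(2) by eventually_elim blast
  qed simp
  then show "((\<lambda>\<eta>. smooth1 c k h l (x + \<eta> *\<^sub>R ?e)) has_real_derivative smooth2 c k h l m x) (at 0)" by simp
qed

text \<open>Derivatives up to order m are put on f. Differentiability at that stage comes from the
  first Hermite weight, and one order higher from the second, which requires the Hoelder continuity
  at order m.\<close>

lemma partials_exist_mixed:
  fixes f :: "real^'d \<Rightarrow> real"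
  assumes f: "bcp m f" and ho: "\<And>ks. length ks = m \<Longrightarrow> holder_continuous \<alpha>' (iter_partial ks f)"
    and \<alpha>': "0 < \<alpha>'" "\<alpha>' \<le> 1" and c: "0 < c" and k: "1 \<le> k"
  shows "partials_exist (m + 2) (mixed c k f)"
  unfolding partials_exist_def
proof (intro allI impI)
  have b: "continuous_on UNIV (iter_partial ks f)" "\<exists>K. \<forall>x. \<bar>iter_partial ks f x\<bar> \<le> K" if "length ks \<le> m" for ks
    using f that unfolding bcp_def bounded_iff by auto
  fix ks :: "'d list" and l x assume len: "length ks < m + 2"
  show "(\<lambda>h. iter_partial ks (mixed c k f) (x + h *\<^sub>R axis l 1)) field_differentiable at 0"
  proof (cases "length ks \<le> m")
    case True
    obtain K where "\<And>x. \<bar>iter_partial ks f x\<bar> \<le> K" using b(2)[OF True] by blast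
    from mixed_has_partial_smooth1[OF b(1)[OF True] this c k]
    show ?thesis unfolding iter_partial_mixed[OF f True] field_differentiable_def by blast
  next
    case False
    then obtain j ms where ks: "ks = j # ms" "length ms = m" using len by (cases ks) auto
    obtain K where K: "\<And>x. \<bar>iter_partial ms f x\<bar> \<le> K" using b(2)[of ms] ks by auto
    have c1: "continuous_on UNIV (iter_partial ms f)" using b(1) ks by simp
    have "iter_partial ks (mixed c k f) = smooth1 c k (iter_partial ms f) j"
      unfolding ks iter_partial_simps iter_partial_mixed[OF f eq_refl[OF ks(2)]]
      by (rule ext, rule partial_derivI, rule mixed_has_partial_smooth1[OF c1 K c k])
    then show ?thesis
      using smooth1_has_partial_smooth2(1)[OF c1 K ho[OF ks(2)] \<alpha>' c k] unfolding field_differentiable_def by auto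
  qed
qed

text \<open>Summed over the axes, the second Hermite weights give |z|^2 - d, the same weight as in
  \<open>heat_has_time_derivative\<close>. This allows spatial and temporal derivatives to be
  compared for F that is only Hoelder continuous.\<close>

lemma laplacian_mixed_smooth:
  fixes F :: "real^'d \<Rightarrow> real"
  assumes F: "continuous_on UNIV F" "\<And>x. \<bar>F x\<bar> \<le> K" and ho: "holder_continuous \<alpha>' F" and \<alpha>': "0 < \<alpha>'" "\<alpha>' \<le> 1"
    and c: "0 < c" and k: "1 \<le> k"
  shows "laplacian (mixed c k F) x = (\<integral>p. fst p ^ k * (1 / (fst p * (c * snd p)) *
      heat (fst p * (c * snd p)) (\<lambda>z. (norm z)\<^sup>2 - real DIM(real^'d)) F x) \<partial>P)"
proof -
  have 1: "partial_deriv l (mixed c k F) = smooth1 c k F l" for l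
    by (rule ext, rule partial_derivI, rule mixed_has_partial_smooth1[OF F c k])
  have 2: "partial_deriv l (smooth1 c k F l) x = smooth2 c k F l l x" for l
    by (rule partial_derivI, rule smooth1_has_partial_smooth2[OF F ho \<alpha>' c k])
  have "laplacian (mixed c k F) x = (\<Sum>l\<in>UNIV. smooth2 c k F l l x)"
    unfolding laplacian_def 1 2 ..
  also have "\<dots> = (\<integral>p. (\<Sum>l\<in>UNIV. fst p ^ k * (1 / (fst p * (c * snd p)) *
     heat (fst p * (c * snd p)) (\<lambda>z. (z \<bullet> axis l 1) * (z \<bullet> axis l 1) - axis l 1 \<bullet> (axis l 1 :: real^'d)) F x)) \<partial>P)"
    unfolding smooth2_def
    by (rule Bochner_Integration.integral_sum[symmetric]) (rule smooth1_has_partial_smooth2(2)[OF F ho \<alpha>' c k])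
  also have "\<dots> = (\<integral>p. fst p ^ k * (1 / (fst p * (c * snd p)) *
      heat (fst p * (c * snd p)) (\<lambda>z. (norm z)\<^sup>2 - real DIM(real^'d)) F x) \<partial>P)"
    unfolding heat_norm_hermite[OF borel_measurable_continuous_onI[OF F(1)] F(2)] sum_distrib_left ..
  finally show ?thesis .
qed

end

section \<open>Caputo derivative and Taylor expansion in time\<close>

text \<open>The target y is fixed and the expansion point z moves. By the product rule consecutive
  terms cancel and only the one with the highest derivative survives.\<close>

lemma taylor_sum_derivative:
  fixes \<phi> :: "nat \<Rightarrow> real \<Rightarrow> real"
  assumes "\<And>i. i < n \<Longrightarrow> (\<phi> (Suc i) has_real_derivative \<phi> (Suc (Suc i)) z) (at z)"
  shows "((\<lambda>z. \<Sum>i<n. \<phi> (Suc i) z * ((y - z) ^ i / fact i)) has_real_derivative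
    (if n = 0 then 0 else \<phi> (Suc n) z * ((y - z) ^ (n - 1) / fact (n - 1)))) (at z)"
  using assms
proof (induction n)
  case (Suc n)
  have IH: "((\<lambda>z. \<Sum>i<n. \<phi> (Suc i) z * ((y - z) ^ i / fact i)) has_real_derivative
    (if n = 0 then 0 else \<phi> (Suc n) z * ((y - z) ^ (n - 1) / fact (n - 1)))) (at z)"
    using Suc by simp
  have p: "((\<lambda>z. (y - z) ^ n / fact n) has_real_derivative (if n = 0 then 0 else - ((y - z) ^ (n - 1) / fact (n - 1)))) (at z)"
  proof (cases n)
    case 0
    then show ?thesis by simp
  next
    case (Suc m)
    have "((\<lambda>z. (y - z) ^ n / fact n) has_real_derivative (real n * (y - z) ^ (n - 1) * (- 1)) / fact n) (at z)"
      by (rule derivative_eq_intros refl | simp)+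
    then show ?thesis unfolding Suc by (simp add: field_simps del: of_nat_Suc)
  qed
  have "((\<lambda>z. (\<Sum>i<n. \<phi> (Suc i) z * ((y - z) ^ i / fact i)) + \<phi> (Suc n) z * ((y - z) ^ n / fact n)) has_real_derivative
     (if n = 0 then 0 else \<phi> (Suc n) z * ((y - z) ^ (n - 1) / fact (n - 1))) +
     (\<phi> (Suc (Suc n)) z * ((y - z) ^ n / fact n) + (if n = 0 then 0 else - ((y - z) ^ (n - 1) / fact (n - 1))) * \<phi> (Suc n) z)) (at z)"
    by (intro DERIV_add IH DERIV_mult p Suc.prems) simp
  then show ?case by (cases "n = 0") (simp_all add: algebra_simps)
qed simp

lemma set_integrable_powr_0:
  assumes \<delta>: "0 < \<delta>" and y: "0 < (y::real)"
  shows "set_integrable lborel {0<..<y} (\<lambda>z. z powr (\<delta> - 1))"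
proof -
  let ?F = "\<lambda>z. indicator {0<..<y} z * z powr (\<delta> - 1)"
  have "?F (0 + y * w) = y powr (\<delta> - 1) * (indicator {0<..<1} w * (w powr (\<delta> - 1) * (1 - w) powr (1 - 1)))" for w
    using y by (auto simp: indicator_def powr_mult zero_less_mult_iff)
  moreover have "integrable lborel (\<lambda>w. y powr (\<delta> - 1) * (indicator {0<..<1} w * (w powr (\<delta> - 1) * (1 - w) powr (1 - 1))))"
    by (intro integrable_mult_right set_integral_Beta) (use \<delta> in auto)
  ultimately have "integrable lborel (\<lambda>w. ?F (0 + y * w))" by simp
  then have "integrable lborel ?F" using y lborel_integrable_real_affine_iff[of y ?F 0] by simp
  then show ?thesis by (simp add: set_integrable_def)
qed

text \<open>The Taylor sum about z with target y is followed from z = 0 to z = y. Its derivative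
  blows up at 0 like z^(\<delta> - 1), so the fundamental theorem is used on the open interval, with
  integrability from \<open>bound\<close> and the boundary values from continuity of the sum.
  Finally z = y w.\<close>

lemma taylor_remainder:
  fixes \<phi> :: "nat \<Rightarrow> real \<Rightarrow> real"
  assumes n: "0 < n" and cont: "\<And>i. i < n \<Longrightarrow> continuous_on UNIV (\<phi> (Suc i))"
    and der: "\<And>i r. i < n \<Longrightarrow> 0 < r \<Longrightarrow> (\<phi> (Suc i) has_real_derivative \<phi> (Suc (Suc i)) r) (at r)"
    and top: "continuous_on {0<..} (\<phi> (Suc n))" "\<phi> (Suc n) \<in> borel_measurable borel"
    and bound: "\<And>r. 0 < r \<Longrightarrow> \<bar>\<phi> (Suc n) r\<bar> \<le> C * r powr (\<delta> - 1)" and \<delta>: "0 < \<delta>" and y: "0 < y"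
  shows "\<phi> 1 y = (\<Sum>i<n. \<phi> (Suc i) 0 * (y ^ i / fact i)) +
    y ^ n / fact (n - 1) * (\<integral>w. indicator {0<..<1} w * ((1 - w) ^ (n - 1) * \<phi> (Suc n) (w * y)) \<partial>lborel)"
proof -
  note [measurable] = top(2)
  define S where "S z = (\<Sum>i<n. \<phi> (Suc i) z * ((y - z) ^ i / fact i))" for z
  define s where "s z = \<phi> (Suc n) z * ((y - z) ^ (n - 1) / fact (n - 1))" for z
  have dS: "(S has_real_derivative s z) (at z)" if "0 < z" for z
    using taylor_sum_derivative[of n \<phi> z y] der n that unfolding S_def[abs_def] s_def by auto
  have cS: "continuous_on UNIV S" unfolding S_def[abs_def] by (intro continuous_intros cont) auto
  have si: "set_integrable lborel {0<..<y} s"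
  proof (rule set_integrable_bound)
    show "set_integrable lborel {0<..<y} (\<lambda>z. (C * (y ^ (n - 1) / fact (n - 1))) * z powr (\<delta> - 1))"
      by (intro set_integrable_mult_right set_integrable_powr_0 \<delta> y)
    show "set_borel_measurable lborel {0<..<y} s" unfolding set_borel_measurable_def s_def[abs_def] by measurable
    show "AE z in lborel. z \<in> {0<..<y} \<longrightarrow> norm (s z) \<le> norm ((C * (y ^ (n - 1) / fact (n - 1))) * z powr (\<delta> - 1))"
    proof (intro AE_I2 impI)
      fix z assume z: "z \<in> {0<..<y}"
      have 1: "\<bar>\<phi> (Suc n) z\<bar> \<le> C * z powr (\<delta> - 1)" using bound z by simp
      have 2: "(y - z) ^ (n - 1) / fact (n - 1) \<le> y ^ (n - 1) / fact (n - 1)"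
        using z by (intro divide_right_mono power_mono) auto
      have "\<bar>\<phi> (Suc n) z\<bar> * ((y - z) ^ (n - 1) / fact (n - 1)) \<le> (C * z powr (\<delta> - 1)) * (y ^ (n - 1) / fact (n - 1))"
        using 1 2 z by (intro mult_mono) (auto intro: order_trans[OF abs_ge_zero])
      then have "norm (s z) \<le> (C * (y ^ (n - 1) / fact (n - 1))) * z powr (\<delta> - 1)"
        using z unfolding s_def by (simp add: abs_mult mult_ac)
      then show "norm (s z) \<le> norm ((C * (y ^ (n - 1) / fact (n - 1))) * z powr (\<delta> - 1))"
        by (rule order_trans) (simp only: real_norm_def abs_ge_self)
    qed
  qed
  have "(LBINT z=ereal 0..ereal y. s z) = S y - S 0"
  proof (rule interval_integral_FTC_integrable)
    show "ereal 0 < ereal y" using y by simp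
    show "(S has_vector_derivative s z) (at z)" if "ereal 0 < ereal z" for z
      using dS that by (simp add: has_real_derivative_iff_has_vector_derivative)
    show "isCont s z" if "ereal 0 < ereal z" for z
    proof -
      have "isCont (\<phi> (Suc n)) z" using top(1) that by (simp add: continuous_on_eq_continuous_at)
      then show ?thesis unfolding s_def[abs_def] by (intro continuous_intros) auto
    qed
    show "set_integrable lborel (einterval (ereal 0) (ereal y)) s" using si by simp
    have "isCont S z" for z using cS by (simp add: continuous_on_eq_continuous_at)
    then have "(S \<longlongrightarrow> S 0) (at_right 0)" "(S \<longlongrightarrow> S y) (at_left y)"
      by (auto simp: isCont_def filterlim_at_split)
    then show "((S \<circ> real_of_ereal) \<longlongrightarrow> S 0) (at_right (ereal 0))" "((S \<circ> real_of_ereal) \<longlongrightarrow> S y) (at_left (ereal y))"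
      by (auto simp: ereal_tendsto_simps)
  qed
  then have "S y = S 0 + (\<integral>z. indicator {0<..<y} z * s z \<partial>lborel)"
    using y by (simp add: interval_lebesgue_integral_def set_lebesgue_integral_def)
  moreover have "S y = \<phi> 1 y"
  proof -
    \<comment> \<open>At z = y only the term i = 0 remains, since \<open>0 ^ 0\<close> is 1.\<close>
    have "S y = (\<Sum>i\<in>{0}. \<phi> (Suc i) y * ((y - y) ^ i / fact i))"
      unfolding S_def by (rule sum.mono_neutral_right) (use n in auto)
    then show ?thesis by simp
  qed
  moreover have "S 0 = (\<Sum>i<n. \<phi> (Suc i) 0 * (y ^ i / fact i))" by (simp add: S_def)
  moreover have "(\<integral>z. indicator {0<..<y} z * s z \<partial>lborel) =
    y ^ n / fact (n - 1) * (\<integral>w. indicator {0<..<1} w * ((1 - w) ^ (n - 1) * \<phi> (Suc n) (w * y)) \<partial>lborel)"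
  proof -
    have e: "indicator {0<..<y} (0 + y * w) * s (0 + y * w) =
      y ^ (n - 1) / fact (n - 1) * (indicator {0<..<1} w * ((1 - w) ^ (n - 1) * \<phi> (Suc n) (w * y)))" for w
    proof -
      have "(y - y * w) ^ (n - 1) = y ^ (n - 1) * (1 - w) ^ (n - 1)"
        unfolding power_mult_distrib[symmetric] by (simp add: algebra_simps)
      then show ?thesis using y by (auto simp: indicator_def s_def zero_less_mult_iff mult_ac)
    qed
    have "(\<integral>z. indicator {0<..<y} z * s z \<partial>lborel) = y * (\<integral>w. indicator {0<..<y} (0 + y * w) * s (0 + y * w) \<partial>lborel)"
      using y by (subst lborel_integral_real_affine[of y _ 0]) auto
    also have "\<dots> = y * (y ^ (n - 1) / fact (n - 1)) * (\<integral>w. indicator {0<..<1} w * ((1 - w) ^ (n - 1) * \<phi> (Suc n) (w * y)) \<partial>lborel)"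
      unfolding e by simp
    also have "y * (y ^ (n - 1) / fact (n - 1)) = y ^ n / fact (n - 1)"
      using n by (cases n) auto
    finally show ?thesis .
  qed
  ultimately show ?thesis by simp
qed

context mixed_law
begin

text \<open>The inner part of the chain rule for d/dt, with y in the place of
  \<open>t powr \<beta>\<close>. Keeping y as a variable lets the same function be evaluated at
  \<open>t powr \<beta> * w powr \<beta>\<close> inside the Caputo integral.\<close>

definition timeJ :: "(real \<Rightarrow> real) \<Rightarrow> real \<Rightarrow> real" where
  "timeJ \<phi> y = (\<integral>p. fst p * (snd p * \<phi> (fst p * (y * snd p))) \<partial>P)"

lemma integrable_fst_snd: "integrable P (\<lambda>p. fst p * snd p)"
  using pair_integral_product(1)[OF sf alpha_moment[of 1], of "\<lambda>z. z"] moment[of 1] by (simp add: has_bochner_integral_iff)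

lemma timeJ_integrable:
  assumes [measurable]: "\<phi> \<in> borel_measurable borel" and b: "\<And>r. \<bar>\<phi> r\<bar> \<le> K"
  shows "integrable P (\<lambda>p. fst p * (snd p * \<phi> (fst p * (y * snd p))))"
    and "AE p in P. \<bar>fst p * (snd p * \<phi> (fst p * (y * snd p)))\<bar> \<le> K * (fst p * snd p)"
proof -
  show A: "AE p in P. \<bar>fst p * (snd p * \<phi> (fst p * (y * snd p)))\<bar> \<le> K * (fst p * snd p)"
    using AE_P_pos
  proof eventually_elim
    case (elim p)
    then have "fst p * snd p * \<bar>\<phi> (fst p * (y * snd p))\<bar> \<le> fst p * snd p * K" by (intro mult_left_mono b) auto
    then show ?case using elim by (simp add: abs_mult mult_ac)
  qed
  show "integrable P (\<lambda>p. fst p * (snd p * \<phi> (fst p * (y * snd p))))"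
  proof (rule Bochner_Integration.integrable_bound[OF integrable_mult_right[OF integrable_fst_snd, of K]])
    show "AE p in P. norm (fst p * (snd p * \<phi> (fst p * (y * snd p)))) \<le> norm (K * (fst p * snd p))"
      using A by eventually_elim (auto intro: order_trans)
  qed measurable
qed

lemma time_derivative:
  assumes \<phi>: "continuous_on UNIV \<phi>" "\<And>r. \<bar>\<phi> r\<bar> \<le> K"
    and der: "\<And>r. 0 < r \<Longrightarrow> (\<phi> has_real_derivative \<phi>1 r) (at r)"
    and \<phi>1: "continuous_on UNIV \<phi>1" "\<And>r. \<bar>\<phi>1 r\<bar> \<le> K1" and s: "0 < s"
  shows "((\<lambda>s. \<integral>p. \<phi> (fst p * (s powr \<beta> * snd p)) \<partial>P) has_real_derivative
    \<beta> * s powr (\<beta> - 1) * timeJ \<phi>1 (s powr \<beta>)) (at s)"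
proof -
  have m[measurable]: "\<phi> \<in> borel_measurable borel" "\<phi>1 \<in> borel_measurable borel"
    using \<phi>(1) \<phi>1(1) by (auto intro: borel_measurable_continuous_onI)
  have "((\<lambda>s. \<integral>p. \<phi> (fst p * (s powr \<beta> * snd p)) \<partial>P) has_real_derivative
    (\<integral>p. \<beta> * s powr (\<beta> - 1) * (fst p * (snd p * \<phi>1 (fst p * (s powr \<beta> * snd p)))) \<partial>P)) (at s)"
  \<comment> \<open>The interval stays away from 0 because the factor
    \<open>s powr (\<beta> - 1)\<close> blows up there.\<close>
  proof (rule integral_has_derivative_dominated[where a="s / 2" and b="2 * s"
        and f="\<lambda>s p. \<phi> (fst p * (s powr \<beta> * snd p))"
        and f'="\<lambda>s p. \<beta> * s powr (\<beta> - 1) * (fst p * (snd p * \<phi>1 (fst p * (s powr \<beta> * snd p))))"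
        and B="\<lambda>p. \<beta> * (s / 2) powr (\<beta> - 1) * (K1 * (fst p * snd p))"])
    show "s \<in> {s / 2<..<2 * s}" using s by simp
    show "integrable P (\<lambda>p. \<phi> (fst p * (r powr \<beta> * snd p)))" for r
      using integrable_bounded_P[OF m(1) \<phi>(2), of 0] by simp
    show "AE p in P. \<forall>r\<in>{s / 2<..<2 * s}. ((\<lambda>s. \<phi> (fst p * (s powr \<beta> * snd p))) has_real_derivative
        \<beta> * r powr (\<beta> - 1) * (fst p * (snd p * \<phi>1 (fst p * (r powr \<beta> * snd p))))) (at r)"
      using AE_P_pos
    proof (eventually_elim, intro ballI)
      fix p :: "real \<times> real" and r assume p: "0 < fst p \<and> 0 < snd p" and "r \<in> {s / 2<..<2 * s}"
      then have r: "0 < r" using s by simp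
      have "((\<lambda>s. fst p * (s powr \<beta> * snd p)) has_real_derivative fst p * (\<beta> * r powr (\<beta> - 1) * snd p)) (at r)"
        using r by (auto intro!: derivative_eq_intros)
      moreover have "0 < fst p * (r powr \<beta> * snd p)" using p r by simp
      ultimately have "((\<lambda>s. \<phi> (fst p * (s powr \<beta> * snd p))) has_real_derivative
          \<phi>1 (fst p * (r powr \<beta> * snd p)) * (fst p * (\<beta> * r powr (\<beta> - 1) * snd p))) (at r)"
        by (intro DERIV_chain2[OF der])
      then show "((\<lambda>s. \<phi> (fst p * (s powr \<beta> * snd p))) has_real_derivative
        \<beta> * r powr (\<beta> - 1) * (fst p * (snd p * \<phi>1 (fst p * (r powr \<beta> * snd p))))) (at r)" by (simp add: mult_ac)
    qed
    show "(\<lambda>p. \<beta> * s powr (\<beta> - 1) * (fst p * (snd p * \<phi>1 (fst p * (s powr \<beta> * snd p))))) \<in> borel_measurable P"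
      by measurable
    show "integrable P (\<lambda>p. \<beta> * (s / 2) powr (\<beta> - 1) * (K1 * (fst p * snd p)))"
      by (intro integrable_mult_right integrable_fst_snd)
    show "AE p in P. \<forall>r\<in>{s / 2<..<2 * s}. \<bar>\<beta> * r powr (\<beta> - 1) * (fst p * (snd p * \<phi>1 (fst p * (r powr \<beta> * snd p))))\<bar>
        \<le> \<beta> * (s / 2) powr (\<beta> - 1) * (K1 * (fst p * snd p))"
      using AE_P_pos
    proof (eventually_elim, intro ballI)
      fix p :: "real \<times> real" and r assume p: "0 < fst p \<and> 0 < snd p" and r: "r \<in> {s / 2<..<2 * s}"
      have "r powr (\<beta> - 1) \<le> (s / 2) powr (\<beta> - 1)" using r s beta by (intro powr_mono2') auto
      then have 1: "\<beta> * r powr (\<beta> - 1) \<le> \<beta> * (s / 2) powr (\<beta> - 1)" using beta by simp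
      have "fst p * snd p * \<bar>\<phi>1 (fst p * (r powr \<beta> * snd p))\<bar> \<le> fst p * snd p * K1" using p by (intro mult_left_mono \<phi>1(2)) auto
      then have 2: "\<bar>fst p * (snd p * \<phi>1 (fst p * (r powr \<beta> * snd p)))\<bar> \<le> K1 * (fst p * snd p)"
        using p by (simp add: abs_mult mult_ac)
      have "\<beta> * r powr (\<beta> - 1) * \<bar>fst p * (snd p * \<phi>1 (fst p * (r powr \<beta> * snd p)))\<bar> \<le> \<beta> * (s / 2) powr (\<beta> - 1) * (K1 * (fst p * snd p))"
        using 1 2 beta by (intro mult_mono) auto
      then show "\<bar>\<beta> * r powr (\<beta> - 1) * (fst p * (snd p * \<phi>1 (fst p * (r powr \<beta> * snd p))))\<bar>
        \<le> \<beta> * (s / 2) powr (\<beta> - 1) * (K1 * (fst p * snd p))"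
        using beta by (simp add: abs_mult)
    qed
  qed
  then show ?thesis by (simp add: timeJ_def)
qed

lemma timeJ_continuous:
  assumes \<phi>1: "continuous_on UNIV \<phi>1" "\<And>r. \<bar>\<phi>1 r\<bar> \<le> K1"
  shows "continuous_on UNIV (timeJ \<phi>1)"
  unfolding timeJ_def
proof (rule integral_continuous_on_dominated[where B="\<lambda>p. K1 * (fst p * snd p)"])
  have [measurable]: "\<phi>1 \<in> borel_measurable borel" using \<phi>1(1) by (rule borel_measurable_continuous_onI)
  show "(\<lambda>p. fst p * (snd p * \<phi>1 (fst p * (y * snd p)))) \<in> borel_measurable P" for y by measurable
  show "AE p in P. continuous_on UNIV (\<lambda>y. fst p * (snd p * \<phi>1 (fst p * (y * snd p))))"
    by (intro AE_I2 continuous_intros continuous_on_compose2[OF \<phi>1(1)]) auto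
  show "integrable P (\<lambda>p. K1 * (fst p * snd p))" by (intro integrable_mult_right integrable_fst_snd)
  show "AE p in P. \<bar>fst p * (snd p * \<phi>1 (fst p * (y * snd p)))\<bar> \<le> K1 * (fst p * snd p)" for y
    by (rule timeJ_integrable(2)) (use \<phi>1 in auto)
qed

text \<open>Here \<open>v\<close> is the formula for the time derivative. Averaging over A first
  (\<open>\<psi>\<close>) leaves a statement about Z alone: the Caputo integral is the beta average
  of the mean of \<open>Z * \<psi> (t powr \<beta> * w powr \<beta> * Z)\<close>, and the mixture
  identity removes both w and the factor Z.\<close>

lemma caputo_mixture:
  assumes \<phi>1: "continuous_on UNIV \<phi>1" "\<And>r. \<bar>\<phi>1 r\<bar> \<le> K1" and t: "0 < t"
  defines "v \<equiv> \<lambda>s. \<beta> * s powr (\<beta> - 1) * timeJ \<phi>1 (s powr \<beta>)"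
  shows "set_integrable lborel {0<..<t} (\<lambda>s. v s / (t - s) powr \<beta>)"
    and "1 / Gamma (1 - \<beta>) * (LINT s:{0<..<t}|lborel. v s / (t - s) powr \<beta>) =
      (\<integral>p. fst p * \<phi>1 (fst p * (t powr \<beta> * snd p)) \<partial>P)"
proof -
  have m[measurable]: "\<phi>1 \<in> borel_measurable borel" using \<phi>1(1) by (rule borel_measurable_continuous_onI)
  define \<psi> where "\<psi> y = (\<integral>a. a * \<phi>1 (a * y) \<partial>\<alpha>)" for y
  have a1: "integrable \<alpha> (\<lambda>a. K1 * \<bar>a\<bar>)" using alpha_moment[of 1] by simp
  have \<psi>c: "continuous_on UNIV \<psi>"
    unfolding \<psi>_def[abs_def]
  proof (rule integral_continuous_on_dominated[OF _ _ a1])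
    show "AE a in \<alpha>. continuous_on UNIV (\<lambda>y. a * \<phi>1 (a * y))"
      by (intro AE_I2 continuous_intros continuous_on_compose2[OF \<phi>1(1)]) auto
    show "AE a in \<alpha>. \<bar>a * \<phi>1 (a * y)\<bar> \<le> K1 * \<bar>a\<bar>" for y
      using \<phi>1(2) by (auto simp: abs_mult mult.commute[of K1] intro!: mult_left_mono)
  qed measurable
  have \<psi>m[measurable]: "\<psi> \<in> borel_measurable borel" using \<psi>c by (rule borel_measurable_continuous_onI)
  have \<psi>b: "\<bar>\<psi> y\<bar> \<le> (\<integral>a. K1 * \<bar>a\<bar> \<partial>\<alpha>)" for y
  proof -
    have "\<bar>\<psi> y\<bar> \<le> (\<integral>a. \<bar>a * \<phi>1 (a * y)\<bar> \<partial>\<alpha>)" unfolding \<psi>_def by (rule integral_abs_bound)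
    also have "\<dots> \<le> (\<integral>a. K1 * \<bar>a\<bar> \<partial>\<alpha>)"
    proof (rule integral_mono[OF _ a1])
      show le: "\<bar>a * \<phi>1 (a * y)\<bar> \<le> K1 * \<bar>a\<bar>" for a
        using \<phi>1(2) by (auto simp: abs_mult mult.commute[of K1] intro!: mult_left_mono)
      show "integrable \<alpha> (\<lambda>a. \<bar>a * \<phi>1 (a * y)\<bar>)"
        by (rule Bochner_Integration.integrable_bound[OF a1]) (use le in \<open>auto intro!: AE_I2 order_trans[OF le abs_ge_self]\<close>)
    qed
    finally show ?thesis .
  qed
  have J: "timeJ \<phi>1 y = (\<integral>z. z * \<psi> (y * z) \<partial>\<zeta>)" for y
  proof -
    have "integrable P (\<lambda>(a, z). a * (z * \<phi>1 (a * (y * z))))"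
      using timeJ_integrable(1)[OF m \<phi>1(2), of y] by (simp add: case_prod_unfold)
    from P.integral_snd[OF this]
    have "timeJ \<phi>1 y = (\<integral>z. (\<integral>a. a * (z * \<phi>1 (a * (y * z))) \<partial>\<alpha>) \<partial>\<zeta>)" by (simp add: timeJ_def case_prod_unfold)
    also have "(\<lambda>z. \<integral>a. a * (z * \<phi>1 (a * (y * z))) \<partial>\<alpha>) = (\<lambda>z. z * \<psi> (y * z))"
    proof
      fix z
      have "(\<integral>a. a * (z * \<phi>1 (a * (y * z))) \<partial>\<alpha>) = (\<integral>a. z * (a * \<phi>1 (a * (y * z))) \<partial>\<alpha>)" by (simp only: mult_ac)
      then show "(\<integral>a. a * (z * \<phi>1 (a * (y * z))) \<partial>\<alpha>) = z * \<psi> (y * z)" by (simp add: \<psi>_def)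
    qed
    finally show ?thesis .
  qed
  let ?c = "\<beta> / Gamma (1 - \<beta>)"
  have G: "Gamma (1 - \<beta>) > 0" using beta by (intro Gamma_real_pos) simp
  have par: "0 \<le> ?c" "0 < \<beta>" "0 < 1 - \<beta>" "0 < \<beta>" using G beta by auto
  have hint: "integrable \<zeta> (\<lambda>z. \<psi> (t powr \<beta> * z))"
    by (rule integrable_const_bound[where B="\<integral>a. K1 * \<bar>a\<bar> \<partial>\<alpha>"]) (use \<psi>b in auto)
  have Jw: "(\<integral>z. z ^ 1 * \<psi> (t powr \<beta> * (w powr \<beta> * z)) \<partial>\<zeta>) = timeJ \<phi>1 (t powr \<beta> * w powr \<beta>)" for w
    unfolding J by (simp add: mult.assoc)
  note mix = mixture_integral[OF par, of 1 "\<lambda>z. \<psi> (t powr \<beta> * z)", OF caputo_moments hint, unfolded Jw]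
  have Jm[measurable]: "timeJ \<phi>1 \<in> borel_measurable borel"
    by (intro borel_measurable_continuous_onI timeJ_continuous[OF \<phi>1])
  have wm: "(\<lambda>w. timeJ \<phi>1 (t powr \<beta> * w powr \<beta>)) \<in> borel_measurable borel" by measurable
  define F where "F w = indicator {0<..<1} w * (w powr (\<beta> - 1) * (1 - w) powr (1 - \<beta> - 1)) * timeJ \<phi>1 (t powr \<beta> * w powr \<beta>)" for w
  have Fi: "integrable lborel (\<lambda>w. ?c * F w)"
    using mix(1) unfolding beta_measure_integral(2)[OF wm par(1)] F_def .
  have Fv: "?c * (\<integral>w. F w \<partial>lborel) = (\<integral>z. \<psi> (t powr \<beta> * z) \<partial>\<zeta>)"
    using mix(2) unfolding beta_measure_integral(1)[OF wm par(1)] F_def .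
  \<comment> \<open>Substitution s = t w. The powers \<open>t powr (\<beta> - 1)\<close> and
    \<open>t powr - \<beta>\<close> leave 1 / t, which ds = t dw cancels afterwards.\<close>
  have sub: "indicator {0<..<t} (0 + t * w) * (v (0 + t * w) / (t - (0 + t * w)) powr \<beta>) = (\<beta> / t) * F w" for w
  proof (cases "w \<in> {0<..<1}")
    case True
    then have w: "0 < w" "w < 1" by auto
    have 1: "(t * w) powr (\<beta> - 1) = t powr (\<beta> - 1) * w powr (\<beta> - 1)" "(t * w) powr \<beta> = t powr \<beta> * w powr \<beta>"
      using t w by (auto simp: powr_mult)
    have "t - t * w = t * (1 - w)" by (simp add: algebra_simps)
    then have 2: "(t - t * w) powr \<beta> = t powr \<beta> * (1 - w) powr \<beta>" using t w by (simp add: powr_mult)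
    have 3: "t powr (\<beta> - 1) = t powr \<beta> / t" using t by (simp add: powr_diff)
    have 4: "(1 - w) powr (1 - \<beta> - 1) = 1 / (1 - w) powr \<beta>" using w by (simp add: powr_minus inverse_eq_divide)
    have "t * w \<in> {0<..<t}" using t w by simp
    then show ?thesis
      using True t w unfolding F_def v_def 4 by (simp add: 1 2 3)
  next
    case False
    then have "t * w \<notin> {0<..<t}" using t by (auto simp: zero_less_mult_iff)
    then show ?thesis using False by (simp add: F_def)
  qed
  let ?H = "\<lambda>s. indicator {0<..<t} s * (v s / (t - s) powr \<beta>)"
  have "integrable lborel (\<lambda>w. (Gamma (1 - \<beta>) / t) * (?c * F w))" by (intro integrable_mult_right Fi)
  moreover have "(Gamma (1 - \<beta>) / t) * (?c * F w) = (\<beta> / t) * F w" for w using G by simp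
  ultimately have "integrable lborel (\<lambda>w. ?H (0 + t * w))" unfolding sub by simp
  then have "integrable lborel ?H" using t lborel_integrable_real_affine_iff[of t ?H 0] by simp
  then show "set_integrable lborel {0<..<t} (\<lambda>s. v s / (t - s) powr \<beta>)" by (simp add: set_integrable_def)
  have "(LINT s:{0<..<t}|lborel. v s / (t - s) powr \<beta>) = (\<integral>s. ?H s \<partial>lborel)" by (simp add: set_lebesgue_integral_def)
  also have "\<dots> = t * (\<integral>w. ?H (0 + t * w) \<partial>lborel)" using t by (subst lborel_integral_real_affine[of t _ 0]) auto
  also have "\<dots> = \<beta> * (\<integral>w. F w \<partial>lborel)" unfolding sub using t by simp
  finally have "1 / Gamma (1 - \<beta>) * (LINT s:{0<..<t}|lborel. v s / (t - s) powr \<beta>) = ?c * (\<integral>w. F w \<partial>lborel)" by simp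
  also have "\<dots> = (\<integral>z. \<psi> (t powr \<beta> * z) \<partial>\<zeta>)" by (rule Fv)
  also have "\<dots> = (\<integral>p. fst p * \<phi>1 (fst p * (t powr \<beta> * snd p)) \<partial>P)"
  proof -
    have "integrable P (\<lambda>(a, z). a * \<phi>1 (a * (t powr \<beta> * z)))"
      using integrable_bounded_P[OF m \<phi>1(2), of 1] by (simp add: case_prod_unfold)
    from P.integral_snd[OF this] show ?thesis by (simp add: \<psi>_def case_prod_unfold)
  qed
  finally show "1 / Gamma (1 - \<beta>) * (LINT s:{0<..<t}|lborel. v s / (t - s) powr \<beta>) =
      (\<integral>p. fst p * \<phi>1 (fst p * (t powr \<beta> * snd p)) \<partial>P)" .
qed

text \<open>\<open>\<phi> i\<close> is the i-th derivative of the heat flow in r, so n = \<nu> - 1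
  terms of the expansion of \<open>\<phi> 1\<close> lead to a remainder with
  \<open>\<phi> \<nu>\<close>. The polynomial part integrates to products of moments; in the
  remainder the beta variable is absorbed by the law of Z.\<close>

lemma taylor_mixture:
  fixes \<phi> :: "nat \<Rightarrow> real \<Rightarrow> real" and \<nu> n :: nat
  assumes \<nu>: "\<beta> = 1 / real \<nu>" "\<nu> = Suc n" "0 < n"
    and cont: "\<And>i. i < n \<Longrightarrow> continuous_on UNIV (\<phi> (Suc i))"
    and b1: "\<And>r. \<bar>\<phi> 1 r\<bar> \<le> K1"
    and der: "\<And>i r. i < n \<Longrightarrow> 0 < r \<Longrightarrow> (\<phi> (Suc i) has_real_derivative \<phi> (Suc (Suc i)) r) (at r)"
    and top: "continuous_on {0<..} (\<phi> \<nu>)" "\<phi> \<nu> \<in> borel_measurable borel"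
    and bound: "\<And>r. 0 < r \<Longrightarrow> \<bar>\<phi> \<nu> r\<bar> \<le> C * r powr (\<delta> - 1)" and \<delta>: "0 < \<delta>" and t: "0 < t"
  shows "\<beta> * t powr (\<beta> - 1) * timeJ (\<phi> 1) (t powr \<beta>) =
    (\<Sum>i<n. \<phi> (Suc i) 0 * ((\<integral>a. a ^ Suc i \<partial>\<alpha>) * (\<integral>z. z ^ Suc i \<partial>\<zeta>) / fact (Suc i) * (\<beta> * real (Suc i) * t powr (\<beta> * real (Suc i) - 1)))) +
    (\<integral>p. fst p ^ \<nu> * \<phi> \<nu> (fst p * (t powr \<beta> * snd p)) \<partial>P)"
proof -
  note [measurable] = top(2)
  define c where "c = t powr \<beta>"
  have c: "0 < c" using t by (simp add: c_def)
  have m1[measurable]: "\<phi> 1 \<in> borel_measurable borel" using cont[OF \<nu>(3)] by (simp add: borel_measurable_continuous_onI)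
  have \<nu>2: "2 \<le> \<nu>" "real \<nu> - 1 = real n" using \<nu> by auto
  have n1: "real n - 1 = real (n - 1)" using \<nu>(3) by (simp add: of_nat_diff)
  have G: "Gamma (real n) = fact (n - 1)" using Gamma_fact[of "n - 1"] \<nu>(3) by (simp add: of_nat_diff)
  let ?\<rho> = "beta_measure (\<beta> / Gamma (real \<nu> - 1)) 1 (real \<nu> - 1)"
  have par: "0 \<le> \<beta> / Gamma (real \<nu> - 1)" "(0::real) < 1" "0 < real \<nu> - 1" "(0::real) < 1"
    using beta \<nu>2 \<nu>(3) G by (auto simp: field_simps)
  have \<rho>: "(\<integral>w. f w \<partial>?\<rho>) = \<beta> / fact (n - 1) * (\<integral>w. indicator {0<..<1} w * ((1 - w) ^ (n - 1) * f w) \<partial>lborel)"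
    if "f \<in> borel_measurable borel" for f :: "real \<Rightarrow> real"
  proof -
    have e: "indicator {0<..<1} w * (w powr (1 - 1) * (1 - w) powr (real \<nu> - 1 - 1)) * f w
      = indicator {0<..<1} w * ((1 - w) ^ (n - 1) * f w)" for w :: real
      unfolding \<nu>2(2) n1 by (auto simp: indicator_def powr_realpow)
    then show ?thesis unfolding beta_measure_integral(1)[OF that par(1)] e by (simp add: \<nu>2(2) G)
  qed
  define T where "T y = (\<Sum>i<n. \<phi> (Suc i) 0 / fact i * y ^ i)" for y
  \<comment> \<open>The factor \<open>\<beta>\<close> is split off to match the normalisation of
    \<open>taylor_moments\<close>, with \<open>Gamma (real n) = fact (n - 1)\<close>.\<close>
  have rem: "\<phi> 1 y - T y = y ^ n / \<beta> * (\<integral>w. \<phi> \<nu> (w * y) \<partial>?\<rho>)" if y: "0 < y" for y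
  proof -
    have "\<phi> 1 y = (\<Sum>i<n. \<phi> (Suc i) 0 * (y ^ i / fact i)) +
      y ^ n / fact (n - 1) * (\<integral>w. indicator {0<..<1} w * ((1 - w) ^ (n - 1) * \<phi> (Suc n) (w * y)) \<partial>lborel)"
      by (rule taylor_remainder[where C=C and \<delta>=\<delta>]) (use \<nu> cont der top bound \<delta> y in auto)
    moreover have "(\<integral>w. \<phi> \<nu> (w * y) \<partial>?\<rho>) = \<beta> / fact (n - 1) * (\<integral>w. indicator {0<..<1} w * ((1 - w) ^ (n - 1) * \<phi> \<nu> (w * y)) \<partial>lborel)"
      by (rule \<rho>) measurable
    ultimately show ?thesis using beta unfolding T_def \<nu>(2) by (simp add: mult_ac)
  qed
  have mom: "integrable P (\<lambda>p. fst p ^ k * snd p ^ k)" "(\<integral>p. fst p ^ k * snd p ^ k \<partial>P) = (\<integral>a. a ^ k \<partial>\<alpha>) * (\<integral>z. z ^ k \<partial>\<zeta>)" for k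
    using pair_integral_product[OF sf alpha_moment[of k], of "\<lambda>z. z ^ k"] moment[of k] by (auto simp: has_bochner_integral_iff)
  have Te: "fst p * (snd p * T (fst p * (c * snd p))) = (\<Sum>i<n. \<phi> (Suc i) 0 / fact i * c ^ i * (fst p ^ Suc i * snd p ^ Suc i))" for p
    unfolding T_def sum_distrib_left by (intro sum.cong refl) (simp add: power_mult_distrib mult_ac)
  have Ti: "integrable P (\<lambda>p. fst p * (snd p * T (fst p * (c * snd p))))"
    unfolding Te by (intro Bochner_Integration.integrable_sum integrable_mult_right mom)
  have Tv: "(\<integral>p. fst p * (snd p * T (fst p * (c * snd p))) \<partial>P) = (\<Sum>i<n. \<phi> (Suc i) 0 / fact i * c ^ i * ((\<integral>a. a ^ Suc i \<partial>\<alpha>) * (\<integral>z. z ^ Suc i \<partial>\<zeta>)))"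
    unfolding Te by (subst Bochner_Integration.integral_sum) (auto intro!: integrable_mult_right mom(1) sum.cong simp: mom(2) simp del: power_Suc)
  have Ji: "integrable P (\<lambda>p. fst p * (snd p * \<phi> 1 (fst p * (c * snd p))))"
    by (rule timeJ_integrable(1)[OF m1 b1])
  \<comment> \<open>The remainder is kept as the difference of two integrable expressions; its
    integrability thus precedes any analysis of its singular integral form.\<close>
  define q where "q p = fst p * (snd p * (\<phi> 1 (fst p * (c * snd p)) - T (fst p * (c * snd p))))" for p
  have qe: "q p = fst p * (snd p * \<phi> 1 (fst p * (c * snd p))) - fst p * (snd p * T (fst p * (c * snd p)))" for p
    by (simp add: q_def algebra_simps)
  have qi: "integrable P q" unfolding qe[abs_def] by (intro Bochner_Integration.integrable_diff Ji Ti)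
  have J: "timeJ (\<phi> 1) c = (\<integral>p. fst p * (snd p * T (fst p * (c * snd p))) \<partial>P) + (\<integral>p. q p \<partial>P)"
    unfolding qe timeJ_def by (subst Bochner_Integration.integral_diff[OF Ji Ti]) simp
  have hb: "AE z in \<zeta>. \<bar>\<phi> \<nu> (a * (c * z))\<bar> \<le> C * (a powr (\<delta> - 1) * c powr (\<delta> - 1)) * z powr (\<delta> - 1)" if a: "0 < a" for a
    using pos
  proof eventually_elim
    case (elim z)
    then have "0 < a * (c * z)" using a c by simp
    from bound[OF this] show ?case using a c elim by (simp add: powr_mult mult_ac)
  qed
  have hi: "integrable \<zeta> (\<lambda>z. \<phi> \<nu> (a * (c * z)))" if a: "0 < a" for a
  proof (rule Bochner_Integration.integrable_bound)
    show "integrable \<zeta> (\<lambda>z. C * (a powr (\<delta> - 1) * c powr (\<delta> - 1)) * z powr (\<delta> - 1))"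
      by (intro integrable_mult_right powr_moment) (use \<delta> in simp)
    show "AE z in \<zeta>. norm (\<phi> \<nu> (a * (c * z))) \<le> norm (C * (a powr (\<delta> - 1) * c powr (\<delta> - 1)) * z powr (\<delta> - 1))"
      using hb[OF a] by eventually_elim (auto intro: order_trans[OF _ abs_ge_self])
  qed measurable
  \<comment> \<open>The mixture identity concerns Z only, so A is frozen at a. The prefactor a z (a
    c z)^n equals c^n a^\<nu> z^\<nu> with \<nu> = n + 1; its z^\<nu> is the weight that the
    identity removes.\<close>
  have inner: "(\<integral>z. q (a, z) \<partial>\<zeta>) = c ^ n / \<beta> * (\<integral>z. a ^ \<nu> * \<phi> \<nu> (a * (c * z)) \<partial>\<zeta>)" if a: "0 < a" for a
  proof -
    have "(\<integral>z. q (a, z) \<partial>\<zeta>) = (\<integral>z. (c ^ n / \<beta> * a ^ \<nu>) * (\<integral>w. z ^ \<nu> * \<phi> \<nu> (a * (c * (w powr 1 * z))) \<partial>?\<rho>) \<partial>\<zeta>)"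
    proof (rule integral_cong_AE)
      have "integrable P (\<lambda>p. case p of (x, y) \<Rightarrow> q (x, y))" using qi by (simp add: case_prod_unfold)
      then have "(\<lambda>p. case p of (x, y) \<Rightarrow> q (x, y)) \<in> borel_measurable P" by (rule borel_measurable_integrable)
      then have [measurable]: "q \<in> borel_measurable (borel \<Otimes>\<^sub>M borel)"
        unfolding measurable_cong_sets[OF sets_pair_measure_cong[OF sets_alpha sets_zeta] refl] by (simp add: case_prod_unfold)
      show "(\<lambda>z. q (a, z)) \<in> borel_measurable \<zeta>" by measurable
      have 1: "finite_measure ?\<rho>" by (rule finite_beta_measure) (use par in auto)
      then interpret R: finite_measure ?\<rho> .
      show "(\<lambda>z. c ^ n / \<beta> * a ^ \<nu> * (\<integral>w. z ^ \<nu> * \<phi> \<nu> (a * (c * (w powr 1 * z))) \<partial>?\<rho>)) \<in> borel_measurable \<zeta>"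
        by measurable
      show "AE z in \<zeta>. q (a, z) = c ^ n / \<beta> * a ^ \<nu> * (\<integral>w. z ^ \<nu> * \<phi> \<nu> (a * (c * (w powr 1 * z))) \<partial>?\<rho>)"
        using pos
      proof eventually_elim
        case (elim z)
        then have y: "0 < a * (c * z)" using a c by simp
        \<comment> \<open>The shared mixture lemma has the exponent q, here 1;
          \<open>w powr 1\<close> equals w only for nonnegative w, which holds almost
          everywhere.\<close>
        have e: "(\<integral>w. \<phi> \<nu> (a * (c * (w powr 1 * z))) \<partial>?\<rho>) = (\<integral>w. \<phi> \<nu> (w * (a * (c * z))) \<partial>?\<rho>)"
        proof (rule integral_cong_AE)
          show "AE w in ?\<rho>. \<phi> \<nu> (a * (c * (w powr 1 * z))) = \<phi> \<nu> (w * (a * (c * z)))"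
            using AE_beta_measure[OF par(1), of 1 "real \<nu> - 1"] by eventually_elim (simp add: mult_ac)
        qed measurable
        have p: "a * (z * ((a * (c * z)) ^ n / \<beta>)) = c ^ n / \<beta> * a ^ \<nu> * z ^ \<nu>"
          unfolding \<nu>(2) by (simp add: power_mult_distrib mult_ac)
        have "q (a, z) = a * (z * ((a * (c * z)) ^ n / \<beta>)) * (\<integral>w. \<phi> \<nu> (w * (a * (c * z))) \<partial>?\<rho>)"
          unfolding q_def fst_conv snd_conv rem[OF y] by (simp only: mult.assoc)
        then show ?case unfolding p e[symmetric] by (simp add: mult_ac)
      qed
    qed
    also have "\<dots> = c ^ n / \<beta> * a ^ \<nu> * (\<integral>z. (\<integral>w. z ^ \<nu> * \<phi> \<nu> (a * (c * (w powr 1 * z))) \<partial>?\<rho>) \<partial>\<zeta>)" by simp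
    also have "(\<integral>z. (\<integral>w. z ^ \<nu> * \<phi> \<nu> (a * (c * (w powr 1 * z))) \<partial>?\<rho>) \<partial>\<zeta>) = (\<integral>z. \<phi> \<nu> (a * (c * z)) \<partial>\<zeta>)"
      by (rule mixture_integral(3)[OF par, of \<nu> "\<lambda>z. \<phi> \<nu> (a * (c * z))", OF taylor_moments[OF \<nu>2(1) \<nu>(1)] hi[OF a]])
    finally show ?thesis by (simp add: mult_ac)
  qed
  have Pi: "integrable P (\<lambda>p. fst p ^ \<nu> * \<phi> \<nu> (fst p * (c * snd p)))"
  proof (rule Bochner_Integration.integrable_bound)
    show "integrable P (\<lambda>p. C * c powr (\<delta> - 1) * (fst p powr (real \<nu> + (\<delta> - 1)) * snd p powr (\<delta> - 1)))"
      by (intro integrable_mult_right integrable_powr_P) (use \<delta> \<nu>2 in auto)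
    show "AE p in P. norm (fst p ^ \<nu> * \<phi> \<nu> (fst p * (c * snd p))) \<le> norm (C * c powr (\<delta> - 1) * (fst p powr (real \<nu> + (\<delta> - 1)) * snd p powr (\<delta> - 1)))"
      using AE_P_pos
    proof eventually_elim
      case (elim p)
      then have r: "0 < fst p * (c * snd p)" using c by simp
      have "fst p ^ \<nu> = fst p powr real \<nu>" using elim by (simp add: powr_realpow)
      then have e: "fst p powr (real \<nu> + (\<delta> - 1)) = fst p ^ \<nu> * fst p powr (\<delta> - 1)" by (simp only: powr_add)
      have "fst p ^ \<nu> * \<bar>\<phi> \<nu> (fst p * (c * snd p))\<bar> \<le> fst p ^ \<nu> * (C * (fst p * (c * snd p)) powr (\<delta> - 1))"
        using elim by (intro mult_left_mono bound[OF r]) auto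
      also have "\<dots> = C * c powr (\<delta> - 1) * (fst p powr (real \<nu> + (\<delta> - 1)) * snd p powr (\<delta> - 1))"
        unfolding e using elim c by (simp add: powr_mult mult_ac)
      finally have "norm (fst p ^ \<nu> * \<phi> \<nu> (fst p * (c * snd p))) \<le> C * c powr (\<delta> - 1) * (fst p powr (real \<nu> + (\<delta> - 1)) * snd p powr (\<delta> - 1))"
        using elim by (simp add: abs_mult)
      then show ?case by (rule order_trans) (simp only: real_norm_def abs_ge_self)
    qed
  qed measurable
  have Q: "(\<integral>p. q p \<partial>P) = c ^ n / \<beta> * (\<integral>p. fst p ^ \<nu> * \<phi> \<nu> (fst p * (c * snd p)) \<partial>P)"
  proof -
    have "(\<integral>p. q p \<partial>P) = (\<integral>a. (\<integral>z. q (a, z) \<partial>\<zeta>) \<partial>\<alpha>)" by (rule P.integral_fst'[OF qi, symmetric])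
    also have "\<dots> = (\<integral>a. c ^ n / \<beta> * (\<integral>z. a ^ \<nu> * \<phi> \<nu> (a * (c * z)) \<partial>\<zeta>) \<partial>\<alpha>)"
    proof (rule integral_cong_AE)
      show "(\<lambda>a. \<integral>z. q (a, z) \<partial>\<zeta>) \<in> borel_measurable \<alpha>"
        by (rule borel_measurable_integrable[OF P.integrable_fst'[OF qi]])
      show "(\<lambda>a. c ^ n / \<beta> * (\<integral>z. a ^ \<nu> * \<phi> \<nu> (a * (c * z)) \<partial>\<zeta>)) \<in> borel_measurable \<alpha>" by measurable
      show "AE a in \<alpha>. (\<integral>z. q (a, z) \<partial>\<zeta>) = c ^ n / \<beta> * (\<integral>z. a ^ \<nu> * \<phi> \<nu> (a * (c * z)) \<partial>\<zeta>)"
        using alpha_pos by eventually_elim (rule inner)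
    qed
    also have "\<dots> = c ^ n / \<beta> * (\<integral>p. fst p ^ \<nu> * \<phi> \<nu> (fst p * (c * snd p)) \<partial>P)"
      using P.integral_fst'[OF Pi] by simp
    finally show ?thesis .
  qed
  have cn: "c ^ k = t powr (\<beta> * real k)" for k 
  proof -
    have "c ^ k = c powr real k" using c by (simp add: powr_realpow)
    then show ?thesis by (simp add: c_def powr_powr)
  qed
  have \<beta>\<nu>: "\<beta> * real n = 1 - \<beta>" using \<nu> by (simp add: field_simps)
  \<comment> \<open>All powers of t in front of the remainder cancel: \<beta> - 1 + \<beta> n = 0
    because \<beta> \<nu> = 1.\<close>
  have one: "\<beta> * t powr (\<beta> - 1) * (c ^ n / \<beta> * y) = y" for y
  proof -
    have "t powr (\<beta> - 1) * c ^ n = 1" unfolding cn \<beta>\<nu> powr_add[symmetric] using t by simp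
    then show ?thesis using beta by (simp add: mult.assoc[symmetric]) 
  qed
  \<comment> \<open>Writing 1 / i! as (i + 1) / (i + 1)! brings out the derivative of
    \<open>t powr (\<beta> * real (Suc i))\<close>, as it occurs in the time derivative of
    \<open>M_fun\<close>.\<close>
  have coef: "\<beta> * t powr (\<beta> - 1) * (\<phi> (Suc i) 0 / fact i * c ^ i * (x * y)) =
    \<phi> (Suc i) 0 * (x * y / fact (Suc i) * (\<beta> * real (Suc i) * t powr (\<beta> * real (Suc i) - 1)))" for i x y
  proof -
    have "t powr (\<beta> - 1) * c ^ i = t powr (\<beta> * real (Suc i) - 1)"
      unfolding cn powr_add[symmetric] by (simp add: algebra_simps)
    moreover have "(1 :: real) / fact i = real (Suc i) / fact (Suc i)" by (simp del: of_nat_Suc)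
    moreover have "\<beta> * t powr (\<beta> - 1) * (\<phi> (Suc i) 0 / fact i * c ^ i * (x * y)) =
        \<phi> (Suc i) 0 * (x * y) * \<beta> * ((1 / fact i) * (t powr (\<beta> - 1) * c ^ i))"
      by (simp only: divide_inverse mult_ac mult_1)
    ultimately have "\<beta> * t powr (\<beta> - 1) * (\<phi> (Suc i) 0 / fact i * c ^ i * (x * y)) =
        \<phi> (Suc i) 0 * (x * y) * \<beta> * (real (Suc i) / fact (Suc i) * t powr (\<beta> * real (Suc i) - 1))"
      by (simp only:)
    then show ?thesis by (simp only: divide_inverse mult_ac)
  qed
  have X: "\<beta> * t powr (\<beta> - 1) * timeJ (\<phi> 1) c = (\<Sum>i<n. \<beta> * t powr (\<beta> - 1) * (\<phi> (Suc i) 0 / fact i * c ^ i * ((\<integral>a. a ^ Suc i \<partial>\<alpha>) * (\<integral>z. z ^ Suc i \<partial>\<zeta>)))) +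
    \<beta> * t powr (\<beta> - 1) * (c ^ n / \<beta> * (\<integral>p. fst p ^ \<nu> * \<phi> \<nu> (fst p * (c * snd p)) \<partial>P))"
    unfolding J Tv Q distrib_left sum_distrib_left ..
  from X[unfolded one coef] show ?thesis unfolding c_def .
qed

end

section \<open>The equations\<close>

lemma lborel_vec_product:
  fixes f :: "'i::finite \<Rightarrow> real \<Rightarrow> real"
  assumes f: "\<And>k. integrable lborel (f k)" and nn: "\<And>k y. 0 \<le> f k y"
  shows "has_bochner_integral lborel (\<lambda>z :: real^'i. \<Prod>k\<in>UNIV. f k (z $ k)) (\<Prod>k\<in>UNIV. \<integral>y. f k y \<partial>lborel)"
proof -
  have [measurable]: "f k \<in> borel_measurable borel" for k using f[of k] by (auto dest: borel_measurable_integrable)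
  have m: "(\<lambda>z :: real^'i. \<Prod>k\<in>UNIV. f k (z $ k)) \<in> borel_measurable lborel"
    by (intro borel_measurable_prod measurable_compose[OF borel_measurable_vec_nth]) auto
  have ax: "axis_index (axis k (1::real) :: real^'i) = k" for k by (simp add: axis_index_axis)
  have "(\<integral>\<^sup>+z. ennreal (\<Prod>k\<in>UNIV. f k ((z :: real^'i) $ k)) \<partial>lborel)
    = (\<integral>\<^sup>+z. (\<Prod>b\<in>Basis. ennreal (f (axis_index b) ((z :: real^'i) \<bullet> b))) \<partial>lborel)"
    unfolding prod_Basis_cart by (simp add: ax cart_eq_inner_axis[symmetric] prod_ennreal nn)
  also have "\<dots> = (\<Prod>b\<in>(Basis :: (real^'i) set). \<integral>\<^sup>+y. ennreal (f (axis_index b) y) \<partial>lborel)"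
    by (rule nn_integral_lborel_prod) auto
  also have "\<dots> = (\<Prod>k\<in>UNIV. \<integral>\<^sup>+y. ennreal (f k y) \<partial>lborel)"
    unfolding prod_Basis_cart ax ..
  also have "\<dots> = ennreal (\<Prod>k\<in>UNIV. \<integral>y. f k y \<partial>lborel)"
    by (simp add: nn_integral_eq_integral f nn prod_ennreal)
  finally show ?thesis
    by (intro has_bochner_integral_nn_integral m) (auto intro!: prod_nonneg nn AE_I2 integral_nonneg_AE)
qed

lemma integral_gauss_norm_hermite:
  "(\<integral>z. ((norm z)\<^sup>2 - real DIM(real^'d)) * gauss (z :: real^'d) \<partial>lborel) = 0"
  unfolding norm_hermite_sum sum_distrib_right
proof (subst Bochner_Integration.integral_sum)
  show "(\<Sum>k\<in>UNIV. \<integral>z. ((z \<bullet> axis k 1) * (z \<bullet> axis k 1) - (axis k 1 :: real^'d) \<bullet> axis k 1) * gauss (z :: real^'d) \<partial>lborel) = 0"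
    by (intro sum.neutral ballI) (rule integral_hermite_2[OF norm_axis_1])
qed auto

lemma holder_partials_laplacian_power:
  assumes "bounded_holder_partials (2 * \<kappa>) \<alpha> f" "bounded (range f)" "0 < \<alpha>"
  shows "bcp (2 * \<kappa>) f" and "holder_continuous \<alpha> ((laplacian ^^ \<kappa>) f)"
proof -
  show b: "bcp (2 * \<kappa>) f" by (rule bounded_holder_partials_imp_bcp[OF assms])
  show "holder_continuous \<alpha> ((laplacian ^^ \<kappa>) f)"
    by (rule laplacian_power_holder[OF b]) (use assms(1) in \<open>simp add: bounded_holder_partials_def\<close>)
qed

context stable_subordinator_process
begin

lemma inverse_powr: "\<omega> \<in> space N \<Longrightarrow> (L 1 \<omega> powr (- \<beta>)) powr \<gamma> = L 1 \<omega> powr (- \<gamma> * \<beta>)"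
  by (simp add: powr_powr mult.commute)

lemma moment_density:
  fixes g :: "real \<Rightarrow> real"
  assumes \<gamma>: "-1 < \<gamma>" and g: "\<And>y. 0 \<le> g y" "distributed N lborel (L 1) (\<lambda>y. ennreal (g y))"
  shows "integrable N (\<lambda>\<omega>. inverse_motion L 1 \<omega> powr \<gamma>)"
    and "set_integrable lborel {0<..} (\<lambda>y. y powr (- \<gamma> * \<beta>) * g y)"
    and "moment_const N L \<gamma> = (LINT y:{0<..}|lborel. y powr (- \<gamma> * \<beta>) * g y)"
proof -
  let ?h = "\<lambda>y. indicator {0<..} y * y powr (- \<gamma> * \<beta>) :: real"
  have i: "integrable N (\<lambda>\<omega>. (L 1 \<omega> powr (- \<beta>)) powr \<gamma>)" by (rule inverse_moment[OF \<gamma>])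
  then show "integrable N (\<lambda>\<omega>. inverse_motion L 1 \<omega> powr \<gamma>)"
    using integral_inverse_motion(2)[of 1 "\<lambda>y. y powr \<gamma>"] by simp
  \<comment> \<open>Restricting to the open half-line changes nothing on the probability space, as L
    1 is positive on every path.\<close>
  have e: "?h (L 1 \<omega>) = (L 1 \<omega> powr (- \<beta>)) powr \<gamma>" if "\<omega> \<in> space N" for \<omega>
    using L_pos[OF that, of 1] inverse_powr[OF that] by simp
  have "integrable N (\<lambda>\<omega>. ?h (L 1 \<omega>))"
    using i by (subst Bochner_Integration.integrable_cong[OF refl e]) auto
  then have "integrable lborel (\<lambda>y. g y * ?h y)"
    by (subst distributed_integrable[OF g(2)]) (use g in auto)
  moreover have f: "g y * ?h y = indicator {0<..} y *\<^sub>R (y powr (- \<gamma> * \<beta>) * g y)" for y by simp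
  ultimately show "set_integrable lborel {0<..} (\<lambda>y. y powr (- \<gamma> * \<beta>) * g y)" unfolding set_integrable_def by (simp only: f)
  have "moment_const N L \<gamma> = (\<integral>\<omega>. ?h (L 1 \<omega>) \<partial>N)"
    unfolding moment_const_eq by (rule Bochner_Integration.integral_cong[OF refl e[symmetric]])
  also have "\<dots> = (\<integral>y. g y * ?h y \<partial>lborel)"
    by (rule distributed_integral[OF g(2), symmetric]) (use g in auto)
  finally show "moment_const N L \<gamma> = (LINT y:{0<..}|lborel. y powr (- \<gamma> * \<beta>) * g y)"
    unfolding f set_lebesgue_integral_def .
qed

lemma inverse_kernel_nonneg: "(\<And>y. 0 \<le> g y) \<Longrightarrow> 0 < t \<Longrightarrow> 0 \<le> inverse_kernel \<beta> g t x"
  using \<beta> by (simp add: inverse_kernel_def)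

text \<open>The kernel is the density of the inverse at t: the substitution y = t x^(- 1/\<beta>)
  turns it into g and x into t^\<beta> y^(- \<beta>). The power x^k thereby becomes that of a scaled
  copy of Z.\<close>

lemma inverse_kernel_moment:
  fixes g :: "real \<Rightarrow> real" and k :: nat
  assumes t: "0 < t" and g: "\<And>y. 0 \<le> g y" "distributed N lborel (L 1) (\<lambda>y. ennreal (g y))"
  shows "has_bochner_integral lborel (\<lambda>x. indicator {0..} x * (x ^ k * inverse_kernel \<beta> g t x))
    ((t powr \<beta>) ^ k * moment_const N L (real k))"
proof -
  have gm[measurable]: "g \<in> borel_measurable borel"
    using distributed_real_measurable[OF _ g(2)] g(1) by simp
  define F where "F y = (t powr \<beta> * y powr (- \<beta>)) ^ k * g y" for y
  have Fm: "F \<in> borel_measurable borel" unfolding F_def by measurable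
  have Fd: "F y = (t powr \<beta>) ^ k * (y powr (- real k * \<beta>) * g y)" if "0 < y" for y
  proof -
    have "(y powr (- \<beta>)) ^ k = (y powr (- \<beta>)) powr real k" using that by (simp add: powr_realpow)
    then have "(y powr (- \<beta>)) ^ k = y powr (- real k * \<beta>)" by (simp add: powr_powr mult.commute)
    then show ?thesis by (simp add: F_def power_mult_distrib mult.assoc)
  qed
  have Fi: "set_integrable lborel {0<..} F"
  proof -
    have "set_integrable lborel {0<..} (\<lambda>y. (t powr \<beta>) ^ k * (y powr (- real k * \<beta>) * g y))"
      by (intro set_integrable_mult_right moment_density g) simp
    moreover have "set_integrable lborel {0<..} F \<longleftrightarrow>
        set_integrable lborel {0<..} (\<lambda>y. (t powr \<beta>) ^ k * (y powr (- real k * \<beta>) * g y))"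
      by (rule set_integrable_cong) (use Fd in auto)
    ultimately show ?thesis by simp
  qed
  have Fv: "(LINT y:{0<..}|lborel. F y) = (t powr \<beta>) ^ k * moment_const N L (real k)"
  proof -
    have "(LINT y:{0<..}|lborel. F y) = (LINT y:{0<..}|lborel. (t powr \<beta>) ^ k * (y powr (- real k * \<beta>) * g y))"
      by (rule set_lebesgue_integral_cong) (use Fd in auto)
    also have "\<dots> = (t powr \<beta>) ^ k * moment_const N L (real k)"
      using moment_density(3)[OF _ g, of "real k"] by simp
    finally show ?thesis .
  qed
  have p: "- 1 / \<beta> \<noteq> 0" using \<beta> by simp
  \<comment> \<open>The substitution lives on the open half-line, the claim on the closed one; they
    agree because \<open>0 powr\<close> anything is 0, so the kernel vanishes at x = 0.\<close>
  have G: "indicator {0<..} x *\<^sub>R (\<bar>t * (- 1 / \<beta>)\<bar> * x powr (- 1 / \<beta> - 1) * F (t * x powr (- 1 / \<beta>))) = indicator {0..} x * (x ^ k * inverse_kernel \<beta> g t x)" for x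
  proof (cases "0 < x")
    case True
    have "(t * x powr (- 1 / \<beta>)) powr (- \<beta>) = t powr (- \<beta>) * x"
      using t True \<beta> by (simp add: powr_mult powr_powr)
    moreover have "t powr \<beta> * t powr (- \<beta>) = 1" using t by (simp add: powr_minus)
    ultimately have "t powr \<beta> * (t * x powr (- 1 / \<beta>)) powr (- \<beta>) = x" by (simp add: mult.assoc[symmetric])
    then have "F (t * x powr (- 1 / \<beta>)) = x ^ k * g (t * x powr (- 1 / \<beta>))" by (simp add: F_def)
    moreover have e: "- 1 / \<beta> - 1 = - 1 - 1 / \<beta>" by simp
    moreover have "\<bar>t * (- 1 / \<beta>)\<bar> = t / \<beta>" using t \<beta> by (simp add: abs_mult)
    ultimately show ?thesis using True unfolding e by (simp add: inverse_kernel_def)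
  next
    case False
    then show ?thesis by (auto simp: indicator_def inverse_kernel_def)
  qed
  show ?thesis
    using lborel_power_substitution[OF Fm t p] Fi Fv
    unfolding set_integrable_def set_lebesgue_integral_def G has_bochner_integral_iff by simp
qed

lemma inverse_motion_powr:
  assumes \<gamma>: "-1 < \<gamma>" and t: "0 < t"
  shows "integrable N (\<lambda>\<omega>. inverse_motion L t \<omega> powr \<gamma>)"
    and "integrable N (\<lambda>\<omega>. L 1 \<omega> powr (- \<gamma> * \<beta>))"
    and "(\<integral>\<omega>. inverse_motion L t \<omega> powr \<gamma> \<partial>N) = (\<integral>\<omega>. (L 1 \<omega> / t) powr (- \<gamma> * \<beta>) \<partial>N)"
    and "(\<integral>\<omega>. (L 1 \<omega> / t) powr (- \<gamma> * \<beta>) \<partial>N) = t powr (\<gamma> * \<beta>) * (\<integral>\<omega>. L 1 \<omega> powr (- \<gamma> * \<beta>) \<partial>N)"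
    and "(\<integral>\<omega>. L 1 \<omega> powr (- \<gamma> * \<beta>) \<partial>N) = moment_const N L \<gamma>"
proof -
  have i: "integrable N (\<lambda>\<omega>. (L 1 \<omega> powr (- \<beta>)) powr \<gamma>)" by (rule inverse_moment[OF \<gamma>])
  then show I: "integrable N (\<lambda>\<omega>. L 1 \<omega> powr (- \<gamma> * \<beta>))"
    by (subst (asm) Bochner_Integration.integrable_cong[OF refl inverse_powr]) auto
  have e1: "(t powr \<beta> * L 1 \<omega> powr (- \<beta>)) powr \<gamma> = t powr (\<gamma> * \<beta>) * L 1 \<omega> powr (- \<gamma> * \<beta>)" for \<omega>
    by (simp add: powr_mult powr_powr mult.commute)
  have e2: "(L 1 \<omega> / t) powr (- \<gamma> * \<beta>) = t powr (\<gamma> * \<beta>) * L 1 \<omega> powr (- \<gamma> * \<beta>)" if "\<omega> \<in> space N" for \<omega>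
  proof -
    have "(L 1 \<omega> / t) powr (- \<gamma> * \<beta>) = L 1 \<omega> powr (- \<gamma> * \<beta>) / t powr (- \<gamma> * \<beta>)"
      by (rule powr_divide)
    moreover have "inverse (t powr (- \<gamma> * \<beta>)) = t powr (\<gamma> * \<beta>)" by (simp add: powr_minus)
    ultimately show ?thesis by (simp only: divide_inverse mult.commute)
  qed
  have "integrable N (\<lambda>\<omega>. (t powr \<beta> * L 1 \<omega> powr (- \<beta>)) powr \<gamma>)" unfolding e1 by (intro integrable_mult_right I)
  then show "integrable N (\<lambda>\<omega>. inverse_motion L t \<omega> powr \<gamma>)"
    using integral_inverse_motion(2)[OF less_imp_le[OF t], of "\<lambda>y. y powr \<gamma>"] by simp
  have "(\<integral>\<omega>. (L 1 \<omega> / t) powr (- \<gamma> * \<beta>) \<partial>N) = (\<integral>\<omega>. t powr (\<gamma> * \<beta>) * L 1 \<omega> powr (- \<gamma> * \<beta>) \<partial>N)"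
    by (rule Bochner_Integration.integral_cong[OF refl e2])
  then show E2: "(\<integral>\<omega>. (L 1 \<omega> / t) powr (- \<gamma> * \<beta>) \<partial>N) = t powr (\<gamma> * \<beta>) * (\<integral>\<omega>. L 1 \<omega> powr (- \<gamma> * \<beta>) \<partial>N)" by simp
  show "(\<integral>\<omega>. inverse_motion L t \<omega> powr \<gamma> \<partial>N) = (\<integral>\<omega>. (L 1 \<omega> / t) powr (- \<gamma> * \<beta>) \<partial>N)"
    unfolding E2 using integral_inverse_motion(1)[OF less_imp_le[OF t], of "\<lambda>y. y powr \<gamma>"] by (simp add: e1)
  show "(\<integral>\<omega>. L 1 \<omega> powr (- \<gamma> * \<beta>) \<partial>N) = moment_const N L \<gamma>"
    unfolding moment_const_eq by (rule Bochner_Integration.integral_cong[OF refl inverse_powr[symmetric]])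
qed

end

section \<open>Boundary values and time derivatives of the functionals of the sheet\<close>

lemma set_coord_simps [simp]:
  "set_coord t j s $ j = s" "i \<noteq> j \<Longrightarrow> set_coord t j s $ i = t $ i" "set_coord t j (t $ j) = t"
  by (auto simp: set_coord_def vec_eq_iff)

lemma pos_imp_nonneg_orthant: "t \<in> pos_orthant \<Longrightarrow> t \<in> nonneg_orthant"
  by (simp add: pos_orthant_def nonneg_orthant_def less_imp_le)

lemma set_coord_nonneg: "t \<in> nonneg_orthant \<Longrightarrow> 0 \<le> s \<Longrightarrow> set_coord t j s \<in> nonneg_orthant"
  by (auto simp: nonneg_orthant_def set_coord_def)

context clocked_sheet
begin

lemma other_clocks_set_coord [simp]: "other_clocks \<Lambda> j (set_coord t j s) = other_clocks \<Lambda> j t"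
  by (auto simp: other_clocks_def fun_eq_iff intro!: prod.cong)

text \<open>The law of A does not see the j-th time, so differentiating in that time leaves the
  measure alone.\<close>

lemma alpha_set_coord [simp]: "alpha j (set_coord t j s) = alpha j t"
  by (simp add: alpha_def)

lemma alpha_moment:
  assumes t: "t \<in> nonneg_orthant"
  shows "has_bochner_integral (alpha j t) (\<lambda>a. a ^ k) (\<Prod>i\<in>UNIV - {j}. (t $ i powr \<beta>) ^ k * moment_const N L (real k))"
proof -
  have [measurable]: "other_clocks \<Lambda> j t \<in> borel_measurable M" by (rule measurable_other_clocks[OF t])
  show ?thesis
    using other_clocks_moment[OF t, of j k]
    unfolding alpha_def has_bochner_integral_iff by (simp add: integrable_distr_eq integral_distr)
qed

lemma zeta_moment: "(\<integral>z. z ^ k \<partial>zeta) = moment_const N L (real k)"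
  unfolding zeta_def stable.moment_const_nat by (subst integral_distr) auto

lemma mixed_law_alpha:
  assumes t: "t \<in> pos_orthant"
  shows "mixed_law (alpha j t) zeta \<beta>"
proof -
  have tn: "t \<in> nonneg_orthant" using t by (rule pos_imp_nonneg_orthant)
  have m[measurable]: "other_clocks \<Lambda> j t \<in> borel_measurable M" by (rule measurable_other_clocks[OF tn])
  interpret A: prob_space "alpha j t" unfolding alpha_def by (rule prob_space_distr) simp
  show ?thesis
  proof
    show "sets (alpha j t) = sets borel" by (simp add: alpha_def)
    have "AE \<omega> in M. \<forall>i. 0 < \<Lambda> i (t $ i) \<omega>"
      unfolding AE_all_countable using t by (auto simp: pos_orthant_def intro!: clock_AE_pos)
    then have "AE \<omega> in M. 0 < other_clocks \<Lambda> j t \<omega>"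
      by eventually_elim (auto simp: other_clocks_def intro!: prod_pos)
    then show "AE a in alpha j t. 0 < a" unfolding alpha_def by (subst AE_distr_iff) auto
    show "integrable (alpha j t) (\<lambda>a. a ^ k)" for k
      using alpha_moment[OF tn, of j k] by (simp add: has_bochner_integral_iff)
  qed
qed

text \<open>At \<open>t $ j = 0\<close> the variance is 0 and the Gaussian average becomes
  evaluation at x, which decouples from A. The exponent k = 0 gives the boundary value of u, k = 1
  that of \<open>V_fun\<close>, and k = \<nu> that of \<open>U_fun\<close>.\<close>

lemma functional_at_zero:
  fixes h :: "real^'d \<Rightarrow> real"
  assumes t: "t \<in> nonneg_orthant" "t $ j = 0" and h: "continuous_on UNIV h" "\<And>y. \<bar>h y\<bar> \<le> K"
  shows "(\<integral>\<omega>. other_clocks \<Lambda> j t \<omega> ^ k * h (time_changed_sheet W \<Lambda> x t \<omega>) \<partial>M) =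
    (\<Prod>i\<in>UNIV - {j}. (t $ i powr \<beta>) ^ k * moment_const N L (real k)) * h x"
proof -
  interpret A: prob_space "alpha j t"
    unfolding alpha_def by (rule prob_space_distr) (rule measurable_other_clocks[OF t(1)])
  interpret P: pair_prob_space "alpha j t" zeta ..
  have sfs: "sigma_finite_measure (alpha j t)" "sigma_finite_measure zeta" by unfold_locales
  have a: "integrable (alpha j t) (\<lambda>a. a ^ k)" "(\<integral>a. a ^ k \<partial>alpha j t) = (\<Prod>i\<in>UNIV - {j}. (t $ i powr \<beta>) ^ k * moment_const N L (real k))"
    using alpha_moment[OF t(1), of j k] by (auto simp: has_bochner_integral_iff)
  have "(\<integral>\<omega>. other_clocks \<Lambda> j t \<omega> ^ k * h (time_changed_sheet W \<Lambda> x t \<omega>) \<partial>M) =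
    (\<integral>p. fst p ^ k * (\<lambda>_. h x) (snd p) \<partial>(alpha j t \<Otimes>\<^sub>M zeta))"
    unfolding sheet_functional(2)[OF t(1) h] using t(2) by (simp add: heat_0 integral_gauss)
  also have "\<dots> = (\<integral>a. a ^ k \<partial>alpha j t) * (\<integral>z. h x \<partial>zeta)"
    by (rule pair_integral_product(2)[OF sfs a(1)]) simp
  finally show ?thesis unfolding a(2) by (simp add: zeta.prob_space)
qed

text \<open>A copy shares only the law of the inverse motion, so its value at time 0 is known almost
  surely rather than pathwise; a nonnegative variable with mean 0 vanishes almost surely.\<close>

lemma other_clocks_zero:
  assumes t: "t \<in> nonneg_orthant" and i: "i \<noteq> j" "t $ i = 0"
  shows "AE \<omega> in M. other_clocks \<Lambda> j t \<omega> = 0"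
proof -
  have "has_bochner_integral M (\<lambda>\<omega>. \<Lambda> i 0 \<omega> ^ 1) ((0 powr \<beta>) ^ 1 * moment_const N L (real 1))"
    by (rule clock_moment) simp
  then have "integrable M (\<Lambda> i 0)" "(\<integral>\<omega>. \<Lambda> i 0 \<omega> \<partial>M) = 0" by (auto simp: has_bochner_integral_iff)
  then have "AE \<omega> in M. \<Lambda> i 0 \<omega> = 0"
    using clock_nonneg[of 0 _ i] by (subst (asm) integral_nonneg_eq_0_iff_AE) (auto intro!: AE_I2)
  then show ?thesis
    unfolding other_clocks_def by eventually_elim (rule prod_zero, simp, rule bexI[of _ i], use i in auto)
qed

lemma u_fun_boundary:
  fixes f :: "real^'d \<Rightarrow> real"
  assumes t: "t \<in> orthant_boundary" and f: "continuous_on UNIV f" "\<And>y. \<bar>f y\<bar> \<le> K"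
  shows "u_fun M W \<Lambda> f t x = f x"
proof -
  obtain j where j: "t \<in> nonneg_orthant" "t $ j = 0" using t by (auto simp: orthant_boundary_def)
  have "moment_const N L 0 = 1" using stable.moment_const_nat[of 0] by (simp add: stable.prob_space)
  then show ?thesis using functional_at_zero[OF j f, of 0 x] by (simp add: u_fun_def)
qed

lemma u_fun_eq:
  fixes f :: "real^'d \<Rightarrow> real"
  assumes t: "t \<in> nonneg_orthant" and s: "0 \<le> s" and f: "continuous_on UNIV f" "\<And>y. \<bar>f y\<bar> \<le> K"
  shows "u_fun M W \<Lambda> f (set_coord t j s) x =
    (\<integral>p. heat (fst p * (s powr \<beta> * snd p)) (\<lambda>_. 1) f x \<partial>(alpha j t \<Otimes>\<^sub>M zeta))"
  using sheet_functional(2)[OF set_coord_nonneg[OF t s, of j] f, of j 0 x] by (simp add: u_fun_def)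

lemma N_fun_eq:
  assumes t: "t \<in> nonneg_orthant"
  shows "N_fun M \<Lambda> \<nu> j t = (\<Prod>i\<in>UNIV - {j}. (t $ i powr \<beta>) ^ \<nu> * moment_const N L (real \<nu>))"
proof -
  have "(\<integral>\<omega>. \<Lambda> i (t $ i) \<omega> ^ \<nu> \<partial>M) = (t $ i powr \<beta>) ^ \<nu> * moment_const N L (real \<nu>)" for i
    using clock_moment[of "t $ i" i \<nu>] t by (simp add: nonneg_orthant_def has_bochner_integral_iff)
  then show ?thesis by (simp add: N_fun_def)
qed

lemma M_fun_eq:
  assumes t: "t \<in> nonneg_orthant"
  shows "M_fun M \<Lambda> \<kappa> j t = (\<integral>a. a ^ \<kappa> \<partial>alpha j t) * (\<integral>z. z ^ \<kappa> \<partial>zeta) / fact \<kappa> * (t $ j powr \<beta>) ^ \<kappa>"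
    and "M_fun M \<Lambda> \<kappa> j t = (\<Prod>i\<in>UNIV. (t $ i powr \<beta>) ^ \<kappa> * moment_const N L (real \<kappa>)) / fact \<kappa>"
proof -
  have c: "(\<integral>\<omega>. \<Lambda> i (t $ i) \<omega> ^ \<kappa> \<partial>M) = (t $ i powr \<beta>) ^ \<kappa> * moment_const N L (real \<kappa>)" for i
    using clock_moment[of "t $ i" i \<kappa>] t by (simp add: nonneg_orthant_def has_bochner_integral_iff)
  have a: "(\<integral>a. a ^ \<kappa> \<partial>alpha j t) = (\<Prod>i\<in>UNIV - {j}. (t $ i powr \<beta>) ^ \<kappa> * moment_const N L (real \<kappa>))"
    using alpha_moment[OF t, of j \<kappa>] by (simp add: has_bochner_integral_iff)
  show "M_fun M \<Lambda> \<kappa> j t = (\<integral>a. a ^ \<kappa> \<partial>alpha j t) * (\<integral>z. z ^ \<kappa> \<partial>zeta) / fact \<kappa> * (t $ j powr \<beta>) ^ \<kappa>"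
    unfolding M_fun_def c a zeta_moment by simp
  show "M_fun M \<Lambda> \<kappa> j t = (\<Prod>i\<in>UNIV. (t $ i powr \<beta>) ^ \<kappa> * moment_const N L (real \<kappa>)) / fact \<kappa>"
    unfolding M_fun_def c by (subst prod_UNIV_remove[of _ j]) simp
qed

text \<open>With \<open>\<phi>1\<close> equal to half the heat average of the Laplacian of f,
  \<open>caputo_mixture\<close> yields half of the mixture of that Laplacian weighted by A. Since f
  has two bounded continuous orders of derivatives, the Laplacian can be taken outside, where it
  acts on \<open>V_fun\<close>.\<close>

lemma sheet_caputo:
  fixes f :: "real^'d \<Rightarrow> real" and j :: 'n and x :: "real^'d"
  assumes t: "t \<in> pos_orthant" and f: "bcp 2 f"
  defines "u \<equiv> \<lambda>s. u_fun M W \<Lambda> f (set_coord t j s) x"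
  shows "caputo_differentiable \<beta> u (t $ j)"
    and "caputo_derivative \<beta> u (t $ j) = 1 / 2 * laplacian (V_fun M W \<Lambda> f j t) x"
proof -
  have tn: "t \<in> nonneg_orthant" using t by (rule pos_imp_nonneg_orthant)
  have tj: "0 < t $ j" using t by (simp add: pos_orthant_def)
  interpret X: mixed_law "alpha j t" zeta \<beta> by (rule mixed_law_alpha[OF t])
  obtain K where K: "\<And>y. \<bar>f y\<bar> \<le> K" using bcp_bound[OF f] by metis
  note fc = bcp_continuous[OF f]
  have lb: "bcp 0 (laplacian f)" by (rule bcp_laplacian) (use f in \<open>simp add: numeral_2_eq_2\<close>)
  obtain K1 where K1: "\<And>y. \<bar>laplacian f y\<bar> \<le> K1" using bcp_bound[OF lb] by metis
  note lc = bcp_continuous[OF lb]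
  define \<phi> where "\<phi> r = heat r (\<lambda>_. 1) f x" for r
  define \<phi>1 where "\<phi>1 r = heat r (\<lambda>_. 1) (laplacian f) x / 2" for r
  have \<phi>: "continuous_on UNIV \<phi>" "\<And>r. \<bar>\<phi> r\<bar> \<le> K"
    unfolding \<phi>_def using heat_continuous_on[OF fc K] heat_1_bound[OF bcp_measurable[OF f] K] by auto
  have \<phi>1: "continuous_on UNIV \<phi>1" "\<And>r. \<bar>\<phi>1 r\<bar> \<le> K1"
  proof -
    show "continuous_on UNIV \<phi>1" unfolding \<phi>1_def by (intro continuous_intros heat_continuous_on[OF lc K1]) simp_all
    show "\<bar>\<phi>1 r\<bar> \<le> K1" for r
      using heat_1_bound[OF bcp_measurable[OF lb] K1, of r x] unfolding \<phi>1_def by simp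
  qed
  have der: "(\<phi> has_real_derivative \<phi>1 r) (at r)" if "0 < r" for r
    unfolding \<phi>_def \<phi>1_def by (rule heat_equation[OF f that])
  define v where "v s = \<beta> * s powr (\<beta> - 1) * X.timeJ \<phi>1 (s powr \<beta>)" for s
  have du: "(u has_real_derivative v s) (at s)" if s: "0 < s" for s
  \<comment> \<open>The representation of u by a fixed product measure is available for s \<ge> 0
    only, hence the comparison on the open half-line.\<close>
  proof (rule has_field_derivative_transform_within_open[where S="{0<..}"])
    show "((\<lambda>s. \<integral>p. \<phi> (fst p * (s powr \<beta> * snd p)) \<partial>X.P) has_real_derivative v s) (at s)"
      unfolding v_def by (rule X.time_derivative[OF \<phi> der \<phi>1 s])
    show "(\<integral>p. \<phi> (fst p * (s powr \<beta> * snd p)) \<partial>X.P) = u s" if "s \<in> {0<..}" for s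
      unfolding u_def \<phi>_def using u_fun_eq[OF tn _ fc K, of s j x] that by simp
  qed (use s in auto)
  have dv: "deriv u s = v s" if "0 < s" for s using du[OF that] by (rule DERIV_imp_deriv)
  have "continuous_on {0<..} v"
    unfolding v_def
    by (intro continuous_intros continuous_on_compose2[OF X.timeJ_continuous[OF \<phi>1]]) auto
  then have cd: "continuous_on {0<..} (deriv u)"
    by (subst continuous_on_cong[OF refl, of _ _ v]) (auto simp: dv)
  have si: "set_integrable lborel {0<..<t $ j} (\<lambda>s. deriv u s / (t $ j - s) powr \<beta>)"
    using X.caputo_mixture(1)[OF \<phi>1 tj, folded v_def]
    by (subst set_integrable_cong[OF refl refl]) (auto simp: dv)
  show "caputo_differentiable \<beta> u (t $ j)"
    unfolding caputo_differentiable_def using du cd si by (auto simp: field_differentiable_def)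
  have V: "V_fun M W \<Lambda> f j t = X.mixed (t $ j powr \<beta>) 1 f"
    unfolding V_fun_def X.mixed_def using sheet_functional(2)[OF tn fc K, of j 1] by (auto simp: fun_eq_iff)
  have "(LINT s:{0<..<t $ j}|lborel. deriv u s / (t $ j - s) powr \<beta>) = (LINT s:{0<..<t $ j}|lborel. v s / (t $ j - s) powr \<beta>)"
    by (rule set_lebesgue_integral_cong) (auto simp: dv)
  then have "caputo_derivative \<beta> u (t $ j) = (\<integral>p. fst p * \<phi>1 (fst p * (t $ j powr \<beta> * snd p)) \<partial>X.P)"
    unfolding caputo_derivative_def using X.caputo_mixture(2)[OF \<phi>1 tj, folded v_def] by simp
  also have "\<dots> = 1 / 2 * X.mixed (t $ j powr \<beta>) 1 (laplacian f) x"
    unfolding X.mixed_def \<phi>1_def by simp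
  finally show "caputo_derivative \<beta> u (t $ j) = 1 / 2 * laplacian (V_fun M W \<Lambda> f j t) x"
    unfolding V X.mixed_laplacian[OF f] .
qed

lemma sheet_partials_exist:
  fixes f :: "real^'d \<Rightarrow> real"
  assumes t: "t \<in> pos_orthant" and f: "bounded_holder_partials m \<alpha> f" "bounded (range f)" and \<alpha>: "0 < \<alpha>" "\<alpha> \<le> 1" and k: "1 \<le> k"
  shows "partials_exist (m + 2) (\<lambda>x. \<integral>\<omega>. other_clocks \<Lambda> j t \<omega> ^ k * f (time_changed_sheet W \<Lambda> x t \<omega>) \<partial>M)"
proof -
  have tn: "t \<in> nonneg_orthant" using t by (rule pos_imp_nonneg_orthant)
  interpret X: mixed_law "alpha j t" zeta \<beta> by (rule mixed_law_alpha[OF t])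
  have b: "bcp m f" by (rule bounded_holder_partials_imp_bcp[OF f \<alpha>(1)])
  obtain K where K: "\<And>y. \<bar>f y\<bar> \<le> K" using bcp_bound[OF b] by metis
  have "(\<lambda>x. \<integral>\<omega>. other_clocks \<Lambda> j t \<omega> ^ k * f (time_changed_sheet W \<Lambda> x t \<omega>) \<partial>M) = X.mixed (t $ j powr \<beta>) k f"
    unfolding X.mixed_def using sheet_functional(2)[OF tn bcp_continuous[OF b] K, of j k] by (auto simp: fun_eq_iff)
  moreover have "partials_exist (m + 2) (X.mixed (t $ j powr \<beta>) k f)"
    by (rule X.partials_exist_mixed[OF b _ \<alpha> _ k]) (use f(1) t in \<open>auto simp: bounded_holder_partials_def pos_orthant_def less_imp_neq[symmetric]\<close>)
  ultimately show ?thesis by simp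
qed

lemma M_fun_has_derivative:
  assumes t: "t \<in> pos_orthant"
  shows "((\<lambda>s. M_fun M \<Lambda> \<kappa> j (set_coord t j s)) has_real_derivative
    (\<integral>a. a ^ \<kappa> \<partial>alpha j t) * (\<integral>z. z ^ \<kappa> \<partial>zeta) / fact \<kappa> * (\<beta> * real \<kappa> * t $ j powr (\<beta> * real \<kappa> - 1))) (at (t $ j))"
proof (rule has_field_derivative_transform_within_open[where S="{0<..}"])
  have tn: "t \<in> nonneg_orthant" using t by (rule pos_imp_nonneg_orthant)
  show "t $ j \<in> {0<..}" using t by (simp add: pos_orthant_def)
  then have tj: "0 < t $ j" by simp
  let ?c = "(\<integral>a. a ^ \<kappa> \<partial>alpha j t) * (\<integral>z. z ^ \<kappa> \<partial>zeta) / fact \<kappa>"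
  show "((\<lambda>s. ?c * s powr (\<beta> * real \<kappa>)) has_real_derivative ?c * (\<beta> * real \<kappa> * t $ j powr (\<beta> * real \<kappa> - 1))) (at (t $ j))"
    using tj by (intro DERIV_cmult) (auto intro!: derivative_eq_intros)
  show "?c * s powr (\<beta> * real \<kappa>) = M_fun M \<Lambda> \<kappa> j (set_coord t j s)" if "s \<in> {0<..}" for s
  proof -
    have s: "0 < s" using that by simp
    then have "(s powr \<beta>) ^ \<kappa> = (s powr \<beta>) powr real \<kappa>" by (simp add: powr_realpow)
    then have "(s powr \<beta>) ^ \<kappa> = s powr (\<beta> * real \<kappa>)" by (simp add: powr_powr)
    then show ?thesis using M_fun_eq(1)[OF set_coord_nonneg[OF tn, of s j], of \<kappa> j] s by simp
  qed
qed simp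

text \<open>\<open>taylor_mixture\<close> splits the chain-rule expression in two. The Taylor
  coefficients at variance 0 pair with the time derivatives of \<open>M_fun\<close>; the mean of
  A^\<nu> times the top derivative is recognised as the last Laplacian of the mixture of F.\<close>

lemma sheet_time_derivative:
  fixes f :: "real^'d \<Rightarrow> real" and \<nu> :: nat
  assumes t: "t \<in> pos_orthant" and \<nu>: "2 \<le> \<nu>" "\<beta> = 1 / real \<nu>"
    and f: "bounded_holder_partials (2 * \<nu> - 2) \<alpha> f" "bounded (range f)" and \<alpha>: "0 < \<alpha>" "\<alpha> \<le> 1"
  shows "((\<lambda>s. u_fun M W \<Lambda> f (set_coord t j s) x) has_real_derivative
     (\<Sum>\<kappa>=1..\<nu> - 1. (laplacian ^^ \<kappa>) f x / 2 ^ \<kappa> * deriv (\<lambda>s. M_fun M \<Lambda> \<kappa> j (set_coord t j s)) (t $ j)) +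
     1 / 2 ^ \<nu> * (laplacian ^^ \<nu>) (U_fun M W \<Lambda> f \<nu> j t) x) (at (t $ j))"
proof -
  have tn: "t \<in> nonneg_orthant" using t by (rule pos_imp_nonneg_orthant)
  have tj: "0 < t $ j" using t by (simp add: pos_orthant_def)
  interpret X: mixed_law "alpha j t" zeta \<beta> by (rule mixed_law_alpha[OF t])
  define n where "n = \<nu> - 1"
  have n: "\<nu> = Suc n" "0 < n" "2 * \<nu> - 2 = 2 * n" using \<nu>(1) by (auto simp: n_def)
  note h = holder_partials_laplacian_power[OF f(1)[unfolded n(3)] f(2) \<alpha>(1)]
  have lb: "bcp m ((laplacian ^^ \<kappa>) f)" if "2 * \<kappa> + m \<le> 2 * n" for \<kappa> m
    by (rule laplacian_power_bcp) (use that h(1) bcp_mono in blast)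
  define F where "F = (laplacian ^^ n) f"
  have Fb: "bcp 0 F" unfolding F_def by (rule lb) simp
  obtain KF where KF: "\<And>y. \<bar>F y\<bar> \<le> KF" using bcp_bound[OF Fb] by metis
  note Fc = bcp_continuous[OF Fb]
  have ho: "holder_continuous \<alpha> F" unfolding F_def by (rule h(2))
  let ?w = "\<lambda>z :: real^'d. (norm z)\<^sup>2 - real DIM(real^'d)"
  have tw: "tempered ?w" by (intro tempered_diff tempered_power tempered_norm tempered_const)
  \<comment> \<open>The \<kappa>-th derivative of the heat flow in r. Below order \<nu> every
    derivative falls on f as half a Laplacian; the last one falls on the Gaussian, because F has no
    further derivatives. This choice carries the singularity at r = 0.\<close>
  define \<phi> where "\<phi> \<kappa> r = (if \<kappa> < \<nu> then heat r (\<lambda>_. 1) ((laplacian ^^ \<kappa>) f) x / 2 ^ \<kappa>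
     else (1 / r * heat r ?w F x) / 2 ^ \<nu>)" for \<kappa> :: nat and r :: real
  have cont: "continuous_on UNIV (\<phi> \<kappa>)" if "\<kappa> < \<nu>" for \<kappa>
  proof -
    have b: "bcp 0 ((laplacian ^^ \<kappa>) f)" by (rule lb) (use that n in simp)
    obtain K where K: "\<And>y. \<bar>(laplacian ^^ \<kappa>) f y\<bar> \<le> K" using bcp_bound[OF b] by metis
    have "continuous_on UNIV (\<lambda>r. heat r (\<lambda>_. 1) ((laplacian ^^ \<kappa>) f) x / 2 ^ \<kappa>)"
      by (intro continuous_intros heat_continuous_on[OF bcp_continuous[OF b] K]) simp_all
    then show ?thesis using that by (simp add: \<phi>_def[abs_def])
  qed
  have bd: "\<exists>K. \<forall>r. \<bar>\<phi> \<kappa> r\<bar> \<le> K" if "\<kappa> < \<nu>" for \<kappa>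
  proof -
    have b: "bcp 0 ((laplacian ^^ \<kappa>) f)" by (rule lb) (use that n in simp)
    obtain K where K: "\<And>y. \<bar>(laplacian ^^ \<kappa>) f y\<bar> \<le> K" using bcp_bound[OF b] by metis
    have "\<bar>\<phi> \<kappa> r\<bar> \<le> K / 2 ^ \<kappa>" for r
      using heat_1_bound[OF bcp_measurable[OF b] K, of r x] that by (simp add: \<phi>_def divide_right_mono)
    then show ?thesis by blast
  qed
  have der: "(\<phi> \<kappa> has_real_derivative \<phi> (Suc \<kappa>) r) (at r)" if \<kappa>: "\<kappa> < \<nu>" and r: "0 < r" for \<kappa> r
  proof (cases "Suc \<kappa> < \<nu>")
    case True
    have b: "bcp 2 ((laplacian ^^ \<kappa>) f)" by (rule lb) (use True n in simp)
    have "((\<lambda>r. heat r (\<lambda>_. 1) ((laplacian ^^ \<kappa>) f) x / 2 ^ \<kappa>) has_real_derivative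
        heat r (\<lambda>_. 1) (laplacian ((laplacian ^^ \<kappa>) f)) x / 2 / 2 ^ \<kappa>) (at r)"
      by (intro DERIV_cdivide heat_equation[OF b r])
    then show ?thesis using True \<kappa> by (simp add: \<phi>_def[abs_def])
  next
    case False
    then have \<kappa>n: "\<kappa> = n" using \<kappa> n by simp
    have "((\<lambda>r. heat r (\<lambda>_. 1) F x / 2 ^ n) has_real_derivative heat r ?w F x / (2 * r) / 2 ^ n) (at r)"
      by (intro DERIV_cdivide heat_has_time_derivative[OF bcp_measurable[OF Fb] KF r])
    moreover have "heat r ?w F x / (2 * r) / 2 ^ n = 1 / r * heat r ?w F x / 2 ^ \<nu>" unfolding n(1) by simp
    moreover have "\<phi> \<kappa> = (\<lambda>r. heat r (\<lambda>_. 1) F x / 2 ^ n)" "\<phi> (Suc \<kappa>) r = 1 / r * heat r ?w F x / 2 ^ \<nu>"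
      using \<kappa>n n by (auto simp: \<phi>_def F_def)
    ultimately show ?thesis by (simp only:)
  qed
  obtain K0 where K0: "\<And>r. \<bar>\<phi> 0 r\<bar> \<le> K0" using bd[of 0] \<nu>(1) by auto
  obtain K1 where K1: "\<And>r. \<bar>\<phi> 1 r\<bar> \<le> K1" using bd[of 1] \<nu>(1) by auto
  obtain C where C: "0 \<le> C" "\<And>r y. 0 < r \<Longrightarrow> \<bar>1 / r * heat r ?w F y\<bar> \<le> C * r powr (- (1 - \<alpha> / 2))"
    using X.smooth2_bounds[OF Fc KF ho \<alpha> tw integral_gauss_norm_hermite] by auto
  have hw: "continuous_on UNIV (\<lambda>r. heat r ?w F x)" by (rule heat_continuous_on[OF Fc KF tw])
  have top: "continuous_on {0<..} (\<phi> \<nu>)" "\<phi> \<nu> \<in> borel_measurable borel"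
  proof -
    have "continuous_on {0<..} (\<lambda>r. 1 / r * heat r ?w F x / 2 ^ \<nu>)"
      by (intro continuous_intros continuous_on_subset[OF hw]) auto
    then show "continuous_on {0<..} (\<phi> \<nu>)" by (simp add: \<phi>_def[abs_def])
    have [measurable]: "(\<lambda>r. heat r ?w F x) \<in> borel_measurable borel" by (rule borel_measurable_continuous_onI[OF hw])
    have "(\<lambda>r. 1 / r * heat r ?w F x / 2 ^ \<nu>) \<in> borel_measurable borel" by measurable
    then show "\<phi> \<nu> \<in> borel_measurable borel" by (simp add: \<phi>_def[abs_def])
  qed
  have bound: "\<bar>\<phi> \<nu> r\<bar> \<le> C * r powr (\<alpha> / 2 - 1)" if "0 < r" for r
  proof -
    have "\<bar>\<phi> \<nu> r\<bar> = \<bar>1 / r * heat r ?w F x\<bar> / 2 ^ \<nu>" by (simp add: \<phi>_def abs_mult)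
    also have "\<dots> \<le> \<bar>1 / r * heat r ?w F x\<bar> / 1" by (intro divide_left_mono) auto
    also have "\<dots> \<le> C * r powr (\<alpha> / 2 - 1)" using C(2)[OF that, of x] by simp
    finally show ?thesis .
  qed
  have D: "((\<lambda>s. u_fun M W \<Lambda> f (set_coord t j s) x) has_real_derivative
      \<beta> * t $ j powr (\<beta> - 1) * X.timeJ (\<phi> 1) (t $ j powr \<beta>)) (at (t $ j))"
  proof (rule has_field_derivative_transform_within_open[where S="{0<..}"])
    show "((\<lambda>s. \<integral>p. \<phi> 0 (fst p * (s powr \<beta> * snd p)) \<partial>X.P) has_real_derivative
        \<beta> * t $ j powr (\<beta> - 1) * X.timeJ (\<phi> 1) (t $ j powr \<beta>)) (at (t $ j))"
      by (rule X.time_derivative[OF cont K0 _ cont K1 tj]) (use der[of 0] \<nu>(1) in auto)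
    have f0: "bcp 0 f" using lb[of 0 0] by simp
    obtain K where K: "\<And>y. \<bar>f y\<bar> \<le> K" using bcp_bound[OF f0] by metis
    show "(\<integral>p. \<phi> 0 (fst p * (s powr \<beta> * snd p)) \<partial>X.P) = u_fun M W \<Lambda> f (set_coord t j s) x" if "s \<in> {0<..}" for s
      using u_fun_eq[OF tn _ bcp_continuous[OF f0] K, of s j x] that \<nu>(1) by (simp add: \<phi>_def)
  qed (use tj in auto)
  have "\<beta> * t $ j powr (\<beta> - 1) * X.timeJ (\<phi> 1) (t $ j powr \<beta>) =
    (\<Sum>i<n. \<phi> (Suc i) 0 * ((\<integral>a. a ^ Suc i \<partial>alpha j t) * (\<integral>z. z ^ Suc i \<partial>zeta) / fact (Suc i) * (\<beta> * real (Suc i) * t $ j powr (\<beta> * real (Suc i) - 1)))) +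
    (\<integral>p. fst p ^ \<nu> * \<phi> \<nu> (fst p * (t $ j powr \<beta> * snd p)) \<partial>X.P)"
    by (rule X.taylor_mixture[OF \<nu>(2) n(1,2) _ K1 _ top bound _ tj]) (use cont der \<alpha> n in auto)
  also have "(\<Sum>i<n. \<phi> (Suc i) 0 * ((\<integral>a. a ^ Suc i \<partial>alpha j t) * (\<integral>z. z ^ Suc i \<partial>zeta) / fact (Suc i) * (\<beta> * real (Suc i) * t $ j powr (\<beta> * real (Suc i) - 1))))
    = (\<Sum>\<kappa>=1..\<nu> - 1. (laplacian ^^ \<kappa>) f x / 2 ^ \<kappa> * deriv (\<lambda>s. M_fun M \<Lambda> \<kappa> j (set_coord t j s)) (t $ j))"
  proof -
    \<comment> \<open>Averages of variance 0 are point evaluations, which is why the sum contains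
      Laplacian powers of f itself at x.\<close>
    have \<phi>0: "\<phi> \<kappa> 0 = (laplacian ^^ \<kappa>) f x / 2 ^ \<kappa>" if "\<kappa> < \<nu>" for \<kappa>
      using that by (simp add: \<phi>_def heat_0 integral_gauss)
    have dM: "deriv (\<lambda>s. M_fun M \<Lambda> \<kappa> j (set_coord t j s)) (t $ j) =
      (\<integral>a. a ^ \<kappa> \<partial>alpha j t) * (\<integral>z. z ^ \<kappa> \<partial>zeta) / fact \<kappa> * (\<beta> * real \<kappa> * t $ j powr (\<beta> * real \<kappa> - 1))" for \<kappa>
      by (rule DERIV_imp_deriv[OF M_fun_has_derivative[OF t]])
    have "(\<Sum>\<kappa>=1..\<nu> - 1. (laplacian ^^ \<kappa>) f x / 2 ^ \<kappa> * deriv (\<lambda>s. M_fun M \<Lambda> \<kappa> j (set_coord t j s)) (t $ j))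
      = (\<Sum>i<n. (laplacian ^^ Suc i) f x / 2 ^ Suc i * deriv (\<lambda>s. M_fun M \<Lambda> (Suc i) j (set_coord t j s)) (t $ j))"
      unfolding n_def[symmetric] unfolding One_nat_def by (rule sum.atLeast1_atMost_eq)
    moreover have "\<phi> (Suc i) 0 = (laplacian ^^ Suc i) f x / 2 ^ Suc i" if "i \<in> {..<n}" for i
      by (rule \<phi>0) (use that n(1) in simp)
    ultimately show ?thesis unfolding dM by (simp only: cong: sum.cong)
  qed
  also have "(\<integral>p. fst p ^ \<nu> * \<phi> \<nu> (fst p * (t $ j powr \<beta> * snd p)) \<partial>X.P) = 1 / 2 ^ \<nu> * (laplacian ^^ \<nu>) (U_fun M W \<Lambda> f \<nu> j t) x"
  proof -
    have f0: "bcp 0 f" using lb[of 0 0] by simp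
    obtain K where K: "\<And>y. \<bar>f y\<bar> \<le> K" using bcp_bound[OF f0] by metis
    have U: "U_fun M W \<Lambda> f \<nu> j t = X.mixed (t $ j powr \<beta>) \<nu> f"
      unfolding U_fun_def X.mixed_def using sheet_functional(2)[OF tn bcp_continuous[OF f0] K, of j \<nu>] by (auto simp: fun_eq_iff)
    \<comment> \<open>The first \<nu> - 1 Laplacians pass onto f, giving F, and only the outermost
      one is taken on the kernel; its weight |z|^2 - d then matches the top time derivative.\<close>
    have "(laplacian ^^ \<nu>) (U_fun M W \<Lambda> f \<nu> j t) x = laplacian (X.mixed (t $ j powr \<beta>) \<nu> F) x"
      unfolding U unfolding n(1) funpow.simps comp_def F_def X.mixed_laplacian_power[OF h(1)] ..
    also have "\<dots> = (\<integral>p. fst p ^ \<nu> * (1 / (fst p * (t $ j powr \<beta> * snd p)) * heat (fst p * (t $ j powr \<beta> * snd p)) ?w F x) \<partial>X.P)"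
      by (rule X.laplacian_mixed_smooth[OF Fc KF ho \<alpha>]) (use tj \<nu>(1) in auto)
    finally have l: "(laplacian ^^ \<nu>) (U_fun M W \<Lambda> f \<nu> j t) x =
      (\<integral>p. fst p ^ \<nu> * (1 / (fst p * (t $ j powr \<beta> * snd p)) * heat (fst p * (t $ j powr \<beta> * snd p)) ?w F x) \<partial>X.P)" .
    have "a * \<phi> \<nu> r = 1 / 2 ^ \<nu> * (a * (1 / r * heat r ?w F x))" for a r by (simp add: \<phi>_def)
    then show ?thesis unfolding l by (simp only: integral_mult_right_zero)
  qed
  finally show ?thesis using D by simp
qed

text \<open>The integrand factors over the coordinates into one-dimensional kernel moments, the
  indicator of the orthant being the product of the indicators of the half-lines.\<close>

lemma M_fun_kernel:
  fixes g :: "real \<Rightarrow> real" and j :: 'n and t :: "real^'n" and \<kappa> :: nat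
  assumes t: "t \<in> pos_orthant" and g: "\<And>y. 0 \<le> g y" "distributed N lborel (L 1) (\<lambda>y. ennreal (g y))"
  defines "G \<equiv> \<lambda>s :: real^'n. (\<Prod>i\<in>UNIV - {j}. s $ i) ^ \<kappa> * (s $ j ^ \<kappa> / fact \<kappa>) * (\<Prod>i\<in>UNIV. inverse_kernel \<beta> g (t $ i) (s $ i))"
  shows "set_integrable lborel nonneg_orthant G"
    and "M_fun M \<Lambda> \<kappa> j t = (LINT s:nonneg_orthant|lborel. G s)"
proof -
  have tp: "0 < t $ i" for i using t by (simp add: pos_orthant_def)
  define H where "H i x = indicator {0..} x * (x ^ \<kappa> * inverse_kernel \<beta> g (t $ i) x)" for i x
  have H: "has_bochner_integral lborel (H i) ((t $ i powr \<beta>) ^ \<kappa> * moment_const N L (real \<kappa>))" for i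
    unfolding H_def by (rule stable.inverse_kernel_moment[OF tp g])
  have Hn: "0 \<le> H i x" for i x
    unfolding H_def using stable.inverse_kernel_nonneg[OF g(1) tp] by (auto simp: indicator_def)
  have B: "has_bochner_integral lborel (\<lambda>s :: real^'n. \<Prod>i\<in>UNIV. H i (s $ i)) (\<Prod>i\<in>UNIV. (t $ i powr \<beta>) ^ \<kappa> * moment_const N L (real \<kappa>))"
    using lborel_vec_product[of H] H Hn by (simp add: has_bochner_integral_iff)
  have e: "indicator nonneg_orthant s *\<^sub>R G s = (\<Prod>i\<in>UNIV. H i (s $ i)) / fact \<kappa>" for s
  proof (cases "s \<in> nonneg_orthant")
    case True
    then have "(\<Prod>i\<in>UNIV. H i (s $ i)) = (\<Prod>i\<in>UNIV. s $ i) ^ \<kappa> * (\<Prod>i\<in>UNIV. inverse_kernel \<beta> g (t $ i) (s $ i))"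
      by (simp add: H_def nonneg_orthant_def prod.distrib prod_power_distrib)
    also have "(\<Prod>i\<in>UNIV. s $ i) = (\<Prod>i\<in>UNIV - {j}. s $ i) * s $ j" by (rule prod_UNIV_remove)
    finally show ?thesis using True by (simp add: G_def power_mult_distrib)
  next
    case False
    then obtain i where "\<not> 0 \<le> s $ i" by (auto simp: nonneg_orthant_def)
    then have "H i (s $ i) = 0" by (simp add: H_def)
    then have "(\<Prod>i\<in>UNIV. H i (s $ i)) = 0" by (intro prod_zero bexI[of _ i]) auto
    then show ?thesis using False by simp
  qed
  show "set_integrable lborel nonneg_orthant G"
    unfolding set_integrable_def e using B by (simp add: has_bochner_integral_iff)
  show "M_fun M \<Lambda> \<kappa> j t = (LINT s:nonneg_orthant|lborel. G s)"
    unfolding set_lebesgue_integral_def e M_fun_eq(2)[OF pos_imp_nonneg_orthant[OF t]]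
    using B by (simp add: has_bochner_integral_iff)
qed

end

context clocked_sheet
begin

lemma clock_functional_zero:
  assumes "t \<in> nonneg_orthant" "i \<noteq> j" "t $ i = 0" "0 < k"
  shows "(\<integral>\<omega>. other_clocks \<Lambda> j t \<omega> ^ k * h \<omega> \<partial>M) = 0"
proof (rule integral_eq_zero_AE)
  show "AE \<omega> in M. other_clocks \<Lambda> j t \<omega> ^ k * h \<omega> = 0"
    using other_clocks_zero[OF assms(1-3)] by eventually_elim (use assms(4) in simp)
qed

lemma N_fun_closed:
  assumes t: "t \<in> nonneg_orthant" and \<nu>: "\<beta> = 1 / real \<nu>" "0 < \<nu>"
  shows "N_fun M \<Lambda> \<nu> j t = moment_const N L (real \<nu>) ^ (CARD('n) - 1) * (\<Prod>i\<in>UNIV - {j}. t $ i)"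
proof -
  have "(t $ i powr \<beta>) ^ \<nu> = t $ i" for i
  proof (cases "t $ i = 0")
    case False
    then have "0 < t $ i" using t by (simp add: nonneg_orthant_def less_le)
    then have "(t $ i powr \<beta>) powr real \<nu> = t $ i" using \<nu> by (simp add: powr_powr)
    then show ?thesis using \<open>0 < t $ i\<close> by (simp add: powr_realpow)
  qed (use \<nu> in simp)
  then show ?thesis
    unfolding N_fun_eq[OF t] by (simp add: prod.distrib card_Diff_singleton)
qed

lemma M_fun_closed:
  assumes t: "t \<in> nonneg_orthant" and \<nu>: "\<beta> = 1 / real \<nu>" and \<kappa>: "0 < \<kappa>"
  shows "M_fun M \<Lambda> \<kappa> j t = moment_const N L (real \<kappa>) ^ CARD('n) / fact \<kappa> * (\<Prod>i\<in>UNIV. t $ i powr (real \<kappa> / real \<nu>))"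
proof -
  have "(t $ i powr \<beta>) ^ \<kappa> = t $ i powr (real \<kappa> / real \<nu>)" for i
  proof (cases "t $ i = 0")
    case False
    then have "0 < t $ i powr \<beta>" by simp
    then have "(t $ i powr \<beta>) ^ \<kappa> = (t $ i powr \<beta>) powr real \<kappa>" by (simp add: powr_realpow)
    then show ?thesis using \<nu> by (simp add: powr_powr)
  \<comment> \<open>At \<open>t $ i = 0\<close> both sides are 0 because \<kappa> > 0; for \<kappa>
    = 0 they would be \<open>0 ^ 0\<close>, which is 1, and \<open>0 powr 0\<close>, which is
    0.\<close>
  qed (use \<kappa> in simp)
  then show ?thesis
    unfolding M_fun_eq(2)[OF t] by (simp add: prod.distrib)
qed

end

theorem theorem1p3:
  fixes M :: "'w measure" and N :: "'v measure"
    and W :: "real^'n \<Rightarrow> 'w \<Rightarrow> real^'d"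
    and \<Lambda> :: "'n \<Rightarrow> real \<Rightarrow> 'w \<Rightarrow> real"
    and L :: "real \<Rightarrow> 'v \<Rightarrow> real"
    and g :: "real \<Rightarrow> real"
    and f :: "real^'d \<Rightarrow> real"
    and \<alpha> \<beta> :: real
  assumes "prob_space M" and "prob_space N"
    and "0 < \<beta>" and "\<beta> < 1"
    and "stable_subordinator \<beta> N L"
    and "\<And>y. 0 \<le> g y" and "distributed N lborel (L 1) (\<lambda>y. ennreal (g y))"
    and "brownian_sheet M W"
    and "independent_inverse_clocks N L M W \<Lambda>"
    and "f \<in> borel_measurable borel" and "bounded (range f)"
    and "0 < \<alpha>" and "\<alpha> \<le> 1" and "bounded_holder_partials 2 \<alpha> f"
  shows
    "(\<forall>j.
        (\<forall>t\<in>nonneg_orthant. \<forall>x.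
           integrable M (\<lambda>\<omega>. f (time_changed_sheet W \<Lambda> x t \<omega>)) \<and>
           integrable M (\<lambda>\<omega>. other_clocks \<Lambda> j t \<omega> * f (time_changed_sheet W \<Lambda> x t \<omega>))) \<and>
        (\<forall>t\<in>pos_orthant. \<forall>x.
           partials_exist 2 (V_fun M W \<Lambda> f j t) \<and>
           caputo_differentiable \<beta> (\<lambda>s. u_fun M W \<Lambda> f (set_coord t j s) x) (t $ j) \<and>
           caputo_derivative \<beta> (\<lambda>s. u_fun M W \<Lambda> f (set_coord t j s) x) (t $ j) =
             1 / 2 * laplacian (V_fun M W \<Lambda> f j t) x) \<and>
        (\<forall>t\<in>orthant_boundary. \<forall>x. u_fun M W \<Lambda> f t x = f x) \<and>
        (\<forall>t\<in>nonneg_orthant. \<forall>x. (\<exists>i. i \<noteq> j \<and> t $ i = 0) \<longrightarrow> V_fun M W \<Lambda> f j t x = 0) \<and>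
        (\<forall>t\<in>nonneg_orthant. \<forall>x. t $ j = 0 \<longrightarrow>
           V_fun M W \<Lambda> f j t x =
             (\<Prod>i\<in>UNIV - {j}. moment_const N L 1 * t $ i powr \<beta>) * f x)) \<and>
     (\<forall>\<gamma>>-1.
        integrable N (\<lambda>\<omega>. inverse_motion L 1 \<omega> powr \<gamma>) \<and>
        set_integrable lborel {0<..} (\<lambda>y. y powr (- \<gamma> * \<beta>) * g y) \<and>
        moment_const N L \<gamma> = (LINT y:{0<..}|lborel. y powr (- \<gamma> * \<beta>) * g y)) \<and>
     (\<forall>(\<nu>::nat) \<alpha>'.
        2 \<le> \<nu> \<and> \<beta> = 1 / real \<nu> \<and> 0 < \<alpha>' \<and> \<alpha>' \<le> 1 \<and> bounded_holder_partials (2 * \<nu> - 2) \<alpha>' f \<longrightarrow>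
        (\<forall>j.
           (\<forall>t\<in>nonneg_orthant. \<forall>x.
              integrable M (\<lambda>\<omega>. other_clocks \<Lambda> j t \<omega> ^ \<nu> * f (time_changed_sheet W \<Lambda> x t \<omega>))) \<and>
           (\<forall>t\<in>pos_orthant. \<forall>x.
              partials_exist (2 * \<nu>) (U_fun M W \<Lambda> f \<nu> j t) \<and>
              (\<forall>\<kappa>\<in>{1..\<nu> - 1}.
                 (\<lambda>s. M_fun M \<Lambda> \<kappa> j (set_coord t j s)) field_differentiable (at (t $ j))) \<and>
              ((\<lambda>s. u_fun M W \<Lambda> f (set_coord t j s) x) has_real_derivative
                 (\<Sum>\<kappa>=1..\<nu> - 1. (laplacian ^^ \<kappa>) f x / 2 ^ \<kappa> *
                    deriv (\<lambda>s. M_fun M \<Lambda> \<kappa> j (set_coord t j s)) (t $ j)) +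
                 1 / 2 ^ \<nu> * (laplacian ^^ \<nu>) (U_fun M W \<Lambda> f \<nu> j t) x) (at (t $ j))) \<and>
           (\<forall>t\<in>orthant_boundary. \<forall>x. u_fun M W \<Lambda> f t x = f x) \<and>
           (\<forall>t\<in>nonneg_orthant. \<forall>x. (\<exists>i. i \<noteq> j \<and> t $ i = 0) \<longrightarrow> U_fun M W \<Lambda> f \<nu> j t x = 0) \<and>
           (\<forall>t\<in>nonneg_orthant. \<forall>x. t $ j = 0 \<longrightarrow> U_fun M W \<Lambda> f \<nu> j t x = f x * N_fun M \<Lambda> \<nu> j t) \<and>
           (\<forall>t\<in>nonneg_orthant.
              N_fun M \<Lambda> \<nu> j t =
                moment_const N L (real \<nu>) ^ (CARD('n) - 1) * (\<Prod>i\<in>UNIV - {j}. t $ i)) \<and>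
           (\<forall>\<kappa>\<in>{1..\<nu> - 1}.
              (\<forall>t\<in>nonneg_orthant.
                 M_fun M \<Lambda> \<kappa> j t =
                   moment_const N L (real \<kappa>) ^ CARD('n) / fact \<kappa> *
                   (\<Prod>i\<in>UNIV. t $ i powr (real \<kappa> / real \<nu>))) \<and>
              (\<forall>t\<in>pos_orthant.
                 set_integrable lborel nonneg_orthant
                   (\<lambda>s. (\<Prod>i\<in>UNIV - {j}. s $ i) ^ \<kappa> * (s $ j ^ \<kappa> / fact \<kappa>) *
                        (\<Prod>i\<in>UNIV. inverse_kernel \<beta> g (t $ i) (s $ i))) \<and>
                 M_fun M \<Lambda> \<kappa> j t =
                   (LINT s:nonneg_orthant|lborel.
                      (\<Prod>i\<in>UNIV - {j}. s $ i) ^ \<kappa> * (s $ j ^ \<kappa> / fact \<kappa>) *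
                      (\<Prod>i\<in>UNIV. inverse_kernel \<beta> g (t $ i) (s $ i)))))) \<and>
        (\<forall>\<gamma>>-1. \<forall>t>0.
           integrable N (\<lambda>\<omega>. inverse_motion L t \<omega> powr \<gamma>) \<and>
           integrable N (\<lambda>\<omega>. L 1 \<omega> powr (- \<gamma> / real \<nu>)) \<and>
           (\<integral>\<omega>. inverse_motion L t \<omega> powr \<gamma> \<partial>N) =
             (\<integral>\<omega>. (L 1 \<omega> / t) powr (- \<gamma> / real \<nu>) \<partial>N) \<and>
           (\<integral>\<omega>. (L 1 \<omega> / t) powr (- \<gamma> / real \<nu>) \<partial>N) =
             t powr (\<gamma> / real \<nu>) * (\<integral>\<omega>. L 1 \<omega> powr (- \<gamma> / real \<nu>) \<partial>N) \<and>
           t powr (\<gamma> / real \<nu>) * (\<integral>\<omega>. L 1 \<omega> powr (- \<gamma> / real \<nu>) \<partial>N) =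
             t powr (\<gamma> / real \<nu>) * moment_const N L \<gamma>))"
proof -
  interpret S: clocked_sheet M N L \<beta> W \<Lambda>
    using assms(1-5,8,9)
    by (simp add: clocked_sheet_def stable_subordinator_process_def stable_subordinator_process_axioms_def clocked_sheet_axioms_def)
  note g = assms(6,7) and fb = assms(11) and \<alpha> = assms(12,13) and fh = assms(14)
  have f2: "bcp 2 f" by (rule bounded_holder_partials_imp_bcp[OF fh fb \<alpha>(1)])
  note fc = bcp_continuous[OF f2]
  obtain K where K: "\<And>y. \<bar>f y\<bar> \<le> K" using bcp_bound[OF f2] by metis
  \<comment> \<open>With V as the case of exponent 1 of U, integrability, boundary values and
    existence of derivatives are settled for both functionals at once.\<close>
  have V: "V_fun M W \<Lambda> f j t = U_fun M W \<Lambda> f 1 j t" for j t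
    unfolding V_fun_def[abs_def] U_fun_def[abs_def] by simp
  have U0: "U_fun M W \<Lambda> f k j t x = 0" if "t \<in> nonneg_orthant" "\<exists>i. i \<noteq> j \<and> t $ i = 0" "0 < k" for k j t x
    using that(2) S.clock_functional_zero[OF that(1) _ _ that(3)] unfolding U_fun_def by fast
  have U1: "U_fun M W \<Lambda> f k j t x = (\<Prod>i\<in>UNIV - {j}. (t $ i powr \<beta>) ^ k * moment_const N L (real k)) * f x"
    if "t \<in> nonneg_orthant" "t $ j = 0" for k j t x
    unfolding U_fun_def by (rule S.functional_at_zero[OF that fc K])
  have ub: "u_fun M W \<Lambda> f t x = f x" if "t \<in> orthant_boundary" for t x
    by (rule S.u_fun_boundary[OF that fc K])
  have int: "integrable M (\<lambda>\<omega>. other_clocks \<Lambda> j t \<omega> ^ k * f (time_changed_sheet W \<Lambda> x t \<omega>))"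
    if "t \<in> nonneg_orthant" for j k t x
    by (rule S.sheet_functional(1)[OF that fc K])
  have ex: "partials_exist (m + 2) (U_fun M W \<Lambda> f k j t)"
    if "bounded_holder_partials m a f" "0 < a" "a \<le> 1" "t \<in> pos_orthant" "1 \<le> k" for m a k j t
    using S.sheet_partials_exist[OF that(4,1) fb that(2,3,5)] by (simp add: U_fun_def[abs_def])
  have fd: "(\<lambda>s. M_fun M \<Lambda> \<kappa> j (set_coord t j s)) field_differentiable (at (t $ j))" if "t \<in> pos_orthant" for \<kappa> j t
    using S.M_fun_has_derivative[OF that] unfolding field_differentiable_def by blast
  let ?H = "\<lambda>\<nu> \<alpha>'. 2 \<le> \<nu> \<and> \<beta> = 1 / real \<nu> \<and> 0 < \<alpha>' \<and> \<alpha>' \<le> 1 \<and> bounded_holder_partials (2 * \<nu> - 2) \<alpha>' f"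
  have H: "2 \<le> \<nu>" "0 < \<nu>" "\<beta> = 1 / real \<nu>" "0 < \<alpha>'" "\<alpha>' \<le> 1" "bounded_holder_partials (2 * \<nu> - 2) \<alpha>' f"
    if "?H \<nu> \<alpha>'" for \<nu> \<alpha>'
    using that by auto
  have e: "- \<gamma> / real \<nu> = - \<gamma> * \<beta>" "\<gamma> / real \<nu> = \<gamma> * \<beta>" if "?H \<nu> \<alpha>'" for \<gamma> \<nu> \<alpha>'
    using H(3)[OF that] by simp_all
  show ?thesis
  proof (intro conjI allI ballI impI)
    fix j x and t :: "real^'n"
    show "integrable M (\<lambda>\<omega>. f (time_changed_sheet W \<Lambda> x t \<omega>))" if "t \<in> nonneg_orthant"
      using int[OF that, of j 0 x] by simp
    show "integrable M (\<lambda>\<omega>. other_clocks \<Lambda> j t \<omega> * f (time_changed_sheet W \<Lambda> x t \<omega>))" if "t \<in> nonneg_orthant"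
      using int[OF that, of j 1 x] by simp
    show "partials_exist 2 (V_fun M W \<Lambda> f j t)" if "t \<in> pos_orthant"
      using ex[OF fh \<alpha> that order_refl, of j] unfolding V partials_exist_def by simp
    show "V_fun M W \<Lambda> f j t x = 0" if "t \<in> nonneg_orthant" "\<exists>i. i \<noteq> j \<and> t $ i = 0"
      unfolding V by (rule U0[OF that]) simp
    show "V_fun M W \<Lambda> f j t x = (\<Prod>i\<in>UNIV - {j}. moment_const N L 1 * t $ i powr \<beta>) * f x"
      if "t \<in> nonneg_orthant" "t $ j = 0"
      unfolding V using U1[OF that, of 1 x] by (simp add: mult.commute)
  next
    fix \<nu> \<alpha>' j x and t :: "real^'n" assume h: "?H \<nu> \<alpha>'" and t: "t \<in> pos_orthant"
    show "partials_exist (2 * \<nu>) (U_fun M W \<Lambda> f \<nu> j t)"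
    proof -
      have "2 * \<nu> - 2 + 2 = 2 * \<nu>" using H(1)[OF h] by simp
      then show ?thesis using ex[OF H(6,4,5)[OF h] t, of \<nu> j] H(2)[OF h] by (metis One_nat_def Suc_leI)
    qed
    show "((\<lambda>s. u_fun M W \<Lambda> f (set_coord t j s) x) has_real_derivative
        (\<Sum>\<kappa>=1..\<nu> - 1. (laplacian ^^ \<kappa>) f x / 2 ^ \<kappa> *
           deriv (\<lambda>s. M_fun M \<Lambda> \<kappa> j (set_coord t j s)) (t $ j)) +
        1 / 2 ^ \<nu> * (laplacian ^^ \<nu>) (U_fun M W \<Lambda> f \<nu> j t) x) (at (t $ j))"
      by (rule S.sheet_time_derivative[OF t H(1,3,6)[OF h] fb H(4,5)[OF h]])
  next
    fix \<nu> \<alpha>' j x and t :: "real^'n" assume h: "?H \<nu> \<alpha>'" and t: "t \<in> nonneg_orthant"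
    show "U_fun M W \<Lambda> f \<nu> j t x = 0" if "\<exists>i. i \<noteq> j \<and> t $ i = 0"
      by (rule U0[OF t that H(2)[OF h]])
    show "U_fun M W \<Lambda> f \<nu> j t x = f x * N_fun M \<Lambda> \<nu> j t" if "t $ j = 0"
      unfolding U1[OF t that] S.N_fun_eq[OF t] by (rule mult.commute)
    show "N_fun M \<Lambda> \<nu> j t = moment_const N L (real \<nu>) ^ (CARD('n) - 1) * (\<Prod>i\<in>UNIV - {j}. t $ i)"
      by (rule S.N_fun_closed[OF t H(3,2)[OF h]])
    show "M_fun M \<Lambda> \<kappa> j t = moment_const N L (real \<kappa>) ^ CARD('n) / fact \<kappa> * (\<Prod>i\<in>UNIV. t $ i powr (real \<kappa> / real \<nu>))"
      if "\<kappa> \<in> {1..\<nu> - 1}" for \<kappa>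
      by (rule S.M_fun_closed[OF t H(3)[OF h]]) (use that in simp)
  next
    fix \<nu> \<alpha>' and \<gamma> t :: real assume h: "?H \<nu> \<alpha>'" and \<gamma>: "-1 < \<gamma>" and t: "0 < t"
    note p = S.stable.inverse_motion_powr[OF \<gamma> t, folded e[OF h]]
    show "integrable N (\<lambda>\<omega>. L 1 \<omega> powr (- \<gamma> / real \<nu>))" by (rule p)
    show "(\<integral>\<omega>. inverse_motion L t \<omega> powr \<gamma> \<partial>N) = (\<integral>\<omega>. (L 1 \<omega> / t) powr (- \<gamma> / real \<nu>) \<partial>N)" by (rule p)
    show "(\<integral>\<omega>. (L 1 \<omega> / t) powr (- \<gamma> / real \<nu>) \<partial>N) =
      t powr (\<gamma> / real \<nu>) * (\<integral>\<omega>. L 1 \<omega> powr (- \<gamma> / real \<nu>) \<partial>N)" by (rule p)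
    show "t powr (\<gamma> / real \<nu>) * (\<integral>\<omega>. L 1 \<omega> powr (- \<gamma> / real \<nu>) \<partial>N) =
      t powr (\<gamma> / real \<nu>) * moment_const N L \<gamma>" by (simp only: p(5))
  qed (rule ub int fd S.sheet_caputo[OF _ f2] S.stable.moment_density[OF _ g] S.stable.inverse_motion_powr
      S.M_fun_kernel[OF _ g]; assumption)+
qed

end
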